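(* (A) Let $n \geq 4$, $\frac{2n}{n-1} \leq p < n$, and $\alpha \in (0, \frac{n}{n-p}]$ with $\alpha \neq 1$. Then for every $u \in C_0^\infty(\mathbb{H}^n)$: (i) if $\alpha > 1$, \[ \|u\|_{L^{\alpha p}(\mathbb{H}^n)} \leq GN(n,p,\alpha)\left(\|\nabla_g u\|_{L^p(\mathbb{H}^n)}^p - \left(\frac{n-1}{p}\right)^p\|u\|_{L^p(\mathbb{H}^n)}^p\right)^{\frac{\theta}{p}} \|u\|_{L^{\alpha(p-1)+1}(\mathbb{H}^n)}^{1-\theta}, \] with $\theta = \frac{n(\alpha-1)}{\alpha(np - (\alpha p + 1 - \alpha)(n-p))}$; (ii) if $\alpha \in (0,1)$, \[ \|u\|_{L^{\alpha(p-1)+1}(\mathbb{H}^n)} \leq GN(n,p,\alpha)\left(\|\nabla_g u\|_{L^p(\mathbb{H}^n)}^p - \left(\frac{n-1}{p}\right)^p\|u\|_{L^p(\mathbb{H}^n)}^p\right)^{\frac{\theta}{p}} \|u\|_{L^{\alpha p}(\mathbb{H}^n)}^{1-\theta}, \] with $\theta = \frac{n(1-\alpha)}{(\alpha p + 1 - \alpha)(n - \alpha(n-p))}$. (B) Let $n \geq 2$ and $p > n$. Then for every $u \in C_0^\infty(\mathbb{H}^n)$, \[ \|u\|_\infty^p \leq b_{n,p}^p \, V(\mathrm{supp}\, u)^{\frac{p-n}{n}}\left(\int_{\mathbb{B}^n}|\nabla_g u|_g^p\,dV - \left(\frac{n-1}{p}\right)^p\int_{\mathbb{B}^n}|u|^p\,dV\right).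 \]
   Context: $\mathbb{H}^n$ denotes the hyperbolic space in the Poincaré ball model: the unit ball $\mathbb{B}^n \subset \mathbb{R}^n$ with metric $g(x) = \frac{4}{(1-|x|^2)^2}\sum_{i=1}^n dx_i^2$, volume element $dV = \left(\frac{2}{1-|x|^2}\right)^n dx$, and $V(E) = \int_E dV$ for measurable $E$. The hyperbolic gradient is $\nabla_g = \left(\frac{1-|x|^2}{2}\right)^2\nabla$ and $|\nabla_g u|_g = \sqrt{g(\nabla_g u,\nabla_g u)} = \frac{1-|x|^2}{2}|\nabla u|$. Norms $\|\cdot\|_{L^q(\mathbb{H}^n)}$ are taken with respect to $dV$, and $\|\nabla_g u\|_{L^p(\mathbb{H}^n)} = \left(\int_{\mathbb{B}^n}|\nabla_g u|_g^p\,dV\right)^{1/p}$. $\mathrm{supp}\,u$ is the support of $u$. $GN(n,p,\alpha)$ is the sharp (smallest) constant in the Euclidean Gagliardo–Nirenberg inequality of Del Pino–Dolbeault: for $\alpha>1$, $\|u\|_{L^{\alpha p}(\mathbb{R}^n)} \leq GN(n,p,\alpha)\|\nabla u\|_{L^p(\mathbb{R}^n)}^\theta \|u\|_{L^{\alpha(p-1)+1}(\mathbb{R}^n)}^{1-\theta}$ for all $u\in C_0^\infty(\mathbb{R}^n)$, and for $\alpha<1$, $\|u\|_{L^{\alpha(p-1)+1}(\mathbb{R}^n)} \leq GN(n,p,\alpha)\|\nabla u\|_{L^p(\mathbb{R}^n)}^\theta \|u\|_{L^{\alpha p}(\mathbb{R}^n)}^{1-\theta}$ for all $u\in C_0^\infty(\mathbb{R}^n)$,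 with the same respective values of $\theta$ as in the claim. $b_{n,p}$ (for $p>n$) is the sharp constant in the Euclidean Morrey–Sobolev inequality $\|u\|_{L^\infty(\mathbb{R}^n)} \leq b_{n,p}\,|\mathrm{supp}\,u|^{\frac{p-n}{np}}\|\nabla u\|_{L^p(\mathbb{R}^n)}$ for $u\in C_0^\infty(\mathbb{R}^n)$ ($|\cdot|$ = Lebesgue measure); explicitly $b_{n,p} = n^{-1/p}\sigma_n^{-1/n}\left(\frac{p-1}{p-n}\right)^{\frac{p-1}{p}}$, with $\sigma_n$ the volume of the unit ball of $\mathbb{R}^n$. *)

theory Defs
  imports "HOL-Analysis.Analysis"
begin

definition grad :: "(real ^ 'n \<Rightarrow> real) \<Rightarrow> real ^ 'n \<Rightarrow> real ^ 'n" where
  "grad u x = (\<chi> i. frechet_derivative u (at x) (axis i 1))"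

fun Ck :: "nat \<Rightarrow> (real ^ 'n \<Rightarrow> real) \<Rightarrow> bool" where
  "Ck 0 u = continuous_on UNIV u"
| "Ck (Suc k) u = (u differentiable_on UNIV \<and> continuous_on UNIV u \<and>
      (\<forall>i. Ck k (\<lambda>x. frechet_derivative u (at x) (axis i 1))))"

definition smooth :: "(real ^ 'n \<Rightarrow> real) \<Rightarrow> bool" where
  "smooth u = (\<forall>k. Ck k u)"

definition supp :: "(real ^ 'n \<Rightarrow> real) \<Rightarrow> (real ^ 'n) set" where
  "supp u = closure {x. u x \<noteq> 0}"

definition C0_inf :: "(real ^ 'n \<Rightarrow> real) set" where
  "C0_inf = {u. smooth u \<and> compact (supp u)}"

(* C_0^infty(H^n) = C_0^infty(B^n): smooth, compact support inside the open unit ball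
   (extended by zero outside the ball) *)
definition C0_inf_ball :: "(real ^ 'n \<Rightarrow> real) set" where
  "C0_inf_ball = {u. smooth u \<and> compact (supp u) \<and> supp u \<subseteq> ball 0 1}"

definition Lnorm :: "real \<Rightarrow> (real ^ 'n \<Rightarrow> real) \<Rightarrow> real" where
  "Lnorm q u = (integral UNIV (\<lambda>x. \<bar>u x\<bar> powr q)) powr (1 / q)"

definition grad_Lnorm :: "real \<Rightarrow> (real ^ 'n \<Rightarrow> real) \<Rightarrow> real" where
  "grad_Lnorm q u = (integral UNIV (\<lambda>x. norm (grad u x) powr q)) powr (1 / q)"

definition sup_norm :: "(real ^ 'n \<Rightarrow> real) \<Rightarrow> real" where
  "sup_norm u = (SUP x. \<bar>u x\<bar>)"

(* hyperbolic volume density (2/(1-|x|^2))^n on the Poincare ball *)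
definition hdens :: "real ^ 'n \<Rightarrow> real" where
  "hdens x = (2 / (1 - (norm x)\<^sup>2)) ^ CARD('n)"

definition hvol :: "(real ^ 'n) set \<Rightarrow> real" where
  "hvol E = integral (E \<inter> ball 0 1) hdens"

definition hint_pow :: "real \<Rightarrow> (real ^ 'n \<Rightarrow> real) \<Rightarrow> real" where
  "hint_pow q u = integral (ball 0 1) (\<lambda>x. \<bar>u x\<bar> powr q * hdens x)"

definition hgrad_len :: "(real ^ 'n \<Rightarrow> real) \<Rightarrow> real ^ 'n \<Rightarrow> real" where
  "hgrad_len u x = (1 - (norm x)\<^sup>2) / 2 * norm (grad u x)"

definition hint_grad_pow :: "real \<Rightarrow> (real ^ 'n \<Rightarrow> real) \<Rightarrow> real" where
  "hint_grad_pow q u = integral (ball 0 1) (\<lambda>x. hgrad_len u x powr q * hdens x)"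

definition hLnorm :: "real \<Rightarrow> (real ^ 'n \<Rightarrow> real) \<Rightarrow> real" where
  "hLnorm q u = hint_pow q u powr (1 / q)"

definition hgrad_Lnorm :: "real \<Rightarrow> (real ^ 'n \<Rightarrow> real) \<Rightarrow> real" where
  "hgrad_Lnorm q u = hint_grad_pow q u powr (1 / q)"

definition theta_gt :: "real \<Rightarrow> real \<Rightarrow> real \<Rightarrow> real" where
  "theta_gt n p \<alpha> = n * (\<alpha> - 1) / (\<alpha> * (n * p - (\<alpha> * p + 1 - \<alpha>) * (n - p)))"

definition theta_lt :: "real \<Rightarrow> real \<Rightarrow> real \<Rightarrow> real" where
  "theta_lt n p \<alpha> = n * (1 - \<alpha>) / ((\<alpha> * p + 1 - \<alpha>) * (n - \<alpha> * (n - p)))"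

definition GN :: "('n::finite) itself \<Rightarrow> real \<Rightarrow> real \<Rightarrow> real" where
  "GN (_ :: ('n::finite) itself) p \<alpha> =
     (let n = real CARD('n) in
      if \<alpha> > 1 then
        Inf {C. \<forall>u :: real ^ 'n \<Rightarrow> real. u \<in> C0_inf \<longrightarrow>
              Lnorm (\<alpha> * p) u \<le> C * grad_Lnorm p u powr (theta_gt n p \<alpha>)
                 * Lnorm (\<alpha> * (p - 1) + 1) u powr (1 - theta_gt n p \<alpha>)}
      else
        Inf {C. \<forall>u :: real ^ 'n \<Rightarrow> real. u \<in> C0_inf \<longrightarrow>
              Lnorm (\<alpha> * (p - 1) + 1) u \<le> C * grad_Lnorm p u powr (theta_lt n p \<alpha>)
                 * Lnorm (\<alpha> * p) u powr (1 - theta_lt n p \<alpha>)})"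

(* sigma_n = Lebesgue volume of the unit ball of R^n; explicit Morrey-Sobolev constant b_{n,p} *)
definition bconst :: "('n::finite) itself \<Rightarrow> real \<Rightarrow> real" where
  "bconst (_ :: ('n::finite) itself) p =
     (let n = real CARD('n); \<sigma> = measure lborel (ball (0 :: real ^ 'n) 1) in
      n powr (-1 / p) * \<sigma> powr (-1 / n) * ((p - 1) / (p - n)) powr ((p - 1) / p))"

end

theory Submission
  imports Defs "HOL-Complex_Analysis.Great_Picard"
begin

text \<open>
  Replacing a function by its polarization with respect to a hyperbolic reflection preserves its
  distribution and does not increase the \<open>L\<^sup>p\<close> norm of the oscillation \<open>sup\<^bsub>B(x,h)\<^esub> v - v(x)\<close>, whose
  quotient by \<open>h\<close> tends to the gradient norm. Among all functions obtained in this way, which form a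
  compact class, one that maximises a centrality functional is fixed by every polarization, hence
  radially decreasing; this reduces everything to (averaged) radial profiles. These are transplanted
  to Euclidean space by matching the hyperbolic volume of geodesic balls with Lebesgue measure. With
  \<open>F\<close> the primitive of \<open>sinh\<^bsup>n-1\<^esup>\<close>, the pointwise inequality
  \<open>sinh\<^bsup>p(n-1)\<^esup> \<ge> (n F)\<^bsup>p(n-1)/n\<^esup> + ((n-1) F)\<^bsup>p\<^esup>\<close> splits the hyperbolic energy into the
  Euclidean energy of the transplant and a term that, by a weighted Hardy inequality, dominates
  \<open>((n-1)/p)\<^sup>p \<integral> |u|\<^sup>p\<close>. Hence the deficit bounds the Euclidean energy while all \<open>L\<^sup>q\<close> norms are
  preserved, and the sharp Euclidean inequalities carry over. That the infimum defining the
  Gagliardo--Nirenberg constant is over a nonempty set follows from the Sobolev inequality, itself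
  obtained by rescaling from small hyperbolic balls, and interpolation.
\<close>


subsection \<open>Hyperbolic reflections\<close>

text \<open>The obstacle is regularity. \<open>pol\<close> destroys differentiability, so a gradient
  energy cannot be carried through the class of polarized functions and their limits. The
  oscillation over balls of fixed radius makes sense for every Lipschitz function and survives
  uniform limits; it meets the gradient only at the two ends, and there one-sided bounds suffice.
  For u, its quotient is asymptotically at most the gradient length. For the limit profile,
  averaging over an interval of length k gives a C^1 profile whose derivative is a difference
  quotient, hence at most the oscillation at distance k. The constant (n-1)/p has two sources: n-1
  comes from (n-1) F <= F', which rests on sinh < cosh, and 1/p from absorbing a term by Young's
  inequality in the Hardy argument. The range of p comes from the splitting inequality: it is proved
  at the exponent 2n/(n-1), where its Euclidean term is the square (n F)^2, and larger p follow
  because t-th powers are superadditive for t >= 1. Transplants are only C^1, so the inequality that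
  defines the sharp constant is first extended from smooth functions by mollification.\<close>

text \<open>\<open>hdel x y\<close> is \<open>sinh\<^sup>2 (d(x, y) / 2)\<close> for the hyperbolic distance \<open>d\<close>; \<open>hrefl c\<close> is the inversion in
  the sphere about \<open>c\<close> orthogonal to the unit sphere.\<close>

definition hdel :: "real ^ 'n \<Rightarrow> real ^ 'n \<Rightarrow> real" where
  "hdel x y = (norm (x - y))\<^sup>2 / ((1 - (norm x)\<^sup>2) * (1 - (norm y)\<^sup>2))"

definition hrefl :: "real ^ 'n \<Rightarrow> real ^ 'n \<Rightarrow> real ^ 'n" where
  "hrefl c x = c + (((norm c)\<^sup>2 - 1) / (norm (x - c))\<^sup>2) *\<^sub>R (x - c)"

lemma one_minus_norm_sq_pos: "norm x < 1 \<Longrightarrow> 0 < 1 - (norm x)\<^sup>2"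
  by (simp add: power_less_one_iff abs_square_less_1)

lemma hdel_commute: "hdel x y = hdel y x"
  by (simp add: hdel_def norm_minus_commute mult.commute)

lemma norm_le_norm_iff_one_minus: "norm x \<le> norm y \<longleftrightarrow> 1 - (norm y)\<^sup>2 \<le> 1 - (norm x)\<^sup>2"
  using abs_le_square_iff[of "norm x" "norm y"] by simp

text \<open>The factor (|c|^2 - 1) / |x - c|^2 is also the factor by which the inversion scales
  lengths at x. That 1 - |x|^2 scales in the same way is the source of the invariance of both
  \<open>hdel\<close> and \<open>hdens\<close>.\<close>

lemma one_minus_norm_hrefl:
  assumes "x \<noteq> c"
  shows "1 - (norm (hrefl c x))\<^sup>2 = ((norm c)\<^sup>2 - 1) * (1 - (norm x)\<^sup>2) / (norm (x - c))\<^sup>2"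
proof -
  define X where "X = x - c"
  define R where "R = (norm c)\<^sup>2 - 1"
  have X0: "(norm X)\<^sup>2 \<noteq> 0" using assms by (simp add: X_def)
  have e1: "(norm (c + (R / (norm X)\<^sup>2) *\<^sub>R X))\<^sup>2 = (norm c)\<^sup>2 + 2 * (R / (norm X)\<^sup>2) * (c \<bullet> X) + (R / (norm X)\<^sup>2)\<^sup>2 * (norm X)\<^sup>2"
    unfolding power2_norm_eq_inner by (simp add: inner_add inner_commute algebra_simps power2_eq_square)
  have "(norm x)\<^sup>2 = (norm (c + X))\<^sup>2" by (simp add: X_def)
  also have "\<dots> = (norm c)\<^sup>2 + 2 * (c \<bullet> X) + (norm X)\<^sup>2"
    unfolding power2_norm_eq_inner by (simp add: inner_add inner_commute algebra_simps)
  finally have e2: "(norm x)\<^sup>2 = (norm c)\<^sup>2 + 2 * (c \<bullet> X) + (norm X)\<^sup>2" .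
  have "(norm (hrefl c x))\<^sup>2 = (norm (c + (R / (norm X)\<^sup>2) *\<^sub>R X))\<^sup>2"
    by (simp add: hrefl_def X_def R_def)
  with e1 e2 have "1 - (norm (hrefl c x))\<^sup>2 = 1 - ((norm c)\<^sup>2 + 2 * (R / (norm X)\<^sup>2) * (c \<bullet> X) + (R / (norm X)\<^sup>2)\<^sup>2 * (norm X)\<^sup>2)"
    by simp
  also have "\<dots> = R * (1 - (norm x)\<^sup>2) / (norm X)\<^sup>2"
    unfolding e2 using X0 by (simp add: R_def field_simps power2_eq_square)
  finally show ?thesis by (simp add: R_def X_def)
qed

text \<open>The centre is sent to itself instead of to infinity, which makes \<open>hrefl c\<close>
  an involution of the whole space.\<close>

lemma hrefl_self [simp]: "hrefl c c = c" by (simp add: hrefl_def)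

lemma norm_center_gt:
  fixes c x :: "real ^ 'n"
  assumes "norm c > 1" "norm x < 1"
  shows "x \<noteq> c" using assms by auto

lemma hrefl_in_ball_iff:
  assumes "norm c > 1"
  shows "norm (hrefl c x) < 1 \<longleftrightarrow> norm x < 1"
proof (cases "x = c")
  case False
  have R: "(norm c)\<^sup>2 - 1 > 0" using assms by (simp add: one_less_power)
  have "norm (hrefl c x) < 1 \<longleftrightarrow> 0 < 1 - (norm (hrefl c x))\<^sup>2"
    using abs_square_less_1[of "norm (hrefl c x)"] by simp
  also have "\<dots> \<longleftrightarrow> 0 < 1 - (norm x)\<^sup>2"
    unfolding one_minus_norm_hrefl[OF False] using R False
    by (simp add: zero_less_divide_iff zero_less_mult_iff)
  also have "\<dots> \<longleftrightarrow> norm x < 1"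
    using abs_square_less_1[of "norm x"] by simp
  finally show ?thesis .
qed simp

lemma hrefl_hrefl:
  assumes "norm c > 1"
  shows "hrefl c (hrefl c x) = x"
proof (cases "x = c")
  case False
  have R: "(norm c)\<^sup>2 - 1 > 0" using assms by (simp add: one_less_power)
  define R where "R = (norm c)\<^sup>2 - 1"
  define X where "X = x - c"
  have Rp: "R > 0" using R R_def by simp
  have Xp: "norm X > 0" using False X_def by simp
  have "hrefl c (hrefl c x) = c + (R / (norm ((R / (norm X)\<^sup>2) *\<^sub>R X))\<^sup>2) *\<^sub>R ((R / (norm X)\<^sup>2) *\<^sub>R X)"
    by (simp add: hrefl_def R_def X_def)
  also have "\<dots> = c + X" using Rp Xp by (simp add: field_simps power2_eq_square)
  finally show ?thesis by (simp add: X_def)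
qed simp

lemma norm_diff_hrefl:
  assumes "x \<noteq> c" "y \<noteq> c"
  shows "(norm (hrefl c x - hrefl c y))\<^sup>2
    = ((norm c)\<^sup>2 - 1)\<^sup>2 * (norm (x - y))\<^sup>2 / ((norm (x - c))\<^sup>2 * (norm (y - c))\<^sup>2)"
proof -
  define R where "R = (norm c)\<^sup>2 - 1"
  define X where "X = x - c"
  define Y where "Y = y - c"
  have X0: "(norm X)\<^sup>2 \<noteq> 0" and Y0: "(norm Y)\<^sup>2 \<noteq> 0" using assms by (simp_all add: X_def Y_def)
  have "(norm (hrefl c x - hrefl c y))\<^sup>2 = (norm ((R / (norm X)\<^sup>2) *\<^sub>R X - (R / (norm Y)\<^sup>2) *\<^sub>R Y))\<^sup>2"
    by (simp add: hrefl_def R_def X_def Y_def)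
  also have "\<dots> = (R / (norm X)\<^sup>2)\<^sup>2 * (norm X)\<^sup>2 - 2 * (R / (norm X)\<^sup>2) * (R / (norm Y)\<^sup>2) * (X \<bullet> Y)
     + (R / (norm Y)\<^sup>2)\<^sup>2 * (norm Y)\<^sup>2"
    unfolding power2_norm_eq_inner
    by (simp add: inner_diff inner_commute algebra_simps power2_eq_square)
  also have "\<dots> = R\<^sup>2 * ((norm Y)\<^sup>2 - 2 * (X \<bullet> Y) + (norm X)\<^sup>2) / ((norm X)\<^sup>2 * (norm Y)\<^sup>2)"
    using X0 Y0 by (simp add: field_simps power2_eq_square)
  also have "(norm Y)\<^sup>2 - 2 * (X \<bullet> Y) + (norm X)\<^sup>2 = (norm (X - Y))\<^sup>2"
    unfolding power2_norm_eq_inner by (simp add: inner_diff inner_commute algebra_simps)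
  also have "X - Y = x - y" by (simp add: X_def Y_def)
  finally show ?thesis by (simp add: R_def X_def Y_def)
qed

lemma hdel_hrefl:
  assumes c: "norm c > 1" and "norm x < 1" "norm y < 1"
  shows "hdel (hrefl c x) (hrefl c y) = hdel x y"
proof -
  have xc: "x \<noteq> c" and yc: "y \<noteq> c" using norm_center_gt assms by blast+
  have R: "(norm c)\<^sup>2 - 1 \<noteq> 0" using c by (simp add: power2_eq_1_iff) 
  have "(norm (x - c))\<^sup>2 \<noteq> 0" "(norm (y - c))\<^sup>2 \<noteq> 0" using xc yc by auto
  moreover have "1 - (norm x)\<^sup>2 \<noteq> 0" "1 - (norm y)\<^sup>2 \<noteq> 0"
    using one_minus_norm_sq_pos assms by fastforce+
  ultimately show ?thesis
    unfolding hdel_def norm_diff_hrefl[OF xc yc] one_minus_norm_hrefl[OF xc] one_minus_norm_hrefl[OF yc]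
    using R by (simp add: divide_simps power2_eq_square)
qed

text \<open>The points closer to the origin than their mirror image are those outside the mirror
  sphere, whose squared radius is |c|^2 - 1. This identifies the half-space that contains the
  origin.\<close>

lemma norm_le_hrefl_iff:
  assumes c: "norm c > 1" and "norm x < 1"
  shows "norm x \<le> norm (hrefl c x) \<longleftrightarrow> (norm c)\<^sup>2 - 1 \<le> (norm (x - c))\<^sup>2"
proof -
  have xc: "x \<noteq> c" using norm_center_gt assms by blast
  have p: "1 - (norm x)\<^sup>2 > 0" using assms one_minus_norm_sq_pos by blast
  have q: "(norm (x - c))\<^sup>2 > 0" using xc by simp
  have "norm x \<le> norm (hrefl c x) \<longleftrightarrow> ((norm c)\<^sup>2 - 1) * (1 - (norm x)\<^sup>2) / (norm (x - c))\<^sup>2 \<le> 1 - (norm x)\<^sup>2"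
    unfolding norm_le_norm_iff_one_minus one_minus_norm_hrefl[OF xc] ..
  also have "\<dots> \<longleftrightarrow> (1 - (norm x)\<^sup>2) * ((norm c)\<^sup>2 - 1) \<le> (1 - (norm x)\<^sup>2) * (norm (x - c))\<^sup>2"
    using q by (simp add: divide_le_eq mult.commute)
  also have "\<dots> \<longleftrightarrow> (norm c)\<^sup>2 - 1 \<le> (norm (x - c))\<^sup>2" using p by simp
  finally show ?thesis .
qed

text \<open>Only points of the mirror are as far from the origin as their image. There the two
  branches of \<open>pol\<close> agree, so the choice made for ties is harmless.\<close>

lemma hrefl_fixed:
  assumes c: "norm c > 1" and x: "norm x < 1" and "norm (hrefl c x) = norm x"
  shows "hrefl c x = x"
proof -
  have xc: "x \<noteq> c" using norm_center_gt assms by blast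
  have p: "1 - (norm x)\<^sup>2 > 0" using assms one_minus_norm_sq_pos by blast
  have "1 - (norm x)\<^sup>2 = ((norm c)\<^sup>2 - 1) * (1 - (norm x)\<^sup>2) / (norm (x - c))\<^sup>2"
    using one_minus_norm_hrefl[OF xc] assms by simp
  then have "(1 - (norm x)\<^sup>2) * (norm (x - c))\<^sup>2 = (1 - (norm x)\<^sup>2) * ((norm c)\<^sup>2 - 1)"
    using xc by (simp add: field_simps)
  then have "(norm (x - c))\<^sup>2 = (norm c)\<^sup>2 - 1" using p by simp
  moreover have "(norm (x - c))\<^sup>2 \<noteq> 0" using xc by simp
  ultimately show ?thesis by (simp add: hrefl_def)
qed

text \<open>Here x lies on the side of the origin and y on the other side; folding y over to the
  side of x brings it closer. With R the squared radius of the mirror sphere, the gain is exactly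
  (|X|^2 - R) (R - |Y|^2) / R, up to the common denominator.\<close>

lemma hdel_hrefl_le:
  assumes c: "norm c > 1" and x: "norm x < 1" and y: "norm y < 1"
    and H: "norm x \<le> norm (hrefl c x)" "norm (hrefl c y) \<le> norm y"
  shows "hdel x (hrefl c y) \<le> hdel x y"
proof -
  have xc: "x \<noteq> c" and yc: "y \<noteq> c" using norm_center_gt assms by blast+
  define R where "R = (norm c)\<^sup>2 - 1"
  define X where "X = x - c"
  define Y where "Y = y - c"
  have R: "R > 0" using c by (simp add: R_def one_less_power)
  have Y0: "(norm Y)\<^sup>2 > 0" using yc by (simp add: Y_def)
  have p: "1 - (norm x)\<^sup>2 > 0" "1 - (norm y)\<^sup>2 > 0" using assms one_minus_norm_sq_pos by blast+
  have hx: "R \<le> (norm X)\<^sup>2" using norm_le_hrefl_iff[OF c x] H by (simp add: R_def X_def)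
  \<comment> \<open>If |Y|^2 > R, then y would be no farther from the origin than its image as well,
    hence fixed; but a fixed point satisfies R / |Y|^2 = 1.\<close>
  have hy: "(norm Y)\<^sup>2 \<le> R"
  proof (rule ccontr)
    assume n: "\<not> ?thesis"
    then have "norm y \<le> norm (hrefl c y)" using norm_le_hrefl_iff[OF c y] by (simp add: R_def Y_def)
    then have "norm (hrefl c y) = norm y" using H(2) by (rule antisym[rotated])
    then have "hrefl c y = y" by (rule hrefl_fixed[OF c y])
    then have "(R / (norm Y)\<^sup>2) *\<^sub>R Y = 1 *\<^sub>R Y"
      unfolding hrefl_def R_def Y_def by (metis add_diff_cancel_left' scaleR_one)
    then have "R / (norm Y)\<^sup>2 = 1" using Y0 by (subst (asm) scaleR_cancel_right) auto
    then show False using n Y0 by simp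
  qed
  have "(norm (x - hrefl c y))\<^sup>2 = (norm (X - (R / (norm Y)\<^sup>2) *\<^sub>R Y))\<^sup>2"
    by (simp add: hrefl_def R_def X_def Y_def algebra_simps)
  also have "\<dots> = (norm X)\<^sup>2 - 2 * (R / (norm Y)\<^sup>2) * (X \<bullet> Y) + (R / (norm Y)\<^sup>2)\<^sup>2 * (norm Y)\<^sup>2"
    unfolding power2_norm_eq_inner
    by (simp add: inner_diff inner_commute algebra_simps power2_eq_square)
  finally have e0: "(norm (x - hrefl c y))\<^sup>2 = (norm X)\<^sup>2 - 2 * (R / (norm Y)\<^sup>2) * (X \<bullet> Y) + (R / (norm Y)\<^sup>2)\<^sup>2 * (norm Y)\<^sup>2" .
  have e1: "(norm (x - hrefl c y))\<^sup>2 * (norm Y)\<^sup>2 / R = (norm X)\<^sup>2 * (norm Y)\<^sup>2 / R - 2 * (X \<bullet> Y) + R"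
  proof -
    define q where "q = (norm Y)\<^sup>2"
    have "q > 0" using Y0 q_def by simp
    then show ?thesis unfolding e0 q_def[symmetric] using R by (simp add: field_simps power2_eq_square)
  qed
  have "(norm (x - y))\<^sup>2 = (norm (X - Y))\<^sup>2" by (simp add: X_def Y_def)
  also have "\<dots> = (norm X)\<^sup>2 - 2 * (X \<bullet> Y) + (norm Y)\<^sup>2"
    unfolding power2_norm_eq_inner by (simp add: inner_diff inner_commute algebra_simps)
  finally have e2: "(norm (x - y))\<^sup>2 = (norm X)\<^sup>2 - 2 * (X \<bullet> Y) + (norm Y)\<^sup>2" .
  have "((norm X)\<^sup>2 - R) * (R - (norm Y)\<^sup>2) / R \<ge> 0" using hx hy R by simp
  then have "(norm X)\<^sup>2 * (norm Y)\<^sup>2 / R + R \<le> (norm X)\<^sup>2 + (norm Y)\<^sup>2"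
    using R by (simp add: field_simps)
  with e1 e2 have le: "(norm (x - hrefl c y))\<^sup>2 * (norm Y)\<^sup>2 / R \<le> (norm (x - y))\<^sup>2" by simp
  have "hdel x (hrefl c y) = ((norm (x - hrefl c y))\<^sup>2 * (norm Y)\<^sup>2 / R) / ((1 - (norm x)\<^sup>2) * (1 - (norm y)\<^sup>2))"
    unfolding hdel_def one_minus_norm_hrefl[OF yc] using R p Y0
    by (simp add: R_def[symmetric] Y_def[symmetric] field_simps)
  also have "\<dots> \<le> hdel x y"
    unfolding hdel_def using le p by (intro divide_right_mono) auto
  finally show ?thesis .
qed

text \<open>The mirror is the perpendicular bisector of a and b. Its centre lies on the Euclidean
  line through them, beyond the point that is farther from the origin; this is why the norms must
  differ.\<close>

lemma hrefl_swap_exists: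
  fixes a b :: "real ^ 'n"
  assumes ab: "norm a < norm b" and b: "norm b < 1"
  obtains c where "norm c > 1" "hrefl c b = a"
proof -
  define A where "A = 1 - (norm a)\<^sup>2"
  define B where "B = 1 - (norm b)\<^sup>2"
  \<comment> \<open>If \<open>hrefl c b = a\<close>, then a - c = l (b - c), and
    \<open>one_minus_norm_hrefl\<close> forces l to be this ratio. Solving the equation for c gives
    the centre chosen below.\<close>
  define l where "l = A / B"
  have "(norm a)\<^sup>2 < (norm b)\<^sup>2" using ab by (simp add: power_strict_mono)
  then have AB: "0 < B" "B < A" using one_minus_norm_sq_pos[OF b] by (auto simp: A_def B_def)
  then have l: "l > 1" by (simp add: l_def)
  have lB: "l * B = A" using AB by (simp add: l_def)
  define c where "c = (1 / (l - 1)) *\<^sub>R (l *\<^sub>R b - a)"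
  have bc: "b - c = (1 / (l - 1)) *\<^sub>R (a - b)"
  proof -
    have "(l - 1) *\<^sub>R (b - c) = (l - 1) *\<^sub>R b - (l *\<^sub>R b - a)" using l by (simp add: c_def scaleR_diff_right)
    also have "\<dots> = a - b" by (simp add: algebra_simps)
    finally have "(1 / (l - 1)) *\<^sub>R ((l - 1) *\<^sub>R (b - c)) = (1 / (l - 1)) *\<^sub>R (a - b)" by simp
    then show ?thesis using l by simp
  qed
  have nc: "(norm c)\<^sup>2 - 1 = l * (norm (b - c))\<^sup>2"
  proof -
    have "(norm (l *\<^sub>R b - a))\<^sup>2 = l\<^sup>2 * (norm b)\<^sup>2 - 2 * l * (a \<bullet> b) + (norm a)\<^sup>2"
      unfolding power2_norm_eq_inner by (simp add: inner_diff inner_commute algebra_simps power2_eq_square)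
    moreover have "(norm (a - b))\<^sup>2 = (norm a)\<^sup>2 - 2 * (a \<bullet> b) + (norm b)\<^sup>2"
      unfolding power2_norm_eq_inner by (simp add: inner_diff inner_commute algebra_simps power2_eq_square)
    moreover have "(norm a)\<^sup>2 = 1 - l * B" "(norm b)\<^sup>2 = 1 - B" using lB by (auto simp: A_def B_def)
    ultimately have "(norm (l *\<^sub>R b - a))\<^sup>2 - (l - 1)\<^sup>2 = l * (norm (a - b))\<^sup>2"
      by algebra
    then have "((norm (l *\<^sub>R b - a))\<^sup>2 - (l - 1)\<^sup>2) / (l - 1)\<^sup>2 = l * (norm (a - b))\<^sup>2 / (l - 1)\<^sup>2" by simp
    then show ?thesis unfolding bc using l unfolding c_def
      by (simp add: power_mult_distrib power_divide diff_divide_distrib)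
  qed
  have ab': "a \<noteq> b" using ab by auto
  have np: "norm (b - c) > 0" unfolding bc using l ab' by simp
  have "(norm c)\<^sup>2 > 1" using nc np l by (smt (verit) mult_pos_pos zero_less_power)
  then have c1: "norm c > 1" by (smt (verit) norm_ge_zero power_le_one)
  have "hrefl c b = c + l *\<^sub>R (b - c)"
    unfolding hrefl_def nc using np by simp
  also have "\<dots> = b + (l - 1) *\<^sub>R (b - c)" by (simp add: algebra_simps)
  also have "\<dots> = a" unfolding bc using l by simp
  finally show ?thesis using that c1 by blast
qed


subsection \<open>The hyperbolic measure\<close>

definition hmeas :: "(real ^ 'n) measure" where
  "hmeas = density lborel (\<lambda>x. ennreal (indicator (ball 0 1) x * hdens x))"

lemma sets_hmeas [simp, measurable_cong]: "sets hmeas = sets borel"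
  and space_hmeas [simp]: "space hmeas = UNIV"
  by (auto simp: hmeas_def)

lemma hdens_measurable [measurable]: "hdens \<in> borel_measurable borel"
  unfolding hdens_def[abs_def] by measurable

lemma hdens_ball_measurable: "(\<lambda>x. indicat_real (ball 0 1) x * hdens x) \<in> borel_measurable borel"
  by (intro borel_measurable_times borel_measurable_indicator hdens_measurable) simp

lemma hdens_ball_measurable_ennreal:
  "(\<lambda>x. ennreal (indicat_real (ball 0 1) x * hdens x)) \<in> borel_measurable borel"
  by (rule measurable_compose[OF hdens_ball_measurable measurable_ennreal])

lemma hrefl_measurable [measurable]: "hrefl c \<in> borel_measurable borel"
  unfolding hrefl_def[abs_def] by measurable

lemma hdens_pos: "norm x < 1 \<Longrightarrow> 0 < hdens x"
  using one_minus_norm_sq_pos[of x] by (simp add: hdens_def)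

lemma hdens_le:
  fixes x :: "real ^ 'n"
  assumes "norm x \<le> R" "R < 1"
  shows "hdens x \<le> (2 / (1 - R\<^sup>2)) ^ CARD('n)"
proof -
  have R0: "0 \<le> R" using assms norm_ge_zero order_trans by blast
  have "(norm x)\<^sup>2 \<le> R\<^sup>2" using assms by (simp add: power_mono)
  moreover have "0 < 1 - R\<^sup>2" using assms R0 by (simp add: power_less_one_iff abs_square_less_1)
  ultimately show ?thesis unfolding hdens_def
    by (intro power_mono divide_left_mono) auto
qed

lemma hdens_abs_integrable:
  fixes A :: "(real ^ 'n) set"
  assumes A: "A \<in> sets borel" "A \<subseteq> cball 0 R" and R: "R < 1"
  shows "set_integrable lborel A hdens"
proof -
  let ?K = "(2 / (1 - R\<^sup>2)) ^ CARD('n)"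
  have "integrable lborel (\<lambda>x :: real ^ 'n. indicator (cball 0 R) x *\<^sub>R ?K :: real)"
    using emeasure_lborel_cball_finite[of "0 :: real ^ 'n" R]
    by (intro integrable_scaleR_left integrable_real_indicator) (auto simp: less_top)
  then show ?thesis unfolding set_integrable_def
  proof (rule Bochner_Integration.integrable_bound)
    show "(\<lambda>x. indicat_real A x *\<^sub>R hdens x) \<in> borel_measurable lborel" using A by measurable
    have "norm (indicat_real A x *\<^sub>R hdens x) \<le> norm (indicator (cball 0 R) x *\<^sub>R ?K :: real)" for x
    proof (cases "x \<in> A")
      case True
      then have xR: "norm x \<le> R" using A by auto
      then have "0 < hdens x" using R by (intro hdens_pos) simp
      then have "\<bar>hdens x\<bar> \<le> \<bar>?K\<bar>" using hdens_le[OF xR R] by linarith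
      then show ?thesis using True xR by simp
    qed simp
    then show "AE x in lborel. norm (indicat_real A x *\<^sub>R hdens x) \<le> norm (indicator (cball 0 R) x *\<^sub>R ?K :: real)"
      by simp
  qed
qed

lemma emeasure_hmeas_eq_integral:
  fixes A :: "(real ^ 'n) set"
  assumes A: "A \<in> sets borel" "A \<subseteq> ball 0 1" and I: "(hdens has_integral I) A"
  shows "emeasure hmeas A = ennreal I"
proof -
  have "emeasure hmeas A = (\<integral>\<^sup>+ x. ennreal (indicator (ball 0 1) x * hdens x) * indicator A x \<partial>lborel)"
    unfolding hmeas_def using A hdens_ball_measurable_ennreal by (subst emeasure_density) auto
  also have "\<dots> = (\<integral>\<^sup>+ x. ennreal (hdens x) * indicator A x \<partial>lborel)"
    using A by (intro nn_integral_cong) (auto simp: indicator_def)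
  also have "\<dots> = ennreal I"
    using A by (intro nn_integral_has_integral_lebesgue' I less_imp_le hdens_pos) auto
  finally show ?thesis .
qed

lemma orthogonal_transformation_hyperplane_reflection:
  fixes e :: "real ^ 'n"
  assumes "e \<bullet> e = 1"
  shows "orthogonal_transformation (\<lambda>h. h - (2 * (e \<bullet> h)) *\<^sub>R e)"
  unfolding orthogonal_transformation_def
proof (intro conjI allI)
  show "linear (\<lambda>h. h - (2 * (e \<bullet> h)) *\<^sub>R e)"
    by (intro linearI) (simp_all add: inner_add_right algebra_simps)
  fix v w
  show "(v - (2 * (e \<bullet> v)) *\<^sub>R e) \<bullet> (w - (2 * (e \<bullet> w)) *\<^sub>R e) = v \<bullet> w"
    using assms by (simp add: inner_diff_left inner_diff_right inner_commute algebra_simps)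
qed

text \<open>The derivative of an inversion is the conformal factor times the reflection in the
  hyperplane orthogonal to x - c, so the absolute determinant is the n-th power of that
  factor.\<close>

lemma hrefl_has_derivative:
  fixes c x :: "real ^ 'n"
  assumes "norm c > 1" "norm x < 1"
  shows "\<exists>D. (hrefl c has_derivative D) (at x within S) \<and>
     \<bar>det (matrix D)\<bar> = (((norm c)\<^sup>2 - 1) / (norm (x - c))\<^sup>2) ^ CARD('n)"
proof -
  define R where "R = (norm c)\<^sup>2 - 1"
  define X where "X = x - c"
  define k where "k = R / (norm X)\<^sup>2"
  define e where "e = (1 / norm X) *\<^sub>R X"
  have xc: "x \<noteq> c" using norm_center_gt assms by blast
  then have X0: "X \<bullet> X \<noteq> 0" "norm X \<noteq> 0" by (auto simp: X_def)
  have R0: "R > 0" using assms by (simp add: R_def one_less_power)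
  define T where "T = (\<lambda>h. h - (2 * (e \<bullet> h)) *\<^sub>R e)"
  define D where "D = (\<lambda>h. k *\<^sub>R T h)"
  have ee: "e \<bullet> e = 1" using X0 by (simp add: e_def dot_square_norm power2_eq_square)
  have oT: "orthogonal_transformation T" unfolding T_def
    by (rule orthogonal_transformation_hyperplane_reflection[OF ee])
  have "(hrefl c has_derivative D) (at x within S)"
  proof -
    have eq: "hrefl c = (\<lambda>x. c + (R * inverse ((x - c) \<bullet> (x - c))) *\<^sub>R (x - c))"
      by (auto simp: hrefl_def R_def dot_square_norm divide_inverse)
    have "((\<lambda>x. c + (R * inverse ((x - c) \<bullet> (x - c))) *\<^sub>R (x - c)) has_derivative
      (\<lambda>h. (R * inverse (X \<bullet> X)) *\<^sub>R h +
         (R * - (inverse (X \<bullet> X) * (X \<bullet> h + h \<bullet> X) * inverse (X \<bullet> X))) *\<^sub>R X)) (at x within S)"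
      unfolding X_def using X0(1) unfolding X_def by (auto intro!: derivative_eq_intros)
    moreover have "(R * inverse (X \<bullet> X)) *\<^sub>R h +
         (R * - (inverse (X \<bullet> X) * (X \<bullet> h + h \<bullet> X) * inverse (X \<bullet> X))) *\<^sub>R X = D h" for h
      using X0 by (simp add: D_def T_def k_def e_def dot_square_norm field_simps power2_eq_square inner_commute scaleR_diff_right)
    ultimately show ?thesis unfolding eq by simp
  qed
  moreover have "\<bar>det (matrix D)\<bar> = k ^ CARD('n)"
  proof -
    have "matrix D = matrix ((*\<^sub>R) k \<circ> T)" by (simp add: D_def o_def)
    also have "\<dots> = matrix ((*\<^sub>R) k) ** matrix T"
      using oT by (intro matrix_compose) (auto simp: orthogonal_transformation_def linear_scaleR)
    finally have "det (matrix D) = k ^ CARD('n) * det (matrix T)" by (simp add: det_mul)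
    then show ?thesis using oT R0 by (simp add: abs_mult k_def)
  qed
  ultimately show ?thesis by (auto simp: k_def R_def X_def)
qed

lemma emeasure_hmeas_Int_ball: "A \<in> sets borel \<Longrightarrow> emeasure hmeas A = emeasure hmeas (A \<inter> ball 0 1)"
  unfolding hmeas_def using hdens_ball_measurable_ennreal
  by (subst (1 2) emeasure_density) (auto intro!: nn_integral_cong simp: indicator_def)

text \<open>Exhaustion by balls of radius less than 1, where \<open>hdens\<close> is integrable and
  the change of variables applies. The map \<open>s\<close> is kept general because the lemma is
  used both for the reflection and for the identity.\<close>

lemma emeasure_hmeas_SUP:
  fixes A :: "(real ^ 'n) set"
  assumes "A \<in> sets borel" and s: "s \<in> borel_measurable borel"
    and ball: "\<And>x. norm (s x) < 1 \<longleftrightarrow> norm x < 1"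
  shows "emeasure hmeas (s -` A) = (SUP k. emeasure hmeas (s -` (A \<inter> cball (0 :: real ^ 'n) (1 - 1 / Suc k))))"
proof -
  have m: "s -` B \<in> sets borel" if "B \<in> sets borel" for B
    using measurable_sets[OF s that] by simp
  have "emeasure hmeas (s -` A) = emeasure hmeas (s -` A \<inter> ball 0 1)"
    by (rule emeasure_hmeas_Int_ball) (use m assms in auto)
  also have "s -` A \<inter> ball 0 1 = (\<Union>k. s -` (A \<inter> cball (0 :: real ^ 'n) (1 - 1 / Suc k)))" (is "?L = ?R")
  proof (intro equalityI subsetI)
    fix x assume x: "x \<in> ?L"
    then have "1 - norm (s x) > 0" using ball by simp
    then obtain k where "inverse (real (Suc k)) < 1 - norm (s x)" using reals_Archimedean by blast
    then have "norm (s x) \<le> 1 - 1 / Suc k" by (simp add: inverse_eq_divide)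
    then show "x \<in> ?R" using x by auto
  next
    fix x assume "x \<in> ?R"
    then obtain k where "s x \<in> A" "norm (s x) \<le> 1 - 1 / Suc k" by auto
    moreover have "1 - 1 / Suc k < (1::real)" by simp
    ultimately have "norm (s x) < 1" by (meson le_less_trans)
    then show "x \<in> ?L" using \<open>s x \<in> A\<close> ball by auto
  qed
  also have "emeasure hmeas \<dots> = (SUP k. emeasure hmeas (s -` (A \<inter> cball (0 :: real ^ 'n) (1 - 1 / Suc k))))"
  proof (rule SUP_emeasure_incseq[symmetric])
    show "range (\<lambda>k. s -` (A \<inter> cball 0 (1 - 1 / real (Suc k)))) \<subseteq> sets hmeas"
      using m assms(1) by auto
    have "1 - 1 / real (Suc m) \<le> 1 - 1 / real (Suc n)" if "m \<le> n" for m n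
      using that by (simp add: frac_le)
    then show "incseq (\<lambda>k. s -` (A \<inter> cball 0 (1 - 1 / real (Suc k))))"
      unfolding incseq_def by (intro allI impI vimage_mono Int_mono subset_cball) auto
  qed
  finally show ?thesis .
qed

lemma emeasure_hrefl_wellorder:
  fixes c :: "real ^ 'm::{finite,wellorder}"
  assumes c: "norm c > 1" and A: "A \<in> sets borel"
  shows "emeasure hmeas (hrefl c -` A) = emeasure hmeas A"
proof -
  have main: "emeasure hmeas (hrefl c -` B) = emeasure hmeas B"
    if B: "B \<in> sets borel" "B \<subseteq> cball 0 R" and R: "R < 1" for B R
  proof -
    let ?S = "hrefl c -` B"
    have S: "?S \<in> sets borel" using measurable_sets[OF hrefl_measurable B(1)] by simp
    have Bball: "B \<subseteq> ball 0 1" using B R by auto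
    have Sball: "?S \<subseteq> ball 0 1" using Bball hrefl_in_ball_iff[OF c] by auto
    have im: "hrefl c ` ?S = B" using hrefl_hrefl[OF c] by (auto simp: image_iff) metis
    have "\<forall>x. \<exists>D. x \<in> ?S \<longrightarrow> (hrefl c has_derivative D) (at x within ?S) \<and>
       \<bar>det (matrix D)\<bar> = (((norm c)\<^sup>2 - 1) / (norm (x - c))\<^sup>2) ^ CARD('m)"
      using hrefl_has_derivative[OF c] Sball by (metis mem_ball_0 subsetD)
    then obtain D where D: "\<And>x. x \<in> ?S \<Longrightarrow> (hrefl c has_derivative D x) (at x within ?S)"
      "\<And>x. x \<in> ?S \<Longrightarrow> \<bar>det (matrix (D x))\<bar> = (((norm c)\<^sup>2 - 1) / (norm (x - c))\<^sup>2) ^ CARD('m)"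
      by metis
    \<comment> \<open>The conformal factor cancels between the Jacobian and
      \<open>one_minus_norm_hrefl\<close>; this is the infinitesimal form of volume
      preservation.\<close>
    have jac: "\<bar>det (matrix (D x))\<bar> * hdens (hrefl c x) = hdens x" if "x \<in> ?S" for x
    proof -
      have nx: "norm x < 1" using that Sball by auto
      then have xc: "x \<noteq> c" using norm_center_gt c by blast
      have R: "(norm c)\<^sup>2 - 1 > 0" using c by (simp add: one_less_power)
      have "\<bar>det (matrix (D x))\<bar> * hdens (hrefl c x)
         = ((((norm c)\<^sup>2 - 1) / (norm (x - c))\<^sup>2) * (2 / (((norm c)\<^sup>2 - 1) * (1 - (norm x)\<^sup>2) / (norm (x - c))\<^sup>2))) ^ CARD('m)"
        unfolding D(2)[OF that] hdens_def one_minus_norm_hrefl[OF xc] by (rule power_mult_distrib[symmetric])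
      also have "(((norm c)\<^sup>2 - 1) / (norm (x - c))\<^sup>2) * (2 / (((norm c)\<^sup>2 - 1) * (1 - (norm x)\<^sup>2) / (norm (x - c))\<^sup>2))
         = 2 / (1 - (norm x)\<^sup>2)"
        using R xc one_minus_norm_sq_pos[OF nx] by (simp add: divide_simps)
      finally show ?thesis by (simp add: hdens_def)
    qed
    have inj: "inj_on (hrefl c) ?S" by (metis hrefl_hrefl[OF c] inj_onI)
    \<comment> \<open>The change-of-variables theorem speaks about functions with values in a vector
      type, so the density is encoded with values in \<open>real ^ 1\<close>.\<close>
    define f :: "(real, 'm) vec \<Rightarrow> real ^ 1" where "f x = vec (hdens x)" for x
    have fint: "hdens absolutely_integrable_on B"
    proof -
      have "set_integrable lborel B hdens" by (rule hdens_abs_integrable[OF B R])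
      then show ?thesis unfolding set_integrable_def by (simp add: integrable_completion)
    qed
    define b where "b = integral B hdens"
    have "f absolutely_integrable_on (hrefl c ` ?S) \<and> integral (hrefl c ` ?S) f = vec b"
      using fint unfolding im f_def absolutely_integrable_on_1_iff integral_on_1_eq by (simp add: b_def)
    then have "(\<lambda>x. \<bar>det (matrix (D x))\<bar> *\<^sub>R f (hrefl c x)) absolutely_integrable_on ?S \<and>
       integral ?S (\<lambda>x. \<bar>det (matrix (D x))\<bar> *\<^sub>R f (hrefl c x)) = vec b"
      using has_absolute_integral_change_of_variables[OF _ D(1) inj, of f "vec b"] S by auto
    then have "(\<lambda>x. \<bar>det (matrix (D x))\<bar> * hdens (hrefl c x)) absolutely_integrable_on ?S \<and>
       integral ?S (\<lambda>x. \<bar>det (matrix (D x))\<bar> * hdens (hrefl c x)) = b"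
      unfolding f_def absolutely_integrable_on_1_iff integral_on_1_eq by (simp add: vec_eq_iff)
    then have "(\<lambda>x. \<bar>det (matrix (D x))\<bar> * hdens (hrefl c x)) integrable_on ?S" "integral ?S (\<lambda>x. \<bar>det (matrix (D x))\<bar> * hdens (hrefl c x)) = b"
      by (auto simp: absolutely_integrable_on_def)
    then have "((\<lambda>x. \<bar>det (matrix (D x))\<bar> * hdens (hrefl c x)) has_integral b) ?S"
      using integrable_integral by blast
    then have "(hdens has_integral b) ?S" using jac by (subst (asm) has_integral_cong) auto
    then have 1: "emeasure hmeas ?S = ennreal b" by (rule emeasure_hmeas_eq_integral[OF S Sball])
    have "(hdens has_integral b) B" using fint by (auto simp: absolutely_integrable_on_def b_def integrable_integral)
    then have "emeasure hmeas B = ennreal b" by (rule emeasure_hmeas_eq_integral[OF B(1) Bball])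
    with 1 show ?thesis by simp
  qed
  have "emeasure hmeas (hrefl c -` A) = (SUP k. emeasure hmeas (hrefl c -` (A \<inter> cball 0 (1 - 1 / Suc k))))"
    by (rule emeasure_hmeas_SUP[OF A hrefl_measurable hrefl_in_ball_iff[OF c]])
  also have "\<dots> = (SUP k. emeasure hmeas (A \<inter> cball 0 (1 - 1 / Suc k)))"
    using A by (intro SUP_cong refl main[where R="1 - 1 / Suc _"]) auto
  also have "\<dots> = emeasure hmeas A"
    using emeasure_hmeas_SUP[OF A, of "\<lambda>x. x"] by simp
  finally show ?thesis .
qed

text \<open>The change-of-variables theorem of the library needs a well-ordered index type, whereas the
  dimension is an arbitrary finite type here; \<open>'n idx\<close> is a well-ordered copy of it.\<close>

typedef (overloaded) ('n::finite) idx = "{..<CARD('n)}"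
  by (rule exI[of _ 0]) simp

instance idx :: (finite) finite
proof
  have "(UNIV :: 'a idx set) = Abs_idx ` {..<CARD('a)}"
    by (metis type_definition.Abs_image type_definition_idx)
  then show "finite (UNIV :: 'a idx set)" by (metis finite_imageI finite_lessThan)
qed

lemma card_idx: "CARD('n::finite idx) = CARD('n)"
  using type_definition.card[OF type_definition_idx] by simp

instantiation idx :: (finite) wellorder
begin
definition "a \<le> b \<longleftrightarrow> Rep_idx a \<le> Rep_idx b"
definition "a < b \<longleftrightarrow> Rep_idx a < Rep_idx b"
instance
proof
  fix P :: "'a idx \<Rightarrow> bool" and a
  assume *: "\<And>x. (\<And>y. y < x \<Longrightarrow> P y) \<Longrightarrow> P x"
  show "P a" by (induction "Rep_idx a" arbitrary: a rule: less_induct) (use * in \<open>auto simp: less_idx_def\<close>)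
qed (auto simp: less_eq_idx_def less_idx_def Rep_idx_inject)
end

definition idx_map :: "'n::finite idx \<Rightarrow> 'n" where
  "idx_map = (SOME b. bij b)"

lemma bij_idx_map: "bij (idx_map :: 'n::finite idx \<Rightarrow> 'n)"
proof -
  have "\<exists>b :: 'n idx \<Rightarrow> 'n. bij b"
    using finite_same_card_bij[of "UNIV :: 'n idx set" "UNIV :: 'n set"] card_idx[where 'n='n] by auto
  then show ?thesis unfolding idx_map_def by (rule someI_ex)
qed

definition to_idx :: "real ^ 'n \<Rightarrow> real ^ ('n::finite idx)" where
  "to_idx x = (\<chi> i. x $ idx_map i)"

definition of_idx :: "real ^ ('n::finite idx) \<Rightarrow> real ^ 'n" where
  "of_idx x = (\<chi> i. x $ (inv idx_map i))"

lemma of_to_idx [simp]: "of_idx (to_idx x) = x"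
  by (simp add: of_idx_def to_idx_def vec_eq_iff surj_f_inv_f[OF bij_is_surj[OF bij_idx_map]])

lemma to_of_idx [simp]: "to_idx (of_idx x) = x"
  by (simp add: of_idx_def to_idx_def vec_eq_iff inv_f_f[OF bij_is_inj[OF bij_idx_map]])

lemma norm_to_idx: "norm (to_idx x) = norm x"
proof -
  have "(\<Sum>i\<in>UNIV. (norm (x $ idx_map i))\<^sup>2) = (\<Sum>i\<in>UNIV. (norm (x $ i))\<^sup>2)"
    using bij_idx_map by (rule sum.reindex_bij_betw)
  then show ?thesis by (simp add: norm_vec_def L2_set_def to_idx_def)
qed

lemma to_idx_hrefl: "to_idx (hrefl c x) = hrefl (to_idx c) (to_idx x)"
proof -
  have "to_idx x - to_idx c = to_idx (x - c)" by (simp add: to_idx_def vec_eq_iff)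
  then have "norm (to_idx x - to_idx c) = norm (x - c)" by (simp add: norm_to_idx)
  then show ?thesis unfolding hrefl_def norm_to_idx by (simp add: to_idx_def vec_eq_iff)
qed

lemma hdens_to_idx: "hdens (to_idx x) = hdens x"
  by (simp add: hdens_def norm_to_idx card_idx)

lemma to_idx_measurable [measurable]: "to_idx \<in> borel_measurable borel"
proof (rule borel_measurable_continuous_onI)
  show "continuous_on UNIV (to_idx :: real ^ 'n \<Rightarrow> _)"
    unfolding to_idx_def[abs_def] by (intro continuous_intros)
qed

lemma of_idx_measurable [measurable]: "of_idx \<in> borel_measurable borel"
proof (rule borel_measurable_continuous_onI)
  show "continuous_on UNIV (of_idx :: _ \<Rightarrow> real ^ 'n)"
    unfolding of_idx_def[abs_def] by (intro continuous_intros)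
qed

lemma distr_lborel_to_idx: "distr lborel borel (to_idx :: real ^ 'n \<Rightarrow> _) = lborel"
proof (rule lborel_eqI[symmetric])
  fix l u :: "real ^ ('n idx)"
  assume le: "\<And>b. b \<in> Basis \<Longrightarrow> l \<bullet> b \<le> u \<bullet> b"
  have le': "l $ i \<le> u $ i" for i using le[of "axis i 1"] by (simp add: inner_axis' cart_eq_inner_axis axis_in_Basis_iff)
  have vim: "to_idx -` box l u = (box (of_idx l) (of_idx u) :: (real ^ 'n) set)"
  proof (intro set_eqI iffI)
    fix x :: "real ^ 'n"
    assume x: "x \<in> to_idx -` box l u"
    then have "l $ (inv idx_map i) < to_idx x $ (inv idx_map i) \<and> to_idx x $ (inv idx_map i) < u $ (inv idx_map i)" for i
      by (auto simp: mem_box_cart)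
    then show "x \<in> box (of_idx l) (of_idx u)" using bij_idx_map[where 'n='n]
      by (simp add: mem_box_cart of_idx_def to_idx_def bij_is_surj surj_f_inv_f)
  next
    fix x :: "real ^ 'n"
    assume x: "x \<in> box (of_idx l) (of_idx u)"
    then have "of_idx l $ (idx_map i) < x $ (idx_map i) \<and> x $ (idx_map i) < of_idx u $ (idx_map i)" for i
      by (auto simp: mem_box_cart)
    then show "x \<in> to_idx -` box l u" using bij_idx_map[where 'n='n]
      by (simp add: mem_box_cart of_idx_def to_idx_def bij_is_inj inv_f_f)
  qed
  have prodB: "(\<Prod>b\<in>Basis. (v - w) \<bullet> b) = (\<Prod>i\<in>UNIV. v $ i - w $ i)" for v w :: "real ^ 'k"
  proof -
    have B: "(Basis :: (real ^ 'k) set) = range (\<lambda>i. axis i 1)" by (auto simp: Basis_vec_def)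
    have "inj (\<lambda>i::'k. axis i (1::real))" by (auto simp: inj_def axis_eq_axis)
    then show ?thesis unfolding B by (subst prod.reindex) (auto simp: cart_eq_inner_axis[symmetric])
  qed
  have "emeasure (distr lborel borel to_idx) (box l u) = emeasure lborel (box (of_idx l) (of_idx u) :: (real ^ 'n) set)"
    by (subst emeasure_distr) (auto simp: vim)
  also have "\<dots> = ennreal (\<Prod>b\<in>Basis. (of_idx u - of_idx l :: real ^ 'n) \<bullet> b)"
  proof (rule emeasure_lborel_box)
    fix b :: "real ^ 'n" assume "b \<in> Basis"
    then obtain i where "b = axis i 1" by (auto simp: Basis_vec_def)
    then show "of_idx l \<bullet> b \<le> of_idx u \<bullet> b" using le' by (simp add: cart_eq_inner_axis[symmetric] of_idx_def)
  qed
  also have "(\<Prod>b\<in>Basis. (of_idx u - of_idx l :: real ^ 'n) \<bullet> b) = (\<Prod>i\<in>UNIV. u $ (inv idx_map i) - l $ (inv idx_map (i :: 'n)))"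
    unfolding prodB by (simp add: of_idx_def)
  also have "\<dots> = (\<Prod>i\<in>UNIV. u $ i - l $ i)"
    using bij_betw_inv_into[OF bij_idx_map[where 'n='n]] by (rule prod.reindex_bij_betw)
  finally show "emeasure (distr lborel borel (to_idx :: real ^ 'n \<Rightarrow> _)) (box l u) = ennreal (\<Prod>b\<in>Basis. (u - l) \<bullet> b)"
    unfolding prodB by simp
qed simp

lemma distr_hmeas_to_idx: "distr hmeas borel (to_idx :: real ^ 'n \<Rightarrow> _) = hmeas"
proof -
  have "hmeas = density (distr lborel borel (to_idx :: real ^ 'n \<Rightarrow> _)) (\<lambda>x. ennreal (indicator (ball 0 1) x * hdens x))"
    unfolding hmeas_def distr_lborel_to_idx ..
  also have "\<dots> = distr (density lborel (\<lambda>x. ennreal (indicator (ball 0 1) (to_idx x) * hdens (to_idx x)))) borel (to_idx :: real ^ 'n \<Rightarrow> _)"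
    using hdens_ball_measurable_ennreal by (subst density_distr) auto
  also have "(\<lambda>x :: real ^ 'n. ennreal (indicator (ball 0 1) (to_idx x) * hdens (to_idx x))) = (\<lambda>x. ennreal (indicator (ball 0 1) x * hdens x))"
    by (auto simp: hdens_to_idx norm_to_idx indicator_def)
  finally show ?thesis by (simp add: hmeas_def)
qed

theorem distr_hmeas_hrefl:
  fixes c :: "real ^ 'n"
  assumes c: "norm c > 1"
  shows "distr hmeas borel (hrefl c) = hmeas"
proof (rule measure_eqI)
  fix A :: "(real ^ 'n) set"
  assume "A \<in> sets (distr hmeas borel (hrefl c))"
  then have A: "A \<in> sets borel" by simp
  let ?B = "of_idx -` A"
  have B: "?B \<in> sets borel" using measurable_sets[OF of_idx_measurable A] by simp
  have hB: "hrefl (to_idx c) -` ?B \<in> sets borel" using measurable_sets[OF hrefl_measurable B] by simp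
  have "emeasure (distr hmeas borel (hrefl c)) A = emeasure hmeas (hrefl c -` A)"
    using A by (subst emeasure_distr) auto
  also have "hrefl c -` A = to_idx -` (hrefl (to_idx c) -` ?B)"
    by (auto simp: to_idx_hrefl[symmetric])
  also have "emeasure hmeas \<dots> = emeasure (distr hmeas borel to_idx) (hrefl (to_idx c) -` ?B)"
    using hB by (subst emeasure_distr) auto
  also have "\<dots> = emeasure hmeas (hrefl (to_idx c) -` ?B)" unfolding distr_hmeas_to_idx ..
  also have "\<dots> = emeasure hmeas ?B"
    by (rule emeasure_hrefl_wellorder[OF _ B]) (simp add: norm_to_idx c)
  also have "\<dots> = emeasure (distr hmeas borel (to_idx :: real ^ 'n \<Rightarrow> _)) ?B" unfolding distr_hmeas_to_idx ..
  also have "\<dots> = emeasure hmeas A" using B by (subst emeasure_distr) (auto simp: vimage_def)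
  finally show "emeasure (distr hmeas borel (hrefl c)) A = emeasure hmeas A" .
qed simp

lemma integral_hmeas_hrefl:
  fixes g :: "real ^ 'n \<Rightarrow> real"
  assumes "norm c > 1" "g \<in> borel_measurable borel"
  shows "(\<integral>x. g (hrefl c x) \<partial>hmeas) = (\<integral>x. g x \<partial>hmeas)"
  using integral_distr[of "hrefl c" hmeas borel g] assms by (simp add: distr_hmeas_hrefl)

lemma integrable_hmeas_hrefl:
  fixes g :: "real ^ 'n \<Rightarrow> real"
  assumes "norm c > 1" "g \<in> borel_measurable borel"
  shows "integrable hmeas (\<lambda>x. g (hrefl c x)) \<longleftrightarrow> integrable hmeas g"
  using integrable_distr_eq[of "hrefl c" hmeas borel g] assms by (simp add: distr_hmeas_hrefl)

lemma integrable_hmeas_bounded: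
  fixes g :: "real ^ 'n \<Rightarrow> real"
  assumes g: "g \<in> borel_measurable borel" and R: "R < 1"
    and supp: "\<And>x. norm x > R \<Longrightarrow> g x = 0" and B: "\<And>x. \<bar>g x\<bar> \<le> B"
  shows "integrable hmeas g"
proof -
  have "integrable lborel (\<lambda>x. B * (indicat_real (cball 0 R) x *\<^sub>R hdens x))"
    using hdens_abs_integrable[of "cball 0 R" R] R unfolding set_integrable_def by (intro integrable_mult_right) auto
  then have "integrable lborel (\<lambda>x. (indicator (ball 0 1) x * hdens x) *\<^sub>R g x)"
  proof (rule Bochner_Integration.integrable_bound)
    show "(\<lambda>x. (indicat_real (ball 0 1) x * hdens x) *\<^sub>R g x) \<in> borel_measurable lborel"
      using borel_measurable_times[OF hdens_ball_measurable g] by simp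
    have "norm ((indicat_real (ball 0 1) x * hdens x) *\<^sub>R g x) \<le> norm (B * (indicat_real (cball 0 R) x *\<^sub>R hdens x))" for x
    proof (cases "norm x \<le> R")
      case True
      then have "0 < hdens x" using R hdens_pos by (meson le_less_trans)
      then show ?thesis using True R mult_right_mono[OF B[of x], of "hdens x"] by (simp add: abs_mult mult.commute order.trans[OF _ mult_right_mono[OF abs_ge_self]])
    next
      case False
      then show ?thesis using supp[of x] by simp
    qed
    then show "AE x in lborel. norm ((indicat_real (ball 0 1) x * hdens x) *\<^sub>R g x) \<le> norm (B * (indicat_real (cball 0 R) x *\<^sub>R hdens x))"
      by simp
  qed
  then show ?thesis unfolding hmeas_def
    by (subst integrable_density) (use g hdens_ball_measurable in \<open>auto simp: indicator_def intro: less_imp_le hdens_pos\<close>)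
qed

lemma integral_hmeas_eq:
  fixes g :: "real ^ 'n \<Rightarrow> real"
  assumes g: "g \<in> borel_measurable borel" and i: "integrable hmeas g"
  shows "(\<integral>x. g x \<partial>hmeas) = integral (ball 0 1) (\<lambda>x. g x * hdens x)"
proof -
  have nn: "AE x in lborel. 0 \<le> indicat_real (ball 0 1) x * hdens (x :: real ^ 'n)"
    by (auto simp: indicator_def intro: less_imp_le hdens_pos)
  have "(\<integral>x. g x \<partial>hmeas) = (\<integral>x. (indicator (ball 0 1) x * hdens x) *\<^sub>R g x \<partial>lborel)"
    unfolding hmeas_def by (rule integral_density) (use g nn hdens_ball_measurable in auto)
  also have "\<dots> = (LINT x : ball 0 1 | lborel. g x * hdens x)"
    unfolding set_lebesgue_integral_def by (rule Bochner_Integration.integral_cong) (auto simp: mult_ac)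
  also have "\<dots> = integral (ball 0 1) (\<lambda>x. g x * hdens x)"
  proof (rule set_borel_integral_eq_integral)
    have "integrable lborel (\<lambda>x. (indicator (ball 0 1) x * hdens x) *\<^sub>R g x)"
      using i unfolding hmeas_def by (subst (asm) integrable_density) (use g nn hdens_ball_measurable in auto)
    then show "set_integrable lborel (ball 0 1) (\<lambda>x. g x * hdens x)"
      unfolding set_integrable_def by (simp add: mult_ac)
  qed
  finally show ?thesis .
qed


section \<open>Convexity of powers and the two-point inequality\<close>

lemma powr_convex_nonneg:
  assumes "p \<ge> (1::real)" shows "convex_on {0..} (\<lambda>x. x powr p)"
  unfolding convex_on_def
proof (intro conjI ballI allI impI)
  fix x y u v :: real
  assume *: "x \<in> {0..}" "y \<in> {0..}" "0 \<le> u" "0 \<le> v" "u + v = 1"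
  have le: "(t * z) powr p \<le> t * z powr p" if "0 \<le> t" "t \<le> 1" "0 \<le> z" for t z :: real
  proof (cases "t = 0")
    case False
    then have "t powr p \<le> t powr 1" using that assms by (intro powr_mono') auto
    then show ?thesis using that by (simp add: powr_mult mult_right_mono)
  qed simp
  show "(u *\<^sub>R x + v *\<^sub>R y) powr p \<le> u * x powr p + v * y powr p"
  proof (cases "x = 0 \<or> y = 0")
    case True
    then show ?thesis using * le[of u x] le[of v y] by auto
  next
    case False
    then show ?thesis using * powr_convex[OF assms] unfolding convex_on_def by auto
  qed
qed simp

text \<open>If the two pairs are ordered alike, both sides agree. Otherwise sorting replaces the
  gaps A - a and B - b by A - b and B - a, which have the same sum and lie between the old gaps;
  convexity of the power then gives the inequality.\<close>

lemma two_point_powr_le: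
  fixes a b A B p :: real
  assumes "p \<ge> 1" "a \<le> A" "b \<le> B"
  shows "(max A B - max a b) powr p + (min A B - min a b) powr p \<le> (A - a) powr p + (B - b) powr p"
proof -
  have key: "(A - b) powr p + (B - a) powr p \<le> (A - a) powr p + (B - b) powr p"
    if "B \<le> A" "a < b" "b \<le> B" for a b A B :: real
  proof -
    define m where "m = (A - a) - (B - b)"
    have m: "m > 0" using that by (simp add: m_def)
    define t where "t = (A - B) / m"
    have t: "0 \<le> t" "t \<le> 1" "1 - t = (b - a) / m" using m that by (auto simp: t_def m_def field_simps)
    have tm: "t * m = A - B" using m by (simp add: t_def)
    have 1: "A - b = t *\<^sub>R (A - a) + (1 - t) *\<^sub>R (B - b)"
      using tm unfolding m_def real_scaleR_def by algebra
    have 2: "B - a = (1 - t) *\<^sub>R (A - a) + t *\<^sub>R (B - b)"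
      using tm unfolding m_def real_scaleR_def by algebra
    note cv = powr_convex_nonneg[OF assms(1), unfolded convex_on_def, THEN conjunct2, rule_format]
    have "(A - b) powr p \<le> t * (A - a) powr p + (1 - t) * (B - b) powr p"
      unfolding 1 by (rule cv) (use t that in auto)
    moreover have "(B - a) powr p \<le> (1 - t) * (A - a) powr p + t * (B - b) powr p"
      unfolding 2 by (rule cv) (use t that in auto)
    ultimately show ?thesis by (simp add: algebra_simps)
  qed
  show ?thesis
  proof (cases "B \<le> A")
    case True
    then show ?thesis using key[of B A a b] assms by (cases "a < b") (auto simp: max_def min_def)
  next
    case False
    then show ?thesis using key[of A B b a] assms by (cases "b < a") (auto simp: max_def min_def)
  qed
qed

subsection \<open>Polarization\<close>

text \<open>As \<open>hdel\<close> is sinh^2 (d/2), the parameter \<open>h\<close> is the sinh of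
  half the radius of a geodesic ball. The value 0 outside the unit ball matches functions supported
  inside.\<close>

definition hsup :: "real \<Rightarrow> (real ^ 'n \<Rightarrow> real) \<Rightarrow> real ^ 'n \<Rightarrow> real" where
  "hsup h v x = (if norm x < 1 then (SUP y\<in>{y. norm y < 1 \<and> hdel x y < h\<^sup>2}. v y) else 0)"

text \<open>Of the two values at x and its mirror image, the larger is placed on the side of the
  mirror that contains the origin.\<close>

definition pol :: "real ^ 'n \<Rightarrow> (real ^ 'n \<Rightarrow> real) \<Rightarrow> real ^ 'n \<Rightarrow> real" where
  "pol c v x = (if norm x \<le> norm (hrefl c x) then max (v x) (v (hrefl c x)) else min (v x) (v (hrefl c x)))"

text \<open>A class that is stable under \<open>pol\<close> and compact for uniform convergence. The
  Lipschitz condition uses sinh (d/2) in place of the distance d: stability under \<open>pol\<close>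
  rests only on its invariance and on \<open>hdel_hrefl_le\<close>.\<close>

definition adm :: "real \<Rightarrow> real \<Rightarrow> real \<Rightarrow> (real ^ 'n \<Rightarrow> real) \<Rightarrow> bool" where
  "adm L R B v \<longleftrightarrow> (\<forall>x. 0 \<le> v x \<and> v x \<le> B) \<and> (\<forall>x. norm x > R \<longrightarrow> v x = 0) \<and>
     (\<forall>x y. norm x < 1 \<longrightarrow> norm y < 1 \<longrightarrow> \<bar>v x - v y\<bar> \<le> L * sqrt (hdel x y))"

lemma hdel_continuous: "norm y < 1 \<Longrightarrow> continuous_on (ball 0 1) (\<lambda>x. hdel x y)"
  unfolding hdel_def
  by (intro continuous_intros) (use one_minus_norm_sq_pos in \<open>fastforce simp: less_imp_neq\<close>)

lemma hdel_self [simp]: "hdel x x = 0" by (simp add: hdel_def)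

lemma adm_continuous:
  assumes v: "adm L R B v" and R: "R < 1"
  shows "continuous_on UNIV v"
proof -
  have "continuous_on (ball 0 1) v"
    unfolding continuous_on_def
  proof
    fix x assume x: "x \<in> ball (0 :: real ^ 'a) 1"
    have "((\<lambda>y. hdel y x) \<longlongrightarrow> hdel x x) (at x within ball 0 1)"
      using hdel_continuous[of x] x unfolding continuous_on_def by (metis mem_ball_0)
    then have "((\<lambda>y. L * sqrt (hdel y x)) \<longlongrightarrow> L * sqrt 0) (at x within ball 0 1)"
      by (intro tendsto_intros) simp
    then have t: "((\<lambda>y. L * sqrt (hdel y x)) \<longlongrightarrow> 0) (at x within ball 0 1)" by simp
    have "((\<lambda>y. v y - v x) \<longlongrightarrow> 0) (at x within ball 0 1)"
    proof (rule tendsto_0_le[OF t, of _ 1])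
      show "\<forall>\<^sub>F y in at x within ball 0 1. norm (v y - v x) \<le> norm (L * sqrt (hdel y x)) * 1"
        unfolding eventually_at_filter
        using v x by (intro always_eventually) (auto simp: adm_def intro: order_trans[OF _ abs_ge_self])
    qed
    then show "(v \<longlongrightarrow> v x) (at x within ball 0 1)" by (simp add: LIM_zero_iff)
  qed
  moreover have "continuous_on {x. norm x > R} v"
    using v by (subst continuous_on_cong[OF refl, where g="\<lambda>_. 0"]) (auto simp: adm_def)
  moreover have "open {x :: real ^ 'a. norm x > R}" by (intro open_Collect_less continuous_intros)
  ultimately have "continuous_on (ball 0 1 \<union> {x. norm x > R}) v"
    by (intro continuous_on_open_Un) auto
  moreover have "ball 0 1 \<union> {x. norm x > R} = (UNIV :: (real ^ 'a) set)" using R by auto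
  ultimately show ?thesis by simp
qed

lemma adm_bdd: "adm L R B v \<Longrightarrow> bdd_above (v ` S)"
  by (rule bdd_aboveI[of _ B]) (auto simp: adm_def)

lemma hsup_ge:
  assumes "adm L R B v" "norm x < 1" "norm y < 1" "hdel x y < h\<^sup>2"
  shows "v y \<le> hsup h v x"
  unfolding hsup_def using assms by (auto intro!: cSUP_upper adm_bdd)

lemma hsup_le:
  assumes "norm x < 1" "h > 0" "\<And>y. norm y < 1 \<Longrightarrow> hdel x y < h\<^sup>2 \<Longrightarrow> v y \<le> a"
  shows "hsup h v x \<le> a"
proof -
  have "x \<in> {y. norm y < 1 \<and> hdel x y < h\<^sup>2}" using assms by simp
  then show ?thesis unfolding hsup_def using assms by (auto intro!: cSUP_least)
qed

lemma hsup_outside [simp]: "\<not> norm x < 1 \<Longrightarrow> hsup h v x = 0" by (simp add: hsup_def)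

lemma hsup_ge_self:
  assumes "adm L R B v" "h > 0" "R < 1"
  shows "v x \<le> hsup h v x"
proof (cases "norm x < 1")
  case True then show ?thesis using hsup_ge[OF assms(1), of x x h] assms by simp
next
  case False then show ?thesis using assms by (auto simp: adm_def)
qed

lemma hsup_nonneg: "adm L R B v \<Longrightarrow> h > 0 \<Longrightarrow> R < 1 \<Longrightarrow> 0 \<le> hsup h v x"
  by (rule order_trans[OF _ hsup_ge_self]) (auto simp: adm_def)

lemma adm_B_nonneg: "adm L R B v \<Longrightarrow> 0 \<le> B"
  unfolding adm_def by (meson order_trans)

lemma hsup_le_bound: "adm L R B v \<Longrightarrow> h > 0 \<Longrightarrow> hsup h v x \<le> B"
  using adm_B_nonneg[of L R B v]
  by (cases "norm x < 1") (auto intro!: hsup_le simp: adm_def)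

lemma hsup_diff_le:
  assumes v: "adm L R B v" "h > 0" "R < 1" "L \<ge> 0"
  shows "hsup h v x - v x \<le> L * h"
proof (cases "norm x < 1")
  case True
  have "hsup h v x \<le> v x + L * h"
  proof (rule hsup_le[OF True v(2)])
    fix y assume y: "norm y < 1" "hdel x y < h\<^sup>2"
    have "sqrt (hdel x y) \<le> sqrt (h\<^sup>2)" using y by (intro real_sqrt_le_mono) simp
    then have "L * sqrt (hdel x y) \<le> L * h" using v by (intro mult_left_mono) auto
    moreover have "\<bar>v x - v y\<bar> \<le> L * sqrt (hdel x y)" using v True y by (auto simp: adm_def)
    ultimately show "v y \<le> v x + L * h" by linarith
  qed
  then show ?thesis by simp
next
  case False
  then show ?thesis using v by (auto simp: adm_def)
qed

lemma hsup_uniform: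
  assumes v: "adm L R B v" and w: "adm L R B w" and h: "h > 0" and e: "\<And>x. \<bar>v x - w x\<bar> \<le> e"
  shows "\<bar>hsup h v x - hsup h w x\<bar> \<le> e"
proof (cases "norm x < 1")
  case True
  have "hsup h v x \<le> hsup h w x + e"
  proof (rule hsup_le[OF True h])
    fix y assume "norm y < 1" "hdel x y < h\<^sup>2"
    then show "v y \<le> hsup h w x + e" using hsup_ge[OF w True] e[of y] by fastforce
  qed
  moreover have "hsup h w x \<le> hsup h v x + e"
  proof (rule hsup_le[OF True h])
    fix y assume "norm y < 1" "hdel x y < h\<^sup>2"
    then show "w y \<le> hsup h v x + e" using hsup_ge[OF v True] e[of y] by fastforce
  qed
  ultimately show ?thesis by linarith
next
  case False
  then show ?thesis using e[of 0] by simp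
qed

text \<open>Lower semicontinuity: a superlevel set is the union of the open geodesic balls about the
  points where v exceeds the level. Outside the unit ball the value is 0, which accounts for
  negative levels.\<close>

lemma hsup_measurable:
  assumes v: "adm L R B v" and h: "h > 0"
  shows "hsup h v \<in> borel_measurable borel"
proof (rule borel_measurableI_greater)
  fix a :: real
  let ?U = "\<Union>y\<in>{y. norm y < 1 \<and> v y > a}. {x \<in> ball 0 1. hdel x y < h\<^sup>2}"
  have "open ?U"
  proof (intro open_UN ballI)
    fix y assume "y \<in> {y. norm y < 1 \<and> v y > a}"
    then have "continuous_on (ball 0 1) (\<lambda>x. hdel x y)" using hdel_continuous by auto
    then have "open ((\<lambda>x. hdel x y) -` {..<h\<^sup>2} \<inter> ball 0 1)"
      by (subst (asm) continuous_on_open_vimage) auto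
    moreover have "(\<lambda>x. hdel x y) -` {..<h\<^sup>2} \<inter> ball 0 1 = {x \<in> ball 0 1. hdel x y < h\<^sup>2}" by auto
    ultimately show "open {x \<in> ball 0 1. hdel x y < h\<^sup>2}" by simp
  qed
  moreover have "{x. a < hsup h v x} = ?U \<union> (if a < 0 then - ball 0 1 else {})"
  proof (intro set_eqI)
    fix x
    show "x \<in> {x. a < hsup h v x} \<longleftrightarrow> x \<in> ?U \<union> (if a < 0 then - ball 0 1 else {})"
    proof (cases "norm x < 1")
      case True
      have "a < hsup h v x \<longleftrightarrow> (\<exists>y\<in>{y. norm y < 1 \<and> hdel x y < h\<^sup>2}. a < v y)"
        unfolding hsup_def using True h adm_bdd[OF v]
        by (simp, subst less_cSUP_iff) (auto intro!: exI[of _ x])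
      then show ?thesis using True by auto
    qed auto
  qed
  ultimately show "{x \<in> space borel. a < hsup h v x} \<in> sets borel" by auto
qed

text \<open>One radius R' < 1 serves all functions of the class and all scales up to h. The volume
  being infinite near the unit sphere, this uniformity is what makes dominated convergence available
  later.\<close>

lemma hsup_supportE:
  assumes R: "R < 1" and h: "h > 0"
  obtains R' where "R \<le> R'" "R' < 1"
    "\<And>L B (v :: real ^ 'n \<Rightarrow> real) x h'. adm L R B v \<Longrightarrow> 0 < h' \<Longrightarrow> h' \<le> h \<Longrightarrow> norm x > R' \<Longrightarrow> hsup h' v x = 0"
proof -
  define a where "a = 1 - R"
  have a: "a > 0" using R by (simp add: a_def)
  \<comment> \<open>For |x| > 1 - a/2 and |y| <= R the distance |x - y| is at least a/2. On the
    other hand \<open>hdel x y < h'\<^sup>2\<close> forces |x - y|^2 < 2 h^2 (1 - |x|), and the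
    second bound makes the right side at most (a/2)^2.\<close>
  define R' where "R' = max (1 - a / 2) (1 - a\<^sup>2 / (8 * h\<^sup>2))"
  have R': "R' < 1" using a h by (simp add: R'_def)
  have zero: "hsup h' v x = 0" if v: "adm L R B v" and h': "0 < h'" "h' \<le> h" and x: "norm x > R'" for L B h' and v :: "real ^ 'n \<Rightarrow> real" and x
  proof (cases "norm x < 1")
    case True
    have "v y = 0" if y: "norm y < 1" "hdel x y < h'\<^sup>2" for y
    proof (rule ccontr)
      assume "v y \<noteq> 0"
      then have yR: "norm y \<le> R" using v by (force simp: adm_def)
      have x1: "norm x > 1 - a / 2" "norm x > 1 - a\<^sup>2 / (8 * h\<^sup>2)" using x by (auto simp: R'_def)
      have "a / 2 \<le> norm x - norm y" using x1 yR by (simp add: a_def field_simps)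
      then have "a / 2 \<le> norm (x - y)" using norm_triangle_ineq2[of x y] by linarith
      then have 1: "(a / 2)\<^sup>2 \<le> (norm (x - y))\<^sup>2" using a by (intro power_mono) auto
      have px: "1 - (norm x)\<^sup>2 > 0" and py: "1 - (norm y)\<^sup>2 > 0" using True y one_minus_norm_sq_pos by auto
      have "(norm (x - y))\<^sup>2 < h'\<^sup>2 * ((1 - (norm x)\<^sup>2) * (1 - (norm y)\<^sup>2))"
        using y px py by (simp add: hdel_def divide_less_eq)
      also have "\<dots> \<le> h\<^sup>2 * ((1 - (norm x)\<^sup>2) * 1)"
        using h' px py by (intro mult_mono power_mono) auto
      also have "1 - (norm x)\<^sup>2 = (1 - norm x) * (1 + norm x)" by (simp add: power2_eq_square algebra_simps)
      also have "\<dots> \<le> (1 - norm x) * 2" using True by (intro mult_left_mono) auto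
      finally have "(norm (x - y))\<^sup>2 < h\<^sup>2 * ((1 - norm x) * 2 * 1)" using h by (simp add: mult_left_mono)
      also have "\<dots> \<le> h\<^sup>2 * (a\<^sup>2 / (8 * h\<^sup>2) * 2 * 1)" using x1 h by (intro mult_left_mono) auto
      also have "\<dots> = (a / 2)\<^sup>2" using h by (simp add: field_simps power2_eq_square)
      finally show False using 1 by simp
    qed
    then have "hsup h' v x \<le> 0" using True h' by (intro hsup_le) auto
    then show ?thesis using hsup_nonneg[OF v h'(1) R, of x] by simp
  qed simp
  have "R \<le> 1 - a / 2" using a by (simp add: a_def field_simps)
  then have RR: "R \<le> R'" by (simp add: R'_def)
  show ?thesis by (rule that[OF RR R' zero])
qed

text \<open>The Lipschitz bound splits according to the sides of x and y. On equal sides the maximum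
  or minimum of two pairs with the same bound is taken; on opposite sides
  \<open>hdel_hrefl_le\<close> bounds the crossed differences as well. The support stays in the ball
  because the larger value moves towards the origin.\<close>

lemma pol_adm:
  assumes c: "norm c > 1" and v: "adm L R B v" and R: "R < 1" and L: "L \<ge> 0"
  shows "adm L R B (pol c v)"
  unfolding adm_def
proof (intro conjI allI impI)
  fix x
  show "0 \<le> pol c v x" "pol c v x \<le> B" using v by (auto simp: adm_def pol_def max_def min_def)
next
  fix x :: "real ^ 'a" assume x: "R < norm x"
  then have vx: "v x = 0" using v by (auto simp: adm_def)
  have nn: "0 \<le> v (hrefl c x)" using v by (auto simp: adm_def)
  show "pol c v x = 0"
  proof (cases "norm x \<le> norm (hrefl c x)")
    case True
    then have "v (hrefl c x) = 0" using v x by (auto simp: adm_def)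
    then show ?thesis using vx by (simp add: pol_def)
  next
    case False
    then show ?thesis using vx nn by (simp add: pol_def)
  qed
next
  fix x y :: "real ^ 'a" assume x: "norm x < 1" and y: "norm y < 1"
  let ?d = "L * sqrt (hdel x y)"
  let ?X = "hrefl c x" let ?Y = "hrefl c y"
  have X: "norm ?X < 1" and Y: "norm ?Y < 1" using hrefl_in_ball_iff[OF c] x y by auto
  have lip: "\<bar>v a - v b\<bar> \<le> L * sqrt (hdel a b)" if "norm a < 1" "norm b < 1" for a b
    using v that by (auto simp: adm_def)
  have d1: "\<bar>v x - v y\<bar> \<le> ?d" using lip x y by blast
  have d2: "\<bar>v ?X - v ?Y\<bar> \<le> ?d" using lip[OF X Y] hdel_hrefl[OF c x y] by simp
  have hh: "hdel ?X y = hdel x ?Y" using hdel_hrefl[OF c x Y] hrefl_hrefl[OF c] by simp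
  have cross: "\<bar>v x - v ?Y\<bar> \<le> ?d \<and> \<bar>v ?X - v y\<bar> \<le> ?d" if "hdel x ?Y \<le> hdel x y"
  proof -
    have "L * sqrt (hdel x ?Y) \<le> ?d" using that L by (intro mult_left_mono) auto
    then show ?thesis using lip[OF x Y] lip[OF X y] hh by auto
  qed
  show "\<bar>pol c v x - pol c v y\<bar> \<le> ?d"
  proof (cases "norm x \<le> norm ?X"; cases "norm y \<le> norm ?Y")
    assume "norm x \<le> norm ?X" "norm y \<le> norm ?Y"
    then show ?thesis using d1 d2 by (auto simp: pol_def)
  next
    assume "\<not> norm x \<le> norm ?X" "\<not> norm y \<le> norm ?Y"
    then show ?thesis using d1 d2 by (auto simp: pol_def)
  next
    assume H: "norm x \<le> norm ?X" "\<not> norm y \<le> norm ?Y"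
    then have "hdel x ?Y \<le> hdel x y" using hdel_hrefl_le[OF c x y] by auto
    then show ?thesis using cross d1 d2 H by (auto simp: pol_def)
  next
    assume H: "\<not> norm x \<le> norm ?X" "norm y \<le> norm ?Y"
    then have "hdel y ?X \<le> hdel y x" using hdel_hrefl_le[OF c y x] by auto
    then have "hdel x ?Y \<le> hdel x y" using hh by (simp add: hdel_commute)
    then show ?thesis using cross d1 d2 H by (auto simp: pol_def)
  qed
qed

text \<open>The delicate case has x on the far side, where the right side is a minimum, and y on the
  side of the origin, where the left side is a maximum. Then, by \<open>hdel_hrefl_le\<close>, y and
  its mirror image are both within the radius of x and of the mirror image of x, so all four
  comparisons hold.\<close>

lemma hsup_pol_le:
  assumes c: "norm c > 1" and v: "adm L R B v" and R: "R < 1" and L: "L \<ge> 0" and h: "h > 0"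
  shows "hsup h (pol c v) x \<le> pol c (hsup h v) x"
proof (cases "norm x < 1")
  case x: True
  let ?s = "hrefl c"
  have X: "norm (?s x) < 1" using hrefl_in_ball_iff[OF c] x by auto
  show ?thesis
  proof (rule hsup_le[OF x h])
    fix y assume y: "norm y < 1" and d: "hdel x y < h\<^sup>2"
    have Y: "norm (?s y) < 1" using hrefl_in_ball_iff[OF c] y by auto
    have 1: "v y \<le> hsup h v x" using hsup_ge[OF v x y d] .
    have 2: "v (?s y) \<le> hsup h v (?s x)" using hsup_ge[OF v X Y] d hdel_hrefl[OF c x y] by simp
    show "pol c v y \<le> pol c (hsup h v) x"
    proof (cases "norm x \<le> norm (?s x)")
      case True
      then show ?thesis using 1 2 by (auto simp: pol_def)
    next
      case False
      note xs = this
      show ?thesis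
      proof (cases "norm y \<le> norm (?s y)")
        case True
        then have le: "hdel y (?s x) \<le> hdel y x" using hdel_hrefl_le[OF c y x] xs by auto
        have "hdel (?s x) y < h\<^sup>2" using le d by (simp add: hdel_commute)
        then have 3: "v y \<le> hsup h v (?s x)" using hsup_ge[OF v X y] by simp
        have "hdel x (?s y) = hdel (?s x) y" using hdel_hrefl[OF c x Y] hrefl_hrefl[OF c] by simp
        then have "v (?s y) \<le> hsup h v x" using hsup_ge[OF v x Y] \<open>hdel (?s x) y < h\<^sup>2\<close> by simp
        then show ?thesis using 1 2 3 xs by (auto simp: pol_def)
      next
        case False
        then show ?thesis using 1 2 xs by (auto simp: pol_def)
      qed
    qed
  qed
next
  case False
  then show ?thesis using hrefl_in_ball_iff[OF c] by (simp add: pol_def)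
qed

text \<open>Polarization at most exchanges the two values on each pair of mirror points; together
  with the invariance of the measure this is why the distribution is preserved.\<close>

lemma pol_pair:
  assumes c: "norm c > 1" and out: "\<And>x. \<not> norm x < 1 \<Longrightarrow> v x = 0"
  shows "pol c v x = v x \<and> pol c v (hrefl c x) = v (hrefl c x) \<or>
     pol c v x = v (hrefl c x) \<and> pol c v (hrefl c x) = v x"
proof (cases "norm x < 1")
  case True
  show ?thesis
  proof (cases "norm (hrefl c x) = norm x")
    case True
    then have "hrefl c x = x" using hrefl_fixed[OF c \<open>norm x < 1\<close>] by simp
    then show ?thesis by (simp add: pol_def)
  next
    case False
    then show ?thesis unfolding pol_def hrefl_hrefl[OF c] by (auto simp: max_def min_def)
  qed
next
  case False
  then have "v x = 0" "v (hrefl c x) = 0" using out hrefl_in_ball_iff[OF c] by auto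
  then show ?thesis by (simp add: pol_def hrefl_hrefl[OF c])
qed

lemma pol_minmax_pair:
  assumes c: "norm c > 1" and x: "norm x < 1"
  shows "(pol c v x = max (v x) (v (hrefl c x)) \<and> pol c v (hrefl c x) = min (v x) (v (hrefl c x)) \<and> norm x \<le> norm (hrefl c x)) \<or>
    (pol c v x = min (v x) (v (hrefl c x)) \<and> pol c v (hrefl c x) = max (v x) (v (hrefl c x)) \<and> norm (hrefl c x) \<le> norm x)"
proof (cases "norm (hrefl c x) = norm x")
  case True
  then have "hrefl c x = x" using hrefl_fixed[OF c x] by simp
  then show ?thesis by (simp add: pol_def)
next
  case False
  then show ?thesis unfolding pol_def hrefl_hrefl[OF c] by (auto simp: max.commute min.commute)
qed


text \<open>Averaging over a point and its mirror image turns an inequality between integrals into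
  an inequality for each pair.\<close>

lemma integral_hmeas_pair:
  fixes g :: "real ^ 'n \<Rightarrow> real"
  assumes c: "norm c > 1" and g: "integrable hmeas g"
  shows "(\<integral>x. g x \<partial>hmeas) = (\<integral>x. (g x + g (hrefl c x)) / 2 \<partial>hmeas)"
    and "integrable hmeas (\<lambda>x. g (hrefl c x))"
proof -
  have m: "g \<in> borel_measurable borel" using g by auto
  show i: "integrable hmeas (\<lambda>x. g (hrefl c x))" using integrable_hmeas_hrefl[OF c m] g by simp
  show "(\<integral>x. g x \<partial>hmeas) = (\<integral>x. (g x + g (hrefl c x)) / 2 \<partial>hmeas)"
    using integral_hmeas_hrefl[OF c m] g i by simp
qed

lemma adm_measurable: "adm L R B v \<Longrightarrow> R < 1 \<Longrightarrow> v \<in> borel_measurable borel"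
  by (intro borel_measurable_continuous_onI adm_continuous)

lemma adm_comp_bounded:
  assumes v: "adm L R B v" and psi: "continuous_on UNIV \<psi>"
  obtains K where "\<And>x. \<bar>\<psi> (v x) :: real\<bar> \<le> K"
proof -
  have "compact (\<psi> ` {0..B})" using psi by (intro compact_continuous_image) (auto intro: continuous_on_subset)
  then obtain K where K: "\<And>y. y \<in> \<psi> ` {0..B} \<Longrightarrow> norm y \<le> K"
    using compact_imp_bounded bounded_iff by metis
  have "\<bar>\<psi> (v x)\<bar> \<le> K" for x using K[of "\<psi> (v x)"] v by (auto simp: adm_def)
  then show ?thesis using that by blast
qed

lemma adm_comp_integrable:
  assumes v: "adm L R B v" and R: "R < 1" and psi: "continuous_on UNIV \<psi>" "\<psi> 0 = (0::real)"
  shows "integrable hmeas (\<lambda>x. \<psi> (v x))"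
proof -
  obtain K where K: "\<And>x. \<bar>\<psi> (v x)\<bar> \<le> K" using adm_comp_bounded[OF v psi(1)] by blast
  show ?thesis
  proof (rule integrable_hmeas_bounded[OF _ R _ K])
    show "(\<lambda>x. \<psi> (v x)) \<in> borel_measurable borel"
      using adm_continuous[OF v R] psi
      by (intro borel_measurable_continuous_onI continuous_on_compose2[OF psi(1)]) auto
  qed (use v psi in \<open>auto simp: adm_def\<close>)
qed

lemma hsup_powr_integrable:
  assumes v: "adm L R B v" and R: "R < 1" and h: "h > 0" and p: "p \<ge> 1"
  shows "integrable hmeas (\<lambda>x. (hsup h v x - v x) powr p)"
proof -
  obtain R' where R': "R \<le> R'" "R' < 1" "\<And>x. norm x > R' \<Longrightarrow> hsup h v x = 0"
    using hsup_supportE[OF R h] v h by (metis order_refl)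
  show ?thesis
  proof (rule integrable_hmeas_bounded[OF _ R'(2)])
    show "(\<lambda>x. (hsup h v x - v x) powr p) \<in> borel_measurable borel"
      using hsup_measurable[OF v h] adm_measurable[OF v R] by measurable
    show "(hsup h v x - v x) powr p = 0" if "norm x > R'" for x
      using that R' v by (auto simp: adm_def)
    show "\<bar>(hsup h v x - v x) powr p\<bar> \<le> B powr p" for x
    proof -
      have "hsup h v x - v x \<le> B" using hsup_le_bound[OF v h, of x] v by (smt (verit) adm_def)
      then show ?thesis using hsup_ge_self[OF v h R, of x] p by (auto intro: powr_mono2)
    qed
  qed
qed

lemma adm_outside: "adm L R B v \<Longrightarrow> R < 1 \<Longrightarrow> \<not> norm x < 1 \<Longrightarrow> v x = 0"
  by (auto simp: adm_def)

lemma pol_integral_comp: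
  assumes c: "norm c > 1" and v: "adm L R B v" and R: "R < 1" and L: "L \<ge> 0"
    and psi: "continuous_on UNIV \<psi>" "\<psi> 0 = (0::real)"
  shows "(\<integral>x. \<psi> (pol c v x) \<partial>hmeas) = (\<integral>x. \<psi> (v x) \<partial>hmeas)"
proof -
  note i1 = adm_comp_integrable[OF v R psi]
  note i2 = adm_comp_integrable[OF pol_adm[OF c v R L] R psi]
  have "\<psi> (pol c v x) + \<psi> (pol c v (hrefl c x)) = \<psi> (v x) + \<psi> (v (hrefl c x))" for x
    using pol_pair[OF c, of v x] adm_outside[OF v R] by auto
  then show ?thesis unfolding integral_hmeas_pair(1)[OF c i1] integral_hmeas_pair(1)[OF c i2] by simp
qed

text \<open>\<open>hsup_pol_le\<close> replaces the supremum of the polarized function by the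
  polarization of the supremum. On each mirror pair what remains is
  \<open>two_point_powr_le\<close>, with the values of v and of its local supremum as end
  points.\<close>

lemma pol_integral_hsup:
  assumes c: "norm c > 1" and v: "adm L R B v" and R: "R < 1" and L: "L \<ge> 0" and h: "h > 0" and p: "p \<ge> 1"
  shows "(\<integral>x. (hsup h (pol c v) x - pol c v x) powr p \<partial>hmeas) \<le> (\<integral>x. (hsup h v x - v x) powr p \<partial>hmeas)"
proof -
  note i1 = hsup_powr_integrable[OF v R h p]
  note a2 = pol_adm[OF c v R L]
  note i2 = hsup_powr_integrable[OF a2 R h p]
  let ?s = "hrefl c"
  have le: "(hsup h (pol c v) x - pol c v x) powr p + (hsup h (pol c v) (?s x) - pol c v (?s x)) powr p
    \<le> (hsup h v x - v x) powr p + (hsup h v (?s x) - v (?s x)) powr p" for x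
  proof (cases "norm x < 1")
    case True
    have g: "v x \<le> hsup h v x" "v (?s x) \<le> hsup h v (?s x)" using hsup_ge_self[OF v h R] by auto
    have gp: "pol c v z \<le> hsup h (pol c v) z" for z using hsup_ge_self[OF a2 h R] .
    have l: "(hsup h (pol c v) z - pol c v z) powr p \<le> (pol c (hsup h v) z - pol c v z) powr p" for z
      using hsup_pol_le[OF c v R L h, of z] gp[of z] p by (intro powr_mono2) auto
    have "(pol c (hsup h v) x - pol c v x) powr p + (pol c (hsup h v) (?s x) - pol c v (?s x)) powr p
      = (max (hsup h v x) (hsup h v (?s x)) - max (v x) (v (?s x))) powr p + (min (hsup h v x) (hsup h v (?s x)) - min (v x) (v (?s x))) powr p"
    proof (cases "norm (?s x) = norm x")
      case True
      then have "?s x = x" using hrefl_fixed[OF c \<open>norm x < 1\<close>] by simp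
      then show ?thesis by (simp add: pol_def)
    next
      case False
      then show ?thesis unfolding pol_def hrefl_hrefl[OF c] by (auto simp: max.commute min.commute)
    qed
    also have "\<dots> \<le> (hsup h v x - v x) powr p + (hsup h v (?s x) - v (?s x)) powr p"
      by (rule two_point_powr_le[OF p g])
    finally show ?thesis using l[of x] l[of "?s x"] by linarith
  next
    case False
    then have "\<not> norm (?s x) < 1" using hrefl_in_ball_iff[OF c] by simp
    then show ?thesis using False adm_outside[OF a2 R] p by simp
  qed
  show ?thesis unfolding integral_hmeas_pair(1)[OF c i1] integral_hmeas_pair(1)[OF c i2]
  proof (rule integral_mono)
    show "integrable hmeas (\<lambda>x. ((hsup h (pol c v) x - pol c v x) powr p + (hsup h (pol c v) (?s x) - pol c v (?s x)) powr p) / 2)"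
      using i2 integral_hmeas_pair(2)[OF c i2] by auto
    show "integrable hmeas (\<lambda>x. ((hsup h v x - v x) powr p + (hsup h v (?s x) - v (?s x)) powr p) / 2)"
      using i1 integral_hmeas_pair(2)[OF c i1] by auto
  qed (rule divide_right_mono[OF le], simp)
qed

subsection \<open>Rearrangement\<close>

text \<open>Equidistribution is expressed by continuous test functions because such a condition
  passes to uniform limits; \<psi> 0 = 0 keeps the integrands compactly supported in the ball. The
  last clause is required at every scale h, since h tends to 0 only at the end.\<close>

definition rearr :: "real \<Rightarrow> real \<Rightarrow> real \<Rightarrow> real \<Rightarrow> (real ^ 'n \<Rightarrow> real) \<Rightarrow> (real ^ 'n \<Rightarrow> real) \<Rightarrow> bool" where
  "rearr L R B p f v \<longleftrightarrow> adm L R B v \<and>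
     (\<forall>\<psi> :: real \<Rightarrow> real. continuous_on UNIV \<psi> \<longrightarrow> \<psi> 0 = 0 \<longrightarrow> (\<integral>x. \<psi> (v x) \<partial>hmeas) = (\<integral>x. \<psi> (f x) \<partial>hmeas)) \<and>
     (\<forall>h>0. (\<integral>x. (hsup h v x - v x) powr p \<partial>hmeas) \<le> (\<integral>x. (hsup h f x - f x) powr p \<partial>hmeas))"

lemma rearr_refl: "adm L R B f \<Longrightarrow> rearr L R B p f f"
  by (simp add: rearr_def)

lemma rearr_pol:
  assumes "norm c > 1" "rearr L R B p f v" "R < 1" "L \<ge> 0" "p \<ge> 1"
  shows "rearr L R B p f (pol c v)"
proof -
  have v: "adm L R B v" using assms by (simp add: rearr_def)
  show ?thesis unfolding rearr_def
  proof (intro conjI allI impI)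
    show "adm L R B (pol c v)" by (rule pol_adm) (use assms v in auto)
    fix \<psi> :: "real \<Rightarrow> real" assume psi: "continuous_on UNIV \<psi>" "\<psi> 0 = 0"
    have "(\<integral>x. \<psi> (pol c v x) \<partial>hmeas) = (\<integral>x. \<psi> (v x) \<partial>hmeas)"
      by (rule pol_integral_comp) (use assms v psi in auto)
    then show "(\<integral>x. \<psi> (pol c v x) \<partial>hmeas) = (\<integral>x. \<psi> (f x) \<partial>hmeas)"
      using assms psi by (simp add: rearr_def)
  next
    fix h :: real assume h: "h > 0"
    have "(\<integral>x. (hsup h (pol c v) x - pol c v x) powr p \<partial>hmeas) \<le> (\<integral>x. (hsup h v x - v x) powr p \<partial>hmeas)"
      by (rule pol_integral_hsup) (use assms v h in auto)
    also have "\<dots> \<le> (\<integral>x. (hsup h f x - f x) powr p \<partial>hmeas)" using assms h by (simp add: rearr_def)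
    finally show "(\<integral>x. (hsup h (pol c v) x - pol c v x) powr p \<partial>hmeas) \<le> (\<integral>x. (hsup h f x - f x) powr p \<partial>hmeas)" .
  qed
qed

text \<open>The weight decreases in \<open>norm x\<close>, so \<open>centr\<close> strictly increases under every polarization that
  changes \<open>v\<close>.\<close>

definition centr :: "(real ^ 'n \<Rightarrow> real) \<Rightarrow> real" where
  "centr v = (\<integral>x. v x * (1 - (norm x)\<^sup>2) \<partial>hmeas)"

lemma centr_integrable:
  assumes v: "adm L R B v" and R: "R < 1"
  shows "integrable hmeas (\<lambda>x. v x * (1 - (norm x)\<^sup>2))"
proof (rule integrable_hmeas_bounded[OF _ R])
  show "(\<lambda>x. v x * (1 - (norm x)\<^sup>2)) \<in> borel_measurable borel" using adm_measurable[OF v R] by measurable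
  show "\<bar>v x * (1 - (norm x)\<^sup>2)\<bar> \<le> B" for x
  proof (cases "norm x < 1")
    case True
    have "v x * (1 - (norm x)\<^sup>2) \<le> B * 1" using v one_minus_norm_sq_pos[OF True] adm_B_nonneg[OF v]
      by (intro mult_mono) (auto simp: adm_def)
    then show ?thesis using v one_minus_norm_sq_pos[OF True] by (simp add: abs_mult adm_def)
  next
    case False
    then show ?thesis using adm_outside[OF v R] adm_B_nonneg[OF v] by simp
  qed
qed (use v in \<open>auto simp: adm_def\<close>)

lemma hmeas_integral_pos:
  fixes k :: "real ^ 'n \<Rightarrow> real"
  assumes i: "integrable hmeas k" and nn: "\<And>x. norm x < 1 \<Longrightarrow> 0 \<le> k x"
    and cont: "continuous_on (ball 0 1) k" and a: "norm a < 1" "k a > 0"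
  shows "(\<integral>x. k x \<partial>hmeas) > 0"
proof -
  have AEb: "AE x in hmeas. norm x < 1"
    unfolding hmeas_def by (subst AE_density) (auto simp: hdens_ball_measurable_ennreal indicator_def split: if_splits)
  then have nn': "AE x in hmeas. 0 \<le> k x" using nn by auto
  have "(\<integral>x. k x \<partial>hmeas) \<noteq> 0"
  proof
    assume "(\<integral>x. k x \<partial>hmeas) = 0"
    then have "AE x in hmeas. k x = 0" using integral_nonneg_eq_0_iff_AE[OF i nn'] by simp
    then have AE: "AE x in lborel. norm x < 1 \<longrightarrow> k x = 0"
      unfolding hmeas_def
      by (subst (asm) AE_density) (auto simp: hdens_ball_measurable_ennreal indicator_def hdens_pos elim!: eventually_mono)
    let ?U = "{x \<in> ball 0 1. k x > 0}"
    have "open (k -` {0<..} \<inter> ball 0 1)" using cont by (subst (asm) continuous_on_open_vimage) auto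
    moreover have "k -` {0<..} \<inter> ball 0 1 = ?U" by auto
    ultimately have "open ?U" by simp
    then obtain e where e: "e > 0" "ball a e \<subseteq> ?U" using a open_contains_ball by (metis (mono_tags, lifting) mem_Collect_eq mem_ball_0)
    have "AE x in lborel. x \<notin> ball a e" using AE by eventually_elim (use e in auto)
    then have "emeasure lborel (ball a e) = 0"
      by (subst (asm) AE_iff_measurable[of "ball a e"]) auto
    then have "measure lborel (ball a e) = 0" by (simp add: measure_def)
    then show False using e(1) content_ball_pos[of e a] by simp
  qed
  moreover have "(\<integral>x. k x \<partial>hmeas) \<ge> 0" using nn' by (rule integral_nonneg_AE)
  ultimately show ?thesis by simp
qed

lemma hrefl_continuous: "norm c > 1 \<Longrightarrow> continuous_on (ball 0 1) (hrefl c)"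
  unfolding hrefl_def by (intro continuous_intros) auto

text \<open>On a mirror pair the gain is the product of the change in value and the difference of
  the weights. It is never negative, and it is positive at the pair a, b, hence by continuity on a
  set of positive measure.\<close>

lemma centr_pol_less:
  fixes v :: "real ^ 'n \<Rightarrow> real"
  assumes c: "norm c > 1" and v: "adm L R B v" and R: "R < 1" and L: "L \<ge> 0"
    and ab: "norm a < norm b" "norm b < 1" "hrefl c b = a" "v a < v b"
  shows "centr v < centr (pol c v)"
proof -
  let ?s = "hrefl c" let ?g = "\<lambda>x :: real ^ 'n. 1 - (norm x)\<^sup>2" let ?w = "pol c v"
  note w = pol_adm[OF c v R L]
  note i1 = centr_integrable[OF v R] note i2 = centr_integrable[OF w R]
  define k where "k x = (?w x - v x) * ?g x" for x
  have ik: "integrable hmeas k" unfolding k_def left_diff_distrib using i1 i2 by auto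
  have "centr ?w - centr v = (\<integral>x. k x \<partial>hmeas)"
    unfolding centr_def k_def left_diff_distrib using i1 i2 by simp
  also have "\<dots> = (\<integral>x. (k x + k (?s x)) / 2 \<partial>hmeas)" by (rule integral_hmeas_pair(1)[OF c ik])
  also have "\<dots> > 0"
  proof (rule hmeas_integral_pos)
    show "integrable hmeas (\<lambda>x. (k x + k (?s x)) / 2)" using ik integral_hmeas_pair(2)[OF c ik] by auto
    show "continuous_on (ball 0 1) (\<lambda>x. (k x + k (?s x)) / 2)"
    proof -
      have ck: "continuous_on UNIV k" unfolding k_def
        by (intro continuous_intros adm_continuous[OF v R] adm_continuous[OF w R])
      have "continuous_on (ball 0 1) (\<lambda>x. k (?s x))"
        by (rule continuous_on_compose2[OF ck hrefl_continuous[OF c]]) auto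
      then show ?thesis using ck by (intro continuous_intros) (auto intro: continuous_on_subset)
    qed
    \<comment> \<open>The changes at x and at its image are opposite because the two values are only
      exchanged.\<close>
    have eq: "k x + k (?s x) = (?w x - v x) * (?g x - ?g (?s x))" for x
    proof -
      have d: "?w (?s x) - v (?s x) = - (?w x - v x)"
        using pol_pair[OF c, of v x] adm_outside[OF v R] by auto
      show ?thesis unfolding k_def d by algebra
    qed
    show "0 \<le> (k x + k (?s x)) / 2" if "norm x < 1" for x
      using pol_minmax_pair[OF c that, of v] unfolding eq
    proof (elim disjE conjE)
      assume "?w x = max (v x) (v (?s x))" "norm x \<le> norm (?s x)"
      then show "0 \<le> (?w x - v x) * (?g x - ?g (?s x)) / 2" by (simp add: power_mono)
    next
      assume "?w x = min (v x) (v (?s x))" "norm (?s x) \<le> norm x"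
      then show "0 \<le> (?w x - v x) * (?g x - ?g (?s x)) / 2" by (simp add: power_mono mult_nonpos_nonpos)
    qed
    show na: "norm a < 1" using ab by simp
    have sa: "?s a = b" using ab hrefl_hrefl[OF c] by metis
    have "?w a = v b" using ab unfolding pol_def sa by simp
    then have "k a + k (?s a) = (v b - v a) * ((norm b)\<^sup>2 - (norm a)\<^sup>2)" using eq[of a, unfolded sa] sa by simp
    moreover have "(norm a)\<^sup>2 < (norm b)\<^sup>2" using ab by (simp add: power_strict_mono)
    ultimately show "0 < (k a + k (?s a)) / 2" using ab by simp
  qed
  finally show ?thesis by simp
qed

lemma adm_limit:
  assumes w: "\<And>i::nat. adm L R B (w i)" and lim: "\<And>x. (\<lambda>i. w i x) \<longlonglongrightarrow> v x"
  shows "adm L R B v"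
  unfolding adm_def
proof (intro conjI allI impI)
  fix x
  show "0 \<le> v x" by (rule LIMSEQ_le_const[OF lim]) (use w in \<open>auto simp: adm_def\<close>)
  show "v x \<le> B" by (rule LIMSEQ_le_const2[OF lim]) (use w in \<open>auto simp: adm_def\<close>)
  assume "norm x > R"
  then have "(\<lambda>i. w i x) \<longlonglongrightarrow> 0" using w by (simp add: adm_def)
  then show "v x = 0" using lim LIMSEQ_unique by blast
next
  fix x y :: "real ^ 'a" assume "norm x < 1" "norm y < 1"
  then have "\<bar>w i x - w i y\<bar> \<le> L * sqrt (hdel x y)" for i using w by (auto simp: adm_def)
  moreover have "(\<lambda>i. \<bar>w i x - w i y\<bar>) \<longlonglongrightarrow> \<bar>v x - v y\<bar>" by (intro tendsto_intros lim)
  ultimately show "\<bar>v x - v y\<bar> \<le> L * sqrt (hdel x y)" by (intro LIMSEQ_le_const2) auto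
qed

lemma hmeas_dominated_convergence:
  fixes g :: "real ^ 'n \<Rightarrow> real"
  assumes m: "\<And>i. G i \<in> borel_measurable borel" "g \<in> borel_measurable borel" and R: "R < 1"
    and lim: "\<And>x. (\<lambda>i. G i x) \<longlonglongrightarrow> g x"
    and supp: "\<And>i x. norm x > R \<Longrightarrow> G i x = 0" and K: "\<And>i x. \<bar>G i x\<bar> \<le> K"
  shows "(\<lambda>i. \<integral>x. G i x \<partial>hmeas) \<longlonglongrightarrow> (\<integral>x. g x \<partial>hmeas)"
proof (rule integral_dominated_convergence[where w="\<lambda>x. K * indicator (cball 0 R) x"])
  have "0 \<le> K" using K[of 0 0] by linarith
  have c: "cball 0 R \<in> sets borel" by simp
  show "integrable hmeas (\<lambda>x. K * indicator (cball 0 R) x)"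
    by (rule integrable_hmeas_bounded[OF _ R, of _ K]) (use \<open>0 \<le> K\<close> in \<open>auto simp: indicator_def\<close>)
  show "AE x in hmeas. norm (G i x) \<le> K * indicator (cball 0 R) x" for i
    using K supp by (intro always_eventually) (auto simp: indicator_def)
qed (use m lim in auto)

text \<open>Sets of rearrangements are closed under uniform convergence: uniform closeness of
  functions passes to their local suprema, and the common support allows dominated convergence.
  Continuity of \<open>centr\<close> comes out of the same argument.\<close>

lemma rearr_limit:
  assumes w: "\<And>i::nat. rearr L R B p f (w i)" and R: "R < 1" and p: "p \<ge> 1"
    and lim: "\<And>e. e > 0 \<Longrightarrow> \<exists>N. \<forall>i\<ge>N. \<forall>x. \<bar>w i x - v x\<bar> \<le> e"
  shows "rearr L R B p f v" "(\<lambda>i. centr (w i)) \<longlonglongrightarrow> centr v"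
proof -
  have aw: "adm L R B (w i)" for i using w by (simp add: rearr_def)
  have pt: "(\<lambda>i. w i x) \<longlonglongrightarrow> v x" for x
  proof (rule LIMSEQ_I)
    fix e :: real assume "e > 0"
    then obtain N where "\<forall>i\<ge>N. \<forall>x. \<bar>w i x - v x\<bar> \<le> e / 2" using lim[of "e / 2"] by auto
    then have "norm (w n x - v x) \<le> e / 2" if "n \<ge> N" for n using that by simp
    moreover have "e / 2 < e" using \<open>e > 0\<close> by simp
    ultimately show "\<exists>no. \<forall>n\<ge>no. norm (w n x - v x) < e" by (meson le_less_trans)
  qed
  have av: "adm L R B v" by (rule adm_limit[OF aw pt])
  show "rearr L R B p f v" unfolding rearr_def
  proof (intro conjI allI impI av)
    fix \<psi> :: "real \<Rightarrow> real" assume psi: "continuous_on UNIV \<psi>" "\<psi> 0 = 0"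
    have "compact (\<psi> ` {0..B})" using psi by (intro compact_continuous_image) (auto intro: continuous_on_subset)
    then obtain K where "\<And>y. y \<in> \<psi> ` {0..B} \<Longrightarrow> norm y \<le> K"
      using compact_imp_bounded bounded_iff by metis
    then have K: "\<bar>\<psi> (w i x)\<bar> \<le> K" for i x using aw[of i] by (auto simp: adm_def)
    have m: "(\<lambda>x. \<psi> (u x)) \<in> borel_measurable borel" if "adm L R B u" for u :: "real ^ 'a \<Rightarrow> real"
      using adm_continuous[OF that R] psi
      by (intro borel_measurable_continuous_onI continuous_on_compose2[OF psi(1)]) auto
    have "isCont \<psi> y" for y using psi by (simp add: continuous_on_eq_continuous_at)
    then have "(\<lambda>i. \<psi> (w i x)) \<longlonglongrightarrow> \<psi> (v x)" for x by (intro isCont_tendsto_compose[OF _ pt]) auto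
    then have "(\<lambda>i. \<integral>x. \<psi> (w i x) \<partial>hmeas) \<longlonglongrightarrow> (\<integral>x. \<psi> (v x) \<partial>hmeas)"
      using aw psi by (intro hmeas_dominated_convergence[OF m[OF aw] m[OF av] R _ _ K]) (auto simp: adm_def)
    moreover have "(\<integral>x. \<psi> (w i x) \<partial>hmeas) = (\<integral>x. \<psi> (f x) \<partial>hmeas)" for i using w psi by (simp add: rearr_def)
    ultimately show "(\<integral>x. \<psi> (v x) \<partial>hmeas) = (\<integral>x. \<psi> (f x) \<partial>hmeas)" by (simp add: LIMSEQ_const_iff)
  next
    fix h :: real assume h: "h > 0"
    obtain R' where R': "R \<le> R'" "R' < 1" "\<And>u x. adm L R B u \<Longrightarrow> norm (x :: real ^ 'a) > R' \<Longrightarrow> hsup h u x = 0"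
      using hsup_supportE[OF R h] h by (metis order_refl)
    have m: "(\<lambda>x. (hsup h u x - u x) powr p) \<in> borel_measurable borel" if "adm L R B u" for u :: "real ^ 'a \<Rightarrow> real"
      using hsup_measurable[OF that h] adm_measurable[OF that R] by measurable
    have hl: "(\<lambda>i. hsup h (w i) x) \<longlonglongrightarrow> hsup h v x" for x
    proof (rule LIMSEQ_I)
      fix e :: real assume "e > 0"
      then obtain N where N: "\<forall>i\<ge>N. \<forall>x. \<bar>w i x - v x\<bar> \<le> e / 2" using lim[of "e / 2"] by auto
      then have "\<bar>hsup h (w i) x - hsup h v x\<bar> \<le> e / 2" if "i \<ge> N" for i
        using hsup_uniform[OF aw av h] that by blast
      moreover have "e / 2 < e" using \<open>e > 0\<close> by simp
      ultimately show "\<exists>no. \<forall>n\<ge>no. norm (hsup h (w n) x - hsup h v x) < e"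
        unfolding real_norm_def by (meson le_less_trans)
    qed
    have "(\<lambda>i. \<integral>x. (hsup h (w i) x - w i x) powr p \<partial>hmeas) \<longlonglongrightarrow> (\<integral>x. (hsup h v x - v x) powr p \<partial>hmeas)"
    proof (rule hmeas_dominated_convergence[OF m[OF aw] m[OF av] R'(2)])
      show "(\<lambda>i. (hsup h (w i) x - w i x) powr p) \<longlonglongrightarrow> (hsup h v x - v x) powr p" for x
        using hsup_ge_self[OF aw h R] p by (intro tendsto_powr' tendsto_intros hl pt) auto
      show "(hsup h (w i) x - w i x) powr p = 0" if "R' < norm x" for i x
        using R' that aw[of i] by (auto simp: adm_def)
      show "\<bar>(hsup h (w i) x - w i x) powr p\<bar> \<le> B powr p" for i x
      proof -
        have "hsup h (w i) x - w i x \<le> B" using hsup_le_bound[OF aw h, of i x] aw[of i] by (smt (verit) adm_def)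
        then show ?thesis using hsup_ge_self[OF aw h R, of i x] p by (auto intro: powr_mono2)
      qed
    qed
    then show "(\<integral>x. (hsup h v x - v x) powr p \<partial>hmeas) \<le> (\<integral>x. (hsup h f x - f x) powr p \<partial>hmeas)"
      by (rule LIMSEQ_le_const2) (use w h in \<open>auto simp: rearr_def\<close>)
  qed
  show "(\<lambda>i. centr (w i)) \<longlonglongrightarrow> centr v" unfolding centr_def
  proof (rule hmeas_dominated_convergence[OF _ _ R])
    show "(\<lambda>i. w i x * (1 - (norm x)\<^sup>2)) \<longlonglongrightarrow> v x * (1 - (norm x)\<^sup>2)" for x by (intro tendsto_intros pt)
    show "w i x * (1 - (norm x)\<^sup>2) = 0" if "R < norm x" for i x using aw[of i] that by (simp add: adm_def)
    show "\<bar>w i x * (1 - (norm x)\<^sup>2)\<bar> \<le> B" for i x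
    proof (cases "norm x < 1")
      case True
      have "w i x * (1 - (norm x)\<^sup>2) \<le> B * 1" using aw[of i] one_minus_norm_sq_pos[OF True] adm_B_nonneg[OF aw]
        by (intro mult_mono) (auto simp: adm_def)
      then show ?thesis using aw[of i] one_minus_norm_sq_pos[OF True] by (simp add: abs_mult adm_def)
    next
      case False
      then show ?thesis using adm_outside[OF aw R] adm_B_nonneg[OF aw] by simp
    qed
    show "(\<lambda>x. w i x * (1 - (norm x)\<^sup>2)) \<in> borel_measurable borel" for i using adm_measurable[OF aw R] by measurable
    show "(\<lambda>x. v x * (1 - (norm x)\<^sup>2)) \<in> borel_measurable borel" using adm_measurable[OF av R] by measurable
  qed
qed

text \<open>Arzela-Ascoli on the closed ball of radius R, where the hyperbolic Lipschitz bound
  becomes a Euclidean one with constant L / (1 - R^2). Outside that ball all functions vanish, so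
  convergence is uniform everywhere.\<close>

lemma adm_compact:
  assumes w: "\<And>i::nat. adm L R B (w i :: real ^ 'n \<Rightarrow> real)" and R: "R < 1" and L: "L \<ge> 0"
  shows "\<exists>k v. strict_mono (k :: nat \<Rightarrow> nat) \<and> (\<forall>e>0. \<exists>N. \<forall>i\<ge>N. \<forall>x. \<bar>w (k i) x - v x\<bar> \<le> e)"
proof -
  have lip: "\<bar>w i x - w i y\<bar> \<le> L / (1 - R\<^sup>2) * norm (x - y)" if xy: "norm x \<le> R" "norm y \<le> R" for i x y
  proof -
    have R0: "0 \<le> R" using xy norm_ge_zero order_trans by blast
    have q: "1 - R\<^sup>2 > 0" using R R0 by (simp add: power_less_one_iff abs_square_less_1)
    have x1: "norm x < 1" "norm y < 1" using xy R by auto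
    have "(norm x)\<^sup>2 \<le> R\<^sup>2" "(norm y)\<^sup>2 \<le> R\<^sup>2" using xy by (auto intro: power_mono)
    then have "(1 - R\<^sup>2) * (1 - R\<^sup>2) \<le> (1 - (norm x)\<^sup>2) * (1 - (norm y)\<^sup>2)" using q by (intro mult_mono) auto
    then have "hdel x y \<le> (norm (x - y))\<^sup>2 / ((1 - R\<^sup>2) * (1 - R\<^sup>2))"
      unfolding hdel_def using q by (intro divide_left_mono) (auto intro!: mult_pos_pos one_minus_norm_sq_pos x1)
    also have "\<dots> = (norm (x - y) / (1 - R\<^sup>2))\<^sup>2" by (simp add: power_divide power2_eq_square)
    finally have "sqrt (hdel x y) \<le> norm (x - y) / (1 - R\<^sup>2)" using q by (intro real_le_lsqrt) auto
    then have "L * sqrt (hdel x y) \<le> L * (norm (x - y) / (1 - R\<^sup>2))" using L by (rule mult_left_mono)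
    moreover have "\<bar>w i x - w i y\<bar> \<le> L * sqrt (hdel x y)" using w[of i] x1 by (auto simp: adm_def)
    ultimately show ?thesis by simp
  qed
  obtain g k where gk: "continuous_on (cball 0 R) g" "strict_mono (k :: nat \<Rightarrow> nat)"
    "\<And>e. 0 < e \<Longrightarrow> \<exists>N. \<forall>n x. n \<ge> N \<and> x \<in> cball 0 R \<longrightarrow> norm (w (k n) x - g x) < e"
  proof (rule Arzela_Ascoli[of "cball 0 R" w B])
    show "norm (w n x) \<le> B" for n x using w[of n] by (auto simp: adm_def)
    fix x :: "real ^ 'n" and e :: real assume x: "x \<in> cball 0 R" and e: "0 < e"
    define C where "C = L / (1 - R\<^sup>2)"
    have "0 \<le> R" using x norm_ge_zero order_trans by (metis mem_cball_0)
    then have "1 - R\<^sup>2 > 0" using R by (simp add: power_less_one_iff abs_square_less_1)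
    then have C: "C \<ge> 0" using L by (simp add: C_def)
    show "\<exists>d>0. \<forall>n y. y \<in> cball 0 R \<and> norm (x - y) < d \<longrightarrow> norm (w n x - w n y) < e"
    proof (intro exI conjI allI impI)
      show "e / (C + 1) > 0" using e C by simp
      fix n y assume y: "y \<in> cball 0 R \<and> norm (x - y) < e / (C + 1)"
      have "norm (w n x - w n y) \<le> C * norm (x - y)" using lip[of x y n] x y by (simp add: C_def)
      also have "\<dots> \<le> C * (e / (C + 1))" using y C by (intro mult_left_mono) auto
      also have "\<dots> < e" using e C by (simp add: field_simps)
      finally show "norm (w n x - w n y) < e" .
    qed
  qed auto
  show ?thesis
  proof (intro exI[of _ k] exI[of _ "\<lambda>x. if norm x \<le> R then g x else 0"] conjI allI impI gk(2))
    fix e :: real assume e: "e > 0"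
    then obtain N where N: "\<forall>n x. n \<ge> N \<and> x \<in> cball 0 R \<longrightarrow> norm (w (k n) x - g x) < e" using gk(3) by blast
    have "\<bar>w (k i) x - (if norm x \<le> R then g x else 0)\<bar> \<le> e" if "i \<ge> N" for i x
      using N that w[of "k i"] e by (auto simp: adm_def less_imp_le)
    then show "\<exists>N. \<forall>i\<ge>N. \<forall>x. \<bar>w (k i) x - (if norm x \<le> R then g x else 0)\<bar> \<le> e" by blast
  qed
qed

text \<open>A maximiser of \<open>centr\<close> is used instead of a sequence of polarizations
  converging to the symmetrization. Only its monotonicity in the norm is extracted, from the fact
  that no polarization can increase \<open>centr\<close> further.\<close>

theorem hyperbolic_rearrangement:
  fixes f :: "real ^ 'n \<Rightarrow> real"
  assumes f: "adm L R B f" and R: "R < 1" and L: "L \<ge> 0" and p: "p \<ge> 1"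
  obtains v where "rearr L R B p f v" "\<And>x y. norm x \<le> norm y \<Longrightarrow> v y \<le> v x"
proof -
  let ?J = "centr ` {v. rearr L R B p f v}"
  have admJ: "adm L R B v" if "rearr L R B p f v" for v using that by (simp add: rearr_def)
  obtain K where K: "\<And>v. rearr L R B p f v \<Longrightarrow> centr v \<le> K"
  proof
    fix v assume v: "rearr L R B p f v"
    show "centr v \<le> (\<integral>x. B * indicator (cball (0 :: real ^ 'n) R) x \<partial>hmeas)" unfolding centr_def
    proof (rule integral_mono[OF centr_integrable[OF admJ[OF v] R]])
      have B: "B \<ge> 0" using adm_B_nonneg[OF f] .
      show "integrable hmeas (\<lambda>x. B * indicator (cball (0 :: real ^ 'n) R) x)"
        by (rule integrable_hmeas_bounded[OF _ R, of _ B]) (use B in \<open>auto simp: indicator_def\<close>)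
      fix x :: "real ^ 'n"
      show "v x * (1 - (norm x)\<^sup>2) \<le> B * indicator (cball 0 R) x"
      proof (cases "norm x \<le> R")
        case True
        have "v x * (1 - (norm x)\<^sup>2) \<le> B * 1" using admJ[OF v] True R B one_minus_norm_sq_pos[of x]
          by (intro mult_mono) (auto simp: adm_def)
        then show ?thesis using True by simp
      next
        case False
        then show ?thesis using admJ[OF v] by (simp add: adm_def)
      qed
    qed
  qed
  have bdd: "bdd_above ?J" using K by (intro bdd_aboveI[of _ K]) auto
  have ne: "?J \<noteq> {}" using rearr_refl[OF f] by auto
  define s where "s = Sup ?J"
  have "\<exists>v. rearr L R B p f v \<and> s - 1 / Suc i < centr v" for i
    using less_cSup_iff[OF ne bdd, of "s - 1 / Suc i"] unfolding s_def by auto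
  then obtain w where w: "\<And>i. rearr L R B p f (w i)" "\<And>i. s - 1 / Suc i < centr (w i)" by metis
  obtain k v where k: "strict_mono (k :: nat \<Rightarrow> nat)" "\<forall>e>0. \<exists>N. \<forall>i\<ge>N. \<forall>x. \<bar>w (k i) x - v x\<bar> \<le> e"
    using adm_compact[of L R B w, OF admJ[OF w(1)] R L] by (elim exE conjE)
  note lim = rearr_limit[of L R B p f "\<lambda>i. w (k i)" v, OF w(1) R p k(2)[rule_format]]
  have v: "rearr L R B p f v" by (rule lim(1))
  have cv: "(\<lambda>i. centr (w (k i))) \<longlonglongrightarrow> centr v" by (rule lim(2))
  have "s \<le> centr v"
  proof (rule LIMSEQ_le[OF _ cv])
    have "(\<lambda>i. s - 1 / Suc i) \<longlonglongrightarrow> s - 0"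
      using LIMSEQ_inverse_real_of_nat by (intro tendsto_intros) (simp add: inverse_eq_divide)
    then show "(\<lambda>i. s - 1 / Suc (k i)) \<longlonglongrightarrow> s" using LIMSEQ_subseq_LIMSEQ[OF _ k(1), of "\<lambda>i. s - 1 / Suc i" s] by (simp add: o_def)
    show "\<exists>N. \<forall>n\<ge>N. s - 1 / real (Suc (k n)) \<le> centr (w (k n))" using w(2) less_imp_le by blast
  qed
  \<comment> \<open>A violation at a and b would be repaired by the reflection that exchanges them,
    with a strict gain in \<open>centr\<close>.\<close>
  have le: "v b \<le> v a" if ab: "norm a < norm b" "norm b < 1" for a b
  proof (rule ccontr)
    assume "\<not> v b \<le> v a"
    obtain c where c: "norm c > 1" "hrefl c b = a" using hrefl_swap_exists[OF ab] by blast
    have "centr v < centr (pol c v)" using centr_pol_less[OF c(1) admJ[OF v] R L ab c(2)] \<open>\<not> v b \<le> v a\<close> by simp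
    also have "\<dots> \<le> s" unfolding s_def using rearr_pol[OF c(1) v R L p] by (intro cSup_upper bdd) auto
    finally show False using \<open>s \<le> centr v\<close> by simp
  qed
  have "v y \<le> v x" if xy: "norm x \<le> norm y" for x y
  proof (cases "norm y < 1")
    case True
    show ?thesis
    proof (cases "y = 0")
      case False
      have cont: "continuous_on UNIV v" by (rule adm_continuous[OF admJ[OF v] R])
      \<comment> \<open>Reflections compare only points of different norm; equal norms are reached
        by shrinking x slightly and using continuity.\<close>
      have lim: "(\<lambda>i. v ((1 - 1 / Suc i) *\<^sub>R x)) \<longlonglongrightarrow> v ((1 - 0) *\<^sub>R x)"
      proof -
        have "(\<lambda>i. (1 - 1 / Suc i) *\<^sub>R x) \<longlonglongrightarrow> (1 - 0) *\<^sub>R x"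
          using LIMSEQ_inverse_real_of_nat by (intro tendsto_intros) (simp add: inverse_eq_divide)
        then show ?thesis using cont by (intro isCont_tendsto_compose[of _ v]) (simp_all add: continuous_on_eq_continuous_at)
      qed
      have "v y \<le> v ((1 - 1 / Suc i) *\<^sub>R x)" for i
      proof (rule le[OF _ True])
        have "norm ((1 - 1 / Suc i) *\<^sub>R x) = (1 - 1 / Suc i) * norm x" by (simp add: field_simps)
        also have "\<dots> \<le> (1 - 1 / Suc i) * norm y" using xy by (intro mult_left_mono) auto
        also have "\<dots> < 1 * norm y" using False by (intro mult_strict_right_mono) auto
        finally show "norm ((1 - 1 / Suc i) *\<^sub>R x) < norm y" by simp
      qed
      then show ?thesis using LIMSEQ_le_const[OF lim] by auto
    qed (use xy in auto)
  next
    case False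
    then show ?thesis using adm_outside[OF admJ[OF v] R False] admJ[OF v] by (simp add: adm_def)
  qed
  then show ?thesis using that v by blast
qed


section \<open>Laws of radius functions on the half line\<close>

lemma distr_eq_density_of_cdf:
  fixes M :: "'a measure" and \<tau> :: "'a \<Rightarrow> real"
  assumes \<tau>: "\<tau> \<in> borel_measurable M" and nn: "\<And>x. x \<in> space M \<Longrightarrow> 0 \<le> \<tau> x"
    and cdf: "\<And>t. 0 \<le> t \<Longrightarrow> emeasure M {x \<in> space M. \<tau> x \<le> t} = ennreal (\<Phi> t)"
    and D: "\<And>t. 0 \<le> t \<Longrightarrow> (\<Phi> has_real_derivative \<phi> t) (at t)"
    and c: "continuous_on {0..} \<phi>" and p: "\<And>t. 0 \<le> t \<Longrightarrow> 0 \<le> \<phi> t" and z: "\<Phi> 0 = 0"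
  shows "distr M borel \<tau> = density lborel (\<lambda>t. ennreal (indicator {0..} t * \<phi> t))"
proof (rule measure_eqI_generator_eq[where E="range (\<lambda>a. {..a::real})" and \<Omega>=UNIV and A="\<lambda>i. {..real i}"])
  have m: "(\<lambda>t. indicator {0..} t * \<phi> t) \<in> borel_measurable borel"
    using borel_measurable_continuous_on_indicator[OF _ c] by simp
  have em: "emeasure (distr M borel \<tau>) {..a} = emeasure M {x \<in> space M. \<tau> x \<le> a}" for a
    using \<tau> by (subst emeasure_distr) (auto simp: vimage_def Int_def conj_commute intro!: arg_cong2[where f=emeasure])
  show "Int_stable (range (\<lambda>a. {..a::real}))" by (auto simp: Int_stable_def)
  have "sets (borel :: real measure) = sigma_sets UNIV (range (\<lambda>a. {..a}))"
    by (subst borel_eq_atMost) simp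
  then show "sets (distr M borel \<tau>) = sigma_sets UNIV (range (\<lambda>a. {..a::real}))"
    "sets (density lborel (\<lambda>t. ennreal (indicator {0..} t * \<phi> t))) = sigma_sets UNIV (range (\<lambda>a. {..a}))" by auto
  show "range (\<lambda>i. {..real i}) \<subseteq> range atMost" by auto
  show "(\<Union>i. {..real i}) = UNIV" using real_arch_simple by auto
  show "emeasure (distr M borel \<tau>) {..real i} \<noteq> \<infinity>" for i unfolding em by (simp add: cdf)
  fix X :: "real set" assume "X \<in> range atMost"
  then obtain a where X: "X = {..a}" by auto
  have d: "emeasure (density lborel (\<lambda>t. ennreal (indicator {0..} t * \<phi> t))) {..a} =
     (\<integral>\<^sup>+ t. ennreal (\<phi> t) * indicator {0..a} t \<partial>lborel)"
    using m by (subst emeasure_density) (auto intro!: nn_integral_cong simp: indicator_def)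
  show "emeasure (distr M borel \<tau>) X = emeasure (density lborel (\<lambda>t. ennreal (indicator {0..} t * \<phi> t))) X"
    unfolding X d em
  proof (cases "0 \<le> a")
    case True
    have "(\<Phi> has_vector_derivative \<phi> t) (at t within {0..a})" if "t \<in> {0..a}" for t
      using has_field_derivative_at_within[OF D[of t]] that by (simp add: has_real_derivative_iff_has_vector_derivative)
    then have "(\<phi> has_integral (\<Phi> a - \<Phi> 0)) {0..a}" by (rule fundamental_theorem_of_calculus[OF True])
    then have "(\<integral>\<^sup>+ t. ennreal (\<phi> t) * indicator {0..a} t \<partial>lborel) = ennreal (\<Phi> a - \<Phi> 0)"
      by (intro nn_integral_has_integral_lebesgue') (use p in auto)
    then show "emeasure M {x \<in> space M. \<tau> x \<le> a} = (\<integral>\<^sup>+ t. ennreal (\<phi> t) * indicator {0..a} t \<partial>lborel)"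
      using cdf[OF True] z by simp
  next
    case False
    then have "{x \<in> space M. \<tau> x \<le> a} = {}" using nn by force
    moreover have "{0..a} = {}" using False by simp
    ultimately show "emeasure M {x \<in> space M. \<tau> x \<le> a} = (\<integral>\<^sup>+ t. ennreal (\<phi> t) * indicator {0..a} t \<partial>lborel)"
      by (simp only: emeasure_empty) simp
  qed
qed auto

lemma integral_pushforward_density:
  fixes M :: "'a measure" and \<tau> :: "'a \<Rightarrow> real" and g :: "real \<Rightarrow> real"
  assumes eq: "distr M borel \<tau> = density lborel (\<lambda>t. ennreal (indicator {0..} t * \<phi> t))"
    and \<tau>: "\<tau> \<in> borel_measurable M"
    and c: "continuous_on {0..} \<phi>" and p: "\<And>t. 0 \<le> t \<Longrightarrow> 0 \<le> \<phi> t"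
    and g: "continuous_on {0..b} g" and gb: "\<And>t. b < t \<Longrightarrow> g t = 0" and b: "0 \<le> b"
    and nn: "\<And>x. x \<in> space M \<Longrightarrow> 0 \<le> \<tau> x"
  shows "(\<integral>x. g (\<tau> x) \<partial>M) = integral {0..b} (\<lambda>t. g t * \<phi> t)"
proof -
  define G where "G t = indicator {0..b} t * g t" for t
  have mG: "G \<in> borel_measurable borel" unfolding G_def
    using borel_measurable_continuous_on_indicator[OF _ g] by simp
  have m: "(\<lambda>t. indicator {0..} t * \<phi> t) \<in> borel_measurable borel"
    using borel_measurable_continuous_on_indicator[OF _ c] by simp
  have "(\<integral>x. g (\<tau> x) \<partial>M) = (\<integral>x. G (\<tau> x) \<partial>M)"
    using gb nn by (intro Bochner_Integration.integral_cong) (auto simp: G_def indicator_def)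
  also have "\<dots> = (\<integral>t. G t \<partial>(distr M borel \<tau>))" using \<tau> mG by (subst integral_distr) auto
  also have "\<dots> = (\<integral>t. (indicator {0..} t * \<phi> t) *\<^sub>R G t \<partial>lborel)"
    unfolding eq using m mG p by (subst integral_density) (auto simp: indicator_def)
  also have "\<dots> = (LINT t : {0..b} | lborel. g t * \<phi> t)"
    unfolding set_lebesgue_integral_def
    by (rule Bochner_Integration.integral_cong) (auto simp: G_def indicator_def)
  also have "\<dots> = integral {0..b} (\<lambda>t. g t * \<phi> t)"
  proof (rule set_borel_integral_eq_integral)
    show "set_integrable lborel {0..b} (\<lambda>t. g t * \<phi> t)" unfolding set_integrable_def
      by (intro borel_integrable_compact continuous_intros g continuous_on_subset[OF c]) auto
  qed
  finally show ?thesis .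
qed

subsection \<open>Volume of geodesic balls\<close>

definition hS :: "nat \<Rightarrow> real \<Rightarrow> real" where
  "hS n r = sinh r ^ (n - 1)"

text \<open>The primitive is continued to negative arguments so that it has a two-sided derivative
  at 0 too.\<close>

definition hF :: "nat \<Rightarrow> real \<Rightarrow> real" where
  "hF n r = (if 0 \<le> r then integral {0..r} (hS n) else - integral {r..0} (hS n))"

lemma hS_cont: "continuous_on A (hS n)" unfolding hS_def[abs_def] by (intro continuous_intros)

lemma hF_0 [simp]: "hF n 0 = 0" by (simp add: hF_def)

lemma antiderivative_from_0:
  fixes f :: "real \<Rightarrow> real"
  assumes f: "continuous_on UNIV f"
  shows "((\<lambda>r. if 0 \<le> r then integral {0..r} f else - integral {r..0} f) has_real_derivative f r) (at r)"
    (is "(?F has_real_derivative _) _")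
proof -
  define K where "K = \<bar>r\<bar> + 1"
  have K: "K > 0" "-K < r" "r < K" by (auto simp: K_def)
  have cf: "continuous_on A f" for A using f by (rule continuous_on_subset) simp
  have int: "f integrable_on {x..y}" for x y by (intro integrable_continuous_real cf)
  have eq: "integral {-K..s} f - integral {-K..0} f = ?F s" if "-K < s" for s
  proof (cases "0 \<le> s")
    case True
    then show ?thesis using K Henstock_Kurzweil_Integration.integral_combine[where a="-K" and c=0 and b=s, OF _ _ int] by simp
  next
    case False
    then show ?thesis using that Henstock_Kurzweil_Integration.integral_combine[where a="-K" and c=s and b=0, OF _ _ int] by simp
  qed
  have "((\<lambda>s. integral {-K..s} f) has_real_derivative f r) (at r within {-K..K})"
    using K by (intro integral_has_real_derivative cf) auto
  then have "((\<lambda>s. integral {-K..s} f) has_real_derivative f r) (at r within {-K<..<K})"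
    by (rule DERIV_subset) auto
  then have "((\<lambda>s. integral {-K..s} f) has_real_derivative f r) (at r)"
    using K by (simp add: at_within_open[of r "{-K<..<K}"])
  then have "((\<lambda>s. integral {-K..s} f - integral {-K..0} f) has_real_derivative f r) (at r)"
    by (auto intro!: derivative_eq_intros)
  then show ?thesis
    by (rule has_field_derivative_transform_within_open[where S="{-K<..<K}"]) (use K eq in auto)
qed

lemma hF_deriv: "(hF n has_real_derivative hS n r) (at r)"
  using antiderivative_from_0[OF hS_cont] by (simp add: hF_def[abs_def])

lemma hF_cont: "continuous_on A (hF n)"
  using hF_deriv by (meson DERIV_isCont continuous_at_imp_continuous_on)

lemma hS_nonneg: "0 \<le> r \<Longrightarrow> 0 \<le> hS n r" by (simp add: hS_def)
lemma hS_pos: "0 < r \<Longrightarrow> 0 < hS n r" by (simp add: hS_def)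

lemma nondecreasing_from_0:
  fixes f :: "real \<Rightarrow> real"
  assumes "0 \<le> r" "f 0 = 0" "\<And>x. 0 \<le> x \<Longrightarrow> x \<le> r \<Longrightarrow> \<exists>y. (f has_real_derivative y) (at x) \<and> 0 \<le> y"
  shows "0 \<le> f r"
  using DERIV_nonneg_imp_nondecreasing[of 0 r f] assms by auto

lemma hF_strict_mono: "0 \<le> r \<Longrightarrow> r < s \<Longrightarrow> hF n r < hF n s"
  by (rule DERIV_pos_imp_increasing_open[of r s "hF n"])
     (auto intro!: hF_deriv hS_pos hF_cont exI)

lemma hF_nonneg: "0 \<le> r \<Longrightarrow> 0 \<le> hF n r"
  using hF_strict_mono[of 0 r n] by (cases "r = 0") auto

lemma hF_pos: "0 < r \<Longrightarrow> 0 < hF n r"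
  using hF_strict_mono[of 0 r n] by auto

lemma hF_le_iff: "0 \<le> r \<Longrightarrow> 0 \<le> s \<Longrightarrow> hF n r \<le> hF n s \<longleftrightarrow> r \<le> s"
  using hF_strict_mono[of r s n] hF_strict_mono[of s r n] by (cases r s rule: linorder_cases) auto

lemma sinh_ge_self: "0 \<le> (x::real) \<Longrightarrow> x \<le> sinh x"
proof -
  assume x: "0 \<le> x"
  have "0 \<le> sinh x - x"
  proof (rule nondecreasing_from_0[OF x, of "\<lambda>x. sinh x - x"])
    fix y :: real
    have "((\<lambda>x. sinh x - x) has_real_derivative (cosh y - 1)) (at y)" by (auto intro!: derivative_eq_intros)
    then show "\<exists>z. ((\<lambda>x. sinh x - x) has_real_derivative z) (at y) \<and> 0 \<le> z"
      using cosh_real_ge_1[of y] by (intro exI[of _ "cosh y - 1"]) auto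
  qed simp
  then show ?thesis by simp
qed

lemma hF_ge_power:
  assumes "0 \<le> r" "n \<ge> 1"
  shows "r ^ n \<le> real n * hF n r"
proof -
  have "0 \<le> real n * hF n r - r ^ n"
  proof (rule nondecreasing_from_0[OF assms(1), of "\<lambda>r. real n * hF n r - r ^ n"])
    fix x :: real assume x: "0 \<le> x" "x \<le> r"
    have "((\<lambda>r. real n * hF n r - r ^ n) has_real_derivative (real n * hS n x - real n * x ^ (n - 1))) (at x)"
      by (auto intro!: derivative_eq_intros hF_deriv)
    moreover have "x ^ (n - 1) \<le> hS n x" unfolding hS_def using x sinh_ge_self by (intro power_mono) auto
    ultimately show "\<exists>y. ((\<lambda>r. real n * hF n r - r ^ n) has_real_derivative y) (at x) \<and> 0 \<le> y"
      by (intro exI[of _ "real n * hS n x - real n * x ^ (n - 1)"]) (simp add: mult_left_mono)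
  qed (use assms in auto)
  then show ?thesis by simp
qed

lemma hF_le_sinh_power:
  assumes "0 \<le> r" "n \<ge> 1"
  shows "real n * hF n r \<le> sinh r ^ n"
proof -
  have "0 \<le> sinh r ^ n - real n * hF n r"
  proof (rule nondecreasing_from_0[OF assms(1), of "\<lambda>r. sinh r ^ n - real n * hF n r"])
    fix x :: real assume x: "0 \<le> x" "x \<le> r"
    have "((\<lambda>r. sinh r ^ n - real n * hF n r) has_real_derivative (real n * sinh x ^ (n - 1) * cosh x - real n * hS n x)) (at x)"
      by (auto intro!: derivative_eq_intros hF_deriv)
    moreover have "real n * hS n x * 1 \<le> real n * hS n x * cosh x"
      using x cosh_real_ge_1 by (intro mult_left_mono) (auto simp: hS_def)
    ultimately show "\<exists>y. ((\<lambda>r. sinh r ^ n - real n * hF n r) has_real_derivative y) (at x) \<and> 0 \<le> y"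
      by (intro exI[of _ "real n * sinh x ^ (n - 1) * cosh x - real n * hS n x"]) (simp add: hS_def)
  qed (use assms in auto)
  then show ?thesis by simp
qed

text \<open>Comparing derivatives reduces this to sinh <= cosh. It is the linear isoperimetric
  inequality of balls, volume against boundary, and the source of the factor n - 1 in the spectral
  constant.\<close>

lemma hF_le_hS:
  assumes "0 \<le> r" "n \<ge> 2"
  shows "(real n - 1) * hF n r \<le> hS n r"
proof -
  have "0 \<le> sinh r ^ (n - 1) - (real n - 1) * hF n r"
  proof (rule nondecreasing_from_0[OF assms(1), of "\<lambda>r. sinh r ^ (n - 1) - (real n - 1) * hF n r"])
    fix x :: real assume x: "0 \<le> x" "x \<le> r"
    have n1: "real (n - 1) = real n - 1" using assms by simp
    have "((\<lambda>r. sinh r ^ (n - 1) - (real n - 1) * hF n r) has_real_derivative (real (n - 1) * sinh x ^ (n - 1 - 1) * cosh x - (real n - 1) * hS n x)) (at x)"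
      by (auto intro!: derivative_eq_intros hF_deriv)
    moreover have "(real n - 1) * hS n x \<le> (real n - 1) * sinh x ^ (n - 1 - 1) * cosh x"
    proof -
      have "n - 1 = Suc (n - 1 - 1)" using assms by simp
      then have "hS n x = sinh x ^ (n - 1 - 1) * sinh x"
        unfolding hS_def by (metis power_Suc2)
      also have "\<dots> \<le> sinh x ^ (n - 1 - 1) * cosh x"
        using x sinh_less_cosh_real[of x] by (intro mult_left_mono) (auto simp: less_imp_le)
      finally show ?thesis using assms by (simp add: mult.assoc mult_left_mono)
    qed
    ultimately show "\<exists>y. ((\<lambda>r. sinh r ^ (n - 1) - (real n - 1) * hF n r) has_real_derivative y) (at x) \<and> 0 \<le> y"
      unfolding n1 by (intro exI[of _ "(real n - 1) * sinh x ^ (n - 1 - 1) * cosh x - (real n - 1) * hS n x"]) simp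
  qed (use assms in auto)
  then show ?thesis by (simp add: hS_def)
qed

section \<open>Geodesic radius and polar coordinates\<close>

lemma sinh_tanh_half: "sinh r = 2 * tanh (r / 2) / (1 - (tanh (r / 2))\<^sup>2)" for r :: real
proof -
  have c: "cosh (r / 2) \<noteq> 0" by simp
  have "1 - (tanh (r / 2))\<^sup>2 = 1 / (cosh (r / 2))\<^sup>2"
  proof -
    have "1 - (tanh (r / 2))\<^sup>2 = ((cosh (r / 2))\<^sup>2 - (sinh (r / 2))\<^sup>2) / (cosh (r / 2))\<^sup>2"
      using c by (simp add: tanh_def power_divide field_simps)
    then show ?thesis by (simp add: cosh_square_eq)
  qed
  moreover have "sinh r = 2 * sinh (r / 2) * cosh (r / 2)" using sinh_double[of "r / 2"] by simp
  ultimately show ?thesis using c by (simp add: tanh_def power2_eq_square)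
qed

text \<open>The geodesic distance d from the origin, determined by sinh d = 2|x| / (1 - |x|^2), or
  equivalently by |x| = tanh (d/2), which is \<open>tanh_hrad\<close>.\<close>

definition hrad :: "real ^ 'n \<Rightarrow> real" where
  "hrad x = arsinh (2 * norm x / (1 - (norm x)\<^sup>2))"

lemma hrad_nonneg: "norm x < 1 \<Longrightarrow> 0 \<le> hrad x"
proof -
  assume "norm x < 1"
  then have "\<not> 2 * norm x / (1 - (norm x)\<^sup>2) < 0" using one_minus_norm_sq_pos[of x] by (simp add: not_less)
  then have "\<not> hrad x < 0" unfolding hrad_def by (subst arsinh_real_neg_iff)
  then show ?thesis by simp
qed

lemma tanh_half_bounds: "0 \<le> r \<Longrightarrow> 0 \<le> tanh (r / 2) \<and> tanh (r / 2) < (1::real)"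
  using tanh_real_lt_1[of "r / 2"] by simp

lemma tanh_hrad: "norm x < 1 \<Longrightarrow> tanh (hrad x / 2) = norm x"
proof -
  assume x: "norm x < 1"
  let ?t = "tanh (hrad x / 2)" let ?r = "norm x"
  have t: "0 \<le> ?t" "?t < 1" using tanh_half_bounds[OF hrad_nonneg[OF x]] by auto
  have p: "1 - ?t\<^sup>2 > 0" "1 - ?r\<^sup>2 > 0" using t x by (auto simp: power_less_one_iff abs_square_less_1)
  have "2 * ?t / (1 - ?t\<^sup>2) = sinh (hrad x)" by (rule sinh_tanh_half[symmetric])
  also have "\<dots> = 2 * ?r / (1 - ?r\<^sup>2)" by (simp add: hrad_def)
  finally have "2 * ?t * (1 - ?r\<^sup>2) = 2 * ?r * (1 - ?t\<^sup>2)" using p by (simp add: frac_eq_eq)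
  then have "(?t - ?r) * (1 + ?t * ?r) = 0" by (simp add: algebra_simps power2_eq_square)
  moreover have "1 + ?t * ?r > 0" using t by (simp add: add_pos_nonneg)
  ultimately show ?thesis by simp
qed

lemma hrad_le_iff:
  assumes "norm x < 1" "0 \<le> t"
  shows "hrad x \<le> t \<longleftrightarrow> norm x \<le> tanh (t / 2)"
proof -
  have "norm x \<le> tanh (t / 2) \<longleftrightarrow> tanh (hrad x / 2) \<le> tanh (t / 2)" using tanh_hrad[OF assms(1)] by simp
  also have "\<dots> \<longleftrightarrow> hrad x \<le> t" by (simp add: tanh_real_le_iff)
  finally show ?thesis by simp
qed

lemma hrad_measurable [measurable]: "hrad \<in> borel_measurable borel"
proof -
  have "arsinh \<in> borel_measurable (borel :: real measure)"
    by (intro borel_measurable_continuous_onI continuous_intros)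
  then show ?thesis unfolding hrad_def[abs_def] by measurable
qed

abbreviation (input) ballvol :: "'n::finite itself \<Rightarrow> real" where
  "ballvol (_ :: 'n itself) \<equiv> measure lborel (ball (0 :: real ^ 'n) 1)"

lemma emeasure_cball_ballvol:
  assumes "0 \<le> r"
  shows "emeasure lborel (cball (0 :: real ^ 'n) r) = ennreal (ballvol TYPE('n) * r ^ CARD('n))"
  using emeasure_cball[OF assms, of "0 :: real ^ 'n"] content_ball[of 1 "0 :: real ^ 'n"] by simp

lemma ballvol_pos: "ballvol TYPE('n::finite) > 0"
  using content_ball_pos[of 1 "0 :: real ^ 'n"] by simp

text \<open>Polar coordinates for radial integrands, read off from the volumes of balls; no surface
  measure enters.\<close>

lemma distr_norm_lborel:
  "distr lborel borel (norm :: real ^ 'n \<Rightarrow> real) =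
    density lborel (\<lambda>t. ennreal (indicator {0..} t * (ballvol TYPE('n) * (real CARD('n) * t ^ (CARD('n) - 1)))))"
proof (rule distr_eq_density_of_cdf[where \<Phi>="\<lambda>t. ballvol TYPE('n) * t ^ CARD('n)"])
  fix t :: real assume t: "0 \<le> t"
  have "{x \<in> space lborel. norm x \<le> t} = cball (0 :: real ^ 'n) t" by auto
  then show "emeasure lborel {x :: real ^ 'n \<in> space lborel. norm x \<le> t} = ennreal (ballvol TYPE('n) * t ^ CARD('n))"
    using emeasure_cball_ballvol[OF t, where 'n='n] by simp
  show "((\<lambda>t. ballvol TYPE('n) * t ^ CARD('n)) has_real_derivative ballvol TYPE('n) * (real CARD('n) * t ^ (CARD('n) - 1))) (at t)"
    by (auto intro!: derivative_eq_intros)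
  show "0 \<le> ballvol TYPE('n) * (real CARD('n) * t ^ (CARD('n) - 1))" using t ballvol_pos[where 'n='n] by simp
qed (auto intro!: continuous_intros)

text \<open>The volume of the geodesic ball of radius t, which has Euclidean radius tanh (t/2):
  Euclidean polar coordinates followed by the substitution from the Euclidean to the geodesic
  radius.\<close>

lemma emeasure_hmeas_cball:
  assumes t: "0 \<le> t"
  shows "emeasure hmeas (cball (0 :: real ^ 'n) (tanh (t / 2))) = ennreal (ballvol TYPE('n) * real CARD('n) * hF CARD('n) t)"
proof -
  let ?n = "CARD('n)" let ?s = "ballvol TYPE('n)" let ?a = "tanh (t / 2)"
  have a: "0 \<le> ?a" "?a < 1" using tanh_half_bounds[OF t] by auto
  define w where "w \<rho> = ?s * real ?n * (2 / (1 - \<rho>\<^sup>2)) ^ ?n * \<rho> ^ (?n - 1)" for \<rho> :: real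
  define q where "q \<rho> = (2 / (1 - \<rho>\<^sup>2)) ^ ?n" for \<rho> :: real
  define \<phi> where "\<phi> \<rho> = ?s * (real ?n * \<rho> ^ (?n - 1))" for \<rho> :: real
  have mq: "q \<in> borel_measurable borel" unfolding q_def[abs_def] by measurable
  have sub: "cball (0 :: real ^ 'n) ?a \<subseteq> ball 0 1" using a by auto
  have "emeasure hmeas (cball (0 :: real ^ 'n) ?a) = (\<integral>\<^sup>+ x. ennreal (hdens x) * indicator (cball (0 :: real ^ 'n) ?a) x \<partial>lborel)"
    unfolding hmeas_def using sub hdens_ball_measurable_ennreal
    by (subst emeasure_density) (auto intro!: nn_integral_cong simp: indicator_def)
  also have "\<dots> = (\<integral>\<^sup>+ x. ennreal (q (norm x)) * indicator {..?a} (norm x) \<partial>(lborel :: (real ^ 'n) measure))"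
    by (intro nn_integral_cong) (auto simp: hdens_def q_def indicator_def)
  also have "\<dots> = (\<integral>\<^sup>+ \<rho>. ennreal (q \<rho>) * indicator {..?a} \<rho> \<partial>(distr lborel borel (norm :: real ^ 'n \<Rightarrow> real)))"
    using mq by (subst nn_integral_distr) auto
  also have "\<dots> = (\<integral>\<^sup>+ \<rho>. ennreal (indicator {0..} \<rho> * \<phi> \<rho>) * (ennreal (q \<rho>) * indicator {..?a} \<rho>) \<partial>lborel)"
    unfolding distr_norm_lborel \<phi>_def using mq
    by (subst nn_integral_density) auto
  also have "\<dots> = (\<integral>\<^sup>+ \<rho>. ennreal (w \<rho>) * indicator {0..?a} \<rho> \<partial>lborel)"
  proof (intro nn_integral_cong)
    fix \<rho> :: real
    show "ennreal (indicator {0..} \<rho> * \<phi> \<rho>) * (ennreal (q \<rho>) * indicator {..?a} \<rho>) = ennreal (w \<rho>) * indicator {0..?a} \<rho>"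
    proof (cases "\<rho> \<in> {0..?a}")
      case True
      then have "0 \<le> \<phi> \<rho>" using ballvol_pos[where 'n='n] by (simp add: \<phi>_def)
      moreover have "w \<rho> = \<phi> \<rho> * q \<rho>" by (simp add: w_def \<phi>_def q_def)
      ultimately show ?thesis using True by (simp add: ennreal_mult')
    next
      case False
      then show ?thesis by (auto simp: indicator_def)
    qed
  qed
  also have "\<dots> = ennreal (?s * real ?n * hF ?n t)"
  proof (rule nn_integral_has_integral_lebesgue')
    show "0 \<le> w \<rho>" if "\<rho> \<in> {0..?a}" for \<rho>
    proof -
      have "\<rho>\<^sup>2 < 1" using that a by (auto simp: power_less_one_iff abs_square_less_1)
      then show ?thesis using that ballvol_pos[where 'n='n] by (simp add: w_def)
    qed
    \<comment> \<open>The antiderivative comes from the geodesic radius as a function of the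
      Euclidean one, arsinh (2\<rho> / (1 - \<rho>^2)), whose derivative is 2 / (1 -
      \<rho>^2).\<close>
    define \<Psi> where "\<Psi> \<rho> = ?s * real ?n * hF ?n (arsinh (2 * \<rho> / (1 - \<rho>\<^sup>2)))" for \<rho> :: real
    have D: "(\<Psi> has_real_derivative w \<rho>) (at \<rho>)" if "\<rho> \<in> {0..?a}" for \<rho>
    proof -
      have q: "1 - \<rho>\<^sup>2 > 0" using that a by (auto simp: power_less_one_iff abs_square_less_1)
      let ?z = "2 * \<rho> / (1 - \<rho>\<^sup>2)"
      have sq: "sqrt (?z\<^sup>2 + 1) = (1 + \<rho>\<^sup>2) / (1 - \<rho>\<^sup>2)"
      proof (rule real_sqrt_unique)
        have e: "(1 + \<rho>\<^sup>2)\<^sup>2 = (2 * \<rho>)\<^sup>2 + (1 - \<rho>\<^sup>2)\<^sup>2" by algebra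
        have "(1 - \<rho>\<^sup>2)\<^sup>2 \<noteq> 0" using q by simp
        then show "((1 + \<rho>\<^sup>2) / (1 - \<rho>\<^sup>2))\<^sup>2 = ?z\<^sup>2 + 1"
          unfolding power_divide e by (simp add: add_divide_distrib)
      qed (use q in simp)
      have dz: "((\<lambda>\<rho>. 2 * \<rho> / (1 - \<rho>\<^sup>2)) has_real_derivative (2 * (1 + \<rho>\<^sup>2) / (1 - \<rho>\<^sup>2)\<^sup>2)) (at \<rho>)"
      proof -
        have "((\<lambda>\<rho>. 2 * \<rho>) has_real_derivative 2) (at \<rho>)" "((\<lambda>\<rho>. 1 - \<rho>\<^sup>2) has_real_derivative - (2 * \<rho>)) (at \<rho>)"
          by (auto intro!: derivative_eq_intros)
        from DERIV_divide[OF this]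
        have "((\<lambda>\<rho>. 2 * \<rho> / (1 - \<rho>\<^sup>2)) has_real_derivative ((2 * (1 - \<rho>\<^sup>2) - 2 * \<rho> * - (2 * \<rho>)) / ((1 - \<rho>\<^sup>2) * (1 - \<rho>\<^sup>2)))) (at \<rho>)"
          using q by simp
        moreover have "2 * (1 - \<rho>\<^sup>2) - 2 * \<rho> * - (2 * \<rho>) = 2 * (1 + \<rho>\<^sup>2)" by algebra
        moreover have "(1 - \<rho>\<^sup>2) * (1 - \<rho>\<^sup>2) = (1 - \<rho>\<^sup>2)\<^sup>2" by (rule power2_eq_square[symmetric])
        ultimately show ?thesis by (simp only:)
      qed
      have "((\<lambda>\<rho>. arsinh (2 * \<rho> / (1 - \<rho>\<^sup>2))) has_real_derivative (1 / sqrt (?z\<^sup>2 + 1) * (2 * (1 + \<rho>\<^sup>2) / (1 - \<rho>\<^sup>2)\<^sup>2))) (at \<rho>)"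
        by (rule DERIV_chain2[OF arsinh_real_has_field_derivative dz])
      moreover have "1 / sqrt (?z\<^sup>2 + 1) * (2 * (1 + \<rho>\<^sup>2) / (1 - \<rho>\<^sup>2)\<^sup>2) = 2 / (1 - \<rho>\<^sup>2)"
      proof -
        have e: "1 / (a / b) * (2 * a / b\<^sup>2) = 2 / b" if "a \<noteq> 0" "b \<noteq> 0" for a b :: real
          using that by (simp add: power2_eq_square)
        have "1 + \<rho>\<^sup>2 > 0" by (simp add: add_pos_nonneg)
        then show ?thesis unfolding sq using q by (intro e) auto
      qed
      ultimately have "((\<lambda>\<rho>. arsinh (2 * \<rho> / (1 - \<rho>\<^sup>2))) has_real_derivative 2 / (1 - \<rho>\<^sup>2)) (at \<rho>)" by simp
      from DERIV_chain2[OF hF_deriv[of ?n] this]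
      have "(\<Psi> has_real_derivative (?s * real ?n * (hS ?n (arsinh ?z) * (2 / (1 - \<rho>\<^sup>2))))) (at \<rho>)"
        unfolding \<Psi>_def by (rule DERIV_cmult)
      moreover have "?s * real ?n * (hS ?n (arsinh ?z) * (2 / (1 - \<rho>\<^sup>2))) = w \<rho>"
      proof -
        have "?z ^ (?n - 1) * (2 / (1 - \<rho>\<^sup>2)) = \<rho> ^ (?n - 1) * (2 / (1 - \<rho>\<^sup>2)) ^ Suc (?n - 1)"
        proof -
          have "(x * y) ^ k * y = x ^ k * y ^ Suc k" for x y :: real and k by (simp add: power_mult_distrib)
          from this[of \<rho> "2 / (1 - \<rho>\<^sup>2)" "?n - 1"] show ?thesis by (simp only: times_divide_eq_right mult.commute[of \<rho> 2])
        qed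
        moreover have "Suc (?n - 1) = ?n" using zero_less_card_finite[where 'a='n] by simp
        ultimately show ?thesis by (simp add: hS_def w_def mult_ac)
      qed
      ultimately show ?thesis by simp
    qed
    have "(\<Psi> has_vector_derivative w t) (at t within {0..?a})" if "t \<in> {0..?a}" for t
      using has_field_derivative_at_within[OF D[OF that]] by (simp add: has_real_derivative_iff_has_vector_derivative)
    then have "(w has_integral (\<Psi> ?a - \<Psi> 0)) {0..?a}" by (rule fundamental_theorem_of_calculus[OF a(1)])
    moreover have "\<Psi> ?a = ?s * real ?n * hF ?n t"
      unfolding \<Psi>_def sinh_tanh_half[symmetric] by (simp add: arsinh_sinh_real)
    moreover have "\<Psi> 0 = 0" by (simp add: \<Psi>_def)
    ultimately show "(w has_integral (?s * real ?n * hF ?n t)) {0..?a}" by simp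
  qed
  finally show ?thesis .
qed

text \<open>Total version that is nonnegative everywhere, as the computation of the law requires;
  outside the ball \<open>hmeas\<close> does not see the value.\<close>

definition hrad0 :: "real ^ 'n \<Rightarrow> real" where
  "hrad0 x = (if norm x < 1 then hrad x else 0)"

lemma hrad0_measurable [measurable]: "hrad0 \<in> borel_measurable borel"
  unfolding hrad0_def[abs_def] by measurable

lemma distr_hrad0:
  "distr hmeas borel (hrad0 :: real ^ 'n \<Rightarrow> real) =
    density lborel (\<lambda>t. ennreal (indicator {0..} t * (ballvol TYPE('n) * real CARD('n) * hS CARD('n) t)))"
proof (rule distr_eq_density_of_cdf[where \<Phi>="\<lambda>t. ballvol TYPE('n) * real CARD('n) * hF CARD('n) t"])
  show "hrad0 \<in> borel_measurable hmeas" by measurable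
  show "0 \<le> hrad0 x" for x :: "real ^ 'n" by (simp add: hrad0_def hrad_nonneg)
  fix t :: real assume t: "0 \<le> t"
  have "{x \<in> space borel. hrad0 (x :: real ^ 'n) \<le> t} \<in> sets borel" by measurable
  then have "{x \<in> space hmeas. hrad0 (x :: real ^ 'n) \<le> t} \<in> sets borel" by simp
  then have "emeasure hmeas {x \<in> space hmeas. hrad0 (x :: real ^ 'n) \<le> t} = emeasure hmeas ({x \<in> space hmeas. hrad0 x \<le> t} \<inter> ball (0 :: real ^ 'n) 1)"
    by (rule emeasure_hmeas_Int_ball)
  also have "{x \<in> space hmeas. hrad0 x \<le> t} \<inter> ball (0 :: real ^ 'n) 1 = cball 0 (tanh (t / 2))"
  proof -
    have "hrad x \<le> t \<longleftrightarrow> norm x \<le> tanh (t / 2)" if "norm x < 1" for x :: "real ^ 'n" by (rule hrad_le_iff[OF that t])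
    then show ?thesis using tanh_half_bounds[OF t] by (auto simp: hrad0_def)
  qed
  finally show "emeasure hmeas {x \<in> space hmeas. hrad0 (x :: real ^ 'n) \<le> t} = ennreal (ballvol TYPE('n) * real CARD('n) * hF CARD('n) t)"
    using emeasure_hmeas_cball[OF t, where 'n='n] by simp
  show "((\<lambda>t. ballvol TYPE('n) * real CARD('n) * hF CARD('n) t) has_real_derivative ballvol TYPE('n) * real CARD('n) * hS CARD('n) t) (at t)"
    by (rule DERIV_cmult[OF hF_deriv])
  show "0 \<le> ballvol TYPE('n) * real CARD('n) * hS CARD('n) t" using ballvol_pos[where 'n='n] hS_nonneg[OF t] by simp
qed (auto intro!: continuous_intros hS_cont)

lemma integral_hmeas_radial:
  fixes g :: "real \<Rightarrow> real"
  assumes g: "continuous_on {0..b} g" and gb: "\<And>t. b < t \<Longrightarrow> g t = 0" and b: "0 \<le> b"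
  shows "(\<integral>x. g (hrad0 x) \<partial>(hmeas :: (real ^ 'n) measure)) = ballvol TYPE('n) * real CARD('n) * integral {0..b} (\<lambda>t. g t * hS CARD('n) t)"
proof -
  have "(\<integral>x. g (hrad0 x) \<partial>(hmeas :: (real ^ 'n) measure)) = integral {0..b} (\<lambda>t. g t * (ballvol TYPE('n) * real CARD('n) * hS CARD('n) t))"
    by (rule integral_pushforward_density[OF distr_hrad0 _ _ _ g gb b])
       (use ballvol_pos[where 'n='n] hS_nonneg in \<open>auto intro!: continuous_intros hS_cont simp: hrad0_def hrad_nonneg\<close>)
  also have "\<dots> = ballvol TYPE('n) * real CARD('n) * integral {0..b} (\<lambda>t. g t * hS CARD('n) t)"
    by (subst integral_mult_right[symmetric]) (simp add: mult_ac)
  finally show ?thesis .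
qed

text \<open>\<open>erad y\<close> is the geodesic radius of the hyperbolic ball whose volume is that of the Euclidean
  ball of radius \<open>norm y\<close>, up to the common normalisation of the two volumes.\<close>

definition erad :: "real ^ 'n \<Rightarrow> real" where
  "erad y = (THE r. 0 \<le> r \<and> real CARD('n) * hF CARD('n) r = norm y ^ CARD('n))"

lemma hF_surj:
  assumes s: "0 \<le> s" and n: "n \<ge> 1"
  shows "\<exists>r\<ge>0. real n * hF n r = s"
proof -
  have "s \<le> max 1 s" by simp
  also have "\<dots> \<le> max 1 s ^ n" using n by (intro self_le_power) auto
  also have "\<dots> \<le> real n * hF n (max 1 s)" using n by (intro hF_ge_power) auto
  finally have "\<exists>x\<ge>0. x \<le> max 1 s \<and> real n * hF n x = s"
    using s by (intro IVT') (auto intro!: continuous_intros hF_cont)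
  then show ?thesis by blast
qed

lemma erad:
  fixes y :: "real ^ 'n"
  shows erad_nonneg: "0 \<le> erad y" and hF_erad: "real CARD('n) * hF CARD('n) (erad y) = norm y ^ CARD('n)"
proof -
  obtain r where r: "0 \<le> r" "real CARD('n) * hF CARD('n) r = norm y ^ CARD('n)"
    using hF_surj[of "norm y ^ CARD('n)" "CARD('n)"] by (auto simp: Suc_le_eq)
  have u: "r' = r" if "0 \<le> r' \<and> real CARD('n) * hF CARD('n) r' = norm y ^ CARD('n)" for r'
  proof -
    have "hF CARD('n) r' = hF CARD('n) r" using r that by (metis mult_cancel_left of_nat_0_eq_iff zero_less_card_finite less_numeral_extra(3))
    then show ?thesis using hF_le_iff[of r r' "CARD('n)"] hF_le_iff[of r' r "CARD('n)"] r that by auto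
  qed
  have "0 \<le> erad y \<and> real CARD('n) * hF CARD('n) (erad y) = norm y ^ CARD('n)"
    unfolding erad_def
    by (rule theI[of "\<lambda>r. 0 \<le> r \<and> real CARD('n) * hF CARD('n) r = norm y ^ CARD('n)" r]) (use r u in blast)+
  then show "0 \<le> erad y" "real CARD('n) * hF CARD('n) (erad y) = norm y ^ CARD('n)" by auto
qed

lemma erad_le_iff:
  fixes y :: "real ^ 'n"
  assumes t: "0 \<le> t"
  shows "erad y \<le> t \<longleftrightarrow> norm y \<le> (real CARD('n) * hF CARD('n) t) powr (1 / CARD('n))"
proof -
  let ?n = "CARD('n)" let ?q = "(real ?n * hF ?n t) powr (1 / ?n)"
  have n0: "?n > 0" by simp
  have q: "?q ^ ?n = real ?n * hF ?n t"
  proof -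
    have "?q ^ ?n = ?q powr (real ?n)" by (simp add: powr_realpow')
    also have "\<dots> = real ?n * hF ?n t" using hF_nonneg[OF t] by (simp add: powr_powr)
    finally show ?thesis .
  qed
  have "erad y \<le> t \<longleftrightarrow> real ?n * hF ?n (erad y) \<le> real ?n * hF ?n t"
    using hF_le_iff[OF erad_nonneg t, of ?n y] n0 by simp
  also have "\<dots> \<longleftrightarrow> norm y ^ ?n \<le> ?q ^ ?n" unfolding hF_erad q ..
  also have "\<dots> \<longleftrightarrow> norm y \<le> ?q" by (rule power_mono_iff) auto
  finally show ?thesis .
qed

lemma erad_measurable [measurable]: "(erad :: real ^ 'n \<Rightarrow> real) \<in> borel_measurable borel"
proof (rule borel_measurableI_le)
  fix a :: real
  show "{x \<in> space borel. erad (x :: real ^ 'n) \<le> a} \<in> sets borel"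
  proof (cases "0 \<le> a")
    case True
    then show ?thesis unfolding erad_le_iff[OF True] by measurable
  next
    case False
    then have "{x \<in> space borel. erad (x :: real ^ 'n) \<le> a} = {}" using erad_nonneg order_trans by auto
    then show ?thesis by simp
  qed
qed

text \<open>This is the density found for \<open>hrad0\<close> under \<open>hmeas\<close> in
  \<open>distr_hrad0\<close>. The coincidence of the two laws is the reason why a radial profile has
  the same L^q integrals on both sides of the transplantation.\<close>

lemma distr_erad:
  "distr lborel borel (erad :: real ^ 'n \<Rightarrow> real) =
    density lborel (\<lambda>t. ennreal (indicator {0..} t * (ballvol TYPE('n) * real CARD('n) * hS CARD('n) t)))"
proof (rule distr_eq_density_of_cdf[where \<Phi>="\<lambda>t. ballvol TYPE('n) * real CARD('n) * hF CARD('n) t"])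
  show "erad \<in> borel_measurable lborel" by measurable
  show "0 \<le> erad x" for x :: "real ^ 'n" by (rule erad_nonneg)
  fix t :: real assume t: "0 \<le> t"
  let ?n = "CARD('n)" let ?q = "(real ?n * hF ?n t) powr (1 / ?n)"
  have q: "?q ^ ?n = real ?n * hF ?n t"
  proof -
    have "?q ^ ?n = ?q powr (real ?n)" by (simp add: powr_realpow')
    also have "\<dots> = real ?n * hF ?n t" using hF_nonneg[OF t] by (simp add: powr_powr)
    finally show ?thesis .
  qed
  have "{x \<in> space lborel. erad (x :: real ^ 'n) \<le> t} = cball 0 ?q"
    unfolding erad_le_iff[OF t] by (simp add: cball_def)
  then show "emeasure lborel {x \<in> space lborel. erad (x :: real ^ 'n) \<le> t} = ennreal (ballvol TYPE('n) * real CARD('n) * hF CARD('n) t)"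
    using emeasure_cball_ballvol[of ?q, where 'n='n] q by (simp add: mult.assoc)
  show "((\<lambda>t. ballvol TYPE('n) * real CARD('n) * hF CARD('n) t) has_real_derivative ballvol TYPE('n) * real CARD('n) * hS CARD('n) t) (at t)"
    by (rule DERIV_cmult[OF hF_deriv])
  show "0 \<le> ballvol TYPE('n) * real CARD('n) * hS CARD('n) t" using ballvol_pos[where 'n='n] hS_nonneg[OF t] by simp
qed (auto intro!: continuous_intros hS_cont)

lemma integral_lborel_radial:
  fixes g :: "real \<Rightarrow> real"
  assumes g: "continuous_on {0..b} g" and gb: "\<And>t. b < t \<Longrightarrow> g t = 0" and b: "0 \<le> b"
  shows "(\<integral>x. g (erad x) \<partial>(lborel :: (real ^ 'n) measure)) = ballvol TYPE('n) * real CARD('n) * integral {0..b} (\<lambda>t. g t * hS CARD('n) t)"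
proof -
  have "(\<integral>x. g (erad x) \<partial>(lborel :: (real ^ 'n) measure)) = integral {0..b} (\<lambda>t. g t * (ballvol TYPE('n) * real CARD('n) * hS CARD('n) t))"
    by (rule integral_pushforward_density[OF distr_erad _ _ _ g gb b])
       (use ballvol_pos[where 'n='n] hS_nonneg in \<open>auto intro!: continuous_intros hS_cont simp: erad_nonneg\<close>)
  also have "\<dots> = ballvol TYPE('n) * real CARD('n) * integral {0..b} (\<lambda>t. g t * hS CARD('n) t)"
    by (subst integral_mult_right[symmetric]) (simp add: mult_ac)
  finally show ?thesis .
qed


text \<open>The degenerate instance of the two-point inequality with the intervals [0, x + y] and
  [y, y].\<close>

lemma powr_superadd:
  fixes x y t :: real
  assumes "0 \<le> x" "0 \<le> y" "t \<ge> 1"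
  shows "x powr t + y powr t \<le> (x + y) powr t"
  using two_point_powr_le[of t 0 "x + y" y y] assms by (simp add: max_def min_def split: if_splits)

lemma nondecreasing_from_0_open:
  fixes f :: "real \<Rightarrow> real"
  assumes "0 \<le> r" "f 0 = 0" "continuous_on {0..r} f"
    "\<And>x. 0 < x \<Longrightarrow> x < r \<Longrightarrow> \<exists>y. (f has_real_derivative y) (at x) \<and> 0 \<le> y"
  shows "0 \<le> f r"
  using DERIV_nonneg_imp_increasing_open[of 0 r f] assms by auto

subsection \<open>Inequalities for radial profiles\<close>

text \<open>Let \<rho> be the radius of the Euclidean ball matched to geodesic radius r, so that
  \<rho>^n = n F(r). Then \<open>eW n r\<close> is \<rho>^(n-1), and \<open>eW n r / hS n r\<close>
  is the derivative of r with respect to \<rho>.\<close>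

definition eW :: "nat \<Rightarrow> real \<Rightarrow> real" where
  "eW n r = (real n * hF n r) powr ((real n - 1) / real n)"

lemma continuous_on_powr_nonneg:
  fixes f :: "real \<Rightarrow> real"
  assumes "continuous_on A f" "\<And>x. x \<in> A \<Longrightarrow> 0 \<le> f x" "q > 0"
  shows "continuous_on A (\<lambda>x. f x powr q)"
  using assms by (intro continuous_on_powr') auto

text \<open>The splitting inequality at the critical exponent p = 2n/(n-1). Two differentiations
  remove the integral F from the leading terms: the derivative of the difference is 2n S times
  \<open>K\<close>, and the derivative of \<open>K\<close> has the sign of sinh^2 - ((n-1)
  F)^(2/(n-1)), which is nonnegative by \<open>hF_le_hS\<close>.\<close>

lemma profile_ineq_base:
  assumes r: "0 \<le> r" and n: "n \<ge> 2"
  shows "(real n * hF n r)\<^sup>2 + ((real n - 1) * hF n r) powr (2 * real n / (real n - 1)) \<le> sinh r ^ (2 * n)"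
proof -
  define N where "N = real n"
  have N: "N > 1" "N \<ge> 2" using n by (auto simp: N_def)
  \<comment> \<open>This is e - 1 for the exponent e = 2N / (N - 1) of the statement, that is, the
    power left after one differentiation.\<close>
  define q where "q = (N + 1) / (N - 1)"
  have q0: "q > 0" using N by (simp add: q_def)
  have q1: "q - 1 = 2 / (N - 1)" using N by (simp add: q_def field_simps)
  have qN: "q * (N - 1) = N + 1" using N by (simp add: q_def)
  define K where "K s = sinh s ^ n * cosh s - N * hF n s - ((N - 1) * hF n s) powr q" for s
  have K: "0 \<le> K s" if s: "0 \<le> s" for s
  proof (rule nondecreasing_from_0_open[OF s])
    show "K 0 = 0" using n by (simp add: K_def)
    show "continuous_on {0..s} K" unfolding K_def[abs_def]
      by (intro continuous_intros continuous_on_powr_nonneg hF_cont) (use N q0 hF_nonneg in auto)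
    fix x :: real assume x: "0 < x" "x < s"
    have Fp: "(N - 1) * hF n x > 0" using N hF_pos[OF x(1)] by simp
    have S1: "sinh x ^ (n - 1) = hS n x" by (simp add: hS_def)
    have d1: "((\<lambda>s. sinh s ^ n * cosh s) has_real_derivative (N * hS n x * cosh x * cosh x + sinh x ^ n * sinh x)) (at x)"
      by (auto intro!: derivative_eq_intros simp: N_def hS_def)
    have d2: "((\<lambda>s. ((N - 1) * hF n s) powr q) has_real_derivative (q * ((N - 1) * hF n x) powr (q - 1) * ((N - 1) * hS n x))) (at x)"
      by (rule DERIV_chain2[OF has_real_derivative_powr[OF Fp] DERIV_cmult[OF hF_deriv]])
    have dK: "(K has_real_derivative (N * hS n x * cosh x * cosh x + sinh x ^ n * sinh x - N * hS n x
        - q * ((N - 1) * hF n x) powr (q - 1) * ((N - 1) * hS n x))) (at x)"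
      unfolding K_def[abs_def] by (intro derivative_intros d1 d2 DERIV_cmult hF_deriv)
    have sn: "sinh x ^ n = hS n x * sinh x" using n unfolding hS_def by (cases n) auto
    have ch: "cosh x * cosh x = 1 + (sinh x)\<^sup>2" using cosh_square_eq[of x] by (simp add: power2_eq_square)
    have "N * hS n x * cosh x * cosh x + sinh x ^ n * sinh x - N * hS n x
        - q * ((N - 1) * hF n x) powr (q - 1) * ((N - 1) * hS n x)
      = hS n x * (N * (cosh x * cosh x) + (sinh x)\<^sup>2 - N - (q * (N - 1)) * ((N - 1) * hF n x) powr (q - 1))"
      unfolding sn by (simp add: algebra_simps power2_eq_square)
    also have "\<dots> = hS n x * (N + 1) * ((sinh x)\<^sup>2 - ((N - 1) * hF n x) powr (q - 1))"
      unfolding ch qN by (simp add: algebra_simps)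
    finally have eq: "N * hS n x * cosh x * cosh x + sinh x ^ n * sinh x - N * hS n x
        - q * ((N - 1) * hF n x) powr (q - 1) * ((N - 1) * hS n x) = hS n x * (N + 1) * ((sinh x)\<^sup>2 - ((N - 1) * hF n x) powr (q - 1))" .
    have "((N - 1) * hF n x) powr (q - 1) \<le> (hS n x) powr (q - 1)"
      using hF_le_hS[of x n] x n Fp q1 N by (intro powr_mono2) (auto simp: N_def)
    also have "(hS n x) powr (q - 1) = (sinh x)\<^sup>2"
    proof -
      have sp: "sinh x > 0" using x by simp
      have "hS n x = sinh x powr (N - 1)" unfolding hS_def N_def using n sp by (simp add: powr_realpow[symmetric] of_nat_diff)
      then have "(hS n x) powr (q - 1) = sinh x powr ((N - 1) * (q - 1))" by (simp add: powr_powr)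
      also have "(N - 1) * (q - 1) = 2" unfolding q1 using N by (simp add: field_simps)
      finally show ?thesis using sp by (simp add: powr_numeral)
    qed
    finally have "0 \<le> hS n x * (N + 1) * ((sinh x)\<^sup>2 - ((N - 1) * hF n x) powr (q - 1))"
      using hS_nonneg[of x n] x N by simp
    with dK eq show "\<exists>y. (K has_real_derivative y) (at x) \<and> 0 \<le> y" by metis
  qed
  define e where "e = 2 * N / (N - 1)"
  have e0: "e > 0" using N by (simp add: e_def)
  have e1: "e - 1 = q" using N by (simp add: e_def q_def field_simps)
  have eN: "e * (N - 1) = 2 * N" using N by (simp add: e_def)
  define G where "G s = sinh s ^ (2 * n) - (N * hF n s)\<^sup>2 - ((N - 1) * hF n s) powr e" for s
  have "0 \<le> G r"
  proof (rule nondecreasing_from_0_open[OF r])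
    show "G 0 = 0" using n by (simp add: G_def)
    show "continuous_on {0..r} G" unfolding G_def[abs_def]
      by (intro continuous_intros continuous_on_powr_nonneg hF_cont) (use N e0 hF_nonneg in auto)
    fix x :: real assume x: "0 < x" "x < r"
    have Fp: "(N - 1) * hF n x > 0" using N hF_pos[OF x(1)] by simp
    have d1: "((\<lambda>s. sinh s ^ (2 * n)) has_real_derivative (2 * N * sinh x ^ (2 * n - 1) * cosh x)) (at x)"
      by (auto intro!: derivative_eq_intros simp: N_def)
    have d3: "((\<lambda>s. (N * hF n s)\<^sup>2) has_real_derivative (2 * (N * hF n x) * (N * hS n x))) (at x)"
      by (auto intro!: derivative_eq_intros hF_deriv)
    have d2: "((\<lambda>s. ((N - 1) * hF n s) powr e) has_real_derivative (e * ((N - 1) * hF n x) powr (e - 1) * ((N - 1) * hS n x))) (at x)"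
      by (rule DERIV_chain2[OF has_real_derivative_powr[OF Fp] DERIV_cmult[OF hF_deriv]])
    have dG: "(G has_real_derivative (2 * N * sinh x ^ (2 * n - 1) * cosh x - 2 * (N * hF n x) * (N * hS n x)
        - e * ((N - 1) * hF n x) powr (e - 1) * ((N - 1) * hS n x))) (at x)"
      unfolding G_def[abs_def] by (intro derivative_intros d1 d2 d3)
    have sn: "sinh x ^ (2 * n - 1) = hS n x * sinh x ^ n"
    proof -
      have "2 * n - 1 = (n - 1) + n" using n by simp
      then show ?thesis unfolding hS_def by (simp only: power_add)
    qed
    have "2 * N * sinh x ^ (2 * n - 1) * cosh x - 2 * (N * hF n x) * (N * hS n x)
        - e * ((N - 1) * hF n x) powr (e - 1) * ((N - 1) * hS n x)
      = 2 * N * hS n x * (sinh x ^ n * cosh x) - 2 * N * hS n x * (N * hF n x) - (e * (N - 1)) * hS n x * ((N - 1) * hF n x) powr q"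
      unfolding sn e1 by (simp add: algebra_simps)
    also have "\<dots> = 2 * N * hS n x * K x" unfolding eN K_def by (simp add: algebra_simps)
    finally have eq: "2 * N * sinh x ^ (2 * n - 1) * cosh x - 2 * (N * hF n x) * (N * hS n x)
        - e * ((N - 1) * hF n x) powr (e - 1) * ((N - 1) * hS n x) = 2 * N * hS n x * K x" .
    have "0 \<le> 2 * N * hS n x * K x" using K[of x] hS_nonneg[of x n] x N by simp
    with dG eq show "\<exists>y. (G has_real_derivative y) (at x) \<and> 0 \<le> y" by metis
  qed
  then show ?thesis by (simp add: G_def N_def e_def)
qed

lemma hF_2: "hF 2 r = cosh r - 1"
proof -
  have "((\<lambda>r. hF 2 r - cosh r) has_real_derivative 0) (at x)" for x
  proof -
    have "(cosh has_real_derivative sinh x) (at x)" by (auto intro!: derivative_eq_intros)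
    from DERIV_diff[OF hF_deriv[of 2 x] this] show ?thesis by (simp add: hS_def)
  qed
  then have "hF 2 r - cosh r = hF 2 0 - cosh 0"
    using DERIV_isconst_all[of "\<lambda>r. hF 2 r - cosh r" r 0] by blast
  then show ?thesis by simp
qed

text \<open>The second disjunct is needed for the Morrey--Sobolev case \<open>n = 2 < p < 4\<close>.\<close>

definition okp :: "nat \<Rightarrow> real \<Rightarrow> bool" where
  "okp n p \<longleftrightarrow> n \<ge> 2 \<and> p > 1 \<and> (2 * real n / (real n - 1) \<le> p \<or> n = 2 \<and> 2 \<le> p)"

text \<open>Above the critical exponent the base inequality is raised to the power t = p (n-1) /
  (2n) >= 1 and superadditivity is applied. In dimension 2 there is an identity instead, sinh^2 = 2f
  + f^2 with f = cosh - 1, and superadditivity of the power p/2 works from p = 2 on.\<close>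

lemma profile_ineq:
  assumes r: "0 < r" and ok: "okp n p"
  shows "eW n r powr p + ((real n - 1) * hF n r) powr p \<le> hS n r powr p"
proof -
  have n: "n \<ge> 2" using ok by (simp add: okp_def)
  define N where "N = real n"
  have N: "N > 1" using n by (simp add: N_def)
  have F: "hF n r > 0" by (rule hF_pos[OF r])
  have sp: "sinh r > 0" using r by simp
  have Wp: "eW n r powr p = (N * hF n r) powr (p * (N - 1) / N)"
    by (simp add: eW_def powr_powr N_def field_simps)
  have S: "hS n r = sinh r powr (N - 1)" unfolding hS_def N_def using n sp by (simp add: powr_realpow[symmetric] of_nat_diff)
  show ?thesis
  proof (cases "2 * real n / (real n - 1) \<le> p")
    case True
    define t where "t = p * (N - 1) / (2 * N)"
    have t: "t \<ge> 1" using True N by (simp add: t_def N_def field_simps)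
    have a: "((N * hF n r)\<^sup>2) powr t = eW n r powr p"
    proof -
      have "(N * hF n r)\<^sup>2 = (N * hF n r) powr 2" using F N by (simp add: powr_numeral)
      then have "((N * hF n r)\<^sup>2) powr t = (N * hF n r) powr (2 * t)" by (simp add: powr_powr)
      also have "2 * t = p * (N - 1) / N" using N by (simp add: t_def)
      finally show ?thesis by (simp add: Wp)
    qed
    have b: "(((N - 1) * hF n r) powr (2 * N / (N - 1))) powr t = ((N - 1) * hF n r) powr p"
    proof -
      have "2 * N / (N - 1) * t = p" using N by (simp add: t_def)
      then show ?thesis by (simp add: powr_powr)
    qed
    have c: "(sinh r ^ (2 * n)) powr t = hS n r powr p"
    proof -
      have "sinh r ^ (2 * n) = sinh r powr (2 * N)" using sp by (simp add: N_def powr_realpow[symmetric])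
      moreover have "2 * N * t = (N - 1) * p" using N by (simp add: t_def)
      ultimately show ?thesis by (simp add: S powr_powr)
    qed
    have "eW n r powr p + ((N - 1) * hF n r) powr p
       \<le> ((N * hF n r)\<^sup>2 + ((N - 1) * hF n r) powr (2 * N / (N - 1))) powr t"
      unfolding a[symmetric] b[symmetric] using t by (intro powr_superadd) auto
    also have "\<dots> \<le> (sinh r ^ (2 * n)) powr t"
      using profile_ineq_base[of r n] r n t by (intro powr_mono2) (auto simp: N_def)
    finally show ?thesis unfolding c N_def .
  next
    case False
    then have n2: "n = 2" and p2: "2 \<le> p" using ok by (auto simp: okp_def)
    define f where "f = hF 2 r"
    have f: "f > 0" using F n2 f_def by simp
    have N2: "N = 2" using n2 by (simp add: N_def)
    have "(sinh r)\<^sup>2 = (f + 1)\<^sup>2 - 1" using cosh_square_eq[of r] hF_2[of r] by (simp add: f_def)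
    then have s2: "(sinh r)\<^sup>2 = 2 * f + f\<^sup>2" by (simp add: power2_eq_square algebra_simps)
    have "eW n r powr p = (2 * f) powr (p / 2)" using Wp n2 N2 by (simp add: f_def)
    moreover have "((real n - 1) * hF n r) powr p = (f\<^sup>2) powr (p / 2)"
    proof -
      have "f\<^sup>2 = f powr 2" using f by (simp add: powr_numeral)
      then show ?thesis using n2 by (simp add: f_def powr_powr)
    qed
    moreover have "hS n r powr p = ((sinh r)\<^sup>2) powr (p / 2)"
    proof -
      have "(sinh r)\<^sup>2 = sinh r powr 2" using sp by (simp add: powr_numeral)
      then show ?thesis using n2 by (simp add: hS_def powr_powr)
    qed
    moreover have "(2 * f) powr (p / 2) + (f\<^sup>2) powr (p / 2) \<le> (2 * f + f\<^sup>2) powr (p / 2)"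
      using f p2 by (intro powr_superadd) auto
    ultimately show ?thesis using s2 by simp
  qed
qed

lemma eW_le_hS:
  assumes r: "0 < r" and n: "n \<ge> 2"
  shows "eW n r \<le> hS n r"
proof -
  have sp: "sinh r > 0" using r by simp
  have "eW n r \<le> (sinh r ^ n) powr ((real n - 1) / real n)"
    unfolding eW_def using hF_le_sinh_power[of r n] hF_nonneg[of r n] r n by (intro powr_mono2) auto
  also have "\<dots> = sinh r powr (real n - 1)" using sp n by (simp add: powr_realpow[symmetric] powr_powr)
  also have "\<dots> = hS n r" unfolding hS_def using n sp by (simp add: powr_realpow[symmetric] of_nat_diff)
  finally show ?thesis .
qed

lemma eW_nonneg: "0 \<le> eW n r" by (simp add: eW_def)

lemma eW_pos: "0 < r \<Longrightarrow> n \<ge> 1 \<Longrightarrow> 0 < eW n r" using hF_pos[of r n] by (simp add: eW_def)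

section \<open>Young, Hardy and Hoelder inequalities\<close>

lemma DERIV_max0_powr:
  fixes x p :: real
  assumes p: "p > 1"
  shows "((\<lambda>x. max 0 x powr p) has_real_derivative p * max 0 x powr (p - 1)) (at x)"
proof (cases x "0 :: real" rule: linorder_cases)
  case less
  have "((\<lambda>x::real. 0) has_real_derivative 0) (at x)" by simp
  then have "((\<lambda>x. max 0 x powr p) has_real_derivative 0) (at x)"
    by (rule has_field_derivative_transform_within_open[where S="{..<0}"]) (use less in auto)
  then show ?thesis using less by simp
next
  case greater
  have "((\<lambda>x. x powr p) has_real_derivative p * x powr (p - 1)) (at x)"
    using greater by (rule has_real_derivative_powr)
  then have "((\<lambda>x. max 0 x powr p) has_real_derivative p * x powr (p - 1)) (at x)"
    by (rule has_field_derivative_transform_within_open[where S="{0<..}"]) (use greater in auto)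
  then show ?thesis using greater by simp
next
  case equal
  have t: "((\<lambda>h::real. \<bar>h\<bar> powr (p - 1)) \<longlongrightarrow> 0) (at 0)"
  proof -
    have "((\<lambda>h::real. \<bar>h\<bar> powr (p - 1)) \<longlongrightarrow> \<bar>0\<bar> powr (p - 1)) (at 0)"
      by (intro tendsto_powr' tendsto_intros) (use p in auto)
    then show ?thesis by simp
  qed
  have "((\<lambda>h. (max 0 (0 + h) powr p - max 0 0 powr p) / h) \<longlongrightarrow> 0) (at 0)"
  proof (rule tendsto_0_le[OF t, of _ 1])
    have "norm ((max 0 (0 + h) powr p - max 0 0 powr p) / h) \<le> norm (\<bar>h\<bar> powr (p - 1)) * 1" if "h \<noteq> 0" for h :: real
    proof (cases "h > 0")
      case True
      then have "h powr p / h = h powr (p - 1)" by (simp add: powr_diff)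
      then show ?thesis using True by simp
    qed (use that in simp)
    then show "\<forall>\<^sub>F h in at 0. norm ((max 0 (0 + h) powr p - max 0 0 powr p) / h) \<le> norm (\<bar>h\<bar> powr (p - 1)) * 1"
      by (simp add: eventually_at_filter)
  qed
  then show ?thesis using equal p by (simp add: DERIV_def)
qed

lemma young_weighted:
  fixes a b s t :: real
  assumes "0 \<le> a" "0 \<le> b" "0 < s" "0 < t" "s + t = 1"
  shows "a powr s * b powr t \<le> s * a + t * b"
proof (cases "a = 0 \<or> b = 0")
  case True
  then show ?thesis using assms by auto
next
  case False
  then show ?thesis using Youngs_inequality_0[of s t a b] assms by auto
qed

lemma young_powr:
  fixes a c p :: real
  assumes "0 \<le> a" "0 \<le> c" "p > 1"
  shows "a powr (p - 1) * c \<le> (1 - 1 / p) * a powr p + c powr p / p"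
proof -
  have "(a powr p) powr (1 - 1 / p) * (c powr p) powr (1 / p) \<le> (1 - 1 / p) * a powr p + 1 / p * c powr p"
    by (rule young_weighted) (use assms in auto)
  moreover have "(a powr p) powr (1 - 1 / p) = a powr (p - 1)" using assms by (simp add: powr_powr right_diff_distrib)
  moreover have "(c powr p) powr (1 / p) = c" using assms by (simp add: powr_powr)
  ultimately show ?thesis by simp
qed

text \<open>Integrating the derivative of M^p F gives a boundary term of the right sign, because M
  vanishes at b and F a is nonnegative. Young's inequality, assumed pointwise as \<open>y\<close>,
  leaves the share 1 - 1/p of the left side to be absorbed. Stating \<open>y\<close> without
  quotients lets it hold at r = 0, where F / S degenerates, and lets one lemma serve two different
  weights.\<close>

lemma hardy_ineq:
  fixes M m F S e :: "real \<Rightarrow> real"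
  assumes ab: "a \<le> b" and p: "p > 1"
    and dM: "\<And>r. r \<in> {a..b} \<Longrightarrow> (M has_real_derivative m r) (at r)"
    and dF: "\<And>r. r \<in> {a..b} \<Longrightarrow> (F has_real_derivative S r) (at r)"
    and cm: "continuous_on {a..b} m" and cS: "continuous_on {a..b} S" and ce: "continuous_on {a..b} e"
    and M0: "\<And>r. r \<in> {a..b} \<Longrightarrow> 0 \<le> M r" and Mb: "M b = 0" and Fa: "0 \<le> F a"
    and y: "\<And>r. r \<in> {a..b} \<Longrightarrow> p * M r powr (p - 1) * (\<bar>m r\<bar> * F r) \<le> (1 - 1 / p) * (M r powr p * S r) + e r / p"
    and Fn: "\<And>r. r \<in> {a..b} \<Longrightarrow> 0 \<le> F r"
  shows "integral {a..b} (\<lambda>r. M r powr p * S r) \<le> integral {a..b} e"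
proof -
  have cM: "continuous_on {a..b} M" using dM by (meson DERIV_isCont continuous_at_imp_continuous_on)
  have cF: "continuous_on {a..b} F" using dF by (meson DERIV_isCont continuous_at_imp_continuous_on)
  have cMp: "continuous_on {a..b} (\<lambda>r. M r powr q)" if "q > 0" for q
    using cM M0 that by (rule continuous_on_powr_nonneg)
  define d where "d r = p * M r powr (p - 1) * m r * F r + M r powr p * S r" for r
  have "(d has_integral (max 0 (M b) powr p * F b - max 0 (M a) powr p * F a)) {a..b}"
  proof (rule fundamental_theorem_of_calculus[OF ab])
    fix r assume r: "r \<in> {a..b}"
    \<comment> \<open>The truncation makes the p-th power differentiable also where M vanishes,
      which happens at b at least.\<close>
    have "((\<lambda>r. max 0 (M r) powr p) has_real_derivative (p * max 0 (M r) powr (p - 1) * m r)) (at r)"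
      by (rule DERIV_chain2[OF DERIV_max0_powr[OF p] dM[OF r]])
    from DERIV_mult[OF this dF[OF r]]
    have "((\<lambda>r. max 0 (M r) powr p * F r) has_real_derivative d r) (at r)"
      using M0[OF r] by (simp add: d_def max_absorb2 mult_ac)
    then show "((\<lambda>r. max 0 (M r) powr p * F r) has_vector_derivative d r) (at r within {a..b})"
      using has_field_derivative_at_within by (simp add: has_real_derivative_iff_has_vector_derivative[symmetric])
  qed
  then have "integral {a..b} d = - (max 0 (M a) powr p * F a)" using Mb p by (simp add: integral_unique)
  then have le0: "integral {a..b} d \<le> 0" using Fa by simp
  have i1: "(\<lambda>r. M r powr p * S r) integrable_on {a..b}"
    by (intro integrable_continuous_real continuous_intros cMp cS) (use p in auto)
  have i2: "d integrable_on {a..b}" unfolding d_def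
    by (intro integrable_continuous_real continuous_intros cMp cS cm cF) (use p in auto)
  have i3: "e integrable_on {a..b}" by (intro integrable_continuous_real ce)
  have "integral {a..b} (\<lambda>r. M r powr p * S r) \<le> integral {a..b} (\<lambda>r. d r + ((1 - 1 / p) * (M r powr p * S r) + e r / p))"
  proof (rule integral_le[OF i1])
    show "(\<lambda>r. d r + ((1 - 1 / p) * (M r powr p * S r) + e r / p)) integrable_on {a..b}"
      by (intro integrable_add i2 integrable_on_mult_right integrable_on_divide i1 i3)
    fix r assume r: "r \<in> {a..b}"
    have "- (p * M r powr (p - 1) * m r * F r) \<le> p * M r powr (p - 1) * (\<bar>m r\<bar> * F r)"
    proof -
      have "p * M r powr (p - 1) * F r * (- m r) \<le> p * M r powr (p - 1) * F r * \<bar>m r\<bar>"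
        using p Fn[OF r] by (intro mult_left_mono) auto
      then show ?thesis by (simp add: mult_ac)
    qed
    then show "M r powr p * S r \<le> d r + ((1 - 1 / p) * (M r powr p * S r) + e r / p)"
      using y[OF r] by (simp add: d_def)
  qed
  also have "\<dots> = integral {a..b} d + ((1 - 1 / p) * integral {a..b} (\<lambda>r. M r powr p * S r) + integral {a..b} e / p)"
    using i1 i2 i3 by (simp add: integral_add integrable_add integrable_on_mult_right integrable_on_divide)
  finally have "integral {a..b} (\<lambda>r. M r powr p * S r) \<le> (1 - 1 / p) * integral {a..b} (\<lambda>r. M r powr p * S r) + integral {a..b} e / p"
    using le0 by linarith
  then show ?thesis using p by (simp add: field_simps)
qed

text \<open>Young's inequality for the normalised functions. The integrals are enlarged by e > 0
  before dividing, which covers the case that one of them is zero; then e tends to 0.\<close>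

lemma Holder_integral:
  fixes f g :: "'a::euclidean_space \<Rightarrow> real"
  assumes f: "f integrable_on A" "\<And>x. x \<in> A \<Longrightarrow> 0 \<le> f x" and g: "g integrable_on A" "\<And>x. x \<in> A \<Longrightarrow> 0 \<le> g x"
    and s: "0 < s" "s < 1" and i: "(\<lambda>x. f x powr s * g x powr (1 - s)) integrable_on A"
  shows "integral A (\<lambda>x. f x powr s * g x powr (1 - s)) \<le> integral A f powr s * integral A g powr (1 - s)"
proof -
  let ?a = "integral A f" let ?b = "integral A g" let ?I = "integral A (\<lambda>x. f x powr s * g x powr (1 - s))"
  have a0: "0 \<le> ?a" "0 \<le> ?b" using f g by (auto intro: integral_nonneg)
  have le: "?I \<le> (?a + e) powr s * (?b + e) powr (1 - s)" if e: "e > 0" for e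
  proof -
    define K where "K = (?a + e) powr s * (?b + e) powr (1 - s)"
    have K0: "K > 0" using a0 e by (simp add: K_def)
    have "?I \<le> integral A (\<lambda>x. K * (s / (?a + e) * f x + (1 - s) / (?b + e) * g x))"
    proof (rule integral_le[OF i])
      show "(\<lambda>x. K * (s / (?a + e) * f x + (1 - s) / (?b + e) * g x)) integrable_on A"
        by (intro integrable_on_mult_right integrable_add f g)
      fix x assume x: "x \<in> A"
      have "(f x / (?a + e)) powr s * (g x / (?b + e)) powr (1 - s) \<le> s * (f x / (?a + e)) + (1 - s) * (g x / (?b + e))"
        by (rule young_weighted) (use s f g x a0 e in auto)
      then have "K * ((f x / (?a + e)) powr s * (g x / (?b + e)) powr (1 - s)) \<le> K * (s * (f x / (?a + e)) + (1 - s) * (g x / (?b + e)))"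
        using K0 by (intro mult_left_mono) auto
      moreover have "K * ((f x / (?a + e)) powr s * (g x / (?b + e)) powr (1 - s)) = f x powr s * g x powr (1 - s)"
        using f g x a0 e unfolding K_def by (simp add: powr_divide)
      ultimately show "f x powr s * g x powr (1 - s) \<le> K * (s / (?a + e) * f x + (1 - s) / (?b + e) * g x)"
        by simp
    qed
    also have "\<dots> = K * (s / (?a + e) * ?a + (1 - s) / (?b + e) * ?b)"
      by (simp only: integral_mult_right integral_add[OF integrable_on_mult_right[OF f(1)] integrable_on_mult_right[OF g(1)]])
    also have "\<dots> \<le> K * (s + (1 - s))"
    proof (intro mult_left_mono add_mono)
      show "s / (?a + e) * ?a \<le> s" using a0 e s by (simp add: field_simps)
      show "(1 - s) / (?b + e) * ?b \<le> 1 - s" using a0 e s by (simp add: pos_divide_le_eq mult_left_mono)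
    qed (use K0 in simp)
    finally show ?thesis by (simp add: K_def)
  qed
  have "(\<lambda>n. (?a + inverse (real (Suc n))) powr s * (?b + inverse (real (Suc n))) powr (1 - s)) \<longlonglongrightarrow> (?a + 0) powr s * (?b + 0) powr (1 - s)"
  proof (intro tendsto_mult tendsto_powr' tendsto_add tendsto_const LIMSEQ_inverse_real_of_nat)
    have "0 \<le> inverse (real (Suc n))" for n by simp
    then show "?a + 0 \<noteq> 0 \<or> 0 < s \<and> (\<forall>\<^sub>F x in sequentially. 0 \<le> ?a + inverse (real (Suc x)))"
      "?b + 0 \<noteq> 0 \<or> 0 < 1 - s \<and> (\<forall>\<^sub>F x in sequentially. 0 \<le> ?b + inverse (real (Suc x)))"
      using s a0 by (auto intro!: always_eventually add_nonneg_nonneg)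
  qed
  then show ?thesis using le by (intro LIMSEQ_le_const) auto
qed


section \<open>Energy estimates for C^1 radial profiles\<close>

lemma eW_cont: "n \<ge> 2 \<Longrightarrow> A \<subseteq> {0..} \<Longrightarrow> continuous_on A (eW n)"
  unfolding eW_def[abs_def] using hF_nonneg
  by (intro continuous_on_powr_nonneg continuous_intros hF_cont) auto

lemma hS_0: "n \<ge> 2 \<Longrightarrow> hS n 0 = 0"
  by (simp add: hS_def zero_power)

lemma mult_powr_powr:
  fixes x z k q :: real
  assumes "0 \<le> x"
  shows "(x * z powr k) powr q = x powr q * z powr (k * q)"
  using assms by (subst powr_mult) (auto simp: powr_powr)

text \<open>Profiles are C^1 on the whole line, negative arguments included, so that derivatives at
  r = 0 are two-sided and nothing special happens at the left end point.\<close>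

locale radial_profile =
  fixes n :: nat and p b :: real and M m :: "real \<Rightarrow> real"
  assumes n: "n \<ge> 2" and p: "p > 1" and b: "b > 0"
    and dM: "\<And>r. (M has_real_derivative m r) (at r)"
    and cm: "continuous_on UNIV m"
    and mneg: "\<And>r. m r \<le> 0" and Mb: "\<And>r. b \<le> r \<Longrightarrow> M r = 0" and mb: "\<And>r. b \<le> r \<Longrightarrow> m r = 0"
begin

lemma M_antimono: "r \<le> s \<Longrightarrow> M s \<le> M r"
  using DERIV_nonpos_imp_nonincreasing[of r s M] dM mneg by blast

lemma M_nonneg: "0 \<le> M r"
  using M_antimono[of r "max r b"] Mb[of "max r b"] by simp

lemma M_cont: "continuous_on A M"
  using dM by (meson DERIV_isCont continuous_at_imp_continuous_on)

text \<open>The Euclidean energy density of the transplanted profile in the geodesic variable: the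
  derivative with respect to the Euclidean radius \<rho> is m eW / S, while \<rho>^(n-1) d\<rho>
  becomes S dr.\<close>

definition eE :: "real \<Rightarrow> real" where
  "eE r = (\<bar>m r\<bar> * (eW n r / hS n r)) powr p * hS n r"

lemma eE_nonneg: "0 \<le> r \<Longrightarrow> 0 \<le> eE r" by (simp add: eE_def hS_nonneg)

text \<open>The only problem is r = 0, where \<open>q\<close> stands for a quotient of the form 0/0.
  Boundedness of \<open>q\<close> for r > 0 and the vanishing of \<open>hS\<close> at 0 settle
  it.\<close>

lemma weighted_cont:
  assumes q: "continuous_on {0<..} q" and C: "\<And>r. 0 < r \<Longrightarrow> 0 \<le> q r \<and> q r \<le> C"
  shows "continuous_on {0..c} (\<lambda>r. (\<bar>m r\<bar> * q r) powr p * hS n r)"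
proof -
  let ?f = "\<lambda>r. (\<bar>m r\<bar> * q r) powr p * hS n r"
  have f0: "?f 0 = 0" using hS_0[OF n] by simp
  obtain K where K: "\<And>r. r \<in> {0..c} \<Longrightarrow> \<bar>m r\<bar> \<le> K"
  proof -
    have "compact (m ` {0..c})" using cm by (intro compact_continuous_image) (auto intro: continuous_on_subset)
    then obtain K where "\<And>y. y \<in> m ` {0..c} \<Longrightarrow> norm y \<le> K" using compact_imp_bounded bounded_iff by metis
    then have "\<bar>m r\<bar> \<le> K" if "r \<in> {0..c}" for r using that by (metis imageI real_norm_def)
    then show ?thesis using that by blast
  qed
  show ?thesis unfolding continuous_on_def
  proof
    fix x assume x: "x \<in> {0..c}"
    show "(?f \<longlongrightarrow> ?f x) (at x within {0..c})"
    proof (cases "x = 0")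
      case True
      have t: "((\<lambda>r. (K * C) powr p * hS n r) \<longlongrightarrow> 0) (at 0 within {0..c})"
      proof -
        have "((\<lambda>r. (K * C) powr p * hS n r) \<longlongrightarrow> (K * C) powr p * hS n 0) (at 0 within {0..c})"
          using hS_cont[of "{0..c}" n] x True unfolding continuous_on_def by (intro tendsto_intros) auto
        then show ?thesis using hS_0[OF n] by simp
      qed
      have "(?f \<longlongrightarrow> 0) (at 0 within {0..c})"
      proof (rule tendsto_0_le[OF t, of _ 1])
        have "norm (?f r) \<le> norm ((K * C) powr p * hS n r) * 1" if r: "r \<in> {0..c}" for r
        proof (cases "r = 0")
          case True then show ?thesis using hS_0[OF n] by simp
        next
          case False
          then have "0 < r" using r by simp
          then have "\<bar>m r\<bar> * q r \<le> K * C" using K[OF r] C by (intro mult_mono) (auto intro: order_trans[OF abs_ge_zero])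
          then have "(\<bar>m r\<bar> * q r) powr p \<le> (K * C) powr p" using C[of r] \<open>0 < r\<close> p by (intro powr_mono2) auto
          then show ?thesis using hS_nonneg[of r n] \<open>0 < r\<close> by (simp add: abs_mult mult_right_mono)
        qed
        then show "\<forall>\<^sub>F r in at 0 within {0..c}. norm (?f r) \<le> norm ((K * C) powr p * hS n r) * 1"
          by (simp add: eventually_at_filter)
      qed
      then show ?thesis using True f0 by (simp only:)
    next
      case False
      then have x0: "0 < x" using x by simp
      have "continuous_on {0<..} ?f"
        by (intro continuous_intros continuous_on_powr_nonneg q hS_cont continuous_on_subset[OF cm])
           (use p C in auto)
      then have "isCont ?f x" using x0 by (simp add: continuous_on_eq_continuous_at)
      then show ?thesis unfolding isCont_def by (rule tendsto_within_subset) simp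
    qed
  qed
qed

lemma eE_cont: "continuous_on {0..c} eE"
  unfolding eE_def[abs_def]
proof (rule weighted_cont)
  show "continuous_on {0<..} (\<lambda>r. eW n r / hS n r)"
    using hS_pos[of _ n] by (intro continuous_intros eW_cont[OF n] hS_cont) (auto simp: less_imp_neq[symmetric])
  show "0 \<le> eW n r / hS n r \<and> eW n r / hS n r \<le> 1" if "0 < r" for r
    using eW_le_hS[OF that n] hS_pos[OF that, of n] eW_nonneg[of n r] by simp
qed

lemma Mp_cont: "q > 0 \<Longrightarrow> continuous_on A (\<lambda>r. M r powr q)"
  by (intro continuous_on_powr_nonneg M_cont M_nonneg) auto

text \<open>Hardy with F the volume and S its derivative bounds the integral of M^p by that of p^p
  (|m| F/S)^p S. The spectral constant cancels p^p and leaves ((n-1) F / S)^p, so that after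
  division by S^p \<open>profile_ineq\<close> compares the integrands pointwise.\<close>

lemma energy_deficit:
  assumes ok: "okp n p"
  shows "integral {0..b} eE + ((real n - 1) / p) powr p * integral {0..b} (\<lambda>r. M r powr p * hS n r)
    \<le> integral {0..b} (\<lambda>r. \<bar>m r\<bar> powr p * hS n r)"
proof -
  define e where "e r = p powr p * ((\<bar>m r\<bar> * (hF n r / hS n r)) powr p * hS n r)" for r
  have n1: "real n - 1 > 0" using n by simp
  have "continuous_on {0..b} (\<lambda>r. (\<bar>m r\<bar> * (hF n r / hS n r)) powr p * hS n r)"
  proof (rule weighted_cont)
    show "continuous_on {0<..} (\<lambda>r. hF n r / hS n r)"
      using hS_pos[of _ n] by (intro continuous_intros hF_cont hS_cont) (auto simp: less_imp_neq[symmetric])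
    show "0 \<le> hF n r / hS n r \<and> hF n r / hS n r \<le> 1 / (real n - 1)" if "0 < r" for r
      using hF_le_hS[of r n] that n n1 hS_pos[OF that, of n] hF_nonneg[of r n] by (simp add: field_simps)
  qed
  then have ce: "continuous_on {0..b} e" unfolding e_def[abs_def] by (rule continuous_on_mult_left)
  have hardy: "integral {0..b} (\<lambda>r. M r powr p * hS n r) \<le> integral {0..b} e"
  proof (rule hardy_ineq[where F="hF n" and m=m])
    fix r assume r: "r \<in> {0..b}"
    show "p * M r powr (p - 1) * (\<bar>m r\<bar> * hF n r) \<le> (1 - 1 / p) * (M r powr p * hS n r) + e r / p"
    proof (cases "r = 0")
      case True
      then show ?thesis using hS_0[OF n] by (simp add: e_def)
    next
      case False
      then have S: "hS n r > 0" using r hS_pos by simp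
      \<comment> \<open>Written as M^(p-1) c S, the left side is ready for Young's inequality; c^p S
        is then exactly \<open>e\<close>.\<close>
      define c where "c = p * (\<bar>m r\<bar> * (hF n r / hS n r))"
      have c0: "0 \<le> c" using p S r hF_nonneg[of r n] by (simp add: c_def)
      have "p * M r powr (p - 1) * (\<bar>m r\<bar> * hF n r) = M r powr (p - 1) * c * hS n r"
        using S by (simp add: c_def)
      also have "\<dots> \<le> ((1 - 1 / p) * M r powr p + c powr p / p) * hS n r"
        using young_powr[OF M_nonneg c0 p] S by (intro mult_right_mono) auto
      also have "((1 - 1 / p) * M r powr p + c powr p / p) * hS n r = (1 - 1 / p) * (M r powr p * hS n r) + c powr p * hS n r / p"
        by (simp only: distrib_right times_divide_eq_left mult.assoc)
      also have "c powr p * hS n r = e r"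
      proof -
        have "0 \<le> \<bar>m r\<bar> * (hF n r / hS n r)" using S r hF_nonneg[of r n] by simp
        then show ?thesis unfolding c_def e_def using p by (subst powr_mult) auto
      qed
      finally show ?thesis .
    qed
  qed (use b p dM hF_deriv cm hS_cont ce M_nonneg Mb hF_nonneg in \<open>auto intro: continuous_on_subset\<close>)
  have i1: "eE integrable_on {0..b}" by (intro integrable_continuous_real eE_cont)
  have i2: "e integrable_on {0..b}" by (intro integrable_continuous_real ce)
  let ?k = "((real n - 1) / p) powr p"
  have "integral {0..b} eE + ?k * integral {0..b} (\<lambda>r. M r powr p * hS n r) \<le> integral {0..b} eE + ?k * integral {0..b} e"
    using hardy by (intro add_left_mono mult_left_mono) auto
  also have "\<dots> = integral {0..b} (\<lambda>r. eE r + ?k * e r)"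
    by (simp add: integral_add[OF i1 integrable_on_mult_right[OF i2]])
  also have "\<dots> \<le> integral {0..b} (\<lambda>r. \<bar>m r\<bar> powr p * hS n r)"
  proof (rule integral_le)
    show "(\<lambda>r. eE r + ?k * e r) integrable_on {0..b}" by (intro integrable_add i1 integrable_on_mult_right i2)
    show "(\<lambda>r. \<bar>m r\<bar> powr p * hS n r) integrable_on {0..b}"
      by (intro integrable_continuous_real continuous_intros hS_cont continuous_on_powr_nonneg continuous_on_subset[OF cm])
         (use p in auto)
    fix r assume r: "r \<in> {0..b}"
    show "eE r + ?k * e r \<le> \<bar>m r\<bar> powr p * hS n r"
    proof (cases "r = 0")
      case True
      then show ?thesis using hS_0[OF n] by (simp add: eE_def e_def)
    next
      case False
      then have r0: "0 < r" using r by simp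
      have S: "hS n r > 0" using r0 hS_pos by simp
      have F: "hF n r \<ge> 0" using r hF_nonneg by simp
      have kp: "?k * p powr p = (real n - 1) powr p" using n1 p by (simp add: powr_divide)
      have "eE r + ?k * e r = eE r + (real n - 1) powr p * ((\<bar>m r\<bar> * (hF n r / hS n r)) powr p * hS n r)"
        unfolding e_def mult.assoc[symmetric] kp ..
      also have "\<dots> = \<bar>m r\<bar> powr p * (eW n r powr p / hS n r powr p) * hS n r
          + (real n - 1) powr p * (\<bar>m r\<bar> powr p * (hF n r powr p / hS n r powr p) * hS n r)"
        using S F eW_nonneg[of n r] by (simp add: eE_def powr_mult powr_divide)
      also have "\<dots> = \<bar>m r\<bar> powr p * hS n r * ((eW n r powr p + ((real n - 1) * hF n r) powr p) / hS n r powr p)"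
      proof -
        have "((real n - 1) * hF n r) powr p = (real n - 1) powr p * hF n r powr p" by (rule powr_mult)
        then show ?thesis by (simp add: add_divide_distrib distrib_left mult_ac)
      qed
      also have "\<dots> \<le> \<bar>m r\<bar> powr p * hS n r * 1"
        using profile_ineq[OF r0 ok] S by (intro mult_left_mono) (auto simp: divide_le_eq)
      finally show ?thesis by simp
    qed
  qed
  finally show ?thesis .
qed

text \<open>Hoelder for M(a), the integral of -m over [a, b], with -m factored into eE^(1/p) and the
  (1 - 1/p)-th power of a weight independent of m. The primitive \<open>H\<close> of that weight
  stays abstract: its sign and growth differ between p < n and p > n.\<close>

lemma pointwise_bound:
  assumes a: "0 < a" "a \<le> b" and H: "\<And>r. 0 < r \<Longrightarrow> (H has_real_derivative eW n r powr (- (p / (p - 1))) * hS n r) (at r)"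
  shows "M a powr p \<le> integral {a..b} eE * (H b - H a) powr (p - 1)"
proof -
  define g where "g r = eW n r powr (- (p / (p - 1))) * hS n r" for r
  have n1: "n \<ge> 1" using n by simp
  have sub: "{a..b} \<subseteq> {0..b}" using a by auto
  have cg: "continuous_on {a..b} g" unfolding g_def[abs_def]
  proof (intro continuous_intros hS_cont)
    show "continuous_on {a..b} (eW n)" using a by (intro eW_cont[OF n]) auto
    show "\<forall>x\<in>{a..b}. eW n x \<noteq> 0" using eW_pos[OF _ n1] a by (auto simp: less_imp_neq[symmetric])
  qed
  have ieE: "eE integrable_on {a..b}" by (intro integrable_continuous_real continuous_on_subset[OF eE_cont sub])
  have ig: "g integrable_on {a..b}" by (intro integrable_continuous_real cg)
  have pt: "eE r powr (1 / p) * g r powr (1 - 1 / p) = - m r" if r: "r \<in> {a..b}" for r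
  proof -
    have r0: "0 < r" using r a by simp
    have S: "hS n r > 0" and W: "eW n r > 0" using hS_pos[OF r0] eW_pos[OF r0 n1] by auto
    have q: "- (p / (p - 1)) * (1 - 1 / p) = -1" using p by (simp add: field_simps)
    have "eE r powr (1 / p) = (\<bar>m r\<bar> * (eW n r / hS n r)) * hS n r powr (1 / p)"
      using p S W by (simp add: eE_def powr_mult powr_powr)
    moreover have "g r powr (1 - 1 / p) = eW n r powr (-1) * hS n r powr (1 - 1 / p)"
    proof -
      have "g r powr (1 - 1 / p) = eW n r powr (- (p / (p - 1)) * (1 - 1 / p)) * hS n r powr (1 - 1 / p)"
        unfolding g_def using S W by (subst powr_mult) (auto simp: powr_powr)
      then show ?thesis unfolding q .
    qed
    moreover have "hS n r powr (1 / p) * hS n r powr (1 - 1 / p) = hS n r" using S by (simp add: powr_add[symmetric])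
    moreover have "eW n r powr (-1) = 1 / eW n r" using W by (simp add: powr_minus_divide)
    ultimately have "eE r powr (1 / p) * g r powr (1 - 1 / p) = \<bar>m r\<bar> * (eW n r / hS n r) * (1 / eW n r) * (hS n r powr (1 / p) * hS n r powr (1 - 1 / p))"
      by simp
    also have "\<dots> = \<bar>m r\<bar>" using S W \<open>hS n r powr (1 / p) * hS n r powr (1 - 1 / p) = hS n r\<close> by simp
    finally show ?thesis using mneg[of r] by simp
  qed
  have "((\<lambda>r. - m r) has_integral (- M b - - M a)) {a..b}"
  proof (rule fundamental_theorem_of_calculus[OF a(2)])
    fix r
    have "((\<lambda>r. - M r) has_real_derivative - m r) (at r)" by (rule DERIV_minus[OF dM])
    then show "((\<lambda>r. - M r) has_vector_derivative - m r) (at r within {a..b})"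
      using has_field_derivative_at_within by (simp add: has_real_derivative_iff_has_vector_derivative[symmetric])
  qed
  then have Ma: "((\<lambda>r. eE r powr (1 / p) * g r powr (1 - 1 / p)) has_integral M a) {a..b}"
    using Mb[of b] pt by (subst has_integral_cong[where g="\<lambda>r. - m r"]) auto
  have gH: "(g has_integral (H b - H a)) {a..b}"
  proof (rule fundamental_theorem_of_calculus[OF a(2)])
    fix r assume "r \<in> {a..b}"
    then have "(H has_real_derivative g r) (at r)" using H[of r] a by (simp add: g_def)
    then show "(H has_vector_derivative g r) (at r within {a..b})"
      using has_field_derivative_at_within by (simp add: has_real_derivative_iff_has_vector_derivative[symmetric])
  qed
  have nn: "0 \<le> eE r" "0 \<le> g r" if "r \<in> {a..b}" for r
    using that a eE_nonneg[of r] hS_nonneg[of r n] by (auto simp: g_def)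
  have "M a \<le> integral {a..b} eE powr (1 / p) * integral {a..b} g powr (1 - 1 / p)"
    using Holder_integral[OF ieE nn(1) ig nn(2), of "1 / p"] Ma p by (auto simp: integral_unique has_integral_integrable)
  also have "integral {a..b} g = H b - H a" using gH by (rule integral_unique)
  finally have "M a powr p \<le> (integral {a..b} eE powr (1 / p) * (H b - H a) powr (1 - 1 / p)) powr p"
    using p M_nonneg by (intro powr_mono2) auto
  also have "\<dots> = integral {a..b} eE * (H b - H a) powr (p - 1)"
  proof -
    have "0 \<le> integral {a..b} eE" using nn ieE by (intro integral_nonneg) auto
    moreover have "(1 - 1 / p) * p = p - 1" using p by (simp add: field_simps)
    ultimately show ?thesis using p by (simp add: powr_mult powr_powr)
  qed
  finally show ?thesis .
qed

text \<open>In terms of the Euclidean radius \<rho> this is (p-1)/(p-n) \<rho>^((p-n)/(p-1)), the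
  radial solution of the p-Laplace equation away from the origin.\<close>

lemma H_deriv:
  assumes r: "0 < r" and pn: "p \<noteq> real n"
  shows "((\<lambda>r. (p - 1) / (p - real n) * (real n * hF n r) powr ((p - real n) / (real n * (p - 1))))
    has_real_derivative eW n r powr (- (p / (p - 1))) * hS n r) (at r)"
proof -
  let ?N = "real n" let ?k = "(p - ?N) / (?N * (p - 1))"
  have N: "?N > 0" using n by simp
  have F: "?N * hF n r > 0" using hF_pos[OF r, of n] N by simp
  have "((\<lambda>r. (?N * hF n r) powr ?k) has_real_derivative (?k * (?N * hF n r) powr (?k - 1) * (?N * hS n r))) (at r)"
    by (rule DERIV_chain2[OF has_real_derivative_powr[OF F] DERIV_cmult[OF hF_deriv]])
  then have "((\<lambda>r. (p - 1) / (p - ?N) * (?N * hF n r) powr ?k) has_real_derivative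
     ((p - 1) / (p - ?N) * (?k * (?N * hF n r) powr (?k - 1) * (?N * hS n r)))) (at r)" by (rule DERIV_cmult)
  moreover have "(p - 1) / (p - ?N) * (?k * (?N * hF n r) powr (?k - 1) * (?N * hS n r)) = (?N * hF n r) powr (?k - 1) * hS n r"
  proof -
    have e: "(p - 1) / (p - ?N) * ?k * ?N = 1" using p pn N by simp
    have "(p - 1) / (p - ?N) * (?k * z * (?N * y)) = ((p - 1) / (p - ?N) * ?k * ?N) * (z * y)" for z y
      by (simp only: mult_ac)
    then show ?thesis unfolding e by simp
  qed
  moreover have "(?N * hF n r) powr (?k - 1) = eW n r powr (- (p / (p - 1)))"
  proof -
    have "?k - 1 = (?N - 1) / ?N * (- (p / (p - 1)))" using p N by (simp add: field_simps)
    then show ?thesis unfolding eW_def powr_powr by (simp only:)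
  qed
  ultimately show ?thesis by simp
qed

lemma eE_integral_mono: "0 \<le> a \<Longrightarrow> a \<le> b \<Longrightarrow> integral {a..b} eE \<le> integral {0..b} eE"
  by (intro integral_subset_le integrable_continuous_real eE_cont continuous_on_subset[OF eE_cont[of b]]) (auto simp: eE_nonneg)

lemma eE_integral_nonneg: "0 \<le> a \<Longrightarrow> 0 \<le> integral {a..b} eE"
  by (intro integral_nonneg integrable_continuous_real continuous_on_subset[OF eE_cont[of b]]) (auto simp: eE_nonneg)

text \<open>For p > n the primitive is nonnegative and increasing, so its value at a may be dropped
  and the bound becomes uniform in a. Letting a tend to 0 reaches M 0.\<close>

lemma morrey_bound:
  assumes pn: "p > real n"
  shows "M 0 powr p \<le> integral {0..b} eE * (((p - 1) / (p - real n)) powr (p - 1) * (real n * hF n b) powr ((p - real n) / real n))"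
proof -
  let ?N = "real n" let ?k = "(p - ?N) / (?N * (p - 1))"
  let ?H = "\<lambda>r. (p - 1) / (p - ?N) * (?N * hF n r) powr ?k"
  have N: "?N > 0" using n by simp
  have bnd: "M a powr p \<le> integral {0..b} eE * (?H b) powr (p - 1)" if a: "0 < a" "a \<le> b" for a
  proof -
    have mono: "(?N * hF n a) powr ?k \<le> (?N * hF n b) powr ?k"
      using a p pn N hF_le_iff[of a b n] hF_nonneg[of a n] by (intro powr_mono2) (auto intro!: divide_nonneg_nonneg)
    have c: "(p - 1) / (p - ?N) \<ge> 0" using p pn by simp
    have "?H a \<ge> 0" by (rule mult_nonneg_nonneg[OF c]) simp
    moreover have "?H a \<le> ?H b" by (rule mult_left_mono[OF mono c])
    ultimately have "(?H b - ?H a) powr (p - 1) \<le> (?H b) powr (p - 1)" using p by (intro powr_mono2) auto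
    then have "integral {a..b} eE * (?H b - ?H a) powr (p - 1) \<le> integral {0..b} eE * (?H b) powr (p - 1)"
      using eE_integral_mono[of a] eE_integral_nonneg[of 0] a by (intro mult_mono) auto
    then show ?thesis using pointwise_bound[OF a H_deriv] pn by force
  qed
  have "M 0 powr p \<le> integral {0..b} eE * (?H b) powr (p - 1)"
  proof (rule LIMSEQ_le_const2)
    have "(\<lambda>i. b * inverse (real (Suc i))) \<longlonglongrightarrow> b * 0" by (intro tendsto_intros LIMSEQ_inverse_real_of_nat)
    then have t0: "(\<lambda>i. b * inverse (real (Suc i))) \<longlonglongrightarrow> 0" by simp
    have "isCont (\<lambda>r. M r powr p) 0" using Mp_cont[of p UNIV] p by (simp add: continuous_on_eq_continuous_at)
    then show "(\<lambda>i. M (b * inverse (real (Suc i))) powr p) \<longlonglongrightarrow> M 0 powr p"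
      by (rule isCont_tendsto_compose[OF _ t0])
    have "b * inverse (real (Suc i)) \<le> b * 1" for i using b by (intro mult_left_mono) (auto simp: field_simps)
    then show "\<exists>N. \<forall>i\<ge>N. M (b * inverse (real (Suc i))) powr p \<le> integral {0..b} eE * (?H b) powr (p - 1)"
      using b by (intro exI allI impI bnd) auto
  qed
  also have "(?H b) powr (p - 1) = ((p - 1) / (p - ?N)) powr (p - 1) * (?N * hF n b) powr ((p - ?N) / ?N)"
  proof -
    have c: "(p - 1) / (p - ?N) \<ge> 0" using p pn by simp
    have "?k * (p - 1) = (p - ?N) / ?N" using p N by simp
    then show ?thesis unfolding mult_powr_powr[OF c] by (simp only:)
  qed
  finally show ?thesis .
qed

text \<open>With A the energy and \<rho> the Euclidean radius, two estimates are multiplied: the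
  decay M^p <= A c1 \<rho>^(-(n-p)) from \<open>pointwise_bound\<close>, and the Hardy bound for the
  integral of M^p \<rho>^(-p). The t-th power of the first, with t = p/(n-p), supplies precisely the
  weight of the second.\<close>

lemma sobolev_bound:
  assumes pn: "p < real n"
  shows "integral {0..b} (\<lambda>r. M r powr (real n * p / (real n - p)) * hS n r)
    \<le> (((p - 1) / (real n - p)) powr (p - 1)) powr (p / (real n - p)) * (p / (real n - p)) powr p
       * integral {0..b} eE powr (real n / (real n - p))"
proof -
  let ?N = "real n" let ?k = "(p - ?N) / (?N * (p - 1))"
  define A where "A = integral {0..b} eE"
  define c1 where "c1 = ((p - 1) / (?N - p)) powr (p - 1)"
  define t where "t = p / (?N - p)"
  let ?H = "\<lambda>r. (p - 1) / (p - ?N) * (?N * hF n r) powr ?k"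
  have N: "?N > 0" using n by simp
  have A0: "A \<ge> 0" unfolding A_def by (rule eE_integral_nonneg) simp
  have t0: "t > 0" using p pn by (simp add: t_def)
  have ptb: "M r powr p \<le> A * c1 * (?N * hF n r) powr (- ((?N - p) / ?N))" if r: "0 < r" "r \<le> b" for r
  proof -
    have neg: "(p - 1) / (p - ?N) = - ((p - 1) / (?N - p))" by (metis minus_diff_eq minus_divide_right)
    have c: "(p - 1) / (?N - p) \<ge> 0" using p pn by simp
    have "0 \<le> ?H b - ?H r"
    proof -
      have "(?N * hF n b) powr ?k \<le> (?N * hF n r) powr ?k"
      proof (rule powr_mono2')
        show "?k \<le> 0" using p pn N by (simp add: divide_nonpos_pos)
        show "0 < ?N * hF n r" using r hF_pos N by simp
        show "?N * hF n r \<le> ?N * hF n b" using r hF_le_iff[of r b n] N by simp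
      qed
      from mult_left_mono[OF this c] show ?thesis unfolding neg by simp
    qed
    moreover have "?H b - ?H r \<le> (p - 1) / (?N - p) * (?N * hF n r) powr ?k"
    proof -
      have "0 \<le> (p - 1) / (?N - p) * (?N * hF n b) powr ?k" by (rule mult_nonneg_nonneg[OF c]) simp
      then show ?thesis unfolding neg by simp
    qed
    ultimately have "(?H b - ?H r) powr (p - 1) \<le> ((p - 1) / (?N - p) * (?N * hF n r) powr ?k) powr (p - 1)"
      using p by (intro powr_mono2) auto
    also have "\<dots> = c1 * (?N * hF n r) powr (- ((?N - p) / ?N))"
    proof -
      have "?k * (p - 1) = - ((?N - p) / ?N)" using p N by (simp add: field_simps)
      then show ?thesis unfolding mult_powr_powr[OF c] c1_def by (simp only:)
    qed
    finally have "integral {r..b} eE * (?H b - ?H r) powr (p - 1) \<le> A * (c1 * (?N * hF n r) powr (- ((?N - p) / ?N)))"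
      unfolding A_def using eE_integral_mono[of r] eE_integral_nonneg[of 0] r by (intro mult_mono) auto
    moreover have "M r powr p \<le> integral {r..b} eE * (?H b - ?H r) powr (p - 1)"
      by (rule pointwise_bound[OF r H_deriv]) (use pn in auto)
    ultimately show ?thesis by (simp add: mult_ac)
  qed
  let ?q = "?N * p / (?N - p)"
  \<comment> \<open>The Sobolev exponent splits so that M^q is M^p times the t-th power of
    M^p.\<close>
  have qp: "?q = p + p * t" unfolding t_def using p pn by (simp add: field_simps)
  have q0: "?q > 0" using p pn N by simp
  have loc: "integral {a..b} (\<lambda>r. M r powr ?q * hS n r) \<le> (A * c1) powr t * (t powr p * A)" if a: "0 < a" "a \<le> b" for a
  proof -
    \<comment> \<open>These are \<rho>^(-p) S and its primitive \<rho>^(n-p)/(n-p). The weight is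
      singular at 0, which is why the estimate is first made on [a, b] with a > 0.\<close>
    define S where "S r = (?N * hF n r) powr (- (p / ?N)) * hS n r" for r
    define F where "F r = (?N * hF n r) powr (1 - p / ?N) / (?N - p)" for r
    have dF: "(F has_real_derivative S r) (at r)" if "0 < r" for r
    proof -
      have Fp: "?N * hF n r > 0" using hF_pos[OF that, of n] N by simp
      have "((\<lambda>r. (?N * hF n r) powr (1 - p / ?N)) has_real_derivative ((1 - p / ?N) * (?N * hF n r) powr (1 - p / ?N - 1) * (?N * hS n r))) (at r)"
        by (rule DERIV_chain2[OF has_real_derivative_powr[OF Fp] DERIV_cmult[OF hF_deriv]])
      from DERIV_cdivide[OF this, of "?N - p"]
      have "(F has_real_derivative ((1 - p / ?N) * (?N * hF n r) powr (1 - p / ?N - 1) * (?N * hS n r)) / (?N - p)) (at r)"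
        unfolding F_def .
      moreover have "((1 - p / ?N) * (?N * hF n r) powr (1 - p / ?N - 1) * (?N * hS n r)) / (?N - p) = S r"
      proof -
        have "(1 - p / ?N) * ?N = ?N - p" using N by (simp add: field_simps)
        then have "(1 - p / ?N) * z * (?N * s) / (?N - p) = z * s" for z s using pn
          by (metis (no_types, opaque_lifting) diff_gt_0_iff_gt less_irrefl mult.assoc mult.commute nonzero_mult_div_cancel_left)
        then show ?thesis by (simp add: S_def)
      qed
      ultimately show ?thesis by simp
    qed
    define e where "e r = t powr p * eE r" for r
    have "integral {a..b} (\<lambda>r. M r powr p * S r) \<le> integral {a..b} e"
    proof (rule hardy_ineq[where F=F and m=m])
      fix r assume r: "r \<in> {a..b}"
      then have r0: "0 < r" using a by simp
      have Sp: "hS n r > 0" and Fp: "?N * hF n r > 0" using hS_pos[OF r0] hF_pos[OF r0, of n] N by auto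
      have "(?N * hF n r) powr (- (p / ?N)) > 0" using Fp by (simp only: powr_gt_zero)
      then have S0: "S r > 0" unfolding S_def using Sp by (rule mult_pos_pos)
      show F0: "0 \<le> F r" using pn by (simp add: F_def)
      have FS: "F r / S r = (?N * hF n r) / ((?N - p) * hS n r)"
      proof -
        have "(?N * hF n r) powr (1 - p / ?N) = (?N * hF n r) * (?N * hF n r) powr (- (p / ?N))"
          using Fp by (simp add: powr_add[of _ 1 "- (p / ?N)", simplified])
        moreover have "(?N * hF n r) powr (- (p / ?N)) > 0" using Fp by (simp only: powr_gt_zero)
        ultimately show ?thesis unfolding F_def S_def by simp
      qed
      define c where "c = p * (\<bar>m r\<bar> * (F r / S r))"
      have c0: "0 \<le> c" using p S0 F0 by (simp add: c_def)
      have "p * M r powr (p - 1) * (\<bar>m r\<bar> * F r) = M r powr (p - 1) * c * S r"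
        using S0 by (simp add: c_def)
      also have "\<dots> \<le> ((1 - 1 / p) * M r powr p + c powr p / p) * S r"
        using young_powr[OF M_nonneg c0 p] S0 by (intro mult_right_mono) auto
      also have "((1 - 1 / p) * M r powr p + c powr p / p) * S r = (1 - 1 / p) * (M r powr p * S r) + c powr p * S r / p"
        by (simp only: distrib_right times_divide_eq_left mult.assoc)
      also have "c powr p * S r = e r"
      proof -
        have cc: "c = t * (\<bar>m r\<bar> * ((?N * hF n r) / hS n r))" unfolding c_def FS t_def by simp
        have W: "eW n r powr p = (?N * hF n r) powr p * (?N * hF n r) powr (- (p / ?N))"
        proof -
          have "(?N - 1) / ?N * p = p + - (p / ?N)" using N by (simp add: field_simps)
          then show ?thesis unfolding eW_def powr_powr by (simp only: powr_add)
        qed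
        have "c powr p * S r = t powr p * (\<bar>m r\<bar> powr p * ((?N * hF n r) powr p / hS n r powr p)) * ((?N * hF n r) powr (- (p / ?N)) * hS n r)"
        proof -
          have X0: "0 \<le> (?N * hF n r) / hS n r" using Sp Fp by simp
          have "(t * (\<bar>m r\<bar> * X)) powr p = t powr p * (\<bar>m r\<bar> powr p * X powr p)" if "0 \<le> X" for X
            using that t0 by (simp add: powr_mult)
          from this[OF X0] have "c powr p = t powr p * (\<bar>m r\<bar> powr p * ((?N * hF n r) / hS n r) powr p)" unfolding cc .
          also have "((?N * hF n r) / hS n r) powr p = (?N * hF n r) powr p / hS n r powr p"
            by (rule powr_divide)
          finally show ?thesis by (simp only: S_def)
        qed
        also have "\<dots> = t powr p * (\<bar>m r\<bar> powr p * (eW n r powr p / hS n r powr p) * hS n r)"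
          unfolding W by simp
        also have "\<dots> = e r"
        proof -
          have "(\<bar>m r\<bar> * (eW n r / hS n r)) powr p = \<bar>m r\<bar> powr p * (eW n r powr p / hS n r powr p)"
            using Sp eW_nonneg[of n r] by (simp add: powr_mult powr_divide)
          then show ?thesis unfolding e_def eE_def by (simp only:)
        qed
        finally show ?thesis .
      qed
      finally show "p * M r powr (p - 1) * (\<bar>m r\<bar> * F r) \<le> (1 - 1 / p) * (M r powr p * S r) + e r / p" .
    next
      show "continuous_on {a..b} S" unfolding S_def[abs_def]
        using a hF_pos[of _ n] N by (intro continuous_intros hF_cont hS_cont) (auto simp: less_imp_neq[symmetric])
      show "continuous_on {a..b} e" unfolding e_def[abs_def]
        using a by (intro continuous_intros continuous_on_subset[OF eE_cont[of b]]) auto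
      show "0 \<le> F a" using pn by (simp add: F_def)
    qed (use a p dM dF cm M_nonneg Mb in \<open>auto intro: continuous_on_subset\<close>)
    also have "integral {a..b} e = t powr p * integral {a..b} eE" unfolding e_def by simp
    also have "\<dots> \<le> t powr p * A" unfolding A_def using eE_integral_mono[of a] a by (intro mult_left_mono) auto
    finally have h: "integral {a..b} (\<lambda>r. M r powr p * S r) \<le> t powr p * A" .
    have cS: "continuous_on {a..b} S" unfolding S_def[abs_def]
        using a hF_pos[of _ n] N by (intro continuous_intros hF_cont hS_cont) (auto simp: less_imp_neq[symmetric])
    have "integral {a..b} (\<lambda>r. M r powr ?q * hS n r) \<le> integral {a..b} (\<lambda>r. (A * c1) powr t * (M r powr p * S r))"
    proof (rule integral_le)
      show "(\<lambda>r. M r powr ?q * hS n r) integrable_on {a..b}"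
        by (intro integrable_continuous_real continuous_intros Mp_cont hS_cont q0)
      show "(\<lambda>r. (A * c1) powr t * (M r powr p * S r)) integrable_on {a..b}"
        by (intro integrable_continuous_real continuous_intros Mp_cont cS) (use p in simp)
      fix r assume r: "r \<in> {a..b}"
      then have r0: "0 < r" using a by simp
      have Sp: "hS n r > 0" and Fp: "?N * hF n r > 0" using hS_pos[OF r0] hF_pos[OF r0, of n] N by auto
      have "M r powr ?q = M r powr p * (M r powr p) powr t" unfolding qp by (simp add: powr_add powr_powr)
      also have "\<dots> \<le> M r powr p * (A * c1 * (?N * hF n r) powr (- ((?N - p) / ?N))) powr t"
        using ptb[OF r0] r t0 by (intro mult_left_mono powr_mono2) auto
      also have "(A * c1 * (?N * hF n r) powr (- ((?N - p) / ?N))) powr t = (A * c1) powr t * (?N * hF n r) powr (- (p / ?N))"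
      proof -
        have "- ((?N - p) / ?N) * t = - (p / ?N)" using pn by (simp add: t_def)
        moreover have "0 \<le> A * c1" using A0 by (simp add: c1_def)
        ultimately show ?thesis by (simp only: mult_powr_powr)
      qed
      finally have "M r powr ?q * hS n r \<le> M r powr p * ((A * c1) powr t * (?N * hF n r) powr (- (p / ?N))) * hS n r"
        using Sp by (intro mult_right_mono) auto
      then show "M r powr ?q * hS n r \<le> (A * c1) powr t * (M r powr p * S r)" by (simp add: S_def mult_ac)
    qed
    also have "\<dots> = (A * c1) powr t * integral {a..b} (\<lambda>r. M r powr p * S r)" by simp
    also have "\<dots> \<le> (A * c1) powr t * (t powr p * A)" using h by (intro mult_left_mono) auto
    finally show ?thesis .
  qed
  have ci: "continuous_on {0..b} (\<lambda>r. M r powr ?q * hS n r)" by (intro continuous_intros Mp_cont hS_cont q0)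
  have "integral {0..b} (\<lambda>r. M r powr ?q * hS n r) \<le> (A * c1) powr t * (t powr p * A)"
  proof (rule LIMSEQ_le_const2)
    have "(\<lambda>i. b * inverse (real (Suc i))) \<longlonglongrightarrow> b * 0" by (intro tendsto_intros LIMSEQ_inverse_real_of_nat)
    then have t0: "(\<lambda>i. b * inverse (real (Suc i))) \<longlonglongrightarrow> 0" by simp
    have le: "b * inverse (real (Suc i)) \<le> b * 1" for i using b by (intro mult_left_mono) (auto simp: field_simps)
    have "continuous_on {0..b} (\<lambda>x. integral {x..b} (\<lambda>r. M r powr ?q * hS n r))"
      by (rule indefinite_integral_continuous_1'[OF integrable_continuous_real[OF ci]])
    then show "(\<lambda>i. integral {b * inverse (real (Suc i))..b} (\<lambda>r. M r powr ?q * hS n r)) \<longlonglongrightarrow> integral {0..b} (\<lambda>r. M r powr ?q * hS n r)"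
      by (rule continuous_on_tendsto_compose[OF _ t0]) (use b le in auto)
    show "\<exists>N. \<forall>i\<ge>N. integral {b * inverse (real (Suc i))..b} (\<lambda>r. M r powr ?q * hS n r) \<le> (A * c1) powr t * (t powr p * A)"
      using b le by (intro exI allI impI loc) auto
  qed
  also have "(A * c1) powr t * (t powr p * A) = c1 powr t * t powr p * A powr (?N / (?N - p))"
  proof -
    have "?N / (?N - p) = t + 1" using pn by (simp add: t_def field_simps)
    then have "A powr (?N / (?N - p)) = A powr t * A" using A0 by (simp add: powr_add)
    then show ?thesis using A0 by (simp add: powr_mult c1_def)
  qed
  finally show ?thesis by (simp only: A_def c1_def t_def)
qed

end


subsection \<open>Reduction to radial profiles\<close>

text \<open>Test functions are too narrow a class, since transplanted profiles are only C^1.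
  Carrying the gradient field as an argument avoids computing Frechet derivatives;
  \<open>c1_grad\<close> links it to \<open>grad\<close>.\<close>

definition c1 :: "(real ^ 'n \<Rightarrow> real) \<Rightarrow> (real ^ 'n \<Rightarrow> real ^ 'n) \<Rightarrow> bool" where
  "c1 u g \<longleftrightarrow> (\<forall>x. (u has_derivative (\<lambda>h. g x \<bullet> h)) (at x)) \<and> continuous_on UNIV g"

lemma c1_grad:
  assumes "c1 u g" shows "grad u = g"
proof
  fix x
  have "frechet_derivative u (at x) = (\<lambda>h. g x \<bullet> h)"
    using assms frechet_derivative_at by (metis c1_def)
  then show "grad u x = g x" by (simp add: grad_def vec_eq_iff inner_axis)
qed

lemma smooth_c1:
  fixes u :: "real ^ 'n \<Rightarrow> real"
  assumes "smooth u" shows "c1 u (grad u)"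
proof -
  have C1: "Ck 1 u" using assms by (simp add: smooth_def)
  have d: "(u has_derivative frechet_derivative u (at x)) (at x)" for x
    using C1 by (simp add: differentiable_on_def frechet_derivative_works[symmetric])
  have "frechet_derivative u (at x) h = grad u x \<bullet> h" for x h
  proof -
    let ?D = "frechet_derivative u (at x)"
    have lin: "linear ?D" using d[of x] has_derivative_linear by blast
    have "h = (\<Sum>i\<in>UNIV. (h $ i) *\<^sub>R axis i 1)" using basis_expansion[of h] by (simp add: scalar_mult_eq_scaleR)
    then have "?D h = ?D (\<Sum>i\<in>UNIV. (h $ i) *\<^sub>R axis i 1)" by simp
    also have "\<dots> = (\<Sum>i\<in>UNIV. h $ i * ?D (axis i 1))" using lin by (simp add: linear_sum linear_scale)
    also have "\<dots> = grad u x \<bullet> h" by (simp add: inner_vec_def grad_def mult.commute)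
    finally show ?thesis .
  qed
  then have "frechet_derivative u (at x) = (\<lambda>h. grad u x \<bullet> h)" for x by auto
  moreover have "continuous_on UNIV (grad u)" unfolding grad_def
    using C1 by (intro continuous_on_vec_lambda) simp
  ultimately show ?thesis using d unfolding c1_def by metis
qed

lemma c1_cont: "c1 u g \<Longrightarrow> continuous_on A u"
  by (meson c1_def continuous_at_imp_continuous_on has_derivative_continuous)

lemma c1_zero_outside:
  assumes c: "c1 u g" and z: "\<And>x. norm x > R \<Longrightarrow> u x = 0" and x: "norm x > R"
  shows "g x = 0"
proof -
  have o: "open {x :: real ^ 'a. norm x > R}" by (intro open_Collect_less continuous_intros)
  have "((\<lambda>_. 0) has_derivative (\<lambda>h. 0 :: real)) (at x)" by simp
  then have "(u has_derivative (\<lambda>h. 0)) (at x)"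
    by (rule has_derivative_transform_within_open[OF _ o]) (use x z in auto)
  moreover have "(u has_derivative (\<lambda>h. g x \<bullet> h)) (at x)" using c by (simp add: c1_def)
  ultimately have "(\<lambda>h. g x \<bullet> h) = (\<lambda>h. 0)" using has_derivative_unique by blast
  then have "g x \<bullet> g x = 0" by meson
  then show ?thesis by simp
qed

lemma continuous_support_bounded:
  fixes g :: "real ^ 'n \<Rightarrow> 'b::real_normed_vector"
  assumes "continuous_on UNIV g" "\<And>x. norm x > R \<Longrightarrow> g x = 0"
  obtains K where "0 \<le> K" "\<And>x. norm (g x) \<le> K"
proof -
  have "compact (g ` cball 0 R)" using assms by (intro compact_continuous_image) (auto intro: continuous_on_subset)
  then obtain K where K: "\<And>y. y \<in> g ` cball 0 R \<Longrightarrow> norm y \<le> K" using compact_imp_bounded bounded_iff by metis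
  have "norm (g x) \<le> max 0 K" for x
    using K[of "g x"] assms(2)[of x] by (cases "norm x \<le> R") (auto simp: max.coboundedI2)
  then show ?thesis using that[of "max 0 K"] by simp
qed

lemma c1_lipschitz:
  assumes c: "c1 u g" and K: "\<And>x. norm (g x) \<le> K"
  shows "\<bar>u x - u y\<bar> \<le> K * norm (x - y)"
proof -
  have "norm (u x - u y) \<le> K * norm (x - y)"
  proof (rule differentiable_bound[OF convex_UNIV])
    show "(u has_derivative (\<lambda>h. g x \<bullet> h)) (at x within UNIV)" for x using c by (simp add: c1_def)
    show "onorm (\<lambda>h. g x \<bullet> h) \<le> K" for x
    proof (rule onorm_le)
      fix h
      have "norm (g x \<bullet> h) \<le> norm (g x) * norm h" using Cauchy_Schwarz_ineq2 by simp
      also have "\<dots> \<le> K * norm h" using K by (intro mult_right_mono) auto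
      finally show "norm (g x \<bullet> h) \<le> K * norm h" .
    qed
  qed auto
  then show ?thesis by simp
qed

section \<open>Oscillation quotients and the hyperbolic gradient\<close>

lemma norm_le_sqrt_hdel:
  assumes "norm x < 1" "norm y < 1"
  shows "norm (x - y) \<le> sqrt (hdel x y)"
proof -
  have p: "0 < 1 - (norm x)\<^sup>2" "0 < 1 - (norm y)\<^sup>2" using assms one_minus_norm_sq_pos by auto
  then have "(1 - (norm x)\<^sup>2) * (1 - (norm y)\<^sup>2) \<le> 1 * 1" by (intro mult_mono) auto
  then have "(norm (x - y))\<^sup>2 / 1 \<le> hdel x y" unfolding hdel_def using p by (intro divide_left_mono) auto
  then show ?thesis by (intro real_le_rsqrt) simp
qed

lemma AE_hmeas_ball: "AE x in hmeas. norm x < 1"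
  unfolding hmeas_def by (subst AE_density) (auto simp: hdens_ball_measurable_ennreal indicator_def split: if_splits)

text \<open>On a ray the point of Euclidean norm tanh a has geodesic radius 2a, so this is the
  instance of \<open>hdel\<close> = sinh^2 (d/2) in which d is known explicitly.\<close>

lemma hdel_ray:
  assumes e: "norm e = 1"
  shows "hdel (tanh a *\<^sub>R e) (tanh b *\<^sub>R e) = (sinh (a - b))\<^sup>2"
proof -
  have t: "1 - (tanh x)\<^sup>2 = 1 / (cosh x)\<^sup>2" for x :: real
  proof -
    have "1 - (tanh x)\<^sup>2 = ((cosh x)\<^sup>2 - (sinh x)\<^sup>2) / (cosh x)\<^sup>2"
      by (simp add: tanh_def power_divide field_simps)
    then show ?thesis by (simp add: cosh_square_eq)
  qed
  have "tanh a *\<^sub>R e - tanh b *\<^sub>R e = (tanh a - tanh b) *\<^sub>R e" by (simp add: scaleR_diff_left)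
  then have "(norm (tanh a *\<^sub>R e - tanh b *\<^sub>R e))\<^sup>2 = (tanh a - tanh b)\<^sup>2" using e by simp
  moreover have "(norm (tanh x *\<^sub>R e))\<^sup>2 = (tanh x)\<^sup>2" for x :: real using e by simp
  ultimately have "hdel (tanh a *\<^sub>R e) (tanh b *\<^sub>R e) = (tanh a - tanh b)\<^sup>2 / ((1 - (tanh a)\<^sup>2) * (1 - (tanh b)\<^sup>2))"
    by (simp add: hdel_def)
  also have "\<dots> = ((tanh a - tanh b) * (cosh a * cosh b))\<^sup>2" unfolding t by (simp add: power_mult_distrib)
  also have "(tanh a - tanh b) * (cosh a * cosh b) = sinh (a - b)"
    by (simp add: tanh_def sinh_diff field_simps)
  finally show ?thesis .
qed

text \<open>The scale sinh (k/2) belongs to geodesic distance k. The summand k^2 makes points at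
  distance exactly k satisfy the strict inequality in \<open>hsup\<close>, without changing the
  limit.\<close>

lemma sinh_half_over_tendsto:
  "((\<lambda>k::real. (sinh (k / 2) + k\<^sup>2) / k) \<longlongrightarrow> 1 / 2) (at_right 0)"
proof -
  have "((\<lambda>k::real. sinh (k / 2)) has_real_derivative 1 / 2) (at 0)" by (auto intro!: derivative_eq_intros)
  then have "((\<lambda>k. (sinh ((0 + k) / 2) - sinh (0 / 2)) / k) \<longlongrightarrow> (1 / 2 :: real)) (at 0)" unfolding DERIV_def .
  then have "((\<lambda>k. sinh (k / 2) / k + k) \<longlongrightarrow> (1 / 2 :: real) + 0) (at 0)" by (intro tendsto_add) auto
  then have "((\<lambda>k. sinh (k / 2) / k + k) \<longlongrightarrow> (1 / 2 :: real)) (at_right 0)"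
    by (auto intro: tendsto_within_subset)
  then show ?thesis
    by (rule Lim_transform_eventually)
       (auto simp: eventually_at_filter add_divide_distrib power2_eq_square)
qed

lemma C0_inf_ball_data:
  fixes u :: "real ^ 'n \<Rightarrow> real"
  assumes u: "u \<in> C0_inf_ball"
  obtains L R B where "c1 u (grad u)" "0 \<le> R" "R < 1" "0 \<le> L" "\<And>x. norm x > R \<Longrightarrow> u x = 0"
    "\<And>x. norm (grad u x) \<le> L" "adm L R B (\<lambda>x. \<bar>u x\<bar>)" "\<And>x y. \<bar>u x - u y\<bar> \<le> L * norm (x - y)"
proof -
  have sm: "smooth u" and cs: "compact (supp u)" and sb: "supp u \<subseteq> ball 0 1" using u by (auto simp: C0_inf_ball_def)
  have c: "c1 u (grad u)" by (rule smooth_c1[OF sm])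
  have ex: "\<exists>R. 0 \<le> R \<and> R < 1 \<and> (\<forall>x. norm x > R \<longrightarrow> u x = 0)"
  proof (cases "supp u = {}")
    case True
    have "{x. u x \<noteq> 0} \<subseteq> supp u" unfolding supp_def by (rule closure_subset)
    then have "u x = 0" for x using True by auto
    then show ?thesis by (intro exI[of _ 0]) auto
  next
    case False
    obtain z where z: "z \<in> supp u" "\<And>y. y \<in> supp u \<Longrightarrow> norm y \<le> norm z"
      using continuous_attains_sup[OF cs False, of norm] by (auto intro!: continuous_intros)
    have "u x = 0" if "norm x > norm z" for x
    proof (rule ccontr)
      assume "u x \<noteq> 0"
      then have "x \<in> supp u" using closure_subset[of "{x. u x \<noteq> 0}"] by (auto simp: supp_def)
      then show False using z(2)[of x] that by simp
    qed
    then show ?thesis using z sb by (intro exI[of _ "norm z"]) auto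
  qed
  then obtain R where R: "0 \<le> R" "R < 1" "\<And>x. norm x > R \<Longrightarrow> u x = 0" by blast
  obtain L where L: "0 \<le> L" "\<And>x. norm (grad u x) \<le> L"
  proof (rule continuous_support_bounded[of "grad u" R])
    show "continuous_on UNIV (grad u)" using c by (simp add: c1_def)
    show "grad u x = 0" if "R < norm x" for x by (rule c1_zero_outside[OF c R(3) that])
  qed auto
  obtain B where B: "0 \<le> B" "\<And>x. norm (u x) \<le> B"
    by (rule continuous_support_bounded[OF c1_cont[OF c] R(3)]) auto
  have lip: "\<bar>u x - u y\<bar> \<le> L * norm (x - y)" for x y by (rule c1_lipschitz[OF c L(2)])
  have "adm L R B (\<lambda>x. \<bar>u x\<bar>)" unfolding adm_def
  proof (intro conjI allI impI)
    fix x y :: "real ^ 'n" assume xy: "norm x < 1" "norm y < 1"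
    have "\<bar>\<bar>u x\<bar> - \<bar>u y\<bar>\<bar> \<le> \<bar>u x - u y\<bar>" by linarith
    also have "\<dots> \<le> L * norm (x - y)" by (rule lip)
    also have "\<dots> \<le> L * sqrt (hdel x y)" using norm_le_sqrt_hdel[OF xy] L by (intro mult_left_mono) auto
    finally show "\<bar>\<bar>u x\<bar> - \<bar>u y\<bar>\<bar> \<le> L * sqrt (hdel x y)" .
  qed (use B R in auto)
  then show ?thesis using that c R L lip by blast
qed

text \<open>First-order expansion of u over the ball, whose points satisfy |y - x| <= h sqrt (P (P +
  2h)) with P = 1 - |x|^2; the quotient h/k tends to 1/2. Only an upper bound is claimed, so the
  possible non-differentiability of |u| at zeros of u does no harm.\<close>

lemma hsup_quotient_limsup:
  fixes u :: "real ^ 'n \<Rightarrow> real"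
  assumes c: "c1 u g" and x: "norm x < 1" and e: "e > 0"
    and adm: "adm L R B (\<lambda>x. \<bar>u x\<bar>)"
  shows "\<forall>\<^sub>F k in at_right 0. (hsup (sinh (k / 2) + k\<^sup>2) (\<lambda>x. \<bar>u x\<bar>) x - \<bar>u x\<bar>) / k \<le> (1 - (norm x)\<^sup>2) / 2 * norm (g x) + e"
proof -
  define P where "P = 1 - (norm x)\<^sup>2"
  have P: "P > 0" "P \<le> 1" using one_minus_norm_sq_pos[OF x] by (auto simp: P_def)
  define h where "h k = sinh (k / 2) + k\<^sup>2" for k :: real
  have h0: "(h \<longlongrightarrow> 0) (at_right 0)"
  proof -
    have "isCont h 0" unfolding h_def[abs_def] by (auto intro!: continuous_intros)
    then have "(h \<longlongrightarrow> h 0) (at 0)" by (simp add: isCont_def)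
    then show ?thesis by (auto simp: h_def intro: tendsto_within_subset)
  qed
  have hk: "((\<lambda>k. h k / k) \<longlongrightarrow> 1 / 2) (at_right 0)" unfolding h_def by (rule sinh_half_over_tendsto)
  obtain d where d: "d > 0" "\<And>y. norm (y - x) < d \<Longrightarrow> \<bar>u y - u x - g x \<bullet> (y - x)\<bar> \<le> e * norm (y - x)"
    using c e unfolding c1_def has_derivative_at_alt by (metis real_norm_def)
  have bnd: "hsup (h k) (\<lambda>x. \<bar>u x\<bar>) x - \<bar>u x\<bar> \<le> (norm (g x) + e) * (h k * sqrt (P * (P + 2 * h k)))" if hk: "0 < h k" "h k < d" for k
  proof -
    have "hsup (h k) (\<lambda>x. \<bar>u x\<bar>) x \<le> \<bar>u x\<bar> + (norm (g x) + e) * (h k * sqrt (P * (P + 2 * h k)))"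
    proof (rule hsup_le[OF x hk(1)])
      fix y :: "real ^ 'n" assume y: "norm y < 1" and del: "hdel x y < (h k)\<^sup>2"
      have "sqrt (hdel x y) < sqrt ((h k)\<^sup>2)" using del by (rule real_sqrt_less_mono)
      then have nh: "norm (x - y) \<le> h k" using norm_le_sqrt_hdel[OF x y] hk by simp
      have Q: "1 - (norm y)\<^sup>2 > 0" using one_minus_norm_sq_pos[OF y] .
      have "(norm x)\<^sup>2 - (norm y)\<^sup>2 = (norm x - norm y) * (norm x + norm y)" by (simp add: power2_eq_square algebra_simps)
      also have "\<dots> \<le> norm (x - y) * 2"
        using norm_triangle_ineq2[of x y] x y by (intro mult_mono) auto
      finally have "1 - (norm y)\<^sup>2 \<le> P + 2 * h k" using nh by (simp add: P_def)
      then have "(h k)\<^sup>2 * (P * (1 - (norm y)\<^sup>2)) \<le> (h k)\<^sup>2 * (P * (P + 2 * h k))" using P by (intro mult_left_mono) auto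
      moreover have "(norm (x - y))\<^sup>2 \<le> (h k)\<^sup>2 * (P * (1 - (norm y)\<^sup>2))"
        using del P Q by (simp add: hdel_def P_def divide_less_eq)
      ultimately have "norm (x - y) \<le> sqrt ((h k)\<^sup>2 * (P * (P + 2 * h k)))" by (intro real_le_rsqrt) linarith
      then have n2: "norm (y - x) \<le> h k * sqrt (P * (P + 2 * h k))" using hk by (simp add: real_sqrt_mult norm_minus_commute)
      have "norm (y - x) < d" using nh hk by (simp add: norm_minus_commute)
      then have "\<bar>u y - u x - g x \<bullet> (y - x)\<bar> \<le> e * norm (y - x)" by (rule d(2))
      moreover have "\<bar>g x \<bullet> (y - x)\<bar> \<le> norm (g x) * norm (y - x)" by (rule Cauchy_Schwarz_ineq2)
      ultimately have "\<bar>u y - u x\<bar> \<le> (norm (g x) + e) * norm (y - x)" by (simp add: distrib_right)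
      also have "\<dots> \<le> (norm (g x) + e) * (h k * sqrt (P * (P + 2 * h k)))" using n2 e by (intro mult_left_mono) auto
      finally show "\<bar>u y\<bar> \<le> \<bar>u x\<bar> + (norm (g x) + e) * (h k * sqrt (P * (P + 2 * h k)))" by linarith
    qed
    then show ?thesis by simp
  qed
  have "((\<lambda>k. (norm (g x) + e) * (h k / k * sqrt (P * (P + 2 * h k)))) \<longlongrightarrow> (norm (g x) + e) * (1 / 2 * sqrt (P * (P + 2 * 0)))) (at_right 0)"
    by (intro tendsto_intros hk h0)
  \<comment> \<open>Strict because P <= 1, so the error e P / 2 stays below e.\<close>
  moreover have "(norm (g x) + e) * (1 / 2 * sqrt (P * (P + 2 * 0))) < P / 2 * norm (g x) + e"
  proof -
    have "sqrt (P * (P + 2 * 0)) = P" using P by simp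
    moreover have "(norm (g x) + e) * (1 / 2 * P) = P / 2 * norm (g x) + e * (P / 2)" by (simp add: algebra_simps)
    moreover have "e * (P / 2) < e * 1" using P e by (intro mult_strict_left_mono) auto
    ultimately show ?thesis by simp
  qed
  ultimately have ev1: "\<forall>\<^sub>F k in at_right 0. (norm (g x) + e) * (h k / k * sqrt (P * (P + 2 * h k))) < P / 2 * norm (g x) + e"
    by (rule order_tendstoD(2))
  have ev2: "\<forall>\<^sub>F k in at_right 0. h k < d" using h0 d(1) by (rule order_tendstoD(2))
  have ev3: "\<forall>\<^sub>F k in at_right (0::real). k > 0" by (simp add: eventually_at_filter)
  from ev1 ev2 ev3 show ?thesis
  proof eventually_elim
    case (elim k)
    have "h k > 0" using elim unfolding h_def by (simp add: add_pos_pos)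
    from bnd[OF this elim(2)] have "(hsup (h k) (\<lambda>x. \<bar>u x\<bar>) x - \<bar>u x\<bar>) / k \<le> (norm (g x) + e) * (h k * sqrt (P * (P + 2 * h k))) / k"
      using elim by (intro divide_right_mono) auto
    also have "\<dots> = (norm (g x) + e) * (h k / k * sqrt (P * (P + 2 * h k)))" by simp
    finally show ?case using elim(1) by (simp add: h_def P_def)
  qed
qed

lemma hgrad_len_bounds: "norm x < 1 \<Longrightarrow> 0 \<le> hgrad_len u x \<and> hgrad_len u x \<le> norm (grad u x)"
proof -
  assume "norm x < 1"
  then have c: "0 \<le> (1 - (norm x)\<^sup>2) / 2" using one_minus_norm_sq_pos[of x] by simp
  have h: "(1 - a) / 2 \<le> 1" if "0 \<le> a" for a :: real using that by simp
  have "(1 - (norm x)\<^sup>2) / 2 \<le> 1" by (rule h[OF zero_le_power2])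
  from mult_right_mono[OF this norm_ge_zero[of "grad u x"]] have "hgrad_len u x \<le> norm (grad u x)"
    unfolding hgrad_len_def by simp
  moreover have "0 \<le> hgrad_len u x" unfolding hgrad_len_def by (rule mult_nonneg_nonneg[OF c norm_ge_zero])
  ultimately show ?thesis by simp
qed

lemma hint_grad_pow_eq:
  fixes u :: "real ^ 'n \<Rightarrow> real"
  assumes u: "u \<in> C0_inf_ball" and p: "p > 0"
  shows "hint_grad_pow p u = (\<integral>x. hgrad_len u x powr p \<partial>hmeas)" "integrable hmeas (\<lambda>x. hgrad_len u x powr p)"
    "(\<lambda>x. hgrad_len u x powr p) \<in> borel_measurable borel"
proof -
  obtain L R B where D: "c1 u (grad u)" "0 \<le> R" "R < 1" "0 \<le> L" "\<And>x. norm x > R \<Longrightarrow> u x = 0"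
    "\<And>x. norm (grad u x) \<le> L" "adm L R B (\<lambda>x. \<bar>u x\<bar>)" by (rule C0_inf_ball_data[OF u]) blast
  have m: "hgrad_len u \<in> borel_measurable borel" unfolding hgrad_len_def[abs_def]
    using D(1) by (intro borel_measurable_continuous_onI continuous_intros) (auto simp: c1_def)
  show m': "(\<lambda>x. hgrad_len u x powr p) \<in> borel_measurable borel" using m by measurable
  show i: "integrable hmeas (\<lambda>x. hgrad_len u x powr p)"
  proof (rule integrable_hmeas_bounded[OF m' D(3)])
    show "hgrad_len u x powr p = 0" if "R < norm x" for x
      using c1_zero_outside[OF D(1) D(5) that] by (simp add: hgrad_len_def)
    show "\<bar>hgrad_len u x powr p\<bar> \<le> L powr p" for x
    proof (cases "norm x < 1")
      case True
      have "hgrad_len u x \<le> L" using hgrad_len_bounds[OF True] D(6)[of x] by (rule order_trans[OF conjunct2])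
      then show ?thesis using hgrad_len_bounds[OF True, of u] p by (auto intro!: powr_mono2)
    next
      case False
      then have "R < norm x" using D(3) by simp
      from c1_zero_outside[OF D(1) D(5) this] show ?thesis by (simp add: hgrad_len_def)
    qed
  qed
  show "hint_grad_pow p u = (\<integral>x. hgrad_len u x powr p \<partial>hmeas)"
    unfolding hint_grad_pow_def by (rule integral_hmeas_eq[OF m' i, symmetric])
qed

text \<open>The pointwise information is an upper bound in the limit, not convergence. Dominated
  convergence is therefore applied to the maximum of the quotient power and the gradient power,
  which does converge. The Lipschitz constant and the common support give the dominating
  function.\<close>

lemma hsup_energy_limsup:
  fixes u :: "real ^ 'n \<Rightarrow> real"
  assumes u: "u \<in> C0_inf_ball" and adm: "adm L R B (\<lambda>x. \<bar>u x\<bar>)" and R: "R < 1" and L: "0 \<le> L" and p: "p \<ge> 1" and e: "e > 0"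
    and k: "\<And>i. 0 < k i" "k \<longlonglongrightarrow> 0"
  shows "\<forall>\<^sub>F i in sequentially. (\<integral>x. ((hsup (sinh (k i / 2) + (k i)\<^sup>2) (\<lambda>x. \<bar>u x\<bar>) x - \<bar>u x\<bar>) / k i) powr p \<partial>hmeas) \<le> hint_grad_pow p u + e"
proof -
  let ?f = "\<lambda>x. \<bar>u x\<bar>"
  have c: "c1 u (grad u)" using u smooth_c1 by (auto simp: C0_inf_ball_def)
  define h where "h i = sinh (k i / 2) + (k i)\<^sup>2" for i
  have h0: "h i > 0" for i unfolding h_def using k(1)[of i] by (simp add: add_pos_pos)
  have kr: "filterlim k (at_right 0) sequentially" 
    unfolding filterlim_at using k by (auto intro!: always_eventually simp: less_imp_neq[symmetric])
  have hk: "(\<lambda>i. h i / k i) \<longlonglongrightarrow> 1 / 2" unfolding h_def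
    by (rule filterlim_compose[OF sinh_half_over_tendsto kr])
  then obtain C where C: "\<And>i. h i / k i \<le> C" using convergent_imp_Bseq[of "\<lambda>i. h i / k i"] unfolding Bseq_def convergent_def
    by (metis abs_le_D1 real_norm_def)
  have "h \<longlonglongrightarrow> 0" unfolding h_def[abs_def] by (auto intro!: tendsto_eq_intros k(2))
  then obtain H where H: "\<And>i. h i \<le> H" using convergent_imp_Bseq[of h] unfolding Bseq_def convergent_def
    by (metis abs_le_D1 real_norm_def)
  have H0: "H > 0" using H[of 0] h0[of 0] by linarith
  obtain R' where R': "R \<le> R'" "R' < 1" "\<And>x h'. 0 < h' \<Longrightarrow> h' \<le> H \<Longrightarrow> norm x > R' \<Longrightarrow> hsup h' ?f x = 0"
    using hsup_supportE[OF R H0] adm by metis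
  define Q where "Q i x = ((hsup (h i) ?f x - ?f x) / k i) powr p" for i x
  define E where "E x = hgrad_len u x powr p" for x
  have p0: "p > 0" using p by simp
  note E = hint_grad_pow_eq[OF u p0, folded E_def]
  have mQ: "Q i \<in> borel_measurable borel" for i unfolding Q_def[abs_def]
    using hsup_measurable[OF adm h0] adm_measurable[OF adm R] by measurable
  have Qb: "Q i x \<le> (L * C) powr p" for i x
  proof -
    have "hsup (h i) ?f x - ?f x \<le> L * h i" by (rule hsup_diff_le[OF adm h0 R L])
    then have "(hsup (h i) ?f x - ?f x) / k i \<le> L * h i / k i" using k(1)[of i] by (intro divide_right_mono) auto
    also have "\<dots> \<le> L * C" using C[of i] L by (simp add: mult_left_mono flip: times_divide_eq_right)
    finally show ?thesis unfolding Q_def using hsup_ge_self[OF adm h0 R, of x i] k(1)[of i] p by (intro powr_mono2) auto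
  qed
  have Qs: "Q i x = 0" if "norm x > R'" for i x
    unfolding Q_def using R'(3)[OF h0 H that] adm R' that by (auto simp: adm_def)
  obtain L' R1 B' where D: "R1 < 1" "\<And>x. norm x > R1 \<Longrightarrow> u x = 0" "\<And>x. norm (grad u x) \<le> L'" "0 \<le> L'"
    by (rule C0_inf_ball_data[OF u]) blast
  have Es: "E x = 0" if "norm x > R1" for x
    using c1_zero_outside[OF c D(2) that] by (simp add: E_def hgrad_len_def)
  have Eb: "E x \<le> L' powr p" for x
  proof (cases "norm x < 1")
    case True
    have "hgrad_len u x \<le> L'" using hgrad_len_bounds[OF True] D(3)[of x] by (rule order_trans[OF conjunct2])
    then show ?thesis unfolding E_def using hgrad_len_bounds[OF True, of u] p by (auto intro!: powr_mono2)
  next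
    case False
    then show ?thesis using Es[of x] D(1) by simp
  qed
  \<comment> \<open>The maximum lies between its limit and a power of max (quotient, gradient
    length), to which \<open>hsup_quotient_limsup\<close> applies.\<close>
  have lim: "(\<lambda>i. max (Q i x) (E x)) \<longlonglongrightarrow> E x" for x
  proof (cases "norm x < 1")
    case False
    then have "Q i x = 0" "E x = 0" for i using Qs[of x] Es[of x] R' D(1) by auto
    then show ?thesis by simp
  next
    case True
    let ?s = "hgrad_len u x"
    have s0: "0 \<le> ?s" unfolding hgrad_len_def using one_minus_norm_sq_pos[OF True] by simp
    show ?thesis
    proof (rule tendsto_sandwich[of "\<lambda>_. E x" _ _ ])
      have "(\<lambda>i. max ((hsup (h i) ?f x - ?f x) / k i) ?s) \<longlonglongrightarrow> ?s"
      proof (rule LIMSEQ_I)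
        fix e :: real assume e: "e > 0"
        have "\<forall>\<^sub>F i in sequentially. (hsup (sinh (k i / 2) + (k i)\<^sup>2) ?f x - ?f x) / k i \<le> (1 - (norm x)\<^sup>2) / 2 * norm (grad u x) + e / 2"
          using filterlim_iff[THEN iffD1, OF kr, rule_format, OF hsup_quotient_limsup[OF c True _ adm, of "e / 2"]] e by simp
        then have "\<forall>\<^sub>F i in sequentially. norm (max ((hsup (h i) ?f x - ?f x) / k i) ?s - ?s) < e"
          by eventually_elim (use e in \<open>auto simp: h_def hgrad_len_def max_def\<close>)
        then show "\<exists>no. \<forall>i\<ge>no. norm (max ((hsup (h i) ?f x - ?f x) / k i) ?s - ?s) < e"
          by (simp add: eventually_sequentially)
      qed
      then show "(\<lambda>i. (max ((hsup (h i) ?f x - ?f x) / k i) ?s) powr p) \<longlonglongrightarrow> E x" unfolding E_def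
        using s0 p by (intro tendsto_powr' tendsto_const) (auto simp: le_max_iff_disj)
      have "max (Q i x) (E x) \<le> (max ((hsup (h i) ?f x - ?f x) / k i) ?s) powr p" for i
        unfolding Q_def E_def using s0 p hsup_ge_self[OF adm h0 R, of x i] k(1)[of i]
        by (auto intro!: powr_mono2)
      then show "\<forall>\<^sub>F i in sequentially. max (Q i x) (E x) \<le> (max ((hsup (h i) ?f x - ?f x) / k i) ?s) powr p" by simp
    qed auto
  qed
  have "(\<lambda>i. \<integral>x. max (Q i x) (E x) \<partial>hmeas) \<longlonglongrightarrow> (\<integral>x. E x \<partial>hmeas)"
  proof (rule hmeas_dominated_convergence[where R="max R' R1" and K="max ((L * C) powr p) (L' powr p)"])
    show "(\<lambda>x. max (Q i x) (E x)) \<in> borel_measurable borel" for i using mQ E(3) by measurable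
    show "\<bar>max (Q i x) (E x)\<bar> \<le> max ((L * C) powr p) (L' powr p)" for i and x :: "real ^ 'n"
    proof -
      have "0 \<le> Q i x" by (simp add: Q_def)
      then have "\<bar>max (Q i x) (E x)\<bar> = max (Q i x) (E x)" by auto
      also have "\<dots> \<le> max ((L * C) powr p) (L' powr p)" using Qb[of i x] Eb[of x] by (rule max.mono)
      finally show ?thesis .
    qed
  qed (use lim Qs Es R' D(1) E(3) in auto)
  then have "\<forall>\<^sub>F i in sequentially. (\<integral>x. max (Q i x) (E x) \<partial>hmeas) < hint_grad_pow p u + e"
    unfolding E(1) using e by (intro order_tendstoD(2)) auto
  then show ?thesis
  proof eventually_elim
    case (elim i)
    have iQ: "integrable hmeas (Q i)"
    proof (rule integrable_hmeas_bounded[OF mQ R'(2)])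
      show "\<bar>Q i x\<bar> \<le> (L * C) powr p" for x using Qb[of i x] by (simp add: Q_def)
    qed (rule Qs)
    have "(\<integral>x. Q i x \<partial>hmeas) \<le> (\<integral>x. max (Q i x) (E x) \<partial>hmeas)"
      by (rule integral_mono[OF iQ]) (use iQ E(2) in auto)
    then show ?case using elim by (simp add: Q_def h_def)
  qed
qed


section \<open>C^1 radial profiles approximating u\<close>

lemma hint_pow_eq:
  fixes u :: "real ^ 'n \<Rightarrow> real"
  assumes adm: "adm L R B (\<lambda>x. \<bar>u x\<bar>)" and R: "R < 1" and q: "q > 0"
  shows "hint_pow q u = (\<integral>x. \<bar>u x\<bar> powr q \<partial>hmeas)"
proof -
  have c: "continuous_on UNIV (\<lambda>t::real. \<bar>t\<bar> powr q)" using q by (intro continuous_on_powr_nonneg continuous_intros) auto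
  have i: "integrable hmeas (\<lambda>x. \<bar>u x\<bar> powr q)" using adm_comp_integrable[OF adm R c] q by simp
  then show ?thesis unfolding hint_pow_def using integral_hmeas_eq[OF _ i] by auto
qed

lemma AE_hmeas_integral_cong:
  fixes f g :: "real ^ 'n \<Rightarrow> real"
  assumes "f \<in> borel_measurable borel" "g \<in> borel_measurable borel" "\<And>x. norm x < 1 \<Longrightarrow> f x = g x"
  shows "(\<integral>x. f x \<partial>hmeas) = (\<integral>x. g x \<partial>hmeas)"
  using assms AE_hmeas_ball by (intro integral_cong_AE) (auto elim: eventually_mono)

text \<open>The function min 1 (|t|/s) is a continuous substitute for the indicator of t > 0, as
  equidistribution is known for continuous test functions only. It is 1 on the ball where v >= s,
  and its value at |u| is at most the indicator of the support of u.\<close>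

lemma hmeas_le_hvol:
  fixes u v :: "real ^ 'n \<Rightarrow> real"
  assumes u: "u \<in> C0_inf_ball" and adm: "adm L R B v" and R: "R < 1"
    and eq: "\<And>\<psi> :: real \<Rightarrow> real. continuous_on UNIV \<psi> \<Longrightarrow> \<psi> 0 = 0 \<Longrightarrow> (\<integral>x. \<psi> (v x) \<partial>hmeas) = (\<integral>x. \<psi> \<bar>u x\<bar> \<partial>hmeas)"
    and s: "s > 0" and c: "0 \<le> c" and v: "\<And>x. norm x \<le> tanh (c / 2) \<Longrightarrow> s \<le> v x"
  shows "ballvol TYPE('n) * real CARD('n) * hF CARD('n) c \<le> hvol (supp u)"
proof -
  let ?C = "cball (0 :: real ^ 'n) (tanh (c / 2))"
  let ?\<psi> = "\<lambda>t. min 1 (\<bar>t\<bar> / s)"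
  have psi: "continuous_on UNIV ?\<psi>" "?\<psi> 0 = 0" by (auto intro!: continuous_intros simp: s less_imp_neq[OF s, symmetric])
  obtain L' R1 B' where D: "R1 < 1" "\<And>x. norm x > R1 \<Longrightarrow> u x = 0" "adm L' R1 B' (\<lambda>x. \<bar>u x\<bar>)" "0 \<le> R1"
    by (rule C0_inf_ball_data[OF u]) blast
  have t1: "0 \<le> tanh (c / 2)" "tanh (c / 2) < 1" using tanh_half_bounds[OF c] by auto
  have iC: "integrable hmeas (indicat_real ?C)"
  proof (rule integrable_hmeas_bounded[OF _ t1(2), where B=1])
    show "indicat_real ?C \<in> borel_measurable borel" by (rule borel_measurable_indicator) simp
  qed (auto simp: indicator_def)
  have cl: "closed (supp u)" by (simp add: supp_def)
  have sub: "supp u \<subseteq> cball 0 R1" unfolding supp_def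
    using D(2) by (intro closure_minimal) (force simp: not_le[symmetric])+
  have msu: "indicat_real (supp u) \<in> borel_measurable borel"
    using cl by (intro borel_measurable_indicator borel_closed)
  have isu: "integrable hmeas (indicat_real (supp u))"
    by (rule integrable_hmeas_bounded[OF msu D(1), where B=1]) (use sub in \<open>auto simp: indicator_def\<close>)
  have "ballvol TYPE('n) * real CARD('n) * hF CARD('n) c = measure hmeas ?C"
    using emeasure_hmeas_cball[OF c, where 'n='n] hF_nonneg[OF c, of "CARD('n)"] ballvol_pos[where 'n='n] by (simp add: measure_def)
  also have "\<dots> = (\<integral>x. indicat_real ?C x \<partial>hmeas)" by simp
  also have "\<dots> \<le> (\<integral>x. ?\<psi> (v x) \<partial>hmeas)"
  proof (rule integral_mono[OF iC adm_comp_integrable[OF adm R psi]])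
    fix x
    show "indicat_real ?C x \<le> ?\<psi> (v x)" using v[of x] s by (auto simp: indicator_def)
  qed
  also have "\<dots> = (\<integral>x. ?\<psi> \<bar>u x\<bar> \<partial>hmeas)" by (rule eq[OF psi])
  also have "\<dots> \<le> (\<integral>x. indicat_real (supp u) x \<partial>hmeas)"
  proof (rule integral_mono[OF adm_comp_integrable[OF D(3) D(1) psi]])
    show "integrable hmeas (indicat_real (supp u))" by (rule isu)
    fix x
    have "{x. u x \<noteq> 0} \<subseteq> supp u" unfolding supp_def by (rule closure_subset)
    then have "x \<notin> supp u \<Longrightarrow> u x = 0" by blast
    then show "?\<psi> \<bar>u x\<bar> \<le> indicat_real (supp u) x" using s by (auto simp: indicator_def)
  qed
  also have "\<dots> = hvol (supp u)"
  proof -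
    have "(\<integral>x. indicat_real (supp u) x \<partial>hmeas) = integral (ball 0 1) (\<lambda>x. indicat_real (supp u) x * hdens x)"
      by (rule integral_hmeas_eq[OF msu isu])
    also have "(\<lambda>x. indicat_real (supp u) x * hdens x) = (\<lambda>x. if x \<in> supp u then hdens x else 0)" by (auto simp: indicator_def)
    also have "integral (ball 0 1) \<dots> = integral (supp u \<inter> ball 0 1) hdens" by (simp add: integral_restrict_Int Int_commute)
    finally show ?thesis by (simp add: hvol_def)
  qed
  finally show ?thesis .
qed

lemma hvol_nonneg: "0 \<le> hvol A"
proof (cases "hdens integrable_on (A \<inter> ball 0 1)")
  case True
  then show ?thesis unfolding hvol_def by (rule integral_nonneg) (auto intro: less_imp_le[OF hdens_pos])
qed (simp add: hvol_def not_integrable_integral)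

text \<open>The rearrangement depends only on the geodesic radius, through a decreasing profile
  \<open>M0\<close> that need not be differentiable. Its averages over [r - k, r] are C^1, and their
  derivative is the difference quotient of \<open>M0\<close>. This is controlled by the oscillation
  at distance k, with no derivative of \<open>M0\<close> involved.\<close>

theorem radial_approximation:
  fixes u :: "real ^ 'n \<Rightarrow> real"
  assumes u: "u \<in> C0_inf_ball" and n2: "CARD('n) \<ge> 2" and p: "p > 1"
  obtains M m :: "nat \<Rightarrow> real \<Rightarrow> real" and b :: "nat \<Rightarrow> real" where
    "\<And>i. radial_profile CARD('n) p (b i) (M i) (m i)" "\<And>i. m i 0 = 0"
    "\<And>q. q > 0 \<Longrightarrow> (\<lambda>i. ballvol TYPE('n) * real CARD('n) * integral {0..b i} (\<lambda>r. M i r powr q * hS CARD('n) r)) \<longlonglongrightarrow> hint_pow q u"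
    "\<And>e. e > 0 \<Longrightarrow> \<forall>\<^sub>F i in sequentially. ballvol TYPE('n) * real CARD('n) * integral {0..b i} (\<lambda>r. \<bar>m i r\<bar> powr p * hS CARD('n) r) \<le> hint_grad_pow p u + e"
    "\<And>i x. \<bar>u x\<bar> \<le> M i 0"
    "\<And>e. e > 0 \<Longrightarrow> \<forall>\<^sub>F i in sequentially. ballvol TYPE('n) * real CARD('n) * hF CARD('n) (b i) \<le> hvol (supp u) + e"
proof -
  let ?n = "CARD('n)" let ?s = "ballvol TYPE('n) * real CARD('n)"
  have s0: "?s > 0" using ballvol_pos[where 'n='n] by simp
  have p1: "p \<ge> 1" using p by simp
  obtain L R B where D: "c1 u (grad u)" "0 \<le> R" "R < 1" "0 \<le> L" "adm L R B (\<lambda>x. \<bar>u x\<bar>)"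
    by (rule C0_inf_ball_data[OF u]) blast
  note R = D(3) note af = D(5)
  obtain v where v: "rearr L R B p (\<lambda>x. \<bar>u x\<bar>) v" and vm: "\<And>x y. norm x \<le> norm y \<Longrightarrow> v y \<le> v x"
    by (rule hyperbolic_rearrangement[OF af R D(4) p1]) blast
  have av: "adm L R B v" using v by (simp add: rearr_def)
  have veq: "(\<integral>x. \<psi> (v x) \<partial>hmeas) = (\<integral>x. \<psi> \<bar>u x\<bar> \<partial>hmeas)" if "continuous_on UNIV \<psi>" "\<psi> 0 = 0" for \<psi> :: "real \<Rightarrow> real"
    using v that by (simp add: rearr_def)
  have cv: "continuous_on UNIV v" by (rule adm_continuous[OF av R])
  have vrad: "v x = v y" if "norm x = norm y" for x y using vm[of x y] vm[of y x] that by simp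
  define e :: "real ^ 'n" where "e = axis (SOME i. True) 1"
  have e1: "norm e = 1" by (simp add: e_def norm_axis_1)
  \<comment> \<open>Constant for r <= 0; this makes the derivative of the averages vanish at 0, as
    transplantation needs.\<close>
  define M0 where "M0 r = v (tanh (max 0 r / 2) *\<^sub>R e)" for r
  have cM0: "continuous_on A M0" for A
  proof -
    have "continuous_on A (\<lambda>r. tanh (max 0 r / 2) *\<^sub>R e)" by (intro continuous_intros) auto
    then show ?thesis unfolding M0_def[abs_def] by (rule continuous_on_compose2[OF cv]) auto
  qed
  have nt: "norm (tanh (max 0 r / 2) *\<^sub>R e) = tanh (max 0 r / 2)" for r :: real using e1 by simp
  have M0mono: "M0 s \<le> M0 r" if "r \<le> s" for r s
    unfolding M0_def by (rule vm, unfold nt) (use that in \<open>simp add: tanh_real_le_iff\<close>)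
  have M0nn: "0 \<le> M0 r" for r using av by (simp add: M0_def adm_def)
  have M0neg: "M0 r = M0 0" if "r \<le> 0" for r using that by (simp add: M0_def)
  have vM0: "v x = M0 (hrad0 x)" if "norm x < 1" for x
    unfolding M0_def by (rule vrad, unfold nt) (use that hrad_nonneg[OF that] tanh_hrad[OF that] in \<open>simp add: hrad0_def max_absorb2\<close>)
  obtain b1 where b1: "b1 \<ge> 0" "M0 b1 = 0"
  proof -
    define z where "z = ((1 + R) / 2) *\<^sub>R e"
    have nz: "norm z = (1 + R) / 2" using e1 D(2) by (simp add: z_def)
    then have z1: "norm z < 1" "norm z > R" using R by auto
    have "v z = 0" using av z1 by (auto simp: adm_def)
    then show ?thesis using that[of "hrad z"] vM0[OF z1(1)] hrad_nonneg[OF z1(1)] z1 by (simp add: hrad0_def)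
  qed
  \<comment> \<open>\<open>b0\<close> is to be the first zero of the profile, hence the geodesic
    radius of the ball on which the rearrangement is positive.\<close>
  define Z where "Z = {r. 0 \<le> r \<and> M0 r = 0}"
  define b0 where "b0 = Inf Z"
  have Zne: "Z \<noteq> {}" and Zb: "bdd_below Z" using b1 by (auto simp: Z_def intro: bdd_belowI[of _ 0])
  have "closed Z"
  proof -
    have "Z = {0..} \<inter> M0 -` {0}" by (auto simp: Z_def)
    then show ?thesis using continuous_closed_preimage[OF cM0, of "{0..}" "{0}"] by simp
  qed
  then have "b0 \<in> Z" unfolding b0_def by (intro closed_contains_Inf Zne Zb)
  then have b0: "b0 \<ge> 0" "M0 b0 = 0" by (auto simp: Z_def)
  have M0z: "M0 r = 0" if "b0 \<le> r" for r using M0mono[OF that] M0nn[of r] b0 by simp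
  have M0pos: "M0 r > 0" if "0 \<le> r" "r < b0" for r
  proof (rule ccontr)
    assume "\<not> M0 r > 0"
    then have "r \<in> Z" using that M0nn[of r] by (simp add: Z_def)
    then have "b0 \<le> r" unfolding b0_def by (rule cInf_lower[OF _ Zb])
    then show False using that by simp
  qed
  have vol: "?s * hF ?n b0 \<le> hvol (supp u)"
  proof (cases "b0 = 0")
    case True
    have "?s * hF ?n 0 \<le> hvol (supp u)"
      using hvol_nonneg by simp
    then show ?thesis using True by simp
  next
    case False
    have lim: "(\<lambda>i. ?s * hF ?n (b0 * (1 - inverse (real (Suc i))))) \<longlonglongrightarrow> ?s * hF ?n (b0 * (1 - 0))"
      using hF_deriv[of ?n] DERIV_isCont by (intro tendsto_intros isCont_tendsto_compose[of _ "hF ?n"] LIMSEQ_inverse_real_of_nat) blast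
    \<comment> \<open>Radii below \<open>b0\<close> are used because \<open>hmeas_le_hvol\<close>
      needs a positive lower bound for the profile, and at \<open>b0\<close> it is zero.\<close>
    have "?s * hF ?n (b0 * (1 - inverse (real (Suc i)))) \<le> hvol (supp u)" for i
    proof -
      let ?c = "b0 * (1 - inverse (real (Suc i)))"
      have i1: "inverse (real (Suc i)) \<le> 1" "inverse (real (Suc i)) > 0" by (auto simp: field_simps)
      have c: "0 \<le> ?c" using b0 i1 by (intro mult_nonneg_nonneg) linarith+
      have "?c < b0 * 1" using False b0 i1 by (intro mult_strict_left_mono) linarith+
      then have c2: "?c < b0" by simp
      show ?thesis
      proof (rule hmeas_le_hvol[OF u av R veq M0pos[OF c c2] c])
        fix x :: "real ^ 'n" assume x: "norm x \<le> tanh (?c / 2)"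
        have x1: "norm x < 1" using x tanh_half_bounds[OF c] by linarith
        then have "hrad0 x \<le> ?c" using hrad_le_iff[OF x1 c] x by (simp add: hrad0_def)
        then show "M0 ?c \<le> v x" using vM0[OF x1] M0mono by simp
      qed
    qed
    then show ?thesis using LIMSEQ_le_const2[OF lim] by simp
  qed
  have sup: "\<bar>u x\<bar> \<le> M0 0" for x
  proof -
    have v0: "v y \<le> M0 0" for y unfolding M0_def by (rule vm) (use e1 in simp)
    \<comment> \<open>The excess over the top value of the profile integrates to zero for the
      rearrangement, hence for |u|, and by continuity it vanishes.\<close>
    let ?\<psi> = "\<lambda>t. max 0 (t - M0 0)"
    have psi: "continuous_on UNIV ?\<psi>" "?\<psi> 0 = 0" using M0nn[of 0] by (auto intro!: continuous_intros)
    have "(\<integral>x. ?\<psi> \<bar>u x\<bar> \<partial>hmeas) = (\<integral>x. ?\<psi> (v x) \<partial>hmeas)" by (rule veq[OF psi, symmetric])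
    also have "\<dots> = 0" using v0 by (simp add: max_absorb1)
    finally have z: "(\<integral>x. ?\<psi> \<bar>u x\<bar> \<partial>hmeas) = 0" .
    show ?thesis
    proof (rule ccontr)
      assume "\<not> ?thesis"
      then have x: "?\<psi> \<bar>u x\<bar> > 0" by simp
      have "u x \<noteq> 0" using x M0nn[of 0] by auto
      then have "norm x < 1" using adm_outside[OF af R, of x] by auto
      have "(\<integral>x. ?\<psi> \<bar>u x\<bar> \<partial>hmeas) > 0"
        by (rule hmeas_integral_pos[OF adm_comp_integrable[OF af R psi] _ _ \<open>norm x < 1\<close> x])
           (auto intro!: continuous_intros c1_cont[OF D(1)])
      then show False using z by simp
    qed
  qed
  define G where "G = (\<lambda>r. if 0 \<le> r then integral {0..r} M0 else - integral {r..0} M0)"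
  have dG: "(G has_real_derivative M0 r) (at r)" for r unfolding G_def by (rule antiderivative_from_0[OF cM0])
  define k where "k i = inverse (real (Suc i))" for i
  have k0: "k i > 0" "k i \<le> 1" for i by (auto simp: k_def field_simps)
  have klim: "k \<longlonglongrightarrow> 0" unfolding k_def[abs_def] by (rule LIMSEQ_inverse_real_of_nat)
  \<comment> \<open>The average of \<open>M0\<close> over [r - k, r], written with its primitive so
    that differentiation is immediate. Averaging to the left gives \<open>M0 r\<close> as a lower
    bound and enlarges the support by k.\<close>
  define M where "M i r = (G r - G (r - k i)) / k i" for i r
  define m where "m i r = (M0 r - M0 (r - k i)) / k i" for i r
  define b where "b i = b0 + k i" for i
  have Mval: "\<exists>\<xi>. r - k i < \<xi> \<and> \<xi> < r \<and> M i r = M0 \<xi>" for i r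
  proof -
    obtain \<xi> where "r - k i < \<xi>" "\<xi> < r" "G r - G (r - k i) = (r - (r - k i)) * M0 \<xi>"
      using MVT2[of "r - k i" r G M0] dG k0[of i] by auto
    then show ?thesis using k0[of i] by (intro exI[of _ \<xi>]) (simp add: M_def)
  qed
  have Mlo: "M0 r \<le> M i r" and Mhi: "M i r \<le> M0 (r - k i)" for i r
    using Mval[of r i] M0mono by (auto intro: less_imp_le)
  have Mz: "M i r = 0" if "b i \<le> r" for i r
    using Mval[of r i] M0z that by (auto simp: b_def)
  have mz: "m i r = 0" if "b i \<le> r" for i r
    using M0z[of r] M0z[of "r - k i"] that k0[of i] by (simp add: b_def m_def)
  have cm: "continuous_on A (m i)" for A i unfolding m_def[abs_def]
    using k0[of i] by (intro continuous_intros cM0 continuous_on_compose2[OF cM0[of UNIV]]) auto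
  have b_pos: "b i > 0" for i using b0 k0[of i] by (simp add: b_def)
  have rp: "radial_profile ?n p (b i) (M i) (m i)" for i
  proof
    show "(M i has_real_derivative m i r) (at r)" for r
    proof -
      have "((\<lambda>r. G (r - k i)) has_real_derivative M0 (r - k i) * (1 - 0)) (at r)"
        by (rule DERIV_chain2[OF dG]) (auto intro!: derivative_eq_intros)
      then show ?thesis unfolding M_def[abs_def] m_def using DERIV_cdivide[OF DERIV_diff[OF dG[of r]]] by fastforce
    qed
    show "m i r \<le> 0" for r unfolding m_def using M0mono[of "r - k i" r] k0[of i] by (intro divide_nonpos_pos) auto
  qed (use n2 p b_pos Mz mz cm in auto)
  have m0: "m i 0 = 0" for i using M0neg[of "0 - k i"] k0[of i] by (simp add: m_def)
  have Mnn: "0 \<le> M i r" for i r using Mlo[of r i] M0nn[of r] by linarith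
  have cM: "continuous_on A (M i)" for A i using radial_profile.M_cont[OF rp] .
  have MM: "\<bar>u x\<bar> \<le> M i 0" for i x using sup[of x] Mlo[of 0 i] by linarith
  have lim1: "(\<lambda>i. ?s * integral {0..b i} (\<lambda>r. M i r powr q * hS ?n r)) \<longlonglongrightarrow> hint_pow q u" if q: "q > 0" for q
  proof -
    \<comment> \<open>\<open>hrad0\<close> is 0 outside the unit ball, where the profile would
      contribute its top value; the cut-off is invisible to \<open>hmeas\<close> but gives the
      support bound for dominated convergence.\<close>
    define g where "g i x = (if norm x < 1 then M i (hrad0 x) powr q else 0)" for i and x :: "real ^ 'n"
    define R1 where "R1 = tanh ((b0 + 1) / 2)"
    have R1: "R1 < 1" using tanh_half_bounds[of "b0 + 1"] b0 by (simp add: R1_def)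
    have mM: "(\<lambda>x. M i (hrad0 x) powr q) \<in> borel_measurable (borel :: (real ^ 'n) measure)" for i
    proof -
      have "M i \<in> borel_measurable borel" by (rule borel_measurable_continuous_onI[OF cM])
      then show ?thesis by measurable
    qed
    have mg: "g i \<in> borel_measurable borel" for i unfolding g_def[abs_def] using mM by measurable
    have mv: "(\<lambda>x. v x powr q) \<in> borel_measurable borel" using adm_measurable[OF av R] by measurable
    have eq: "?s * integral {0..b i} (\<lambda>r. M i r powr q * hS ?n r) = (\<integral>x. g i x \<partial>hmeas)" for i
    proof -
      have "(\<integral>x. g i x \<partial>hmeas) = (\<integral>x. M i (hrad0 (x :: real ^ 'n)) powr q \<partial>hmeas)"
        by (rule AE_hmeas_integral_cong[OF mg mM]) (simp add: g_def)
      also have "\<dots> = ?s * integral {0..b i} (\<lambda>r. M i r powr q * hS ?n r)"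
        by (rule integral_hmeas_radial[where g="\<lambda>r. M i r powr q"])
           (use Mnn q Mz b_pos[of i] in \<open>auto intro!: continuous_on_powr_nonneg cM\<close>)
      finally show ?thesis by simp
    qed
    have "(\<lambda>i. \<integral>x. g i x \<partial>hmeas) \<longlonglongrightarrow> (\<integral>x. v x powr q \<partial>hmeas)"
    proof (rule hmeas_dominated_convergence[OF mg mv R1])
      fix x :: "real ^ 'n"
      show "(\<lambda>i. g i x) \<longlonglongrightarrow> v x powr q"
      proof (cases "norm x < 1")
        case True
        have "(\<lambda>i. M i (hrad0 x)) \<longlonglongrightarrow> M0 (hrad0 x)"
        proof (rule tendsto_sandwich[of "\<lambda>_. M0 (hrad0 x)" _ _ "\<lambda>i. M0 (hrad0 x - k i)"])
          show "(\<lambda>i. M0 (hrad0 x - k i)) \<longlonglongrightarrow> M0 (hrad0 x)"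
          proof -
            have c: "isCont M0 (hrad0 x)" using cM0[of UNIV] by (simp add: continuous_on_eq_continuous_at)
            have "(\<lambda>i. hrad0 x - k i) \<longlonglongrightarrow> hrad0 x - 0" by (intro tendsto_intros klim)
            then have "(\<lambda>i. hrad0 x - k i) \<longlonglongrightarrow> hrad0 x" by simp
            then show ?thesis by (rule isCont_tendsto_compose[OF c])
          qed
        qed (use Mlo Mhi in auto)
        then have "(\<lambda>i. M i (hrad0 x) powr q) \<longlonglongrightarrow> M0 (hrad0 x) powr q"
          using q Mnn by (intro tendsto_powr') auto
        then show ?thesis using True vM0[OF True] by (simp add: g_def)
      next
        case False
        then show ?thesis using adm_outside[OF av R False] q by (simp add: g_def)
      qed
      fix i
      show "\<bar>g i x\<bar> \<le> M0 0 powr q"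
      proof -
        have "M i r \<le> M0 0" for r using Mhi[of i r] M0mono[of "min 0 (r - k i)" "r - k i"] M0neg[of "min 0 (r - k i)"] by simp
        then show ?thesis using Mnn q by (auto simp: g_def intro!: powr_mono2)
      qed
      show "g i x = 0" if x: "R1 < norm x"
      proof (cases "norm x < 1")
        case True
        have "\<not> hrad x \<le> b0 + 1" using hrad_le_iff[OF True, of "b0 + 1"] b0 x by (simp add: R1_def)
        then have "b i \<le> hrad x" using k0(2)[of i] by (simp add: b_def)
        then show ?thesis using Mz True q by (simp add: g_def hrad0_def)
      qed (simp add: g_def)
    qed
    also have "(\<integral>x. v x powr q \<partial>hmeas) = (\<integral>x. \<bar>v x\<bar> powr q \<partial>hmeas)" using av by (simp add: adm_def)
    also have "\<dots> = (\<integral>x. \<bar>\<bar>u x\<bar>\<bar> powr q \<partial>hmeas)"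
    proof (rule veq[of "\<lambda>t. \<bar>t\<bar> powr q"])
      show "continuous_on UNIV (\<lambda>t::real. \<bar>t\<bar> powr q)" using q by (intro continuous_on_powr_nonneg continuous_intros) auto
    qed simp
    also have "\<dots> = hint_pow q u" using hint_pow_eq[OF af R q] by simp
    finally show ?thesis unfolding eq .
  qed
  have lim2: "\<forall>\<^sub>F i in sequentially. ?s * integral {0..b i} (\<lambda>r. \<bar>m i r\<bar> powr p * hS ?n r) \<le> hint_grad_pow p u + \<epsilon>" if eps: "\<epsilon> > 0" for \<epsilon>
    using hsup_energy_limsup[OF u af R D(4) p1 eps k0(1) klim]
  proof eventually_elim
    case (elim i)
    let ?h = "sinh (k i / 2) + (k i)\<^sup>2"
    have h0: "?h > 0" using k0(1)[of i] by (simp add: add_pos_pos)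
    have mm: "(\<lambda>x. \<bar>m i (hrad0 x)\<bar> powr p) \<in> borel_measurable (borel :: (real ^ 'n) measure)"
    proof -
      have "m i \<in> borel_measurable borel" by (rule borel_measurable_continuous_onI[OF cm])
      then show ?thesis by measurable
    qed
    define g where "g x = (if norm x < 1 then \<bar>m i (hrad0 x)\<bar> powr p else 0)" for x :: "real ^ 'n"
    have mg: "g \<in> borel_measurable borel" unfolding g_def[abs_def] using mm by measurable
    have iv: "integrable hmeas (\<lambda>x. (hsup ?h w x - w x) powr p)" if "adm L R B w" for w :: "real ^ 'n \<Rightarrow> real"
      by (rule hsup_powr_integrable[OF that R h0 p1])
    have sc: "((hsup ?h w x - w x) / k i) powr p = (hsup ?h w x - w x) powr p / (k i) powr p" for w :: "real ^ 'n \<Rightarrow> real" and x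
      by (rule powr_divide)
    have "?s * integral {0..b i} (\<lambda>r. \<bar>m i r\<bar> powr p * hS ?n r) = (\<integral>x. \<bar>m i (hrad0 (x :: real ^ 'n))\<bar> powr p \<partial>hmeas)"
    proof (rule integral_hmeas_radial[where g="\<lambda>r. \<bar>m i r\<bar> powr p", symmetric])
      show "continuous_on {0..b i} (\<lambda>r. \<bar>m i r\<bar> powr p)"
        using p by (intro continuous_on_powr_nonneg continuous_intros cm) auto
    qed (use mz b_pos[of i] in auto)
    also have "\<dots> = (\<integral>x. g x \<partial>hmeas)" by (rule AE_hmeas_integral_cong[OF mm mg]) (simp add: g_def)
    also have "\<dots> \<le> (\<integral>x. ((hsup ?h v x - v x) / k i) powr p \<partial>hmeas)"
    proof (rule integral_mono')
      show "integrable hmeas (\<lambda>x. ((hsup ?h v x - v x) / k i) powr p)" unfolding sc using iv[OF av] by simp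
      fix x :: "real ^ 'n"
      show "g x \<le> ((hsup ?h v x - v x) / k i) powr p"
      proof (cases "norm x < 1")
        case True
        \<comment> \<open>The competitor y in the supremum lies on the ray of x, at distance k
          nearer to the origin, or at the origin if x is closer than k.\<close>
        let ?r = "hrad0 x" let ?r' = "max 0 (?r - k i)"
        have r0: "0 \<le> ?r" using hrad_nonneg[OF True] True by (simp add: hrad0_def)
        have nx: "norm x = tanh (?r / 2)" using tanh_hrad[OF True] True by (simp add: hrad0_def)
        define e' where "e' = (if x = 0 then e else (1 / norm x) *\<^sub>R x)"
        have e': "norm e' = 1" "x = tanh (?r / 2) *\<^sub>R e'" using e1 by (auto simp: e'_def nx[symmetric])
        define y where "y = tanh (?r' / 2) *\<^sub>R e'"
        have ny: "norm y = tanh (?r' / 2)" using e' by (simp add: y_def)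
        have y1: "norm y < 1" unfolding ny using tanh_half_bounds[of ?r'] by simp
        have "hdel x y = (sinh (?r / 2 - ?r' / 2))\<^sup>2"
          unfolding y_def by (subst e'(2)) (rule hdel_ray[OF e'(1)])
        also have "\<dots> \<le> (sinh (k i / 2))\<^sup>2"
        proof (rule power_mono)
          show "0 \<le> sinh (?r / 2 - ?r' / 2)" using r0 k0(1)[of i] by simp
          show "sinh (?r / 2 - ?r' / 2) \<le> sinh (k i / 2)" using r0 k0(1)[of i] by (auto simp: max_def field_simps)
        qed
        \<comment> \<open>The summand k^2 in the scale provides the strict inequality.\<close>
        also have "\<dots> < ?h\<^sup>2" using k0(1)[of i] by (intro power_strict_mono) auto
        finally have "v y \<le> hsup ?h v x" using hsup_ge[OF av True y1] by simp
        moreover have "v y = M0 (?r - k i)" unfolding M0_def by (rule vrad) (simp only: ny nt)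
        moreover have "v x = M0 ?r" by (rule vM0[OF True])
        ultimately have "(M0 (?r - k i) - M0 ?r) / k i \<le> (hsup ?h v x - v x) / k i" using k0(1)[of i]
          by (intro divide_right_mono) auto
        moreover have "- m i ?r = (M0 (?r - k i) - M0 ?r) / k i" unfolding m_def minus_divide_left by simp
        ultimately have "- m i ?r \<le> (hsup ?h v x - v x) / k i" by simp
        moreover have "\<bar>m i ?r\<bar> = - m i ?r" using radial_profile.mneg[OF rp, of i ?r] by simp
        ultimately show ?thesis using True p by (simp add: g_def powr_mono2)
      qed (simp add: g_def)
    qed simp
    also have "\<dots> = (\<integral>x. (hsup ?h v x - v x) powr p \<partial>hmeas) / (k i) powr p" unfolding sc by simp
    also have "\<dots> \<le> (\<integral>x. (hsup ?h (\<lambda>x. \<bar>u x\<bar>) x - \<bar>u x\<bar>) powr p \<partial>hmeas) / (k i) powr p"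
      using v h0 by (intro divide_right_mono) (auto simp: rearr_def)
    also have "\<dots> = (\<integral>x. ((hsup ?h (\<lambda>x. \<bar>u x\<bar>) x - \<bar>u x\<bar>) / k i) powr p \<partial>hmeas)"
      unfolding sc[of "\<lambda>x. \<bar>u x\<bar>"] by simp
    finally show ?case using elim by simp
  qed
  have lim3: "\<forall>\<^sub>F i in sequentially. ?s * hF ?n (b i) \<le> hvol (supp u) + \<epsilon>" if "\<epsilon> > 0" for \<epsilon>
  proof -
    have "(\<lambda>i. b0 + k i) \<longlonglongrightarrow> b0 + 0" by (intro tendsto_intros klim)
    then have "(\<lambda>i. hF ?n (b i)) \<longlonglongrightarrow> hF ?n (b0 + 0)" unfolding b_def
      using hF_deriv[of ?n] DERIV_isCont by (intro isCont_tendsto_compose[of _ "hF ?n"]) blast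
    then have "(\<lambda>i. ?s * hF ?n (b i)) \<longlonglongrightarrow> ?s * hF ?n (b0 + 0)" by (intro tendsto_intros)
    then have "\<forall>\<^sub>F i in sequentially. ?s * hF ?n (b i) < hvol (supp u) + \<epsilon>"
      by (rule order_tendstoD(2)) (use vol that in simp)
    then show ?thesis by (rule eventually_mono) simp
  qed
  show ?thesis by (rule that[OF rp m0 lim1 lim2 MM lim3])
qed


subsection \<open>The Poincare deficit\<close>

definition hdeficit :: "real \<Rightarrow> (real ^ 'n \<Rightarrow> real) \<Rightarrow> real" where
  "hdeficit p u = hint_grad_pow p u - ((real CARD('n) - 1) / p) powr p * hint_pow p u"

text \<open>\<open>energy_deficit\<close> applied to each profile; the L^p integrals converge while
  the gradient energies are bounded only up to e, so the error is shared between the two.\<close>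

theorem radial_approximation_deficit:
  fixes u :: "real ^ 'n \<Rightarrow> real"
  assumes u: "u \<in> C0_inf_ball" and ok: "okp CARD('n) p"
  obtains M m :: "nat \<Rightarrow> real \<Rightarrow> real" and b :: "nat \<Rightarrow> real" where
    "\<And>i. radial_profile CARD('n) p (b i) (M i) (m i)" "\<And>i. m i 0 = 0"
    "\<And>q. q > 0 \<Longrightarrow> (\<lambda>i. ballvol TYPE('n) * real CARD('n) * integral {0..b i} (\<lambda>r. M i r powr q * hS CARD('n) r)) \<longlonglongrightarrow> hint_pow q u"
    "\<And>e. e > 0 \<Longrightarrow> \<forall>\<^sub>F i in sequentially. ballvol TYPE('n) * real CARD('n) * integral {0..b i} (radial_profile.eE CARD('n) p (m i)) \<le> hdeficit p u + e"
    "\<And>i x. \<bar>u x\<bar> \<le> M i 0"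
    "\<And>e. e > 0 \<Longrightarrow> \<forall>\<^sub>F i in sequentially. ballvol TYPE('n) * real CARD('n) * hF CARD('n) (b i) \<le> hvol (supp u) + e"
proof -
  have n2: "CARD('n) \<ge> 2" and p: "p > 1" using ok by (auto simp: okp_def)
  let ?s = "ballvol TYPE('n) * real CARD('n)"
  have s0: "?s > 0" using ballvol_pos[where 'n='n] by simp
  obtain M m b where rp: "\<And>i. radial_profile CARD('n) p (b i) (M i) (m i)" and m0: "\<And>i. m i 0 = 0"
    and l1: "\<And>q. q > 0 \<Longrightarrow> (\<lambda>i. ?s * integral {0..b i} (\<lambda>r. M i r powr q * hS CARD('n) r)) \<longlonglongrightarrow> hint_pow q u"
    and l2: "\<And>e. e > 0 \<Longrightarrow> \<forall>\<^sub>F i in sequentially. ?s * integral {0..b i} (\<lambda>r. \<bar>m i r\<bar> powr p * hS CARD('n) r) \<le> hint_grad_pow p u + e"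
    and MM: "\<And>i x. \<bar>u x\<bar> \<le> M i 0"
    and l3: "\<And>e. e > 0 \<Longrightarrow> \<forall>\<^sub>F i in sequentially. ?s * hF CARD('n) (b i) \<le> hvol (supp u) + e"
    by (rule radial_approximation[OF u n2 p]) blast
  let ?k = "((real CARD('n) - 1) / p) powr p"
  have l2': "\<forall>\<^sub>F i in sequentially. ?s * integral {0..b i} (radial_profile.eE CARD('n) p (m i)) \<le> hdeficit p u + e" if e: "e > 0" for e
  proof -
    have "(\<lambda>i. ?k * (?s * integral {0..b i} (\<lambda>r. M i r powr p * hS CARD('n) r))) \<longlonglongrightarrow> ?k * hint_pow p u"
      using p by (intro tendsto_intros l1) simp
    then have "\<forall>\<^sub>F i in sequentially. ?k * hint_pow p u - e / 2 < ?k * (?s * integral {0..b i} (\<lambda>r. M i r powr p * hS CARD('n) r))"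
      by (rule order_tendstoD(1)) (use e in simp)
    moreover have "\<forall>\<^sub>F i in sequentially. ?s * integral {0..b i} (\<lambda>r. \<bar>m i r\<bar> powr p * hS CARD('n) r) \<le> hint_grad_pow p u + e / 2"
      using e by (intro l2) simp
    ultimately show ?thesis
    proof eventually_elim
      case (elim i)
      have "?s * (integral {0..b i} (radial_profile.eE CARD('n) p (m i)) + ?k * integral {0..b i} (\<lambda>r. M i r powr p * hS CARD('n) r))
        \<le> ?s * integral {0..b i} (\<lambda>r. \<bar>m i r\<bar> powr p * hS CARD('n) r)"
        using radial_profile.energy_deficit[OF rp ok, of i] s0 by (intro mult_left_mono) auto
      then have "?s * integral {0..b i} (radial_profile.eE CARD('n) p (m i)) + ?k * (?s * integral {0..b i} (\<lambda>r. M i r powr p * hS CARD('n) r))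
        \<le> ?s * integral {0..b i} (\<lambda>r. \<bar>m i r\<bar> powr p * hS CARD('n) r)"
        by (simp only: distrib_left mult.left_commute mult.commute)
      then show ?case using elim by (simp only: hdeficit_def)
    qed
  qed
  show ?thesis by (rule that[OF rp m0 l1 l2' MM l3])
qed

lemma le_of_eps:
  fixes a c :: real and f :: "real \<Rightarrow> real"
  assumes "(f \<longlongrightarrow> c) (at_right 0)" "\<And>e. e > 0 \<Longrightarrow> a \<le> f e"
  shows "a \<le> c"
proof (rule tendsto_lowerbound[OF assms(1)])
  show "\<forall>\<^sub>F e in at_right 0. a \<le> f e" using assms(2) by (simp add: eventually_at_filter)
qed simp

lemma hdeficit_nonneg:
  fixes u :: "real ^ 'n \<Rightarrow> real"
  assumes u: "u \<in> C0_inf_ball" and ok: "okp CARD('n) p"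
  shows "0 \<le> hdeficit p u"
proof -
  obtain M m b where rp: "\<And>i. radial_profile CARD('n) p (b i) (M i) (m i)"
    and l2: "\<And>e. e > 0 \<Longrightarrow> \<forall>\<^sub>F i in sequentially. ballvol TYPE('n) * real CARD('n) * integral {0..b i} (radial_profile.eE CARD('n) p (m i)) \<le> hdeficit p u + e"
    by (rule radial_approximation_deficit[OF u ok]) blast
  have "0 \<le> hdeficit p u + e" if e: "e > 0" for e
  proof -
    obtain i where "ballvol TYPE('n) * real CARD('n) * integral {0..b i} (radial_profile.eE CARD('n) p (m i)) \<le> hdeficit p u + e"
      using eventually_happens[OF l2[OF e]] by auto
    moreover have "0 \<le> ballvol TYPE('n) * real CARD('n) * integral {0..b i} (radial_profile.eE CARD('n) p (m i))"
      using radial_profile.eE_integral_nonneg[OF rp, of 0 i] ballvol_pos[where 'n='n] by simp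
    ultimately show ?thesis by simp
  qed
  then show ?thesis using field_le_epsilon by blast
qed

text \<open>For n >= 3 the threshold 2n/(n-1) is at most n. For n = 2 it is 4, and the alternative
  disjunct of \<open>okp\<close> takes over.\<close>

lemma okp_gt: "n \<ge> 2 \<Longrightarrow> p > real n \<Longrightarrow> okp n p"
proof -
  assume n: "n \<ge> 2" and p: "p > real n"
  show ?thesis
  proof (cases "n = 2")
    case False
    then have "real n - 1 \<ge> 2" using n by simp
    then have "real n * 2 \<le> real n * (real n - 1)" by (intro mult_left_mono) auto
    then have "2 * real n / (real n - 1) \<le> real n" using n by (simp add: divide_le_eq mult.commute)
    then show ?thesis using n p by (auto simp: okp_def)
  qed (use n p in \<open>auto simp: okp_def\<close>)
qed

text \<open>\<open>morrey_bound\<close> at radius b already contains the volume of the ball of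
  radius b, which is at most that of the support of u up to e. The top value of each profile
  dominates the sup norm, so no convergence of the profiles is needed.\<close>

theorem poincare_morrey_sobolev:
  fixes u :: "real ^ 'n \<Rightarrow> real"
  assumes u: "u \<in> C0_inf_ball" and n: "CARD('n) \<ge> 2" and p: "p > real CARD('n)"
  shows "sup_norm u powr p \<le> bconst TYPE('n) p powr p * hvol (supp u) powr ((p - real CARD('n)) / real CARD('n)) * hdeficit p u"
proof -
  let ?N = "real CARD('n)" let ?\<sigma> = "ballvol TYPE('n)" let ?s = "?\<sigma> * ?N"
  let ?c = "((p - 1) / (p - ?N)) powr (p - 1)" let ?a = "(p - ?N) / ?N"
  have N: "?N \<ge> 2" "?N > 0" using n by auto
  have \<sigma>: "?\<sigma> > 0" by (rule ballvol_pos)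
  have ok: "okp CARD('n) p" by (rule okp_gt[OF n p])
  obtain M m b where rp: "\<And>i. radial_profile CARD('n) p (b i) (M i) (m i)"
    and l2: "\<And>e. e > 0 \<Longrightarrow> \<forall>\<^sub>F i in sequentially. ?s * integral {0..b i} (radial_profile.eE CARD('n) p (m i)) \<le> hdeficit p u + e"
    and MM: "\<And>i x. \<bar>u x\<bar> \<le> M i 0"
    and l3: "\<And>e. e > 0 \<Longrightarrow> \<forall>\<^sub>F i in sequentially. ?s * hF CARD('n) (b i) \<le> hvol (supp u) + e"
    by (rule radial_approximation_deficit[OF u ok]) blast
  have bd: "sup_norm u powr p \<le> (hdeficit p u + e) / ?s * (?c * ((hvol (supp u) + e) / ?\<sigma>) powr ?a)" if e: "e > 0" for e
  proof -
    obtain i where i: "?s * integral {0..b i} (radial_profile.eE CARD('n) p (m i)) \<le> hdeficit p u + e" "?s * hF CARD('n) (b i) \<le> hvol (supp u) + e"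
      using eventually_happens[OF eventually_conj[OF l2[OF e] l3[OF e]]] by auto
    have b0: "b i > 0" using rp[of i] by (simp add: radial_profile_def)
    have "sup_norm u \<le> M i 0" unfolding sup_norm_def using MM by (intro cSUP_least) auto
    moreover have "0 \<le> sup_norm u" unfolding sup_norm_def
      using MM[of _ i] by (intro cSUP_upper2[of _ _ 0]) (auto intro!: bdd_aboveI)
    ultimately have "sup_norm u powr p \<le> M i 0 powr p" using p N by (intro powr_mono2) auto
    also have "\<dots> \<le> integral {0..b i} (radial_profile.eE CARD('n) p (m i)) * (?c * (?N * hF CARD('n) (b i)) powr ?a)"
      by (rule radial_profile.morrey_bound[OF rp p])
    also have "\<dots> \<le> (hdeficit p u + e) / ?s * (?c * ((hvol (supp u) + e) / ?\<sigma>) powr ?a)"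
    proof (intro mult_mono powr_mono2)
      show "integral {0..b i} (radial_profile.eE CARD('n) p (m i)) \<le> (hdeficit p u + e) / ?s"
        using i(1) \<sigma> N by (simp add: pos_le_divide_eq mult.commute)
      show "?N * hF CARD('n) (b i) \<le> (hvol (supp u) + e) / ?\<sigma>" using i(2) \<sigma> by (simp add: pos_le_divide_eq mult_ac)
      show "0 \<le> (hdeficit p u + e) / ?s" using hdeficit_nonneg[OF u ok] e \<sigma> N by simp
    qed (use p N hF_nonneg[of "b i" "CARD('n)"] b0 in auto)
    finally show ?thesis .
  qed
  have "((\<lambda>e. (hdeficit p u + e) / ?s * (?c * ((hvol (supp u) + e) / ?\<sigma>) powr ?a)) \<longlongrightarrow>
     (hdeficit p u + 0) / ?s * (?c * ((hvol (supp u) + 0) / ?\<sigma>) powr ?a)) (at_right 0)"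
  proof (intro tendsto_intros tendsto_powr')
    show "(hvol (supp u) + 0) / ?\<sigma> \<noteq> 0 \<or> 0 < ?a \<and> (\<forall>\<^sub>F e in at_right 0. 0 \<le> (hvol (supp u) + e) / ?\<sigma>)"
      using p N \<sigma> hvol_nonneg[of "supp u"] by (auto simp: eventually_at_filter)
  qed (use \<sigma> N in auto)
  from le_of_eps[OF this bd]
  have "sup_norm u powr p \<le> hdeficit p u / ?s * (?c * (hvol (supp u) / ?\<sigma>) powr ?a)" by simp
  also have "\<dots> = bconst TYPE('n) p powr p * hvol (supp u) powr ?a * hdeficit p u"
  proof -
    have p0: "p > 0" "p - 1 > 0" "p - ?N > 0" using p N by auto
    have "bconst TYPE('n) p powr p = ?N powr (-1 / p * p) * ?\<sigma> powr (-1 / ?N * p) * ((p - 1) / (p - ?N)) powr ((p - 1) / p * p)"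
      unfolding bconst_def Let_def by (simp only: powr_mult powr_powr)
    also have "\<dots> = ?N powr (- 1) * ?\<sigma> powr (- 1 - ?a) * ?c"
    proof -
      have "-1 / p * p = -1" "(p - 1) / p * p = p - 1" using p0 by auto
      \<comment> \<open>One power of the ball volume normalises the energy, and the remaining (p -
        n)/n turn \<open>hF\<close> into a hyperbolic volume.\<close>
      moreover have "-1 / ?N * p = -1 - ?a" using N by (simp add: field_simps)
      ultimately show ?thesis by (simp only:)
    qed
    also have "\<dots> = 1 / ?N * (1 / ?\<sigma> * (1 / ?\<sigma> powr ?a)) * ?c"
      using \<sigma> N by (simp add: powr_diff powr_minus_divide)
    finally have b: "bconst TYPE('n) p powr p = 1 / ?N * (1 / ?\<sigma> * (1 / ?\<sigma> powr ?a)) * ?c" .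
    show ?thesis unfolding b powr_divide[of "hvol (supp u)"] by (simp add: mult_ac)
  qed
  finally show ?thesis .
qed

text \<open>The constant produced by \<open>sobolev_bound\<close>. No sharpness is sought: it serves
  to show that some Gagliardo-Nirenberg constant exists.\<close>

definition sob :: "nat \<Rightarrow> real \<Rightarrow> real" where
  "sob n p = (((p - 1) / (real n - p)) powr (p - 1)) powr (p / (real n - p)) * (p / (real n - p)) powr p"

lemma hyperbolic_sobolev:
  fixes u :: "real ^ 'n \<Rightarrow> real"
  assumes u: "u \<in> C0_inf_ball" and ok: "okp CARD('n) p" and p: "p < real CARD('n)"
  shows "hint_pow (real CARD('n) * p / (real CARD('n) - p)) u
    \<le> ballvol TYPE('n) * real CARD('n) * sob CARD('n) p * (hint_grad_pow p u / (ballvol TYPE('n) * real CARD('n))) powr (real CARD('n) / (real CARD('n) - p))"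
proof -
  let ?N = "real CARD('n)" let ?s = "ballvol TYPE('n) * ?N" let ?q = "?N * p / (?N - p)" let ?t = "?N / (?N - p)"
  have p1: "p > 1" using ok by (simp add: okp_def)
  have q0: "?q > 0" using p p1 by simp
  have t0: "?t > 0" using p p1 by simp
  have s0: "?s > 0" using ballvol_pos[where 'n='n] by simp
  obtain M m b where rp: "\<And>i. radial_profile CARD('n) p (b i) (M i) (m i)"
    and l1: "\<And>q. q > 0 \<Longrightarrow> (\<lambda>i. ?s * integral {0..b i} (\<lambda>r. M i r powr q * hS CARD('n) r)) \<longlonglongrightarrow> hint_pow q u"
    and l2: "\<And>e. e > 0 \<Longrightarrow> \<forall>\<^sub>F i in sequentially. ?s * integral {0..b i} (radial_profile.eE CARD('n) p (m i)) \<le> hdeficit p u + e"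
    by (rule radial_approximation_deficit[OF u ok]) blast
  obtain L R B where D: "R < 1" "adm L R B (\<lambda>x. \<bar>u x\<bar>)" by (rule C0_inf_ball_data[OF u]) blast
  have hp: "0 \<le> hint_pow p u" using hint_pow_eq[OF D(2,1), of p] p1 by simp
  then have dl: "hdeficit p u \<le> hint_grad_pow p u" by (simp add: hdeficit_def)
  have nn: "0 \<le> hdeficit p u" by (rule hdeficit_nonneg[OF u ok])
  have bd: "hint_pow ?q u \<le> ?s * sob CARD('n) p * ((hint_grad_pow p u + e) / ?s) powr ?t" if e: "e > 0" for e
  proof (rule tendsto_upperbound[OF l1[OF q0]])
    show "\<forall>\<^sub>F i in sequentially. ?s * integral {0..b i} (\<lambda>r. M i r powr ?q * hS CARD('n) r) \<le> ?s * sob CARD('n) p * ((hint_grad_pow p u + e) / ?s) powr ?t"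
      using l2[OF e]
    proof eventually_elim
      case (elim i)
      have "integral {0..b i} (radial_profile.eE CARD('n) p (m i)) \<le> (hint_grad_pow p u + e) / ?s"
        using elim dl s0 by (simp add: pos_le_divide_eq mult.commute)
      then have "integral {0..b i} (radial_profile.eE CARD('n) p (m i)) powr ?t \<le> ((hint_grad_pow p u + e) / ?s) powr ?t"
        using radial_profile.eE_integral_nonneg[OF rp, of 0 i] t0 by (intro powr_mono2) auto
      then have "integral {0..b i} (\<lambda>r. M i r powr ?q * hS CARD('n) r) \<le> sob CARD('n) p * ((hint_grad_pow p u + e) / ?s) powr ?t"
        using radial_profile.sobolev_bound[OF rp p, of i] unfolding sob_def[symmetric]
        by (elim order_trans) (auto intro!: mult_left_mono simp: sob_def)
      then show ?case using s0 by (simp add: mult.assoc mult_left_mono)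
    qed
  qed simp
  have "((\<lambda>e. ?s * sob CARD('n) p * ((hint_grad_pow p u + e) / ?s) powr ?t) \<longlongrightarrow> ?s * sob CARD('n) p * ((hint_grad_pow p u + 0) / ?s) powr ?t) (at_right 0)"
  proof (intro tendsto_intros tendsto_powr')
    show "(hint_grad_pow p u + 0) / ?s \<noteq> 0 \<or> 0 < ?t \<and> (\<forall>\<^sub>F e in at_right 0. 0 \<le> (hint_grad_pow p u + e) / ?s)"
      using t0 s0 nn dl by (auto simp: eventually_at_filter)
  qed (use s0 in auto)
  from le_of_eps[OF this bd] show ?thesis by simp
qed


subsection \<open>Mollification\<close>

lemma integrable_compact_support:
  fixes f :: "real ^ 'n \<Rightarrow> 'b::{banach, second_countable_topology}"
  assumes f: "continuous_on UNIV f" and z: "\<And>x. norm x > R \<Longrightarrow> f x = 0"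
  shows "integrable lborel f"
proof -
  have "integrable lborel (\<lambda>x. indicator (cball 0 R) x *\<^sub>R f x)"
    using f by (intro borel_integrable_compact) (auto intro: continuous_on_subset)
  moreover have "(\<lambda>x. indicator (cball 0 R) x *\<^sub>R f x) = f" using z by (auto simp: indicator_def)
  ultimately show ?thesis by simp
qed

lemma integral_UNIV_eq_lborel:
  fixes f :: "real ^ 'n \<Rightarrow> real"
  assumes f: "continuous_on UNIV f" and z: "\<And>x. norm x > R \<Longrightarrow> f x = 0"
  shows "integral UNIV f = (\<integral>x. f x \<partial>lborel)" "f integrable_on UNIV"
proof -
  have i: "set_integrable lborel UNIV f"
    using integrable_compact_support[OF assms] by (simp add: set_integrable_def)
  from set_borel_integral_eq_integral[OF i] show "integral UNIV f = (\<integral>x. f x \<partial>lborel)" "f integrable_on UNIV"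
    by (auto simp: set_lebesgue_integral_def)
qed

lemma lborel_integral_scale:
  fixes f :: "real ^ 'n \<Rightarrow> real"
  assumes f: "f \<in> borel_measurable borel" and c: "c > 0"
  shows "(\<integral>x. f x \<partial>lborel) = c ^ CARD('n) * (\<integral>x. f (c *\<^sub>R x) \<partial>lborel)"
proof -
  have "(\<integral>x. f x \<partial>lborel) = (\<integral>x. f x \<partial>(density (distr lborel borel (\<lambda>x :: real ^ 'n. 0 + c *\<^sub>R x)) (\<lambda>_. ennreal (\<bar>c\<bar> ^ DIM(real ^ 'n)))))"
    using lborel_affine[of c "0 :: real ^ 'n"] c by simp
  also have "\<dots> = (\<integral>x. (\<bar>c\<bar> ^ DIM(real ^ 'n)) *\<^sub>R f x \<partial>(distr lborel borel (\<lambda>x :: real ^ 'n. 0 + c *\<^sub>R x)))"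
    using f by (intro integral_density) auto
  also have "\<dots> = (\<integral>x. (\<bar>c\<bar> ^ DIM(real ^ 'n)) *\<^sub>R f (0 + c *\<^sub>R x) \<partial>lborel)"
    using f by (intro integral_distr) auto
  finally show ?thesis using c by simp
qed

lemma lborel_integral_reflect:
  fixes f :: "real ^ 'n \<Rightarrow> real"
  assumes f: "f \<in> borel_measurable borel"
  shows "(\<integral>z. f (x - z) \<partial>lborel) = (\<integral>z. f z \<partial>lborel)"
proof -
  have "(\<integral>x. f x \<partial>lborel) = (\<integral>x. f x \<partial>(density (distr lborel borel (\<lambda>z :: real ^ 'n. x + (-1) *\<^sub>R z)) (\<lambda>_. ennreal (\<bar>-1\<bar> ^ DIM(real ^ 'n)))))"
    using lborel_affine[of "-1" x] by simp
  also have "\<dots> = (\<integral>x. (\<bar>-1\<bar> ^ DIM(real ^ 'n)) *\<^sub>R f x \<partial>(distr lborel borel (\<lambda>z :: real ^ 'n. x + (-1) *\<^sub>R z)))"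
    using f by (intro integral_density) auto
  also have "\<dots> = (\<integral>z. (\<bar>-1\<bar> ^ DIM(real ^ 'n)) *\<^sub>R f (x + (-1) *\<^sub>R z) \<partial>lborel)"
    using f by (intro integral_distr) auto
  finally show ?thesis by simp
qed

lemma uniformly_continuous_compact_support:
  fixes g :: "real ^ 'n \<Rightarrow> 'b::real_normed_vector"
  assumes g: "continuous_on UNIV g" and z: "\<And>x. norm x > R \<Longrightarrow> g x = 0" and e: "e > 0"
  obtains d where "d > 0" "\<And>x y. norm (x - y) < d \<Longrightarrow> norm (g x - g y) \<le> e"
proof -
  have "uniformly_continuous_on (cball 0 (R + 1)) g"
    using g by (intro compact_uniformly_continuous) (auto intro: continuous_on_subset)
  then obtain d where d: "d > 0" "\<And>x y. x \<in> cball 0 (R + 1) \<Longrightarrow> y \<in> cball 0 (R + 1) \<Longrightarrow> dist y x < d \<Longrightarrow> dist (g y) (g x) < e"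
    using e unfolding uniformly_continuous_on_def by metis
  have "norm (g x - g y) \<le> e" if xy: "norm (x - y) < min d 1" for x y
  proof (cases "norm x \<le> R + 1 \<and> norm y \<le> R + 1")
    case True
    then show ?thesis using d(2)[of y x] xy by (simp add: dist_norm less_imp_le)
  next
    case False
    have "\<bar>norm x - norm y\<bar> \<le> norm (x - y)" by (rule norm_triangle_ineq3)
    then have "norm x > R" "norm y > R" using False xy by auto
    then show ?thesis using z e by simp
  qed
  then show ?thesis using that[of "min d 1"] d(1) by simp
qed

definition conv :: "(real ^ 'n \<Rightarrow> real) \<Rightarrow> (real ^ 'n \<Rightarrow> real) \<Rightarrow> real ^ 'n \<Rightarrow> real" where
  "conv a k x = (\<integral>z. a z * k (x - z) \<partial>lborel)"

lemma conv_commute: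
  assumes "a \<in> borel_measurable borel" "k \<in> borel_measurable borel"
  shows "conv a k = conv k a"
proof
  fix x
  show "conv a k x = conv k a x" unfolding conv_def
    using lborel_integral_reflect[of "\<lambda>z. a z * k (x - z)" x] assms by (simp add: mult.commute)
qed

text \<open>The derivative falls on \<open>k\<close>, while \<open>a\<close> is only continuous.
  Uniform continuity of the gradient of \<open>k\<close> makes its first-order error uniform in the
  base point, so it can be integrated against |a|.\<close>

lemma conv_c1:
  fixes a k :: "real ^ 'n \<Rightarrow> real"
  assumes a: "continuous_on UNIV a" "\<And>x. norm x > R \<Longrightarrow> a x = 0"
    and k: "c1 k g" "\<And>x. norm x > S \<Longrightarrow> k x = 0"
  shows "c1 (conv a k) (\<lambda>x. \<integral>z. a z *\<^sub>R g (x - z) \<partial>lborel)"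
proof -
  have gc: "continuous_on UNIV g" using k by (simp add: c1_def)
  have gz: "g x = 0" if "norm x > S" for x by (rule c1_zero_outside[OF k that])
  define A where "A = (\<integral>z. \<bar>a z\<bar> \<partial>lborel)"
  have A0: "A \<ge> 0" by (simp add: A_def)
  have ia: "integrable lborel (\<lambda>z. \<bar>a z\<bar>)" by (rule integrable_compact_support[where R=R]) (use a in \<open>auto intro!: continuous_intros\<close>)
  have cc: "continuous_on UNIV (\<lambda>z. a z *\<^sub>R w (x - z))" if "continuous_on UNIV w" for w :: "real ^ 'n \<Rightarrow> 'c::real_normed_vector" and x
    by (intro continuous_intros a continuous_on_compose2[OF that]) auto
  have iw: "integrable lborel (\<lambda>z. a z *\<^sub>R w (x - z))" if "continuous_on UNIV w"
    for w :: "real ^ 'n \<Rightarrow> 'c::{banach, second_countable_topology}" and x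
    by (rule integrable_compact_support[where R=R, OF cc[OF that]]) (use a in simp)
  have ik: "integrable lborel (\<lambda>z. a z * k (x - z))" for x using iw[OF c1_cont[OF k(1)], of x] by simp
  define G where "G x = (\<integral>z. a z *\<^sub>R g (x - z) \<partial>lborel)" for x
  have "(conv a k has_derivative (\<lambda>h. G x \<bullet> h)) (at x)" for x
    unfolding has_derivative_at_alt
  proof (intro conjI allI impI)
    show "bounded_linear (\<lambda>h. G x \<bullet> h)" by (rule bounded_linear_inner_right)
    fix e :: real assume e: "e > 0"
    define e' where "e' = e / (A + 1)"
    have e': "e' > 0" "e' * A \<le> e" using e A0 by (auto simp: e'_def field_simps)
    obtain d where d: "d > 0" "\<And>x y. norm (x - y) < d \<Longrightarrow> norm (g x - g y) \<le> e'"
      by (rule uniformly_continuous_compact_support[OF gc gz e'(1)]) auto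
    \<comment> \<open>Mean value inequality for k minus its linear part at y; the derivative of that
      difference is small throughout the ball of radius d.\<close>
    have lin: "\<bar>k (y + h) - k y - g y \<bullet> h\<bar> \<le> e' * norm h" if h: "norm h < d" for y h
    proof -
      have "norm ((k (y + h) - g y \<bullet> (y + h)) - (k y - g y \<bullet> y)) \<le> e' * norm ((y + h) - y)"
      proof (rule differentiable_bound[where S="ball y d" and f'="\<lambda>z h. g z \<bullet> h - g y \<bullet> h"])
        show "((\<lambda>z. k z - g y \<bullet> z) has_derivative (\<lambda>h. g z \<bullet> h - g y \<bullet> h)) (at z within ball y d)" for z
        proof (rule has_derivative_diff)
          show "(k has_derivative (\<lambda>h. g z \<bullet> h)) (at z within ball y d)"
            using k(1) by (auto simp: c1_def intro: has_derivative_at_withinI)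
          show "((\<lambda>z. g y \<bullet> z) has_derivative (\<lambda>h. g y \<bullet> h)) (at z within ball y d)"
            by (rule bounded_linear_imp_has_derivative[OF bounded_linear_inner_right])
        qed
        show "onorm (\<lambda>h. g z \<bullet> h - g y \<bullet> h) \<le> e'" if "z \<in> ball y d" for z
        proof (rule onorm_le)
          fix h
          have "norm (g z \<bullet> h - g y \<bullet> h) \<le> norm (g z - g y) * norm h"
            unfolding inner_diff_left[symmetric] using Cauchy_Schwarz_ineq2 by simp
          also have "\<dots> \<le> e' * norm h" using d(2)[of z y] that by (intro mult_right_mono) (auto simp: dist_norm norm_minus_commute)
          finally show "norm (g z \<bullet> h - g y \<bullet> h) \<le> e' * norm h" .
        qed
      qed (use h d in \<open>auto simp: dist_norm\<close>)
      then show ?thesis by (simp add: inner_add_right algebra_simps)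
    qed
    show "\<exists>d>0. \<forall>y. norm (y - x) < d \<longrightarrow> norm (conv a k y - conv a k x - G x \<bullet> (y - x)) \<le> e * norm (y - x)"
    proof (intro exI[of _ d] conjI allI impI d(1))
      fix y assume y: "norm (y - x) < d"
      let ?h = "y - x"
      have iG: "integrable lborel (\<lambda>z. (a z *\<^sub>R g (x - z)) \<bullet> ?h)" using iw[OF gc, of x] by (intro integrable_inner_left)
      have Gh: "G x \<bullet> ?h = (\<integral>z. (a z *\<^sub>R g (x - z)) \<bullet> ?h \<partial>lborel)"
        unfolding G_def using iw[OF gc, of x] by (intro integral_inner_left[symmetric])
      have "conv a k y - conv a k x - G x \<bullet> ?h = (\<integral>z. a z * k (y - z) - a z * k (x - z) - (a z *\<^sub>R g (x - z)) \<bullet> ?h \<partial>lborel)"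
        unfolding conv_def Gh using ik[of x] ik[of y] iG
        by (simp only: Bochner_Integration.integral_diff Bochner_Integration.integrable_diff)
      also have "norm \<dots> \<le> (\<integral>z. \<bar>a z\<bar> * (e' * norm ?h) \<partial>lborel)"
      proof (rule order_trans[OF integral_norm_bound integral_mono])
        show "integrable lborel (\<lambda>z. norm (a z * k (y - z) - a z * k (x - z) - (a z *\<^sub>R g (x - z)) \<bullet> ?h))"
          using ik iG by (intro integrable_norm Bochner_Integration.integrable_diff)
        show "integrable lborel (\<lambda>z. \<bar>a z\<bar> * (e' * norm ?h))" using ia by simp
        fix z
        have "a z * k (y - z) - a z * k (x - z) - (a z *\<^sub>R g (x - z)) \<bullet> ?h = a z * (k ((x - z) + ?h) - k (x - z) - g (x - z) \<bullet> ?h)"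
          by (simp add: algebra_simps)
        then show "norm (a z * k (y - z) - a z * k (x - z) - (a z *\<^sub>R g (x - z)) \<bullet> ?h) \<le> \<bar>a z\<bar> * (e' * norm ?h)"
          using lin[OF y, of "x - z"] by (simp add: abs_mult mult_left_mono)
      qed
      also have "\<dots> = e' * A * norm ?h" by (simp add: A_def)
      also have "\<dots> \<le> e * norm ?h" using e' by (intro mult_right_mono) auto
      finally show "norm (conv a k y - conv a k x - G x \<bullet> ?h) \<le> e * norm ?h" .
    qed
  qed
  moreover have "continuous_on UNIV G"
  proof (rule continuous_onI)
    fix x :: "real ^ 'n" and e :: real assume e: "e > 0"
    define e' where "e' = e / (A + 1)"
    have e': "e' > 0" "e' * A \<le> e" using e A0 by (auto simp: e'_def field_simps)
    obtain d where d: "d > 0" "\<And>x y. norm (x - y) < d \<Longrightarrow> norm (g x - g y) \<le> e'"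
      by (rule uniformly_continuous_compact_support[OF gc gz e'(1)]) auto
    have "dist (G y) (G x) \<le> e" if y: "dist y x < d" for y
    proof -
      have "G y - G x = (\<integral>z. a z *\<^sub>R g (y - z) - a z *\<^sub>R g (x - z) \<partial>lborel)" unfolding G_def using iw[OF gc] by simp
      also have "norm \<dots> \<le> (\<integral>z. \<bar>a z\<bar> * e' \<partial>lborel)"
      proof (rule order_trans[OF integral_norm_bound integral_mono])
        show "integrable lborel (\<lambda>z. norm (a z *\<^sub>R g (y - z) - a z *\<^sub>R g (x - z)))"
          using iw[OF gc] by (intro integrable_norm Bochner_Integration.integrable_diff)
        show "integrable lborel (\<lambda>z. \<bar>a z\<bar> * e')" using ia by simp
        fix z
        have "norm (a z *\<^sub>R g (y - z) - a z *\<^sub>R g (x - z)) = \<bar>a z\<bar> * norm (g (y - z) - g (x - z))"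
          by (simp add: scaleR_diff_right[symmetric])
        then show "norm (a z *\<^sub>R g (y - z) - a z *\<^sub>R g (x - z)) \<le> \<bar>a z\<bar> * e'"
          using d(2)[of "y - z" "x - z"] y by (simp add: dist_norm mult_left_mono)
      qed
      also have "\<dots> = e' * A" by (simp add: A_def)
      finally show ?thesis using e' by (simp add: dist_norm)
    qed
    then show "\<exists>d>0. \<forall>x'\<in>UNIV. dist x' x < d \<longrightarrow> dist (G x') (G x) \<le> e" using d(1) by blast
  qed
  ultimately show ?thesis unfolding c1_def G_def by simp
qed

lemma c1_partial: "c1 u g \<Longrightarrow> frechet_derivative u (at x) (axis i 1) = g x $ i"
proof -
  assume "c1 u g"
  then have "g x $ i = grad u x $ i" by (simp add: c1_grad)
  then show ?thesis by (simp add: grad_def)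
qed

lemma C0_inf_support:
  assumes "u \<in> C0_inf"
  obtains R where "0 \<le> R" "\<And>x. norm x > R \<Longrightarrow> u x = 0"
proof -
  have "bounded (supp u)" using assms by (auto simp: C0_inf_def compact_imp_bounded)
  then obtain R where R: "\<And>x. x \<in> supp u \<Longrightarrow> norm x \<le> R" by (auto simp: bounded_iff)
  have "u x = 0" if "norm x > max 0 R" for x
  proof (rule ccontr)
    assume "u x \<noteq> 0"
    then have "x \<in> supp u" using closure_subset[of "{x. u x \<noteq> 0}"] by (auto simp: supp_def)
    then show False using R[of x] that by simp
  qed
  then show ?thesis using that[of "max 0 R"] by simp
qed

lemma C0_infI:
  assumes "smooth u" "\<And>x. norm x > R \<Longrightarrow> u x = 0"
  shows "u \<in> C0_inf"
proof -
  have "supp u \<subseteq> cball 0 R" unfolding supp_def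
    using assms(2) by (intro closure_minimal) (force simp: not_le[symmetric])+
  then have "bounded (supp u)" using bounded_cball bounded_subset by blast
  then have "compact (supp u)" unfolding compact_eq_bounded_closed by (simp add: supp_def)
  then show ?thesis using assms by (simp add: C0_inf_def)
qed

lemma C0_inf_partial:
  fixes u :: "real ^ 'n \<Rightarrow> real"
  assumes u: "u \<in> C0_inf"
  shows "(\<lambda>x. frechet_derivative u (at x) (axis i 1)) \<in> C0_inf"
proof -
  have sm: "smooth u" using u by (simp add: C0_inf_def)
  obtain R where R: "\<And>x. norm x > R \<Longrightarrow> u x = 0" by (rule C0_inf_support[OF u]) blast
  have c: "c1 u (grad u)" by (rule smooth_c1[OF sm])
  show ?thesis
  proof (rule C0_infI[of _ R])
    have "Ck k (\<lambda>x. frechet_derivative u (at x) (axis i 1))" for k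
      using sm unfolding smooth_def by (metis Ck.simps(2))
    then show "smooth (\<lambda>x. frechet_derivative u (at x) (axis i 1))" by (simp add: smooth_def)
    show "frechet_derivative u (at x) (axis i 1) = 0" if "norm x > R" for x
      using c1_partial[OF c, of x i] c1_zero_outside[OF c R that] by simp
  qed
qed

text \<open>Induction on the order with \<open>k\<close> arbitrary: a partial derivative of the
  convolution is the convolution with the partial derivative of \<open>k\<close>, again a test
  function.\<close>

lemma conv_smooth:
  fixes a k :: "real ^ 'n \<Rightarrow> real"
  assumes a: "continuous_on UNIV a" "\<And>x. norm x > R \<Longrightarrow> a x = 0" and k: "k \<in> C0_inf"
  shows "smooth (conv a k)"
proof -
  have "Ck j (conv a k)" if "k \<in> C0_inf" for j k using that
  proof (induction j arbitrary: k)
    case (0 k)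
    obtain S where S: "\<And>x. norm x > S \<Longrightarrow> k x = 0" by (rule C0_inf_support[OF 0]) blast
    have ck: "c1 k (grad k)" using 0 smooth_c1 by (auto simp: C0_inf_def)
    have "c1 (conv a k) (\<lambda>x. \<integral>z. a z *\<^sub>R grad k (x - z) \<partial>lborel)" by (rule conv_c1[OF a ck S])
    from c1_cont[OF this] show ?case by simp
  next
    case (Suc j k)
    obtain S where S: "\<And>x. norm x > S \<Longrightarrow> k x = 0" by (rule C0_inf_support[OF Suc.prems]) blast
    have ck: "c1 k (grad k)" using Suc.prems smooth_c1 by (auto simp: C0_inf_def)
    have c: "c1 (conv a k) (\<lambda>x. \<integral>z. a z *\<^sub>R grad k (x - z) \<partial>lborel)" by (rule conv_c1[OF a ck S])
    have "(\<lambda>x. frechet_derivative (conv a k) (at x) (axis i 1)) = conv a (\<lambda>x. frechet_derivative k (at x) (axis i 1))" for i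
    proof
      fix x
      have "integrable lborel (\<lambda>z. a z *\<^sub>R grad k (x - z))"
      proof (rule integrable_compact_support[where R=R])
        show "continuous_on UNIV (\<lambda>z. a z *\<^sub>R grad k (x - z))"
          by (intro continuous_on_scaleR a(1) continuous_on_compose2[OF conjunct2[OF ck[unfolded c1_def]]]) (auto intro!: continuous_intros)
      qed (use a in simp)
      then have "(\<integral>z. a z *\<^sub>R grad k (x - z) \<partial>lborel) $ i = (\<integral>z. (a z *\<^sub>R grad k (x - z)) $ i \<partial>lborel)"
        unfolding cart_eq_inner_axis by (intro integral_inner_left[symmetric])
      then show "frechet_derivative (conv a k) (at x) (axis i 1) = conv a (\<lambda>x. frechet_derivative k (at x) (axis i 1)) x"
        using c1_partial[OF c, of x i] unfolding conv_def c1_partial[OF ck] by simp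
    qed
    then have "Ck j (\<lambda>x. frechet_derivative (conv a k) (at x) (axis i 1))" for i
      using Suc.IH[OF C0_inf_partial[OF Suc.prems]] by simp
    moreover have "conv a k differentiable_on UNIV"
      using c unfolding c1_def differentiable_on_def differentiable_def by auto
    ultimately show ?case using c1_cont[OF c] by simp
  qed
  then show ?thesis using k by (simp add: smooth_def)
qed


section \<open>Smooth bump functions and mollifiers\<close>

definition bmp :: "nat \<Rightarrow> real \<Rightarrow> real" where
  "bmp k t = (if t > 0 then (1 / t) ^ k * exp (- (1 / t)) else 0)"

lemma bmp_tendsto_0: "(bmp k \<longlongrightarrow> 0) (at_right 0)"
proof -
  have "((\<lambda>t::real. inverse t ^ k / exp (inverse t)) \<longlongrightarrow> 0) (at_right 0)"
    by (rule filterlim_compose[OF tendsto_power_div_exp_0 filterlim_inverse_at_top_right])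
  then show ?thesis
    by (rule Lim_transform_eventually) (auto simp: eventually_at_filter bmp_def inverse_eq_divide exp_minus field_simps)
qed

text \<open>The negative powers are part of the family so that it is closed under differentiation.
  At 0 the difference quotient from the right is the next member of the family, which tends to
  0.\<close>

lemma bmp_deriv: "(bmp k has_real_derivative (bmp (k + 2) t - real k * bmp (k + 1) t)) (at t)"
proof (cases t "0 :: real" rule: linorder_cases)
  case less
  have "((\<lambda>x::real. 0) has_real_derivative 0) (at t)" by simp
  then have "(bmp k has_real_derivative 0) (at t)"
    by (rule has_field_derivative_transform_within_open[where S="{..<0}"]) (use less in \<open>auto simp: bmp_def\<close>)
  then show ?thesis using less by (simp add: bmp_def)
next
  case greater
  have dy: "((\<lambda>t::real. 1 / t) has_real_derivative - ((1 / t)\<^sup>2)) (at t)"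
    using greater by (auto intro!: derivative_eq_intros simp: power2_eq_square)
  have "((\<lambda>t::real. (1 / t) ^ k * exp (- (1 / t))) has_real_derivative
     (real k * (1 / t) ^ (k - 1) * - ((1 / t)\<^sup>2)) * exp (- (1 / t)) + (exp (- (1 / t)) * - (- ((1 / t)\<^sup>2))) * (1 / t) ^ k) (at t)"
  proof (rule DERIV_mult)
    show "((\<lambda>t. (1 / t) ^ k) has_real_derivative real k * (1 / t) ^ (k - 1) * - ((1 / t)\<^sup>2)) (at t)"
      using DERIV_power[OF dy, of k] by (simp add: mult_ac)
    show "((\<lambda>t. exp (- (1 / t))) has_real_derivative exp (- (1 / t)) * - (- ((1 / t)\<^sup>2))) (at t)"
      by (rule DERIV_chain2[OF DERIV_exp DERIV_minus[OF dy]])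
  qed
  moreover have "(real k * (1 / t) ^ (k - 1) * - ((1 / t)\<^sup>2)) * exp (- (1 / t)) + (exp (- (1 / t)) * - (- ((1 / t)\<^sup>2))) * (1 / t) ^ k
     = bmp (k + 2) t - real k * bmp (k + 1) t"
  proof -
    have "real k * y ^ (k - 1) * - (y\<^sup>2) * e + e * - (- (y\<^sup>2)) * y ^ k = y ^ (k + 2) * e - real k * (y ^ (k + 1) * e)" for y e :: real
    proof (cases k)
      case (Suc j)
      have "(1 + real j) * y ^ j * - (y\<^sup>2) * e + e * - (- (y\<^sup>2)) * y ^ Suc j = y ^ (Suc j + 2) * e - (1 + real j) * (y ^ (Suc j + 1) * e)"
        by (simp add: power2_eq_square algebra_simps)
      then show ?thesis using Suc by simp
    qed (simp add: power2_eq_square)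
    from this[of "1 / t" "exp (- (1 / t))"] show ?thesis using greater unfolding bmp_def by simp
  qed
  ultimately have "((\<lambda>t::real. (1 / t) ^ k * exp (- (1 / t))) has_real_derivative bmp (k + 2) t - real k * bmp (k + 1) t) (at t)" by simp
  then show ?thesis
    by (rule has_field_derivative_transform_within_open[where S="{0<..}"]) (use greater in \<open>auto simp: bmp_def\<close>)
next
  case equal
  have "((\<lambda>h. bmp k h / h) \<longlongrightarrow> 0) (at_right 0)"
    by (rule Lim_transform_eventually[OF bmp_tendsto_0[of "k + 1"]]) (auto simp: eventually_at_filter bmp_def)
  moreover have "((\<lambda>h. bmp k h / h) \<longlongrightarrow> 0) (at_left 0)"
    by (rule Lim_transform_eventually[OF tendsto_const]) (auto simp: eventually_at_filter bmp_def)
  ultimately have "((\<lambda>h. bmp k h / h) \<longlongrightarrow> 0) (at 0)" by (rule filterlim_split_at[rotated])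
  then show ?thesis using equal by (simp add: DERIV_def bmp_def)
qed

text \<open>An algebra that contains the radial bumps and is closed under partial derivatives.
  Smoothness of all its elements follows by one induction, without formulas for higher
  derivatives.\<close>

inductive_set smth :: "(real ^ 'n \<Rightarrow> real) set" where
  bump: "(\<lambda>x. bmp k (1 - s * (x \<bullet> x))) \<in> smth"
| coord: "(\<lambda>x. x $ i) \<in> smth"
| const: "(\<lambda>x. c) \<in> smth"
| add: "f \<in> smth \<Longrightarrow> g \<in> smth \<Longrightarrow> (\<lambda>x. f x + g x) \<in> smth"
| mult: "f \<in> smth \<Longrightarrow> g \<in> smth \<Longrightarrow> (\<lambda>x. f x * g x) \<in> smth"

lemma smth_deriv:
  assumes "f \<in> smth"
  shows "\<exists>f'. (\<forall>x. (f has_derivative f' x) (at x)) \<and> (\<forall>i. (\<lambda>x. f' x (axis i 1)) \<in> smth)"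
  using assms
proof induction
  case (bump k s)
  let ?t = "\<lambda>x. 1 - s * (x \<bullet> x)"
  let ?D = "\<lambda>x :: real ^ 'a. bmp (k + 2) (?t x) - real k * bmp (k + 1) (?t x)"
  have "((\<lambda>x. bmp k (?t x)) has_derivative (\<lambda>h. ?D x * (- s * (2 * (x \<bullet> h))))) (at x)" for x :: "real ^ 'a"
  proof -
    have "(?t has_derivative (\<lambda>h. - s * (2 * (x \<bullet> h)))) (at x)"
      by (auto intro!: derivative_eq_intros simp: inner_commute)
    from has_derivative_compose[OF this bmp_deriv[of k "?t x", unfolded has_field_derivative_def]]
    show ?thesis by simp
  qed
  moreover have "(\<lambda>x :: real ^ 'a. ?D x * (- s * (2 * (x \<bullet> axis i 1)))) \<in> smth" for i
  proof -
    have "(\<lambda>x :: real ^ 'a. (bmp (k + 2) (?t x) + (- real k) * bmp (k + 1) (?t x)) * ((- s * 2) * x $ i)) \<in> smth"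
      by (intro smth.intros)
    then show ?thesis by (simp add: inner_axis mult_ac)
  qed
  ultimately show ?case by (intro exI[of _ "\<lambda>x h. ?D x * (- s * (2 * (x \<bullet> h)))"]) auto
next
  case (coord i)
  have "((\<lambda>x :: real ^ 'a. x $ i) has_derivative (\<lambda>h. h $ i)) (at x)" for x
    by (rule bounded_linear_imp_has_derivative[OF bounded_linear_vec_nth])
  then show ?case by (intro exI[of _ "\<lambda>x h. h $ i"]) (auto intro: smth.const)
next
  case (const c)
  show ?case by (intro exI[of _ "\<lambda>x h. 0"]) (auto intro: smth.const)
next
  case (add f g)
  then obtain f' g' where "\<forall>x. (f has_derivative f' x) (at x)" "\<forall>i. (\<lambda>x. f' x (axis i 1)) \<in> smth"
    "\<forall>x. (g has_derivative g' x) (at x)" "\<forall>i. (\<lambda>x. g' x (axis i 1)) \<in> smth" by blast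
  then show ?case by (intro exI[of _ "\<lambda>x h. f' x h + g' x h"]) (auto intro!: has_derivative_add smth.add)
next
  case (mult f g)
  then obtain f' g' where "\<forall>x. (f has_derivative f' x) (at x)" "\<forall>i. (\<lambda>x. f' x (axis i 1)) \<in> smth"
    "\<forall>x. (g has_derivative g' x) (at x)" "\<forall>i. (\<lambda>x. g' x (axis i 1)) \<in> smth" by blast
  with mult show ?case
    by (intro exI[of _ "\<lambda>x h. f x * g' x h + f' x h * g x"]) (auto intro!: has_derivative_mult smth.add smth.mult)
qed

lemma smth_smooth:
  assumes "f \<in> smth" shows "smooth f"
proof -
  have "Ck k f" if "f \<in> smth" for k and f :: "real ^ 'a \<Rightarrow> real" using that
  proof (induction k arbitrary: f)
    case (0 f)
    then obtain f' where "\<And>x. (f has_derivative f' x) (at x)" using smth_deriv by blast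
    then show ?case using has_derivative_continuous continuous_at_imp_continuous_on by (metis Ck.simps(1))
  next
    case (Suc k f)
    then obtain f' where f': "\<And>x. (f has_derivative f' x) (at x)" "\<And>i. (\<lambda>x. f' x (axis i 1)) \<in> smth" using smth_deriv by blast
    have "frechet_derivative f (at x) = f' x" for x using frechet_derivative_at[OF f'(1)] by simp
    then have "Ck k (\<lambda>x. frechet_derivative f (at x) (axis i 1))" for i using Suc.IH[OF f'(2)] by simp
    moreover have "f differentiable_on UNIV" using f'(1) by (auto simp: differentiable_on_def differentiable_def)
    ultimately show ?case using differentiable_imp_continuous_on by simp
  qed
  then show ?thesis using assms by (simp add: smooth_def)
qed

lemma lborel_integral_pos:
  fixes f :: "real ^ 'n \<Rightarrow> real"
  assumes f: "continuous_on UNIV f" "integrable lborel f" "\<And>x. 0 \<le> f x" "f a > 0"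
  shows "(\<integral>x. f x \<partial>lborel) > 0"
proof -
  have "(\<integral>x. f x \<partial>lborel) \<noteq> 0"
  proof
    assume "(\<integral>x. f x \<partial>lborel) = 0"
    then have AE: "AE x in lborel. f x = 0" using integral_nonneg_eq_0_iff_AE[OF f(2)] f(3) by simp
    have "open {x. f x > 0}" using f(1) by (intro open_Collect_less continuous_intros)
    then obtain e where e: "e > 0" "ball a e \<subseteq> {x. f x > 0}" using f(4) open_contains_ball by (metis mem_Collect_eq)
    have "AE x in lborel. x \<notin> ball a e" using AE by eventually_elim (use e in auto)
    then have "emeasure lborel (ball a e) = 0" by (subst (asm) AE_iff_measurable[of "ball a e"]) auto
    then have "measure lborel (ball a e) = 0" by (simp add: measure_def)
    then show False using e(1) content_ball_pos[of e a] by simp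
  qed
  moreover have "(\<integral>x. f x \<partial>lborel) \<ge> 0" using f(3) by simp
  ultimately show ?thesis by simp
qed

lemma mollifier_exists:
  assumes e: "e > 0"
  obtains K :: "real ^ 'n \<Rightarrow> real" where "K \<in> C0_inf" "\<And>x. 0 \<le> K x" "\<And>x. norm x > e \<Longrightarrow> K x = 0" "(\<integral>x. K x \<partial>lborel) = 1"
proof -
  \<comment> \<open>The argument of the bump is positive exactly for |x| < e.\<close>
  define b where "b x = bmp 0 (1 - (1 / e\<^sup>2) * (x \<bullet> x))" for x :: "real ^ 'n"
  have bs: "b \<in> smth" unfolding b_def[abs_def] by (rule smth.bump)
  have bz: "b x = 0" if "norm x > e" for x
  proof -
    have "x \<bullet> x \<ge> e\<^sup>2" using that e by (simp add: dot_square_norm power_mono)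
    then have "1 - (1 / e\<^sup>2) * (x \<bullet> x) \<le> 0" using e by (simp add: field_simps)
    then show ?thesis by (simp add: b_def bmp_def)
  qed
  have b0: "b x \<ge> 0" for x by (simp add: b_def bmp_def)
  have bc: "continuous_on UNIV b" using smth_smooth[OF bs] by (metis smooth_def Ck.simps(1))
  have bi: "integrable lborel b" by (rule integrable_compact_support[OF bc bz])
  define c where "c = (\<integral>x. b x \<partial>lborel)"
  have c: "c > 0" unfolding c_def by (rule lborel_integral_pos[OF bc bi b0, of 0]) (simp add: b_def bmp_def)
  show ?thesis
  proof (rule that[of "\<lambda>x. (1 / c) * b x"])
    have "(\<lambda>x. (1 / c) * b x) \<in> smth" by (intro smth.intros bs)
    then show "(\<lambda>x. (1 / c) * b x) \<in> C0_inf" using bz by (intro C0_infI[of _ e] smth_smooth) auto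
    show "0 \<le> (1 / c) * b x" for x using b0 c by simp
    show "(1 / c) * b x = 0" if "norm x > e" for x using bz[OF that] by simp
    show "(\<integral>x. (1 / c) * b x \<partial>lborel) = 1" using c by (simp add: c_def)
  qed
qed

lemma average_bound:
  fixes G :: "real ^ 'n \<Rightarrow> 'b::{banach, second_countable_topology}"
  assumes K: "continuous_on UNIV K" "\<And>x. 0 \<le> K x" "\<And>x. norm x > d \<Longrightarrow> K x = 0" "(\<integral>x. K x \<partial>lborel) = (1::real)"
    and G: "continuous_on UNIV G" "\<And>x y. norm (x - y) \<le> d \<Longrightarrow> norm (G x - G y) \<le> e"
  shows "norm ((\<integral>z. K z *\<^sub>R G (x - z) \<partial>lborel) - G x) \<le> e"
proof -
  have iK: "integrable lborel K" by (rule integrable_compact_support[OF K(1,3)])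
  have i1: "integrable lborel (\<lambda>z. K z *\<^sub>R G (x - z))"
    by (rule integrable_compact_support[where R=d])
       (use K(3) in \<open>auto intro!: continuous_on_scaleR K(1) continuous_on_compose2[OF G(1)] continuous_intros\<close>)
  have i2: "integrable lborel (\<lambda>z. K z *\<^sub>R G x)" using iK by simp
  have "(\<integral>z. K z *\<^sub>R G (x - z) \<partial>lborel) - G x = (\<integral>z. K z *\<^sub>R G (x - z) - K z *\<^sub>R G x \<partial>lborel)"
    using i1 i2 iK K(4) by simp
  also have "norm \<dots> \<le> (\<integral>z. K z * e \<partial>lborel)"
  proof (rule order_trans[OF integral_norm_bound integral_mono])
    show "integrable lborel (\<lambda>z. norm (K z *\<^sub>R G (x - z) - K z *\<^sub>R G x))" using i1 i2 by (intro integrable_norm Bochner_Integration.integrable_diff)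
    show "integrable lborel (\<lambda>z. K z * e)" using iK by simp
    fix z
    have "norm (K z *\<^sub>R G (x - z) - K z *\<^sub>R G x) = K z * norm (G (x - z) - G x)"
      using K(2)[of z] by (simp add: scaleR_diff_right[symmetric])
    also have "\<dots> \<le> K z * e"
    proof (cases "norm z \<le> d")
      case True
      then show ?thesis using G(2)[of "x - z" x] K(2) by (intro mult_left_mono) auto
    next
      case False
      then show ?thesis using K(3)[of z] by simp
    qed
    finally show "norm (K z *\<^sub>R G (x - z) - K z *\<^sub>R G x) \<le> K z * e" .
  qed
  also have "\<dots> = e" using K(4) by simp
  finally show ?thesis .
qed

text \<open>The mollification is read in two ways: derivatives put on the kernel give smoothness,
  derivatives put on w give closeness of the gradients. \<open>conv_commute\<close> passes from one
  to the other.\<close>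

lemma c1_approx:
  fixes w :: "real ^ 'n \<Rightarrow> real"
  assumes c: "c1 w g" and z: "\<And>x. norm x > R \<Longrightarrow> w x = 0" and e: "e > 0"
  shows "\<exists>u\<in>C0_inf. (\<forall>x. norm x > R + 1 \<longrightarrow> u x = 0) \<and> (\<forall>x. \<bar>u x - w x\<bar> \<le> e) \<and> (\<forall>x. norm (grad u x - g x) \<le> e)"
proof -
  have gc: "continuous_on UNIV g" using c by (simp add: c1_def)
  have gz: "g x = 0" if "norm x > R" for x by (rule c1_zero_outside[OF c z that])
  have wc: "continuous_on UNIV w" by (rule c1_cont[OF c])
  obtain d1 where d1: "d1 > 0" "\<And>x y. norm (x - y) < d1 \<Longrightarrow> norm (w x - w y) \<le> e"
    by (rule uniformly_continuous_compact_support[OF wc z e]) auto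
  obtain d2 where d2: "d2 > 0" "\<And>x y. norm (x - y) < d2 \<Longrightarrow> norm (g x - g y) \<le> e"
    by (rule uniformly_continuous_compact_support[OF gc gz e]) auto
  define d where "d = min 1 (min d1 d2 / 2)"
  have d: "d > 0" "d \<le> 1" "d < d1" "d < d2" using d1 d2 by (auto simp: d_def)
  obtain K :: "real ^ 'n \<Rightarrow> real" where K: "K \<in> C0_inf" "\<And>x. 0 \<le> K x" "\<And>x. norm x > d \<Longrightarrow> K x = 0" "(\<integral>x. K x \<partial>lborel) = 1"
    by (rule mollifier_exists[OF d(1)]) blast
  have Kc: "continuous_on UNIV K" using K(1) c1_cont[OF smooth_c1] by (auto simp: C0_inf_def)
  have comm: "conv w K = conv K w"
    by (rule conv_commute) (use wc Kc in \<open>auto intro: borel_measurable_continuous_onI\<close>)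
  have supp: "conv w K x = 0" if x: "norm x > R + 1" for x
  proof -
    have "w y * K (x - y) = 0" for y
    proof (cases "norm y > R")
      case False
      have "norm x - norm y \<le> norm (x - y)" by (rule norm_triangle_ineq2)
      then have "norm (x - y) > d" using False x d by linarith
      then show ?thesis using K(3) by simp
    qed (use z in simp)
    then have "(\<lambda>y. w y * K (x - y)) = (\<lambda>_. 0)" by (rule ext)
    then show ?thesis unfolding conv_def by simp
  qed
  have w2: "norm (w x - w y) \<le> e" if "norm (x - y) \<le> d" for x y using d1(2)[of x y] that d(3) by simp
  have g2: "norm (g x - g y) \<le> e" if "norm (x - y) \<le> d" for x y using d2(2)[of x y] that d(4) by simp
  have "smooth (conv w K)" by (rule conv_smooth[OF wc z K(1)])
  then have "conv w K \<in> C0_inf" using supp by (rule C0_infI)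
  moreover have "\<bar>conv w K x - w x\<bar> \<le> e" for x
  proof -
    have "norm ((\<integral>z. K z *\<^sub>R w (x - z) \<partial>lborel) - w x) \<le> e"
      by (rule average_bound[OF Kc K(2) K(3) K(4) wc w2])
    then show ?thesis unfolding comm conv_def by simp
  qed
  moreover have "norm (grad (conv w K) x - g x) \<le> e" for x
  proof -
    have "grad (conv w K) x = (\<integral>z. K z *\<^sub>R g (x - z) \<partial>lborel)"
    proof -
      have "c1 (conv K w) (\<lambda>x. \<integral>z. K z *\<^sub>R g (x - z) \<partial>lborel)" by (rule conv_c1[OF Kc K(3) c z])
      from c1_grad[OF this] show ?thesis unfolding comm by simp
    qed
    also have "norm (\<dots> - g x) \<le> e" by (rule average_bound[OF Kc K(2) K(3) K(4) gc g2])
    finally show ?thesis .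
  qed
  ultimately show ?thesis using supp by blast
qed


subsection \<open>Gagliardo--Nirenberg inequalities\<close>

text \<open>General exponents A, B and \<theta> treat the cases \<alpha> > 1 and \<alpha> < 1
  together; they differ only in which of the two norms is estimated.\<close>

definition gnset :: "'n::finite itself \<Rightarrow> real \<Rightarrow> real \<Rightarrow> real \<Rightarrow> real \<Rightarrow> real set" where
  "gnset (_ :: 'n itself) p A B \<theta> = {C. \<forall>u :: real ^ 'n \<Rightarrow> real. u \<in> C0_inf \<longrightarrow>
     Lnorm A u \<le> C * grad_Lnorm p u powr \<theta> * Lnorm B u powr (1 - \<theta>)}"

text \<open>The infimum is itself admissible, because each function alone imposes a closed condition
  on the constant. If the right-hand product is zero, any admissible constant shows that the left
  side is at most zero.\<close>

lemma gnset_Inf: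
  fixes u :: "real ^ 'n \<Rightarrow> real"
  assumes ne: "gnset TYPE('n) p A B \<theta> \<noteq> {}" and u: "u \<in> C0_inf"
  shows "Lnorm A u \<le> Inf (gnset TYPE('n) p A B \<theta>) * grad_Lnorm p u powr \<theta> * Lnorm B u powr (1 - \<theta>)"
proof -
  define X where "X = grad_Lnorm p u powr \<theta> * Lnorm B u powr (1 - \<theta>)"
  have X: "X \<ge> 0" by (simp add: X_def)
  have C: "Lnorm A u \<le> C * X" if "C \<in> gnset TYPE('n) p A B \<theta>" for C
    using that u by (simp add: gnset_def X_def mult.assoc)
  show ?thesis
  proof (cases "X = 0")
    case True
    obtain C where "C \<in> gnset TYPE('n) p A B \<theta>" using ne by blast
    then show ?thesis using C[of C] True unfolding mult.assoc X_def[symmetric] by simp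
  next
    case False
    then have X0: "X > 0" using X by simp
    have "Lnorm A u / X \<le> Inf (gnset TYPE('n) p A B \<theta>)"
      by (rule cInf_greatest[OF ne]) (use C X0 in \<open>simp add: pos_divide_le_eq\<close>)
    then show ?thesis using X0 by (simp add: pos_divide_le_eq X_def mult.assoc)
  qed
qed

lemma tendsto_integral_powr:
  fixes F :: "nat \<Rightarrow> real ^ 'n \<Rightarrow> real"
  assumes F: "\<And>i. continuous_on UNIV (F i)" "\<And>i x. norm x > R \<Longrightarrow> F i x = 0" "\<And>i x. 0 \<le> F i x"
    and f: "continuous_on UNIV f" "\<And>x. norm x > R \<Longrightarrow> f x = 0" "\<And>x. 0 \<le> f x"
    and e: "\<And>i x. \<bar>F i x - f x\<bar> \<le> e i" "e \<longlonglongrightarrow> 0" and q: "q > 0"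
  shows "(\<lambda>i. integral UNIV (\<lambda>x. F i x powr q)) \<longlonglongrightarrow> integral UNIV (\<lambda>x. f x powr q)"
proof -
  have cF: "continuous_on UNIV (\<lambda>x. F i x powr q)" for i
    using F q by (intro continuous_on_powr') auto
  have cf: "continuous_on UNIV (\<lambda>x. f x powr q)" using f q by (intro continuous_on_powr') auto
  obtain K where K: "0 \<le> K" "\<And>x. norm (f x) \<le> K" by (rule continuous_support_bounded[OF f(1,2)]) auto
  obtain E where E: "\<And>i. \<bar>e i\<bar> \<le> E" using convergent_imp_Bseq[of e] e(2) unfolding Bseq_def convergent_def by (metis real_norm_def)
  have E0: "0 \<le> E" using E[of 0] by linarith
  have "(\<lambda>i. \<integral>x. F i x powr q \<partial>lborel) \<longlonglongrightarrow> (\<integral>x. f x powr q \<partial>lborel)"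
  proof (rule integral_dominated_convergence[where w="\<lambda>x. (K + E) powr q * indicator (cball 0 R) x"])
    show "(\<lambda>x. f x powr q) \<in> borel_measurable lborel" "\<And>i. (\<lambda>x. F i x powr q) \<in> borel_measurable lborel"
      using cf cF by (auto intro: borel_measurable_continuous_onI)
    show "integrable lborel (\<lambda>x :: real ^ 'n. (K + E) powr q * indicator (cball 0 R) x)"
      using emeasure_lborel_cball_finite[of "0 :: real ^ 'n" R] by (intro integrable_mult_right integrable_real_indicator) auto
    have pt: "(\<lambda>i. F i x powr q) \<longlonglongrightarrow> f x powr q" for x
    proof -
      have "(\<lambda>i. F i x - f x) \<longlonglongrightarrow> 0"
        by (rule Lim_null_comparison[OF _ e(2)]) (use e(1) in auto)
      then have "(\<lambda>i. F i x) \<longlonglongrightarrow> f x" by (simp add: LIM_zero_iff)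
      then show ?thesis using q F(3) by (intro tendsto_powr') auto
    qed
    then show "AE x in lborel. (\<lambda>i. F i x powr q) \<longlonglongrightarrow> f x powr q" by simp
    have "norm (F i x powr q) \<le> (K + E) powr q * indicator (cball 0 R) x" for i x
    proof (cases "norm x \<le> R")
      case True
      have "F i x \<le> K + E" using e(1)[of i x] K(2)[of x] E[of i] unfolding real_norm_def by linarith
      then show ?thesis using True F(3) q by (auto intro!: powr_mono2)
    next
      case False
      then show ?thesis using F(2)[of x i] by simp
    qed
    then show "AE x in lborel. norm (F i x powr q) \<le> (K + E) powr q * indicator (cball 0 R) x" for i by simp
  qed
  moreover have "integral UNIV (\<lambda>x. F i x powr q) = (\<integral>x. F i x powr q \<partial>lborel)" for i
    by (rule integral_UNIV_eq_lborel[OF cF, of R]) (use F in simp)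
  moreover have "integral UNIV (\<lambda>x. f x powr q) = (\<integral>x. f x powr q \<partial>lborel)"
    by (rule integral_UNIV_eq_lborel[OF cf, of R]) (use f in simp)
  ultimately show ?thesis by simp
qed

lemma integral_UNIV_powr_nonneg: "0 \<le> integral UNIV (\<lambda>x :: real ^ 'n. f x powr q :: real)"
  by (cases "(\<lambda>x. f x powr q) integrable_on UNIV") (auto intro: integral_nonneg simp: not_integrable_integral)

lemma Lnorm_pos:
  fixes w :: "real ^ 'n \<Rightarrow> real"
  assumes w: "continuous_on UNIV w" "\<And>x. norm x > R \<Longrightarrow> w x = 0" "w a \<noteq> 0" and q: "q > 0"
  shows "Lnorm q w > 0"
proof -
  have c: "continuous_on UNIV (\<lambda>x. \<bar>w x\<bar> powr q)" using w(1) q by (intro continuous_on_powr' continuous_intros) auto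
  have z: "\<bar>w x\<bar> powr q = 0" if "norm x > R" for x using w(2)[OF that] by simp
  have "integral UNIV (\<lambda>x. \<bar>w x\<bar> powr q) = (\<integral>x. \<bar>w x\<bar> powr q \<partial>lborel)" by (rule integral_UNIV_eq_lborel[OF c z])
  moreover have "integrable lborel (\<lambda>x. \<bar>w x\<bar> powr q)" by (rule integrable_compact_support[OF c z])
  then have "(\<integral>x. \<bar>w x\<bar> powr q \<partial>lborel) > 0" by (rule lborel_integral_pos[OF c, of a]) (use w(3) in auto)
  ultimately have "integral UNIV (\<lambda>x. \<bar>w x\<bar> powr q) > 0" by simp
  then show ?thesis by (simp add: Lnorm_def)
qed

text \<open>The sharp inequality for smooth functions passes to C^1 functions of compact support by
  uniform approximation of the function and its gradient on a common support.\<close>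

theorem gagliardo_nirenberg_c1:
  fixes w :: "real ^ 'n \<Rightarrow> real"
  assumes ne: "gnset TYPE('n) p A B \<theta> \<noteq> {}" and p: "p > 0" and A: "A > 0" and B: "B > 0" and \<theta>: "0 < \<theta>" "\<theta> \<le> 1"
    and c: "c1 w g" and z: "\<And>x. norm x > R \<Longrightarrow> w x = 0" and a: "w a \<noteq> 0"
  shows "Lnorm A w \<le> Inf (gnset TYPE('n) p A B \<theta>) * grad_Lnorm p w powr \<theta> * Lnorm B w powr (1 - \<theta>)"
proof -
  define e where "e i = inverse (real (Suc i))" for i
  have e0: "e i > 0" for i by (simp add: e_def)
  have elim: "e \<longlonglongrightarrow> 0" unfolding e_def[abs_def] by (rule LIMSEQ_inverse_real_of_nat)
  have "\<exists>u\<in>C0_inf. (\<forall>x. norm x > R + 1 \<longrightarrow> u x = 0) \<and> (\<forall>x. \<bar>u x - w x\<bar> \<le> e i) \<and> (\<forall>x. norm (grad u x - g x) \<le> e i)" for i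
    by (rule c1_approx[OF c z e0])
  then obtain u where u: "\<And>i. u i \<in> C0_inf" "\<And>i x. norm x > R + 1 \<Longrightarrow> u i x = 0" "\<And>i x. \<bar>u i x - w x\<bar> \<le> e i"
    "\<And>i x. norm (grad (u i) x - g x) \<le> e i" by metis
  have uc: "c1 (u i) (grad (u i))" for i using u(1) smooth_c1 by (auto simp: C0_inf_def)
  have gc: "continuous_on UNIV g" using c by (simp add: c1_def)
  have gw: "grad w = g" by (rule c1_grad[OF c])
  have gz: "g x = 0" if "norm x > R" for x by (rule c1_zero_outside[OF c z that])
  have guz: "grad (u i) x = 0" if "norm x > R + 1" for i x by (rule c1_zero_outside[OF uc u(2) that])
  have LN: "(\<lambda>i. Lnorm q (u i)) \<longlonglongrightarrow> Lnorm q w" if q: "q > 0" for q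
  proof -
    have "(\<lambda>i. integral UNIV (\<lambda>x. \<bar>u i x\<bar> powr q)) \<longlonglongrightarrow> integral UNIV (\<lambda>x. \<bar>w x\<bar> powr q)"
    proof (rule tendsto_integral_powr[where R="R + 1" and e=e])
      show "\<bar>\<bar>u i x\<bar> - \<bar>w x\<bar>\<bar> \<le> e i" for i x using u(3)[of i x] by linarith
      show "continuous_on UNIV (\<lambda>x. \<bar>u i x\<bar>)" for i by (intro continuous_intros c1_cont[OF uc])
      show "continuous_on UNIV (\<lambda>x. \<bar>w x\<bar>)" by (intro continuous_intros c1_cont[OF c])
    qed (use u(2) z elim q in auto)
    then show ?thesis unfolding Lnorm_def
      using q by (intro tendsto_powr' tendsto_const) (auto intro!: always_eventually integral_UNIV_powr_nonneg)
  qed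
  have GN: "(\<lambda>i. grad_Lnorm p (u i)) \<longlonglongrightarrow> grad_Lnorm p w"
  proof -
    have "(\<lambda>i. integral UNIV (\<lambda>x. norm (grad (u i) x) powr p)) \<longlonglongrightarrow> integral UNIV (\<lambda>x. norm (g x) powr p)"
    proof (rule tendsto_integral_powr[where R="R + 1" and e=e])
      show "\<bar>norm (grad (u i) x) - norm (g x)\<bar> \<le> e i" for i x
        using u(4)[of i x] norm_triangle_ineq3[of "grad (u i) x" "g x"] by linarith
      show "continuous_on UNIV (\<lambda>x. norm (grad (u i) x))" for i using uc[of i] by (intro continuous_intros) (simp add: c1_def)
      show "continuous_on UNIV (\<lambda>x. norm (g x))" by (intro continuous_intros gc)
    qed (use guz gz elim p in auto)
    then show ?thesis unfolding grad_Lnorm_def gw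
      using p by (intro tendsto_powr' tendsto_const) (auto intro!: always_eventually integral_UNIV_powr_nonneg)
  qed
  \<comment> \<open>Needed for \<theta> = 1: the exponent 1 - \<theta> is then 0, and
    \<open>powr\<close> with exponent 0 is discontinuous at 0.\<close>
  have LB: "Lnorm B w > 0" by (rule Lnorm_pos[OF c1_cont[OF c] z a B])
  have "(\<lambda>i. Inf (gnset TYPE('n) p A B \<theta>) * grad_Lnorm p (u i) powr \<theta> * Lnorm B (u i) powr (1 - \<theta>))
     \<longlonglongrightarrow> Inf (gnset TYPE('n) p A B \<theta>) * grad_Lnorm p w powr \<theta> * Lnorm B w powr (1 - \<theta>)"
  proof (intro tendsto_mult tendsto_const)
    show "(\<lambda>i. grad_Lnorm p (u i) powr \<theta>) \<longlonglongrightarrow> grad_Lnorm p w powr \<theta>"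
      using \<theta> by (intro tendsto_powr' GN tendsto_const) (auto simp: grad_Lnorm_def)
    show "(\<lambda>i. Lnorm B (u i) powr (1 - \<theta>)) \<longlonglongrightarrow> Lnorm B w powr (1 - \<theta>)"
      using LB by (intro tendsto_powr LN[OF B] tendsto_const) auto
  qed
  then show ?thesis by (rule LIMSEQ_le[OF LN[OF A]]) (use gnset_Inf[OF ne u(1)] in auto)
qed

section \<open>Transplantation of profiles to Euclidean space\<close>

lemma erad_continuous: "continuous_on UNIV (erad :: real ^ 'n \<Rightarrow> real)"
proof -
  have n1: "CARD('n) \<ge> 1" by (simp add: Suc_le_eq)
  have "isCont erad y" for y :: "real ^ 'n"
    unfolding continuous_at_eps_delta
  proof (intro allI impI)
    fix e :: real assume e: "e > 0"
    let ?r = "erad y" let ?n = "CARD('n)"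
    let ?f = "\<lambda>y :: real ^ 'n. norm y ^ ?n"
    have r0: "0 \<le> ?r" by (rule erad_nonneg)
    have fy: "?f y = real ?n * hF ?n ?r" by (rule hF_erad[symmetric])
    have up: "?f y < real ?n * hF ?n (?r + e / 2)" unfolding fy using hF_strict_mono[OF r0, of "?r + e / 2" ?n] e by simp
    have ev: "\<forall>\<^sub>F z in at y. ?f z < real ?n * hF ?n (?r + e / 2) \<and> (?r < e \<or> real ?n * hF ?n (?r - e / 2) < ?f z)"
    proof (rule eventually_conj)
      have t: "(?f \<longlongrightarrow> ?f y) (at y)" by (intro tendsto_intros)
      show "\<forall>\<^sub>F z in at y. ?f z < real ?n * hF ?n (?r + e / 2)" using t up by (rule order_tendstoD(2))
      show "\<forall>\<^sub>F z in at y. ?r < e \<or> real ?n * hF ?n (?r - e / 2) < ?f z"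
      proof (cases "?r < e")
        case False
        then have "real ?n * hF ?n (?r - e / 2) < ?f y" unfolding fy using hF_strict_mono[of "?r - e / 2" ?r ?n] e by simp
        with t have "\<forall>\<^sub>F z in at y. real ?n * hF ?n (?r - e / 2) < ?f z" by (rule order_tendstoD(1))
        then show ?thesis by (rule eventually_mono) simp
      qed simp
    qed
    then obtain d where d: "d > 0" "\<And>z. z \<noteq> y \<Longrightarrow> dist z y < d \<Longrightarrow> ?f z < real ?n * hF ?n (?r + e / 2) \<and> (?r < e \<or> real ?n * hF ?n (?r - e / 2) < ?f z)"
      unfolding eventually_at by auto
    have "dist (erad z) ?r < e" if z: "dist z y < d" for z
    proof (cases "z = y")
      case False
      have zz: "real ?n * hF ?n (erad z) < real ?n * hF ?n (?r + e / 2)" "?r < e \<or> real ?n * hF ?n (?r - e / 2) < real ?n * hF ?n (erad z)"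
        using d(2)[OF False z] by (auto simp: hF_erad)
      have "\<not> ?r + e / 2 \<le> erad z" using zz(1) hF_le_iff[of "?r + e / 2" "erad z" ?n] r0 e erad_nonneg[of z] by auto
      moreover have "?r < e \<or> \<not> erad z \<le> ?r - e / 2"
        using zz(2) hF_le_iff[of "erad z" "?r - e / 2" ?n] e erad_nonneg[of z] by force
      ultimately show ?thesis using erad_nonneg[of z] e by (auto simp: dist_real_def)
    qed (use e in simp)
    then show "\<exists>d>0. \<forall>z. dist z y < d \<longrightarrow> dist (erad z) ?r < e" using d(1) by blast
  qed
  then show ?thesis by (simp add: continuous_on_eq_continuous_at)
qed

lemma erad_le_norm: "erad y \<le> norm (y :: real ^ 'n)"
proof -
  have "erad y ^ CARD('n) \<le> norm y ^ CARD('n)"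
    using hF_ge_power[OF erad_nonneg, of "CARD('n)" y] hF_erad[of y] by (simp add: Suc_le_eq)
  then show ?thesis by (subst (asm) power_mono_iff) (auto simp: erad_nonneg)
qed

lemma erad_0 [simp]: "erad (0 :: real ^ 'n) = 0"
  using erad_le_norm[of "0 :: real ^ 'n"] erad_nonneg[of "0 :: real ^ 'n"] by simp

lemma erad_pos:
  fixes y :: "real ^ 'n"
  assumes "y \<noteq> 0" shows "erad y > 0"
proof -
  have "norm y ^ CARD('n) \<noteq> 0" using assms by simp
  then have "erad y \<noteq> 0" using hF_erad[of y] by (metis hF_0 mult_zero_right)
  then show ?thesis using erad_nonneg[of y] by simp
qed

lemma eW_erad:
  assumes "CARD('n) \<ge> 2"
  shows "eW CARD('n) (erad y) = norm (y :: real ^ 'n) ^ (CARD('n) - 1)"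
proof (cases "y = 0")
  case True
  then show ?thesis using assms by (simp add: eW_def zero_power)
next
  case False
  have "eW CARD('n) (erad y) = (norm y powr real CARD('n)) powr ((real CARD('n) - 1) / real CARD('n))"
    unfolding eW_def hF_erad using False by (simp add: powr_realpow)
  also have "\<dots> = norm y powr (real CARD('n) - 1)" by (simp add: powr_powr)
  also have "\<dots> = norm y ^ (CARD('n) - 1)" using False assms by (simp add: powr_realpow[symmetric] of_nat_diff)
  finally show ?thesis .
qed


text \<open>Implicit differentiation of n F(r) = |y|^n gives dr/d|y| = |y|^(n-1) / S(r), and
  |y|^(n-1) is \<open>eW\<close> at r by \<open>eW_erad\<close>.\<close>

lemma erad_has_derivative:
  fixes y :: "real ^ 'n"
  assumes y: "y \<noteq> 0" and n: "CARD('n) \<ge> 2"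
  shows "(erad has_derivative (\<lambda>h. (eW CARD('n) (erad y) / hS CARD('n) (erad y)) * (sgn y \<bullet> h))) (at y)"
proof -
  let ?n = "CARD('n)"
  define e :: "real ^ 'n" where "e = axis (SOME i. True) 1"
  have e1: "norm e = 1" by (simp add: e_def norm_axis_1)
  \<comment> \<open>The inverse function of n F on the half line: \<open>erad\<close> depends on the
    norm only, so any vector of norm \<open>root ?n s\<close> may be inserted.\<close>
  define Fi where "Fi s = erad (root ?n s *\<^sub>R e)" for s
  have n0: "?n > 0" by simp
  have ey: "erad z = Fi (norm z ^ ?n)" for z :: "real ^ 'n"
    unfolding Fi_def erad_def using e1 n0 by (simp add: real_root_power_cancel)
  have S: "hS ?n (erad y) > 0" by (rule hS_pos[OF erad_pos[OF y]])
  have dFi: "DERIV Fi (norm y ^ ?n) :> inverse (real ?n * hS ?n (erad y))"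
  proof (rule DERIV_inverse_function[where f="\<lambda>r. real ?n * hF ?n r" and a=0 and b="norm y ^ ?n + 1"])
    show "((\<lambda>r. real ?n * hF ?n r) has_real_derivative real ?n * hS ?n (erad y)) (at (Fi (norm y ^ ?n)))"
      unfolding ey[symmetric] by (rule DERIV_cmult[OF hF_deriv])
    show "real ?n * hS ?n (erad y) \<noteq> 0" using S by simp
    show "0 < norm y ^ ?n" using y by simp
    show "real ?n * hF ?n (Fi s) = s" if "0 < s" for s
      unfolding Fi_def hF_erad using that e1 n0 by (simp add: real_root_pos_pos_le)
    have "continuous_on UNIV Fi" unfolding Fi_def[abs_def]
      by (rule continuous_on_compose2[OF erad_continuous]) (auto intro!: continuous_intros)
    then show "isCont Fi (norm y ^ ?n)" by (simp add: continuous_on_eq_continuous_at)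
  qed simp
  have dn: "((\<lambda>z. norm z ^ ?n) has_derivative (\<lambda>h. real ?n * norm y ^ (?n - 1) * (h \<bullet> sgn y))) (at y)"
    using has_derivative_power[OF has_derivative_norm[OF y], of ?n] by (simp add: mult_ac)
  have "((\<lambda>z. Fi (norm z ^ ?n)) has_derivative (\<lambda>h. inverse (real ?n * hS ?n (erad y)) * (real ?n * norm y ^ (?n - 1) * (h \<bullet> sgn y)))) (at y)"
    by (rule has_derivative_compose[OF dn dFi[unfolded has_field_derivative_def]])
  moreover have "inverse (real ?n * hS ?n (erad y)) * (real ?n * norm y ^ (?n - 1) * (h \<bullet> sgn y)) = (eW ?n (erad y) / hS ?n (erad y)) * (sgn y \<bullet> h)" for h
    unfolding eW_erad[OF n] using S n0 by (simp add: field_simps inner_commute)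
  ultimately show ?thesis unfolding ey[symmetric] by simp
qed

text \<open>\<open>w\<close> is the Euclidean function whose superlevel balls have the same volumes
  as those of the hyperbolic profile, and \<open>g\<close> is its gradient by the chain rule. At the
  origin \<open>sgn 0 = 0\<close> supplies the right value.\<close>

context
  fixes p b :: real and M m :: "real \<Rightarrow> real" and w :: "real ^ 'n \<Rightarrow> real" and g :: "real ^ 'n \<Rightarrow> real ^ 'n"
  assumes rp: "radial_profile CARD('n) p b M m" and m0: "m 0 = 0"
  defines "w \<equiv> \<lambda>y. M (erad y)"
    and "g \<equiv> \<lambda>y. (m (erad y) * (eW CARD('n) (erad y) / hS CARD('n) (erad y))) *\<^sub>R sgn y"
begin

interpretation radial_profile "CARD('n)" p b M m by (rule rp)

lemma transplant_quotient: "0 \<le> eW CARD('n) r / hS CARD('n) r \<and> eW CARD('n) r / hS CARD('n) r \<le> 1" if "0 \<le> r" for r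
proof (cases "r = 0")
  case True
  then show ?thesis using n by (simp add: eW_def)
next
  case False
  then have "0 < r" using that by simp
  then show ?thesis using eW_le_hS[OF \<open>0 < r\<close> n] hS_pos[OF \<open>0 < r\<close>, of "CARD('n)"] eW_nonneg[of "CARD('n)" r] by simp
qed

lemma transplant_norm_grad: "norm (g y) = \<bar>m (erad y)\<bar> * (eW CARD('n) (erad y) / hS CARD('n) (erad y))"
proof -
  define k where "k = eW CARD('n) (erad y) / hS CARD('n) (erad y)"
  have "k \<ge> 0" using transplant_quotient[OF erad_nonneg[of y]] by (simp only: k_def)
  then show ?thesis unfolding g_def k_def[symmetric] using m0 by (cases "y = 0") (simp_all add: norm_sgn abs_mult erad_0)
qed

lemma transplant_norm_grad_le: "norm (g y) \<le> \<bar>m (erad y)\<bar>"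
  unfolding transplant_norm_grad using transplant_quotient[OF erad_nonneg[of y]] by (intro mult_left_le) auto

text \<open>Away from the origin this is the chain rule. At the origin, where \<open>erad\<close> is
  not known to be differentiable, \<open>erad y\<close> is at most |y| and M has derivative 0, so
  the increment of w is o(|y|); the bound of |g| by |m| gives continuity there.\<close>

lemma transplant_c1: "c1 w g"
  unfolding c1_def
proof
  show "\<forall>y. (w has_derivative (\<lambda>h. g y \<bullet> h)) (at y)"
  proof
    fix y :: "real ^ 'n"
    show "(w has_derivative (\<lambda>h. g y \<bullet> h)) (at y)"
    proof (cases "y = 0")
      case False
      have "((\<lambda>z. M (erad z)) has_derivative (\<lambda>h. m (erad y) * ((eW CARD('n) (erad y) / hS CARD('n) (erad y)) * (sgn y \<bullet> h)))) (at y)"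
        by (rule has_derivative_compose[OF erad_has_derivative[OF False n] dM[unfolded has_field_derivative_def]])
      then show ?thesis unfolding w_def g_def by (simp add: mult.assoc)
    next
      case True
      have g0: "g y = 0" using True by (simp add: g_def)
      show ?thesis unfolding has_derivative_at_alt
      proof (intro conjI allI impI)
        show "bounded_linear (\<lambda>h. g y \<bullet> h)" by (rule bounded_linear_inner_right)
        fix e :: real assume e: "e > 0"
        have "(M has_derivative (\<lambda>h. 0)) (at 0)" using dM[of 0] m0 by (simp add: has_field_derivative_def mult_zero_left[abs_def])
        then obtain d where d: "d > 0" "\<And>s. \<bar>s\<bar> < d \<Longrightarrow> \<bar>M s - M 0\<bar> \<le> e * \<bar>s\<bar>"
          using e unfolding has_derivative_at_alt by (metis diff_zero real_norm_def)
        show "\<exists>d>0. \<forall>z. norm (z - y) < d \<longrightarrow> norm (w z - w y - g y \<bullet> (z - y)) \<le> e * norm (z - y)"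
        proof (intro exI[of _ d] conjI allI impI d(1))
          fix z assume z: "norm (z - y) < d"
          have ez: "0 \<le> erad z" "erad z \<le> norm z" using erad_nonneg[of z] erad_le_norm[of z] by auto
          then have "\<bar>M (erad z) - M 0\<bar> \<le> e * \<bar>erad z\<bar>" using z True by (intro d(2)) auto
          also have "\<dots> \<le> e * norm z" using ez e by (intro mult_left_mono) auto
          finally show "norm (w z - w y - g y \<bullet> (z - y)) \<le> e * norm (z - y)" using True g0 by (simp add: w_def)
        qed
      qed
    qed
  qed
  have cme: "continuous_on UNIV (\<lambda>y :: real ^ 'n. m (erad y))"
    by (rule continuous_on_compose2[OF cm erad_continuous]) auto
  have "isCont g y" for y
  proof (cases "y = 0")
    case True
    have "isCont (\<lambda>y :: real ^ 'n. m (erad y)) 0" using cme by (simp add: continuous_on_eq_continuous_at)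
    then have "((\<lambda>y :: real ^ 'n. m (erad y)) \<longlongrightarrow> 0) (at 0)" using m0 by (simp add: isCont_def)
    then have "(g \<longlongrightarrow> 0) (at 0)"
      by (rule tendsto_0_le[of _ _ _ 1]) (auto intro!: always_eventually transplant_norm_grad_le)
    then show ?thesis using True by (simp add: isCont_def g_def)
  next
    case False
    have "continuous_on (- {0}) g" unfolding g_def
    proof (intro continuous_intros continuous_on_subset[OF cme])
      show "continuous_on (- {0}) (\<lambda>y :: real ^ 'n. eW CARD('n) (erad y))"
        by (rule continuous_on_compose2[OF eW_cont[OF n order_refl] continuous_on_subset[OF erad_continuous]]) (auto simp: erad_nonneg)
      show "continuous_on (- {0}) (\<lambda>y :: real ^ 'n. hS CARD('n) (erad y))"
        by (rule continuous_on_compose2[OF hS_cont[of UNIV] continuous_on_subset[OF erad_continuous]]) auto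
      show "\<forall>y\<in>- {0 :: real ^ 'n}. hS CARD('n) (erad y) \<noteq> 0" using hS_pos[OF erad_pos] by (metis ComplD insertI1 less_irrefl)
    qed auto
    then show ?thesis using False by (simp add: continuous_on_eq_continuous_at open_Compl)
  qed
  then show "continuous_on UNIV g" by (simp add: continuous_on_eq_continuous_at)
qed

text \<open>Volume matching with n F(b) <= sinh^n b bounds the Euclidean radius that corresponds to
  b.\<close>

lemma transplant_support:
  assumes "norm y > sinh b"
  shows "w y = 0"
proof -
  have "\<not> erad y < b"
  proof
    assume lt: "erad y < b"
    have "norm y ^ CARD('n) = real CARD('n) * hF CARD('n) (erad y)" by (rule hF_erad[symmetric])
    also have "\<dots> \<le> real CARD('n) * hF CARD('n) b" using hF_strict_mono[OF erad_nonneg lt, of "CARD('n)"] by simp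
    also have "\<dots> \<le> sinh b ^ CARD('n)" using b n by (intro hF_le_sinh_power) auto
    finally have "norm y \<le> sinh b" using b by (subst (asm) power_mono_iff) auto
    then show False using assms by simp
  qed
  then show ?thesis using Mb by (simp add: w_def)
qed

lemma transplant_integral:
  assumes q: "q > 0"
  shows "integral UNIV (\<lambda>y. \<bar>w y\<bar> powr q) = ballvol TYPE('n) * real CARD('n) * integral {0..b} (\<lambda>r. M r powr q * hS CARD('n) r)"
proof -
  have c: "continuous_on UNIV (\<lambda>y. \<bar>w y\<bar> powr q)" using q by (intro continuous_on_powr' continuous_intros c1_cont[OF transplant_c1]) auto
  have "integral UNIV (\<lambda>y. \<bar>w y\<bar> powr q) = (\<integral>y. \<bar>w y\<bar> powr q \<partial>lborel)"
    by (rule integral_UNIV_eq_lborel(1)[OF c, of "sinh b"]) (use transplant_support in simp)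
  also have "\<dots> = (\<integral>y. M (erad (y :: real ^ 'n)) powr q \<partial>lborel)" using M_nonneg by (simp add: w_def)
  also have "\<dots> = ballvol TYPE('n) * real CARD('n) * integral {0..b} (\<lambda>r. M r powr q * hS CARD('n) r)"
    by (rule integral_lborel_radial[where g="\<lambda>r. M r powr q"]) (use Mp_cont[OF q] Mb b in auto)
  finally show ?thesis .
qed

text \<open>The gradient length is a function of \<open>erad y\<close> alone, so the law of
  \<open>erad\<close> turns the energy into the integral of \<open>eE\<close>, the quantity that
  \<open>energy_deficit\<close> controls.\<close>

lemma transplant_energy:
  "integral UNIV (\<lambda>y. norm (grad w y) powr p) = ballvol TYPE('n) * real CARD('n) * integral {0..b} eE"
proof -
  have gw: "grad w = g" by (rule c1_grad[OF transplant_c1])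
  have gc: "continuous_on UNIV g" using transplant_c1 by (simp add: c1_def)
  have c: "continuous_on UNIV (\<lambda>y. norm (g y) powr p)" using p by (intro continuous_on_powr' continuous_intros gc) auto
  have z: "g y = 0" if "norm y > sinh b" for y by (rule c1_zero_outside[OF transplant_c1 transplant_support that])
  let ?k = "\<lambda>r. \<bar>m r\<bar> * (eW CARD('n) r / hS CARD('n) r)"
  have ck: "continuous_on {0..b} ?k"
    unfolding continuous_on_def
  proof
    fix r assume r: "r \<in> {0..b}"
    show "(?k \<longlongrightarrow> ?k r) (at r within {0..b})"
    proof (cases "r = 0")
      case True
      have t: "(m \<longlongrightarrow> 0) (at 0 within {0..b})"
        using continuous_on_subset[OF cm, of "{0..b}"] b m0 unfolding continuous_on_def by force
      have "(?k \<longlongrightarrow> 0) (at 0 within {0..b})"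
      proof (rule tendsto_0_le[OF t, of _ 1])
        have "norm (?k s) \<le> norm (m s) * 1" if "0 \<le> s" for s
        proof -
          define k where "k = eW CARD('n) s / hS CARD('n) s"
          have "0 \<le> k" "k \<le> 1" using transplant_quotient[OF that] by (simp_all only: k_def)
          then show ?thesis unfolding k_def[symmetric] by (simp add: abs_mult mult_left_le)
        qed
        then show "\<forall>\<^sub>F s in at 0 within {0..b}. norm (?k s) \<le> norm (m s) * 1" by (simp add: eventually_at_filter)
      qed
      then show ?thesis using True m0 by simp
    next
      case False
      then have r0: "0 < r" using r by simp
      have "continuous_on {0<..} ?k"
        using hS_pos[of _ "CARD('n)"]
        by (intro continuous_intros eW_cont[OF n] hS_cont continuous_on_subset[OF cm]) (auto simp: less_imp_neq[symmetric])
      then have "isCont ?k r" using r0 by (simp add: continuous_on_eq_continuous_at)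
      then show ?thesis unfolding isCont_def by (rule tendsto_within_subset) simp
    qed
  qed
  have "integral UNIV (\<lambda>y. norm (grad w y) powr p) = (\<integral>y. norm (g y) powr p \<partial>lborel)"
    unfolding gw by (rule integral_UNIV_eq_lborel(1)[OF c, of "sinh b"]) (use z in simp)
  also have "\<dots> = (\<integral>y. ?k (erad (y :: real ^ 'n)) powr p \<partial>lborel)" unfolding transplant_norm_grad ..
  also have "\<dots> = ballvol TYPE('n) * real CARD('n) * integral {0..b} (\<lambda>r. ?k r powr p * hS CARD('n) r)"
  proof (rule integral_lborel_radial[where g="\<lambda>r. ?k r powr p"])
    show "continuous_on {0..b} (\<lambda>r. ?k r powr p)"
      using ck p transplant_quotient by (intro continuous_on_powr_nonneg mult_nonneg_nonneg) auto
  qed (use mb b in auto)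
  finally show ?thesis by (simp add: eE_def[abs_def])
qed

end

text \<open>The Euclidean inequality is applied to the transplants, whose L^q norms converge to
  those of u and whose energies are eventually at most the deficit plus e. The functions themselves
  need not converge.\<close>

theorem poincare_gagliardo_nirenberg:
  fixes u :: "real ^ 'n \<Rightarrow> real"
  assumes u: "u \<in> C0_inf_ball" and ok: "okp CARD('n) p" and ne: "gnset TYPE('n) p A B \<theta> \<noteq> {}"
    and A: "A > 0" and B: "B > 0" and \<theta>: "0 < \<theta>" "\<theta> \<le> 1"
  shows "hLnorm A u \<le> Inf (gnset TYPE('n) p A B \<theta>) * hdeficit p u powr (\<theta> / p) * hLnorm B u powr (1 - \<theta>)"
proof (cases "\<forall>x. u x = 0")
  case True
  then have "hint_pow q u = 0" for q by (simp add: hint_pow_def)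
  then show ?thesis by (simp add: hLnorm_def)
next
  case False
  then obtain a where a: "u a \<noteq> 0" by blast
  let ?I = "Inf (gnset TYPE('n) p A B \<theta>)" let ?s = "ballvol TYPE('n) * real CARD('n)"
  have p: "p > 1" using ok by (simp add: okp_def)
  have s0: "?s > 0" using ballvol_pos[where 'n='n] by simp
  obtain L R B' where D: "c1 u (grad u)" "R < 1" "adm L R B' (\<lambda>x. \<bar>u x\<bar>)" by (rule C0_inf_ball_data[OF u]) blast
  have hp: "hint_pow q u > 0" if q: "q > 0" for q
  proof -
    have c: "continuous_on UNIV (\<lambda>t::real. \<bar>t\<bar> powr q)" using q by (intro continuous_on_powr_nonneg continuous_intros) auto
    have i: "integrable hmeas (\<lambda>x. \<bar>u x\<bar> powr q)" using adm_comp_integrable[OF D(3,2) c] q by simp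
    have "norm a < 1" using adm_outside[OF D(3,2), of a] a by auto
    moreover have "continuous_on (ball 0 1) (\<lambda>x. \<bar>u x\<bar> powr q)"
      using q by (intro continuous_on_powr' continuous_intros c1_cont[OF D(1)]) auto
    ultimately have "(\<integral>x. \<bar>u x\<bar> powr q \<partial>hmeas) > 0" by (intro hmeas_integral_pos[OF i]) (use a in auto)
    then show ?thesis using hint_pow_eq[OF D(3,2) q] by simp
  qed
  obtain M m b where rp: "\<And>i. radial_profile CARD('n) p (b i) (M i) (m i)" and m0: "\<And>i. m i 0 = 0"
    and l1: "\<And>q. q > 0 \<Longrightarrow> (\<lambda>i. ?s * integral {0..b i} (\<lambda>r. M i r powr q * hS CARD('n) r)) \<longlonglongrightarrow> hint_pow q u"
    and l2: "\<And>e. e > 0 \<Longrightarrow> \<forall>\<^sub>F i in sequentially. ?s * integral {0..b i} (radial_profile.eE CARD('n) p (m i)) \<le> hdeficit p u + e"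
    by (rule radial_approximation_deficit[OF u ok]) blast
  define w where "w i y = M i (erad (y :: real ^ 'n))" for i y
  have LN: "Lnorm q (w i) = (?s * integral {0..b i} (\<lambda>r. M i r powr q * hS CARD('n) r)) powr (1 / q)" if "q > 0" for q i
    unfolding Lnorm_def w_def using transplant_integral[OF rp m0 that, of i] by simp
  have LG: "grad_Lnorm p (w i) = (?s * integral {0..b i} (radial_profile.eE CARD('n) p (m i))) powr (1 / p)" for i
    unfolding grad_Lnorm_def w_def[abs_def] using transplant_energy[OF rp m0, of i] by simp
  have Llim: "(\<lambda>i. Lnorm q (w i)) \<longlonglongrightarrow> hLnorm q u" if q: "q > 0" for q
    unfolding LN[OF q] hLnorm_def using hp[OF q] by (intro tendsto_powr l1[OF q] tendsto_const) auto
  \<comment> \<open>Positivity of both limits keeps \<open>powr\<close> continuous when 1 - \<theta>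
    = 0 and excludes vanishing transplants.\<close>
  have hA: "hLnorm A u > 0" and hB: "hLnorm B u > 0"
    unfolding hLnorm_def powr_gt_zero using hp[OF A] hp[OF B] by (simp_all only: less_imp_neq[symmetric] simp_thms)
  \<comment> \<open>The sign of the infimum is read off as well: a nonzero transplant makes the
    right side positive. It is needed to replace the energy by its upper bound.\<close>
  have ev: "\<forall>\<^sub>F i in sequentially. Lnorm A (w i) \<le> ?I * grad_Lnorm p (w i) powr \<theta> * Lnorm B (w i) powr (1 - \<theta>) \<and> ?I \<ge> 0"
    using order_tendstoD(1)[OF Llim[OF A] hA]
  proof eventually_elim
    case (elim i)
    have "\<exists>y. w i y \<noteq> 0"
    proof (rule ccontr)
      assume "\<not> ?thesis"
      then have "w i = (\<lambda>_. 0)" by blast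
      then have "Lnorm A (w i) = 0" by (simp only: Lnorm_def abs_zero powr_0 integral_0)
      then show False using elim by (simp only: less_irrefl)
    qed
    then obtain y where y: "w i y \<noteq> 0" by blast
    have le: "Lnorm A (w i) \<le> ?I * grad_Lnorm p (w i) powr \<theta> * Lnorm B (w i) powr (1 - \<theta>)"
    proof (rule gagliardo_nirenberg_c1[where w="w i" and R="sinh (b i)" and a=y])
      show "c1 (w i) (\<lambda>y. (m i (erad y) * (eW CARD('n) (erad y) / hS CARD('n) (erad y))) *\<^sub>R sgn y)"
        unfolding w_def[abs_def] by (rule transplant_c1[OF rp m0])
      show "w i x = 0" if "norm x > sinh (b i)" for x unfolding w_def by (rule transplant_support[OF rp m0 that])
    qed (use p ne A B \<theta> y in auto)
    then have pos: "0 < ?I * grad_Lnorm p (w i) powr \<theta> * Lnorm B (w i) powr (1 - \<theta>)" using elim by linarith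
    have "?I \<ge> 0"
    proof (rule ccontr)
      assume "\<not> ?thesis"
      then have "?I * grad_Lnorm p (w i) powr \<theta> * Lnorm B (w i) powr (1 - \<theta>) \<le> 0"
        by (intro mult_nonpos_nonneg powr_ge_zero) linarith
      then show False using pos by linarith
    qed
    then show ?case using le by (simp only: simp_thms)
  qed
  then have I0: "?I \<ge> 0" using eventually_happens[OF ev] by auto
  have bd: "hLnorm A u \<le> ?I * (hdeficit p u + e) powr (\<theta> / p) * hLnorm B u powr (1 - \<theta>)" if e: "e > 0" for e
  proof (rule tendsto_le[OF _ _ Llim[OF A]])
    show "(\<lambda>i. ?I * (hdeficit p u + e) powr (\<theta> / p) * Lnorm B (w i) powr (1 - \<theta>)) \<longlonglongrightarrow> ?I * (hdeficit p u + e) powr (\<theta> / p) * hLnorm B u powr (1 - \<theta>)"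
      using hB by (intro tendsto_mult tendsto_const tendsto_powr Llim[OF B]) auto
    show "\<forall>\<^sub>F i in sequentially. Lnorm A (w i) \<le> ?I * (hdeficit p u + e) powr (\<theta> / p) * Lnorm B (w i) powr (1 - \<theta>)"
      using ev l2[OF e]
    proof eventually_elim
      case (elim i)
      have "0 \<le> ?s * integral {0..b i} (radial_profile.eE CARD('n) p (m i))"
        using radial_profile.eE_integral_nonneg[OF rp, of 0 i] s0 by simp
      then have "grad_Lnorm p (w i) powr \<theta> \<le> (hdeficit p u + e) powr (\<theta> / p)"
        unfolding LG powr_powr using elim(2) p \<theta> by (simp add: powr_mono2)
      then have "?I * grad_Lnorm p (w i) powr \<theta> * Lnorm B (w i) powr (1 - \<theta>) \<le> ?I * (hdeficit p u + e) powr (\<theta> / p) * Lnorm B (w i) powr (1 - \<theta>)"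
        using I0 by (intro mult_right_mono mult_left_mono) auto
      then show ?case using elim(1) by linarith
    qed
  qed simp
  have "((\<lambda>e. ?I * (hdeficit p u + e) powr (\<theta> / p) * hLnorm B u powr (1 - \<theta>)) \<longlongrightarrow> ?I * (hdeficit p u + 0) powr (\<theta> / p) * hLnorm B u powr (1 - \<theta>)) (at_right 0)"
  proof (intro tendsto_intros tendsto_powr')
    show "hdeficit p u + 0 \<noteq> 0 \<or> 0 < \<theta> / p \<and> (\<forall>\<^sub>F e in at_right 0. 0 \<le> hdeficit p u + e)"
      using \<theta> p hdeficit_nonneg[OF u ok] by (auto simp: eventually_at_filter)
  qed
  from le_of_eps[OF this bd] show ?thesis by simp
qed


section \<open>Euclidean Sobolev inequality and existence of constants\<close>

lemma Ck_scale:
  fixes f :: "real ^ 'n \<Rightarrow> real"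
  shows "Ck k f \<Longrightarrow> Ck k (\<lambda>x. a * f (c *\<^sub>R x))"
proof (induction k arbitrary: f a)
  case 0
  then have "continuous_on UNIV f" by simp
  then have "continuous_on UNIV (\<lambda>x. f (c *\<^sub>R x))"
    by (rule continuous_on_compose2) (auto intro!: continuous_intros)
  then show ?case by (auto intro!: continuous_intros)
next
  case (Suc k)
  let ?D = "\<lambda>x. frechet_derivative f (at x)"
  have df: "(f has_derivative ?D x) (at x)" for x
    using Suc.prems by (simp add: differentiable_on_def frechet_derivative_works)
  have d: "((\<lambda>x. a * f (c *\<^sub>R x)) has_derivative (\<lambda>h. a * ?D (c *\<^sub>R x) (c *\<^sub>R h))) (at x)" for x
    by (rule has_derivative_mult_right[OF has_derivative_compose[OF _ df]]) (auto intro!: derivative_eq_intros)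
  have fd: "frechet_derivative (\<lambda>x. a * f (c *\<^sub>R x)) (at x) = (\<lambda>h. a * ?D (c *\<^sub>R x) (c *\<^sub>R h))" for x
    by (rule frechet_derivative_at[OF d, symmetric])
  have "frechet_derivative (\<lambda>x. a * f (c *\<^sub>R x)) (at x) h = (a * c) * ?D (c *\<^sub>R x) h" for x h
    unfolding fd using linear_cmul[OF has_derivative_linear[OF df[of "c *\<^sub>R x"]], of c h] by simp
  moreover have "Ck k (\<lambda>x. (a * c) * ?D (c *\<^sub>R x) (axis i 1))" for i
    using Suc.prems by (intro Suc.IH) simp
  moreover have "(\<lambda>x. a * f (c *\<^sub>R x)) differentiable_on UNIV"
    using d by (auto simp: differentiable_on_def differentiable_def)
  ultimately show ?case by (simp add: differentiable_imp_continuous_on)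
qed

text \<open>For |x| <= 1/2 the conformal factor 2 / (1 - |x|^2) lies between 1 and 2 / (1 - 1/4) =
  8/3, so the two measures are comparable there.\<close>

lemma hmeas_lborel_compare:
  fixes h :: "real ^ 'n \<Rightarrow> real"
  assumes c: "continuous_on UNIV h" and nn: "\<And>x. 0 \<le> h x" and z: "\<And>x. norm x > 1 / 2 \<Longrightarrow> h x = 0"
  shows "(\<integral>x. h x \<partial>lborel) \<le> (\<integral>x. h x \<partial>hmeas)"
    and "(\<integral>x. h x \<partial>hmeas) \<le> (8 / 3) ^ CARD('n) * (\<integral>x. h x \<partial>lborel)"
    and "integrable hmeas h"
proof -
  let ?d = "\<lambda>x :: real ^ 'n. indicator (ball 0 1) x * hdens x"
  have hm [measurable]: "h \<in> borel_measurable borel" by (rule borel_measurable_continuous_onI[OF c])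
  have dm: "?d \<in> borel_measurable borel" by (rule hdens_ball_measurable)
  have il: "integrable lborel h" by (rule integrable_compact_support[OF c, of "1 / 2"]) (rule z)
  have d0: "0 \<le> ?d x" for x
  proof (cases "norm x < 1")
    case True
    then have "(norm x)\<^sup>2 \<le> 1" by (simp add: power_le_one)
    then show ?thesis by (simp add: hdens_def)
  qed simp
  have db: "1 \<le> ?d x \<and> ?d x \<le> (8 / 3) ^ CARD('n)" if "norm x \<le> 1 / 2" for x
  proof -
    have "(norm x)\<^sup>2 \<le> (1 / 2)\<^sup>2" using that by (intro power_mono) auto
    then have "1 \<le> 2 / (1 - (norm x)\<^sup>2)" "2 / (1 - (norm x)\<^sup>2) \<le> 8 / 3" by (auto simp: field_simps power2_eq_square)
    then have "1 \<le> hdens x" "hdens x \<le> (8 / 3) ^ CARD('n)"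
      unfolding hdens_def using one_le_power power_mono[of "2 / (1 - (norm x)\<^sup>2)" "8 / 3"] by (blast, force)
    then show ?thesis using that by simp
  qed
  have lo: "h x \<le> ?d x * h x" for x
    using z[of x] db[of x] nn[of x] mult_right_mono[of 1 "?d x" "h x"] by (cases "norm x \<le> 1 / 2") auto
  have hi: "?d x * h x \<le> (8 / 3) ^ CARD('n) * h x" for x
    using z[of x] db[of x] nn[of x] mult_right_mono[of "?d x" "(8 / 3) ^ CARD('n)" "h x"] by (cases "norm x \<le> 1 / 2") auto
  have id: "integrable lborel (\<lambda>x. ?d x * h x)"
  proof (rule Bochner_Integration.integrable_bound[OF integrable_mult_right[OF il, of "(8 / 3) ^ CARD('n)"]])
    have "norm (?d x * h x) \<le> norm ((8 / 3) ^ CARD('n) * h x)" for x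
      using hi[of x] mult_nonneg_nonneg[OF d0[of x] nn[of x]] nn[of x] by (simp add: abs_of_nonneg)
    then show "AE x in lborel. norm (?d x * h x) \<le> norm ((8 / 3) ^ CARD('n) * h x)" by (rule AE_I2)
  qed (use borel_measurable_times[OF dm hm] in simp)
  have eq: "(\<integral>x. h x \<partial>hmeas) = (\<integral>x. ?d x * h x \<partial>lborel)"
    unfolding hmeas_def by (subst integral_density) (use d0 dm hm in auto)
  show "(\<integral>x. h x \<partial>lborel) \<le> (\<integral>x. h x \<partial>hmeas)" unfolding eq by (rule integral_mono[OF il id lo])
  have "(\<integral>x. ?d x * h x \<partial>lborel) \<le> (\<integral>x. (8 / 3) ^ CARD('n) * h x \<partial>lborel)"
    by (rule integral_mono[OF id integrable_mult_right[OF il] hi])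
  then show "(\<integral>x. h x \<partial>hmeas) \<le> (8 / 3) ^ CARD('n) * (\<integral>x. h x \<partial>lborel)" unfolding eq by simp
  show "integrable hmeas h" unfolding hmeas_def by (subst integrable_density) (use d0 id dm hm in auto)
qed

text \<open>A test function is scaled into the ball of radius 1/2, where the hyperbolic and
  Euclidean integrals are comparable, and \<open>hyperbolic_sobolev\<close> is applied. The constant
  does not depend on the scaling because the inequality is dilation invariant.\<close>

lemma euclidean_sobolev:
  fixes p :: real
  assumes ok: "okp CARD('n::finite) p" and pn: "p < real CARD('n)"
  shows "\<exists>K\<ge>0. \<forall>w :: real ^ 'n \<Rightarrow> real. w \<in> C0_inf \<longrightarrow>
    integral UNIV (\<lambda>x. \<bar>w x\<bar> powr (real CARD('n) * p / (real CARD('n) - p)))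
      \<le> K * integral UNIV (\<lambda>x. norm (grad w x) powr p) powr (real CARD('n) / (real CARD('n) - p))"
proof -
  define n where "n = real CARD('n)"
  define q where "q = n * p / (n - p)"
  define e where "e = n / (n - p)"
  define s where "s = ballvol TYPE('n) * n"
  define S where "S = s * sob CARD('n) p"
  define k where "k = ((8 / 3) ^ CARD('n) / s :: real)"
  have p: "p > 1" and n: "n > 0" and np: "n > p" using ok pn by (simp_all add: okp_def n_def)
  have q0: "q > 0" and e0: "e > 0" using p n np by (auto simp: q_def e_def)
  have s0: "s > 0" using ballvol_pos[where 'n='n] by (simp add: s_def n_def)
  have S0: "S \<ge> 0" using s0 by (simp add: S_def sob_def)
  have k0: "k \<ge> 0" using s0 by (simp add: k_def)
  have "integral UNIV (\<lambda>x. \<bar>w x\<bar> powr q) \<le> S * k powr e * integral UNIV (\<lambda>x. norm (grad w x) powr p) powr e"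
    if w: "w \<in> C0_inf" for w :: "real ^ 'n \<Rightarrow> real"
  proof -
    let ?X = "integral UNIV (\<lambda>x. \<bar>w x\<bar> powr q)" let ?G = "integral UNIV (\<lambda>x. norm (grad w x) powr p)"
    obtain R where R: "0 \<le> R" "\<And>x. norm x > R \<Longrightarrow> w x = 0" by (rule C0_inf_support[OF w]) blast
    have sm: "smooth w" using w by (simp add: C0_inf_def)
    have cw: "c1 w (grad w)" by (rule smooth_c1[OF sm])
    have z': "grad w x = 0" if "norm x > R" for x by (rule c1_zero_outside[OF cw R(2) that])
    \<comment> \<open>The ball of radius 1/2 is mapped onto that of radius R + 1, which contains the
      support of w.\<close>
    define c where "c = 2 * (R + 1)"
    have c: "c > 0" using R by (simp add: c_def)
    define u where "u x = w (c *\<^sub>R x)" for x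
    have small: "norm (c *\<^sub>R x) > R" if "norm x > 1 / 2" for x :: "real ^ 'n"
    proof -
      have "c * (1 / 2) < c * norm x" using that c by (intro mult_strict_left_mono)
      moreover have "R < c * (1 / 2)" by (simp add: c_def)
      ultimately have "R < c * norm x" by linarith
      then show ?thesis using c by simp
    qed
    have uz: "u x = 0" if "norm x > 1 / 2" for x unfolding u_def by (rule R(2)[OF small[OF that]])
    have su: "smooth u" using Ck_scale[of _ w 1 c] sm by (simp add: smooth_def u_def[abs_def])
    have "u \<in> C0_inf" by (rule C0_infI[OF su, of "1 / 2"]) (rule uz)
    moreover have "supp u \<subseteq> cball 0 (1 / 2)"
      unfolding supp_def by (rule closure_minimal) (use uz in force)+
    ultimately have u: "u \<in> C0_inf_ball" by (auto simp: C0_inf_def C0_inf_ball_def)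
    have cu: "c1 u (\<lambda>x. c *\<^sub>R grad w (c *\<^sub>R x))"
      unfolding c1_def
    proof (intro conjI allI)
      fix x
      have "(w has_derivative (\<lambda>h. grad w (c *\<^sub>R x) \<bullet> h)) (at (c *\<^sub>R x))" using cw by (simp add: c1_def)
      then have "((\<lambda>x. w (c *\<^sub>R x)) has_derivative (\<lambda>h. grad w (c *\<^sub>R x) \<bullet> (c *\<^sub>R h))) (at x)"
        by (intro has_derivative_compose[of "\<lambda>x. c *\<^sub>R x" "\<lambda>h. c *\<^sub>R h" x UNIV w]) (auto intro!: derivative_eq_intros)
      then show "(u has_derivative (\<lambda>h. (c *\<^sub>R grad w (c *\<^sub>R x)) \<bullet> h)) (at x)" by (simp add: u_def[abs_def])
      have "continuous_on UNIV (grad w)" using cw by (simp add: c1_def)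
      then have "continuous_on UNIV (\<lambda>x. grad w (c *\<^sub>R x))"
        by (rule continuous_on_compose2) (auto intro!: continuous_intros)
      then show "continuous_on UNIV (\<lambda>x. c *\<^sub>R grad w (c *\<^sub>R x))" by (intro continuous_intros)
    qed
    have gu: "grad u x = c *\<^sub>R grad w (c *\<^sub>R x)" for x using c1_grad[OF cu] by simp
    have cw1: "continuous_on UNIV (\<lambda>x. \<bar>w x\<bar> powr q)" using q0 by (intro continuous_on_powr' continuous_intros c1_cont[OF cw]) auto
    have cw2: "continuous_on UNIV (\<lambda>x. norm (grad w x) powr p)"
      using p cw by (intro continuous_on_powr' continuous_intros) (auto simp: c1_def)
    have cu1: "continuous_on UNIV (\<lambda>x. \<bar>u x\<bar> powr q)" using q0 by (intro continuous_on_powr' continuous_intros c1_cont[OF cu]) auto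
    have cu2: "continuous_on UNIV (\<lambda>x. norm (grad u x) powr p)"
      using p cu c1_grad[OF cu] by (intro continuous_on_powr' continuous_intros) (auto simp: c1_def)
    have X: "?X = c powr n * (\<integral>x. \<bar>u x\<bar> powr q \<partial>lborel)"
    proof -
      have "?X = (\<integral>x. \<bar>w x\<bar> powr q \<partial>lborel)" by (rule integral_UNIV_eq_lborel(1)[OF cw1, of R]) (use R(2) in simp)
      also have "\<dots> = c ^ CARD('n) * (\<integral>x. \<bar>u x\<bar> powr q \<partial>lborel)" unfolding u_def
        by (rule lborel_integral_scale[OF borel_measurable_continuous_onI[OF cw1] c])
      finally show ?thesis using c by (simp add: n_def powr_realpow)
    qed
    have G: "(\<integral>x. norm (grad u x) powr p \<partial>lborel) = c powr (p - n) * ?G"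
    proof -
      have "?G = (\<integral>x. norm (grad w x) powr p \<partial>lborel)" by (rule integral_UNIV_eq_lborel(1)[OF cw2, of R]) (use z' in simp)
      also have "\<dots> = c ^ CARD('n) * (\<integral>x. norm (grad w (c *\<^sub>R x)) powr p \<partial>lborel)"
        by (rule lborel_integral_scale[OF borel_measurable_continuous_onI[OF cw2] c])
      finally have g: "?G = c powr n * (\<integral>x. norm (grad w (c *\<^sub>R x)) powr p \<partial>lborel)" using c by (simp add: n_def powr_realpow)
      have "(\<integral>x. norm (grad u x) powr p \<partial>lborel) = c powr p * (\<integral>x. norm (grad w (c *\<^sub>R x)) powr p \<partial>lborel)"
        unfolding gu using c by (simp add: powr_mult)
      also have "\<dots> = c powr (p - n) * ?G" unfolding g using c by (simp add: powr_diff)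
      finally show ?thesis .
    qed
    have G0: "?G \<ge> 0" by (rule integral_UNIV_powr_nonneg)
    obtain L R' B' where D: "R' < 1" "adm L R' B' (\<lambda>x. \<bar>u x\<bar>)" by (rule C0_inf_ball_data[OF u]) blast
    have "(\<integral>x. \<bar>u x\<bar> powr q \<partial>lborel) \<le> (\<integral>x. \<bar>u x\<bar> powr q \<partial>hmeas)"
      by (rule hmeas_lborel_compare(1)[OF cu1]) (use uz in auto)
    also have "\<dots> = hint_pow q u" by (rule hint_pow_eq[OF D(2,1) q0, symmetric])
    also have "\<dots> \<le> S * (hint_grad_pow p u / s) powr e"
      using hyperbolic_sobolev[OF u ok pn] by (simp add: S_def s_def n_def q_def e_def)
    also have "\<dots> \<le> S * (k * (c powr (p - n) * ?G)) powr e"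
    proof -
      have gz: "norm (grad u x) powr p = 0" if "norm x > 1 / 2" for x
        using c1_zero_outside[OF cu uz that] gu[of x] by simp
      have ig: "integrable hmeas (\<lambda>x. norm (grad u x) powr p)"
        by (rule hmeas_lborel_compare(3)[OF cu2]) (use gz in auto)
      have le: "hgrad_len u x powr p \<le> norm (grad u x) powr p" for x
      proof (cases "norm x < 1")
        case True
        then show ?thesis using hgrad_len_bounds[OF True, of u] p by (intro powr_mono2) auto
      next
        case False
        then have "norm (grad u x) powr p = 0" by (intro gz) simp
        then show ?thesis by (simp add: hgrad_len_def)
      qed
      have "hint_grad_pow p u = (\<integral>x. hgrad_len u x powr p \<partial>hmeas)" using hint_grad_pow_eq(1)[OF u] p by simp
      also have "\<dots> \<le> (\<integral>x. norm (grad u x) powr p \<partial>hmeas)"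
        using hint_grad_pow_eq(2)[OF u, of p] p by (intro integral_mono[OF _ ig le]) simp
      also have "\<dots> \<le> (8 / 3) ^ CARD('n) * (\<integral>x. norm (grad u x) powr p \<partial>lborel)"
        by (rule hmeas_lborel_compare(2)[OF cu2]) (use gz in auto)
      finally have "hint_grad_pow p u / s \<le> k * (c powr (p - n) * ?G)" unfolding G k_def using s0 by (simp add: field_simps)
      moreover have "0 \<le> hint_grad_pow p u / s" using hint_grad_pow_eq(1)[OF u, of p] p s0 by simp
      ultimately show ?thesis using S0 e0 by (intro mult_left_mono powr_mono2) auto
    qed
    also have "\<dots> = S * (k powr e * (c powr (- n) * ?G powr e))"
    proof -
      \<comment> \<open>Here the powers of the dilation factor cancel.\<close>
      have "(p - n) * e = - n" using np by (simp add: e_def field_simps)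
      then have "(c powr (p - n) * ?G) powr e = c powr (- n) * ?G powr e" using G0 by (simp add: powr_mult powr_powr)
      then show ?thesis using k0 G0 by (simp add: powr_mult)
    qed
    finally have "c powr n * (\<integral>x. \<bar>u x\<bar> powr q \<partial>lborel) \<le> c powr n * (S * (k powr e * (c powr (- n) * ?G powr e)))"
      by (intro mult_left_mono) auto
    also have "\<dots> = S * k powr e * ?G powr e" using c by (simp add: powr_minus field_simps)
    finally show ?thesis unfolding X .
  qed
  moreover have "S * k powr e \<ge> 0" using S0 by simp
  ultimately show ?thesis unfolding q_def e_def n_def by blast
qed

text \<open>Interpolation of the A-norm between the B-norm and the Sobolev exponent q; \<theta>
  solves 1/A = \<theta>/q + (1 - \<theta>)/B. The number \<open>s\<close> is the same interpolation
  parameter for the integrals before taking roots.\<close>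

lemma gnset_nonempty:
  fixes p :: real
  assumes ok: "okp CARD('n::finite) p" and pn: "p < real CARD('n)"
    and q: "q = real CARD('n) * p / (real CARD('n) - p)" and AB: "0 < B" "B < A" "A \<le> q"
    and \<theta>: "\<theta> = q * (A - B) / (A * (q - B))"
  shows "gnset TYPE('n) p A B \<theta> \<noteq> {}"
proof -
  define e where "e = real CARD('n) / (real CARD('n) - p)"
  define s where "s = (A - B) / (q - B)"
  have p: "p > 1" using ok by (simp add: okp_def)
  have A: "A > 0" using AB by simp
  have qB: "q - B > 0" using AB by simp
  have s: "0 < s" "s \<le> 1" using AB by (auto simp: s_def)
  have sB: "s * (q - B) = A - B" using qB by (simp add: s_def)
  have As: "A = q * s + B * (1 - s)" using sB by (simp add: algebra_simps)
  have t1: "\<theta> / p = e * s / A"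
  proof -
    have "\<theta> = q * s / A" using \<theta> by (simp add: s_def)
    moreover have "q = e * p" by (simp add: q e_def)
    ultimately show ?thesis using p by simp
  qed
  have t2: "(1 - \<theta>) / B = (1 - s) / A"
  proof -
    have "\<theta> = q * s / A" using \<theta> by (simp add: s_def)
    then have "1 - \<theta> = (A - q * s) / A" using A by (simp add: field_simps)
    also have "A - q * s = B * (1 - s)" using As by simp
    finally show ?thesis using AB by simp
  qed
  obtain K where K: "K \<ge> 0" "\<And>w :: real ^ 'n \<Rightarrow> real. w \<in> C0_inf \<Longrightarrow>
    integral UNIV (\<lambda>x. \<bar>w x\<bar> powr q) \<le> K * integral UNIV (\<lambda>x. norm (grad w x) powr p) powr e"
    using euclidean_sobolev[OF ok pn] unfolding q e_def by blast
  have "Lnorm A w \<le> K powr (s / A) * grad_Lnorm p w powr \<theta> * Lnorm B w powr (1 - \<theta>)"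
    if w: "w \<in> C0_inf" for w :: "real ^ 'n \<Rightarrow> real"
  proof -
    let ?X = "\<lambda>r. integral UNIV (\<lambda>x. \<bar>w x\<bar> powr r)" let ?G = "integral UNIV (\<lambda>x. norm (grad w x) powr p)"
    obtain R where R: "\<And>x. norm x > R \<Longrightarrow> w x = 0" by (rule C0_inf_support[OF w]) blast
    have cw: "continuous_on UNIV w" using w by (intro c1_cont[OF smooth_c1]) (simp add: C0_inf_def)
    have X0: "0 \<le> ?X r" for r by (rule integral_UNIV_powr_nonneg)
    have i: "(\<lambda>x. \<bar>w x\<bar> powr r) integrable_on UNIV" if r: "r > 0" for r
    proof (rule integral_UNIV_eq_lborel(2))
      show "continuous_on UNIV (\<lambda>x. \<bar>w x\<bar> powr r)" using r by (intro continuous_on_powr' continuous_intros cw) auto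
      show "\<bar>w x\<bar> powr r = 0" if "norm x > R" for x using R[OF that] by simp
    qed
    have interp: "?X A \<le> ?X q powr s * ?X B powr (1 - s)"
    proof (cases "s = 1")
      \<comment> \<open>The end point A = q lies outside the range of Hoelder. As
        \<open>0 powr 0\<close> is 0, the factor with exponent 0 equals 1 only for nonzero w; for w
        = 0 both sides vanish.\<close>
      case True
      then have Aq: "A = q" using As by simp
      show ?thesis
      proof (cases "\<exists>a. w a \<noteq> 0")
        case True
        then obtain a where a: "w a \<noteq> 0" by blast
        have "Lnorm B w > 0" by (rule Lnorm_pos[OF cw _ a AB(1)]) (rule R)
        then have "?X B > 0" using X0[of B] by (simp add: Lnorm_def less_le)
        then show ?thesis using X0[of q] Aq \<open>s = 1\<close> by simp
      qed simp
    next
      case False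
      then have s1: "s < 1" using s by simp
      have eq: "(\<bar>w x\<bar> powr q) powr s * (\<bar>w x\<bar> powr B) powr (1 - s) = \<bar>w x\<bar> powr A" for x
        unfolding powr_powr powr_add[symmetric] using As by simp
      have "integral UNIV (\<lambda>x. (\<bar>w x\<bar> powr q) powr s * (\<bar>w x\<bar> powr B) powr (1 - s)) \<le> ?X q powr s * ?X B powr (1 - s)"
        using AB A by (intro Holder_integral i s s1) (auto simp: eq intro!: i)
      then show ?thesis by (simp only: eq)
    qed
    have "Lnorm A w = ?X A powr (1 / A)" by (simp add: Lnorm_def)
    also have "\<dots> \<le> ((K * ?G powr e) powr s * ?X B powr (1 - s)) powr (1 / A)"
    proof (rule powr_mono2)
      have "?X q powr s \<le> (K * ?G powr e) powr s" using K(2)[OF w] X0[of q] s by (intro powr_mono2) auto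
      then show "?X A \<le> (K * ?G powr e) powr s * ?X B powr (1 - s)"
        using interp by (meson mult_right_mono order_trans powr_ge_zero)
    qed (use A X0 in auto)
    also have "\<dots> = K powr (s / A) * ?G powr (e * s / A) * ?X B powr ((1 - s) / A)"
      using K(1) by (simp add: powr_mult powr_powr)
    also have "\<dots> = K powr (s / A) * grad_Lnorm p w powr \<theta> * Lnorm B w powr (1 - \<theta>)"
      unfolding Lnorm_def grad_Lnorm_def powr_powr by (simp add: t1[symmetric] t2[symmetric])
    finally show ?thesis .
  qed
  then show ?thesis unfolding gnset_def by blast
qed

lemma hLnorm_powr:
  fixes u :: "real ^ 'n \<Rightarrow> real"
  assumes "u \<in> C0_inf_ball" "p > 0"
  shows "hgrad_Lnorm p u powr p = hint_grad_pow p u" "hLnorm p u powr p = hint_pow p u"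
proof -
  obtain L R B where D: "R < 1" "adm L R B (\<lambda>x. \<bar>u x\<bar>)" by (rule C0_inf_ball_data[OF assms(1)]) blast
  show "hgrad_Lnorm p u powr p = hint_grad_pow p u" "hLnorm p u powr p = hint_pow p u"
    using assms hint_grad_pow_eq(1)[OF assms] hint_pow_eq[OF D(2,1) assms(2)]
    by (simp_all add: hgrad_Lnorm_def hLnorm_def powr_powr)
qed

lemma poincare_gagliardo_nirenberg_interpolation:
  fixes u :: "real ^ 'n \<Rightarrow> real" and p :: real
  assumes u: "u \<in> C0_inf_ball" and ok: "okp CARD('n) p" and pn: "p < real CARD('n)"
    and q: "q = real CARD('n) * p / (real CARD('n) - p)" and AB: "0 < B" "B < A" "A \<le> q"
    and \<theta>: "\<theta> = q * (A - B) / (A * (q - B))"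
  shows "hLnorm A u \<le> Inf (gnset TYPE('n) p A B \<theta>)
    * (hgrad_Lnorm p u powr p - ((real CARD('n) - 1) / p) powr p * hLnorm p u powr p) powr (\<theta> / p)
    * hLnorm B u powr (1 - \<theta>)"
proof -
  have p: "p > 0" using ok by (simp add: okp_def)
  have d: "0 < A * (q - B)" and n: "0 < q * (A - B)" using AB by auto
  have "A * B \<le> q * B" using AB by (intro mult_right_mono) auto
  then have "q * (A - B) \<le> A * (q - B)" by (simp add: algebra_simps)
  then have "0 < \<theta>" "\<theta> \<le> 1" unfolding \<theta> using d n by (simp_all only: zero_less_divide_iff divide_le_eq_1) auto
  from poincare_gagliardo_nirenberg[OF u ok gnset_nonempty[OF ok pn q AB \<theta>] _ AB(1) this]
  show ?thesis using AB unfolding hLnorm_powr[OF u p] hdeficit_def by simp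
qed

theorem theorem1p2:
  fixes u :: "real ^ 'n \<Rightarrow> real"
  assumes u: "u \<in> C0_inf_ball"
  shows "(\<forall>p \<alpha>. CARD('n) \<ge> 4 \<and> 2 * real CARD('n) / (real CARD('n) - 1) \<le> p
             \<and> p < real CARD('n) \<and> 0 < \<alpha> \<and> \<alpha> \<le> real CARD('n) / (real CARD('n) - p)
             \<and> \<alpha> \<noteq> 1 \<longrightarrow>
          (\<alpha> > 1 \<longrightarrow>
             hLnorm (\<alpha> * p) u \<le> GN TYPE('n) p \<alpha>
               * (hgrad_Lnorm p u powr p
                  - ((real CARD('n) - 1) / p) powr p * hLnorm p u powr p)
                 powr (theta_gt (real CARD('n)) p \<alpha> / p)
               * hLnorm (\<alpha> * (p - 1) + 1) u powr (1 - theta_gt (real CARD('n)) p \<alpha>))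
        \<and> (\<alpha> < 1 \<longrightarrow>
             hLnorm (\<alpha> * (p - 1) + 1) u \<le> GN TYPE('n) p \<alpha>
               * (hgrad_Lnorm p u powr p
                  - ((real CARD('n) - 1) / p) powr p * hLnorm p u powr p)
                 powr (theta_lt (real CARD('n)) p \<alpha> / p)
               * hLnorm (\<alpha> * p) u powr (1 - theta_lt (real CARD('n)) p \<alpha>)))
       \<and> (\<forall>p. CARD('n) \<ge> 2 \<and> p > real CARD('n) \<longrightarrow>
          sup_norm u powr p \<le> bconst TYPE('n) p powr p
             * hvol (supp u) powr ((p - real CARD('n)) / real CARD('n))
             * (hint_grad_pow p u - ((real CARD('n) - 1) / p) powr p * hint_pow p u))"
proof (intro conjI allI impI; elim conjE)
  fix p \<alpha> :: real
  assume n4: "CARD('n) \<ge> 4" and pl: "2 * real CARD('n) / (real CARD('n) - 1) \<le> p" and pn: "p < real CARD('n)"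
    and a0: "0 < \<alpha>" and a: "\<alpha> \<le> real CARD('n) / (real CARD('n) - p)"
  define n where "n = real CARD('n)"
  define q where "q = n * p / (n - p)"
  have n: "n \<ge> 4" and np: "n - p > 0" using n4 pn by (simp_all add: n_def)
  have "2 < 2 * n / (n - 1)" using n by (simp add: field_simps)
  then have p: "p > 2" using pl by (simp add: n_def)
  have ok: "okp CARD('n) p" using p n4 pl by (simp add: okp_def)
  \<comment> \<open>The upper limit for \<alpha> is exactly the condition that \<alpha> p does not
    exceed the Sobolev exponent.\<close>
  have ap: "\<alpha> * p \<le> q" using mult_right_mono[OF a, of p] p by (simp add: q_def n_def)
  have pq: "p \<le> q" using np p n by (simp add: q_def field_simps)
  have qnp: "q * (n - p) = n * p" using np by (simp add: q_def)
  note main = poincare_gagliardo_nirenberg_interpolation[OF u ok pn q_def[unfolded n_def]]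
  {
    assume a1: "\<alpha> > 1"
    let ?B = "\<alpha> * (p - 1) + 1"
    have B: "0 < ?B" using a0 p by (intro add_nonneg_pos mult_nonneg_nonneg) auto
    have BA: "?B < \<alpha> * p" using a1 by (simp add: algebra_simps)
    \<comment> \<open>Numerator and denominator are multiplied by p, and q (n - p) = n p brings the
      given exponent into interpolation form.\<close>
    have "theta_gt n p \<alpha> = (p * (n * (\<alpha> - 1))) / (p * (\<alpha> * ((q - ?B) * (n - p))))"
      using p by (simp add: theta_gt_def left_diff_distrib[of q] qnp) (simp add: algebra_simps)
    also have "\<dots> = (q * (\<alpha> * p - ?B) * (n - p)) / (\<alpha> * p * (q - ?B) * (n - p))"
      using qnp by (simp add: algebra_simps)
    finally have \<theta>: "theta_gt n p \<alpha> = q * (\<alpha> * p - ?B) / (\<alpha> * p * (q - ?B))" using np by simp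
    have "GN TYPE('n) p \<alpha> = Inf (gnset TYPE('n) p (\<alpha> * p) ?B (theta_gt n p \<alpha>))"
      using a1 by (simp add: GN_def gnset_def Let_def n_def)
    with main[OF B BA ap \<theta>]
    show "hLnorm (\<alpha> * p) u \<le> GN TYPE('n) p \<alpha>
      * (hgrad_Lnorm p u powr p - ((real CARD('n) - 1) / p) powr p * hLnorm p u powr p) powr (theta_gt (real CARD('n)) p \<alpha> / p)
      * hLnorm ?B u powr (1 - theta_gt (real CARD('n)) p \<alpha>)" by (simp add: n_def)
  next
    assume a1: "\<alpha> < 1"
    let ?A = "\<alpha> * (p - 1) + 1"
    have B: "0 < \<alpha> * p" "\<alpha> * p < ?A" using a0 a1 p by (auto simp: algebra_simps)
    \<comment> \<open>For \<alpha> < 1 the larger exponent is below p, hence below q.\<close>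
    have "\<alpha> * (p - 1) \<le> 1 * (p - 1)" using a1 p by (intro mult_right_mono) auto
    then have A: "?A \<le> q" using pq by simp
    have "theta_lt n p \<alpha> = (p * (n * (1 - \<alpha>))) / (p * (?A * (n - \<alpha> * (n - p))))"
      using p by (simp add: theta_lt_def) (simp add: algebra_simps)
    also have "\<dots> = (q * (?A - \<alpha> * p) * (n - p)) / (?A * ((q - \<alpha> * p) * (n - p)))"
      unfolding left_diff_distrib[of q] qnp by (simp add: algebra_simps) (use qnp in \<open>simp add: algebra_simps\<close>)
    finally have \<theta>: "theta_lt n p \<alpha> = q * (?A - \<alpha> * p) / (?A * (q - \<alpha> * p))" using np by simp
    have "GN TYPE('n) p \<alpha> = Inf (gnset TYPE('n) p ?A (\<alpha> * p) (theta_lt n p \<alpha>))"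
      using a1 by (simp add: GN_def gnset_def Let_def n_def)
    with main[OF B A \<theta>]
    show "hLnorm ?A u \<le> GN TYPE('n) p \<alpha>
      * (hgrad_Lnorm p u powr p - ((real CARD('n) - 1) / p) powr p * hLnorm p u powr p) powr (theta_lt (real CARD('n)) p \<alpha> / p)
      * hLnorm (\<alpha> * p) u powr (1 - theta_lt (real CARD('n)) p \<alpha>)" by (simp add: n_def)
  }
next
  fix p :: real
  assume "CARD('n) \<ge> 2" "p > real CARD('n)"
  from poincare_morrey_sobolev[OF u this]
  show "sup_norm u powr p \<le> bconst TYPE('n) p powr p
      * hvol (supp u) powr ((p - real CARD('n)) / real CARD('n))
      * (hint_grad_pow p u - ((real CARD('n) - 1) / p) powr p * hint_pow p u)" by (simp add: hdeficit_def)
qed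

end
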